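(* $$\lim_{n\to\infty}\frac{\mathrm{GR}(n,18,146)}{n^2}=\frac{5}{12}.$$
   Context: For integers $p\ge 3$ and $2\le q\le\binom{p}{2}$, a $(p,q)$-colouring of the complete graph $K_n$ is a colouring of the edges of $K_n$ such that every clique on $p$ vertices receives at least $q$ distinct colours on its edges. The generalised Ramsey number $\mathrm{GR}(n,p,q)$ is the minimum number of colours in a $(p,q)$-colouring of $K_n$. *)

theory Defs
  imports Complex_Main "HOL-Library.Ramsey"
begin

text \<open>The complete graph \<open>K\<^sub>n\<close> has vertex set \<open>{..<n}\<close>, and the edges of the clique on a vertex
  set \<open>S\<close> are the two-element subsets \<open>nsets S 2\<close>.  Only the values of a colouring \<open>c\<close> on
  \<open>nsets {..<n} 2\<close> matter; natural numbers serve as colours, which is no restriction because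
  there are finitely many edges.\<close>

definition pq_colouring :: "nat \<Rightarrow> nat \<Rightarrow> nat \<Rightarrow> (nat set \<Rightarrow> nat) \<Rightarrow> bool" where
  "pq_colouring n p q c \<longleftrightarrow> (\<forall>S \<in> nsets {..<n} p. q \<le> card (c ` nsets S 2))"

definition GR :: "nat \<Rightarrow> nat \<Rightarrow> nat \<Rightarrow> nat" where
  "GR n p q = (LEAST k. \<exists>c. pq_colouring n p q c \<and> card (c ` nsets {..<n} 2) = k)"

text \<open>The minimum in \<^const>\<open>GR\<close> is over a nonempty set in the relevant range of \<open>q\<close>.\<close>

lemma GR_attained:
  assumes "q \<le> p choose 2"
  shows "\<exists>c. pq_colouring n p q c \<and> card (c ` nsets {..<n} 2) = GR n p q"
proof -
  have "finite (nsets {..<n} 2)"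
    by (simp add: finite_imp_finite_nsets)
  then obtain c :: "nat set \<Rightarrow> nat" where c: "inj_on c (nsets {..<n} 2)"
    using finite_imp_inj_to_nat_seg by metis
  have "pq_colouring n p q c"
    unfolding pq_colouring_def
  proof
    fix S assume S: "S \<in> nsets {..<n} p"
    then have "inj_on c (nsets S 2)"
      by (intro inj_on_subset[OF c] nsets_mono) (auto simp: nsets_def)
    moreover have "nsets S 2 = {N. N \<subseteq> S \<and> card N = 2}"
      using S by (auto simp: nsets_def intro: finite_subset)
    ultimately have "card (c ` nsets S 2) = p choose 2"
      using S n_subsets[of S 2] by (auto simp: card_image nsets_def)
    then show "q \<le> card (c ` nsets S 2)"
      using assms by simp
  qed
  then have "\<exists>k c. pq_colouring n p q c \<and> card (c ` nsets {..<n} 2) = k"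
    by blast
  then show ?thesis
    unfolding GR_def by (rule LeastI_ex)
qed

end

theory Submission
  imports Defs "HOL-Library.FuncSet"
begin

text \<open>
  \<^emph>\<open>Upper bound.\<close> Call a family of four-element sets (blocks) dense if it has between two and eight
  members, \<open>j\<close> say, and covers at most \<open>2 j + 2\<close> vertices.  If a family of about \<open>n\<^sup>2 / 12\<close> blocks has no dense subfamily, then one may give two
  opposite edges of each block a common colour and every other edge a colour of its own: eighteen vertices
  contain at most seven blocks and so lose at most seven of their 153 colours.  Such a family is produced
  by a random process in which every phase accepts a tiny random portion of the blocks that are
  still free, that is, not excluded by a minimal dense family (a conflict) all of whose other members are
  accepted.  Prescribing which blocks of a small set are free and which are accepted, one can
  follow the probability from phase to phase; it stays close to the product
  \<open>u\<^sup>e c\<^sup>s a\<^sup>t / n\<^bsup>2t\<^esup>\<close>, where \<open>s\<close> blocks are to be free, cover \<open>e\<close> pairs, and \<open>t\<close> blocks are to be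
  accepted.  As \<open>u\<close>, the chance that a pair is still uncovered, tends to \<open>0\<close>, \<open>a\<close> tends to \<open>2\<close>,
  and \<open>a\<close> times the number \<open>n\<^sup>4 / 24\<close> of all blocks over \<open>n\<^sup>2\<close> is the size of the family.

  \<^emph>\<open>Lower bound.\<close> Choose one edge of every colour, and unite each remaining edge with the
  chosen edge of its colour.  Eight of the resulting sets must span nineteen vertices.  After removing
  linearly many of them one obtains four-element sets in which every union built up along shared pairs
  has exactly \<open>2 j + 2\<close> vertices for \<open>j\<close> sets.  A discharging argument, which compensates each pair lying in
  several of the sets by pairs lying in none, bounds their number by one sixth of the number of pairs.
\<close>

section \<open>The random process\<close>

text \<open>In a phase of length \<open>d\<close>, a pair still uncovered lies in about
  \<open>n^2 / 2\<close> blocks, each free with chance near \<open>u^5 * c\<close>; so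
  \<open>u\<close> drops by about \<open>d * u^6 * c / 2\<close> while \<open>a\<close> grows by
  \<open>d * u^6 * c\<close>. Hence \<open>a + 2 * u\<close> is nearly invariant, whatever
  \<open>c\<close> does. Conflicts of three or more blocks enter only \<open>c\<close>; their
  densities need not be computed, merely bounded so that \<open>c\<close> stays away from
  \<open>0\<close>. The obstacle is dependence: the number of blocks that would destroy a prescribed
  set must be concentrated. Its first two moments are again probabilities of prescribed
  configurations, with up to 7 and 14 more blocks, so the induction over the phases treats all sizes
  at once. The number of phases is fixed before \<open>n\<close>, so each phase may add an error
  vanishing with \<open>n\<close>. Conflicts with two blocks from one phase escape the exclusion
  rule; at most a constant times \<open>d * n^2\<close> are expected, and one block of each is
  deleted at the end. For the lower bound, blocks may share pairs, so six pairs per block cannot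
  simply be counted. What helps is that eight blocks never fit on \<open>18 = 2 * 8 + 2\<close>
  vertices, so, after the removal, unions glued along pairs stop at seven blocks.\<close>

definition blocks :: "nat \<Rightarrow> nat set set" where
  "blocks n = {b. b \<subseteq> {..<n} \<and> card b = 4}"

text \<open>Minimality is what all later counts exploit: a proper part with at least two blocks
  already spans three vertices more than twice its size, so the rest of the conflict brings fewer
  than two new vertices per block.\<close>

definition conflict :: "nat set set \<Rightarrow> bool" where
  "conflict C \<longleftrightarrow> finite C \<and> 2 \<le> card C \<and> card C \<le> 8 \<and> card (\<Union>C) \<le> 2 * card C + 2 \<and>
     (\<forall>D. D \<subset> C \<longrightarrow> 2 \<le> card D \<longrightarrow> 2 * card D + 3 \<le> card (\<Union>D))"

definition threat :: "nat set set \<Rightarrow> nat set \<Rightarrow> nat set \<Rightarrow> bool" where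
  "threat A b w \<longleftrightarrow> (\<exists>C. conflict C \<and> b \<in> C \<and> w \<in> C \<and> b \<noteq> w \<and> C - {b, w} \<subseteq> A)"

definition acc :: "nat \<Rightarrow> (nat \<Rightarrow> nat set set) \<Rightarrow> nat set set" where
  "acc i h = (\<Union>r<i. h r)"

primrec free :: "nat \<Rightarrow> nat \<Rightarrow> (nat \<Rightarrow> nat set set) \<Rightarrow> nat set set" where
  "free n 0 h = blocks n"
| "free n (Suc i) h = {b \<in> free n i h. b \<notin> h i \<and> (\<forall>w\<in>h i. \<not> threat (acc i h) b w)}"

text \<open>Accepting any of these blocks in phase \<open>i\<close> stops some member of
  \<open>B\<close> from being free; a member of \<open>B\<close> does so by being accepted
  itself.\<close>

definition kill :: "nat \<Rightarrow> nat \<Rightarrow> (nat \<Rightarrow> nat set set) \<Rightarrow> nat set set \<Rightarrow> nat set set" where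
  "kill n i h B = {w \<in> free n i h. w \<in> B \<or> (\<exists>b\<in>B. threat (acc i h) b w)}"

definition valid :: "nat \<Rightarrow> nat \<Rightarrow> (nat \<Rightarrow> nat set set) \<Rightarrow> bool" where
  "valid n i h \<longleftrightarrow> (\<forall>r<i. h r \<subseteq> free n r h)"

lemma finite_blocks [simp]: "finite (blocks n)"
  unfolding blocks_def by simp

lemma blocksD: "b \<in> blocks n \<Longrightarrow> b \<subseteq> {..<n}" "b \<in> blocks n \<Longrightarrow> card b = 4"
  "b \<in> blocks n \<Longrightarrow> finite b"
  unfolding blocks_def by (auto intro: finite_subset)

lemma card_blocks: "card (blocks n) = n choose 4"
  unfolding blocks_def using n_subsets[of "{..<n}" 4] by simp

lemma free_subset_blocks: "free n i h \<subseteq> blocks n"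
  by (induction i) auto

lemma finite_free [simp]: "finite (free n i h)"
  by (meson finite_blocks finite_subset free_subset_blocks)

lemma free_antimono: "i \<le> j \<Longrightarrow> free n j h \<subseteq> free n i h"
  by (induction rule: dec_induct) auto

lemma valid_acc_free: "valid n i h \<Longrightarrow> acc i h \<inter> free n i h = {}"
proof -
  assume v: "valid n i h"
  have "b \<notin> free n i h" if "b \<in> h r" "r < i" for b r
    using free_antimono[of "Suc r" i n h] that by (auto simp: Suc_le_eq)
  then show ?thesis by (auto simp: acc_def)
qed

lemma valid_acc_blocks: "valid n i h \<Longrightarrow> acc i h \<subseteq> blocks n"
  unfolding valid_def acc_def using free_subset_blocks by blast

lemma acc_cong: "(\<And>r. r < i \<Longrightarrow> h r = h' r) \<Longrightarrow> acc i h = acc i h'"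
  by (auto simp: acc_def)

lemma free_cong: "(\<And>r. r < i \<Longrightarrow> h r = h' r) \<Longrightarrow> free n i h = free n i h'"
proof (induction i)
  case (Suc i)
  have "free n i h = free n i h'" "acc i h = acc i h'" "h i = h' i"
    using Suc by (auto intro!: acc_cong)
  then show ?case by simp
qed simp

lemma acc_upd [simp]: "acc i (h(i := W)) = acc i h"
  by (rule acc_cong) auto

lemma free_upd [simp]: "free n i (h(i := W)) = free n i h"
  by (rule free_cong) auto

lemma acc_Suc: "acc (Suc i) h = acc i h \<union> h i"
  by (auto simp: acc_def less_Suc_eq)

lemma valid_upd: "valid n i h \<Longrightarrow> W \<subseteq> free n i h \<Longrightarrow> valid n (Suc i) (h(i := W))"
proof -
  assume v: "valid n i h" and W: "W \<subseteq> free n i h"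
  have "free n r (h(i := W)) = free n r h" if "r \<le> i" for r
    using that by (intro free_cong) auto
  then show ?thesis using v W unfolding valid_def
    by (auto simp: less_Suc_eq)
qed

lemma subset_free_Suc:
  assumes "B \<subseteq> free n i h" "W \<subseteq> free n i h"
  shows "B \<subseteq> free n (Suc i) (h(i := W)) \<longleftrightarrow> W \<inter> kill n i h B = {}"
proof -
  have "B \<subseteq> free n (Suc i) (h(i := W)) \<longleftrightarrow> (\<forall>b\<in>B. b \<notin> W \<and> (\<forall>w\<in>W. \<not> threat (acc i h) b w))"
    using assms(1) by auto
  also have "\<dots> \<longleftrightarrow> W \<inter> kill n i h B = {}"
    using assms(2) unfolding kill_def by blast
  finally show ?thesis .
qed

lemma finite_arg_max:
  fixes f :: "'a \<Rightarrow> 'b::linorder"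
  assumes "finite C" "C \<noteq> {}"
  obtains b where "b \<in> C" "\<And>x. x \<in> C \<Longrightarrow> f x \<le> f b"
proof -
  have "Max (f ` C) \<in> f ` C" using assms by (intro Max_in) auto
  then obtain b where "b \<in> C" "f b = Max (f ` C)" by auto
  with assms(1) show thesis by (intro that[of b]) auto
qed

text \<open>The latest and second latest block of a conflict contained in \<open>acc R h\<close> come from the same
  phase or the second latest one shares its phase with another block: otherwise the second latest
  one would have removed the latest one from the free blocks.\<close>

lemma conflict_same_phase:
  assumes v: "valid n R h" and C: "conflict C" "C \<subseteq> acc R h"
  shows "\<exists>r<R. \<exists>x\<in>C. \<exists>y\<in>C. x \<noteq> y \<and> x \<in> h r \<and> y \<in> h r"
proof (rule ccontr)
  assume neg: "\<not> ?thesis"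
  have "\<forall>x\<in>C. \<exists>r<R. x \<in> h r" using C(2) by (auto simp: acc_def)
  then obtain ph where ph: "\<And>x. x \<in> C \<Longrightarrow> ph x < R \<and> x \<in> h (ph x)" by metis
  have inj: "inj_on ph C" using neg ph by (metis inj_onI)
  have fin: "finite C" and c2: "2 \<le> card C" using C(1) by (auto simp: conflict_def)
  then have "C \<noteq> {}" by auto
  then obtain b where b: "b \<in> C" "\<And>x. x \<in> C \<Longrightarrow> ph x \<le> ph b"
    using finite_arg_max[OF fin, of ph] by metis
  have "C - {b} \<noteq> {}" using c2 b(1) fin
    by (metis card.empty card_Suc_Diff1 not_less_eq_eq numeral_2_eq_2 order_refl)
  then obtain w where w: "w \<in> C - {b}" "\<And>x. x \<in> C - {b} \<Longrightarrow> ph x \<le> ph w"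
    using finite_arg_max[of "C - {b}" ph] fin by blast
  have "ph w < ph b" using w b inj by (metis DiffE inj_onD insertI1 le_neq_implies_less)
  have "C - {b, w} \<subseteq> acc (ph w) h"
  proof
    fix x assume x: "x \<in> C - {b, w}"
    then have "ph x \<le> ph w" "ph x \<noteq> ph w" using w inj by (auto dest: inj_onD)
    then show "x \<in> acc (ph w) h" using ph[of x] x by (auto simp: acc_def)
  qed
  then have "threat (acc (ph w) h) b w"
    unfolding threat_def using C(1) b(1) w(1) by blast
  then have "b \<notin> free n (Suc (ph w)) h" using ph[of w] w(1) by auto
  moreover have "b \<in> free n (ph b) h" using v ph[OF b(1)] by (auto simp: valid_def)
  ultimately show False
    using free_antimono[of "Suc (ph w)" "ph b" n h] \<open>ph w < ph b\<close> by auto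
qed

section \<open>Expectation over a random subset containing each element independently with
  probability \<open>p\<close>\<close>

definition bite :: "real \<Rightarrow> 'a set \<Rightarrow> ('a set \<Rightarrow> real) \<Rightarrow> real" where
  "bite p F g = (\<Sum>W\<in>Pow F. p ^ card W * (1 - p) ^ card (F - W) * g W)"

text \<open>The weights and the constraint both factor over the elements of \<open>F\<close>, so the
  sum over all subsets is the expansion of a product of two-term factors.\<close>

lemma bite_event:
  assumes F: "finite F" and S: "S \<subseteq> F" and K: "K \<subseteq> F" and SK: "S \<inter> K = {}"
  shows "bite p F (\<lambda>W. of_bool (S \<subseteq> W \<and> W \<inter> K = {})) = p ^ card S * (1 - p) ^ card K"
proof -
  define f where "f x = (if x \<in> K then 0 else p)" for x
  define g where "g x = (if x \<in> S then 0 else 1 - p)" for x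
  have "prod f W * prod g (F - W)
        = p ^ card W * (1 - p) ^ card (F - W) * of_bool (S \<subseteq> W \<and> W \<inter> K = {})" if "W \<in> Pow F" for W
  proof -
    have fW: "finite W" using that F by (auto intro: finite_subset)
    have 1: "prod f W = (if W \<inter> K = {} then p ^ card W else 0)"
    proof (cases "W \<inter> K = {}")
      case True
      then have "prod f W = prod (\<lambda>_. p) W" by (intro prod.cong) (auto simp: f_def)
      with True show ?thesis by simp
    next
      case False
      then show ?thesis using fW by (auto simp: f_def intro!: prod_zero)
    qed
    have 2: "prod g (F - W) = (if S \<subseteq> W then (1 - p) ^ card (F - W) else 0)"
    proof (cases "S \<subseteq> W")
      case True
      then have "prod g (F - W) = prod (\<lambda>_. 1 - p) (F - W)" by (intro prod.cong) (auto simp: g_def)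
      with True show ?thesis by simp
    next
      case False
      then have "\<exists>x\<in>F - W. g x = 0" using S by (auto simp: g_def)
      then show ?thesis using False F by (auto intro!: prod_zero)
    qed
    show ?thesis unfolding 1 2 by auto
  qed
  then have "bite p F (\<lambda>W. of_bool (S \<subseteq> W \<and> W \<inter> K = {})) = (\<Prod>x\<in>F. f x + g x)"
    unfolding bite_def prod_add[OF F] by (intro sum.cong) auto
  also have "\<dots> = (\<Prod>x\<in>F. (if x \<in> S then p else 1) * (if x \<in> K then 1 - p else 1))"
    using SK by (intro prod.cong) (auto simp: f_def g_def)
  also have "\<dots> = (\<Prod>x\<in>S. p) * (\<Prod>x\<in>K. 1 - p)"
    using F S K by (simp add: prod.distrib prod.If_cases Int_absorb1 Int_commute)
  finally show ?thesis by simp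
qed

lemma bite_add: "bite p F (\<lambda>W. f W + g W) = bite p F f + bite p F g"
  unfolding bite_def by (simp add: distrib_left sum.distrib)

lemma bite_cmult: "bite p F (\<lambda>W. c * f W) = c * bite p F f"
  unfolding bite_def by (simp add: sum_distrib_left mult_ac)

lemma bite_const: "finite F \<Longrightarrow> bite p F (\<lambda>W. c) = c"
  using bite_event[of F "{}" "{}" p] bite_cmult[of p F c "\<lambda>_. 1"] by simp

lemma bite_mono:
  assumes "0 \<le> p" "p \<le> 1" "\<And>W. W \<subseteq> F \<Longrightarrow> f W \<le> g W"
  shows "bite p F f \<le> bite p F g"
  unfolding bite_def using assms by (intro sum_mono mult_left_mono) auto

text \<open>\<open>h r\<close> is the set of blocks accepted in phase \<open>r\<close>, so \<open>ex n p i g\<close> is the expectation of \<open>g\<close> after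
  \<open>i\<close> phases when each accepts every free block independently with probability \<open>p\<close>.\<close>

primrec ex :: "nat \<Rightarrow> real \<Rightarrow> nat \<Rightarrow> ((nat \<Rightarrow> nat set set) \<Rightarrow> real) \<Rightarrow> real" where
  "ex n p 0 g = g (\<lambda>_. {})"
| "ex n p (Suc i) g = ex n p i (\<lambda>h. bite p (free n i h) (\<lambda>W. g (h(i := W))))"

lemma ex_add: "ex n p i (\<lambda>h. f h + g h) = ex n p i f + ex n p i g"
  by (induction i arbitrary: f g) (simp_all add: bite_add)

lemma ex_cmult: "ex n p i (\<lambda>h. c * f h) = c * ex n p i f"
  by (induction i arbitrary: f) (simp_all add: bite_cmult)

lemma ex_const: "ex n p i (\<lambda>h. c) = c"
  by (induction i) (simp_all add: bite_const)

lemma ex_diff: "ex n p i (\<lambda>h. f h - g h) = ex n p i f - ex n p i g"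
  using ex_add[of n p i f "\<lambda>h. - 1 * g h"] ex_cmult[of n p i "- 1" g] by simp

lemma ex_sum: "finite I \<Longrightarrow> ex n p i (\<lambda>h. \<Sum>x\<in>I. f x h) = (\<Sum>x\<in>I. ex n p i (f x))"
  by (induction I rule: finite_induct) (simp_all add: ex_add ex_const)

lemma ex_mono:
  assumes "0 \<le> p" "p \<le> 1" "\<And>h. valid n i h \<Longrightarrow> f h \<le> g h"
  shows "ex n p i f \<le> ex n p i g"
  using assms(3)
proof (induction i arbitrary: f g)
  case 0
  then show ?case by (simp add: valid_def)
next
  case (Suc i)
  show ?case
    by (simp, intro Suc.IH bite_mono assms(1,2) Suc.prems valid_upd)
qed

lemma ex_cong:
  assumes "0 \<le> p" "p \<le> 1" "\<And>h. valid n i h \<Longrightarrow> f h = g h"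
  shows "ex n p i f = ex n p i g"
  by (intro antisym ex_mono assms(1,2)) (auto simp: assms(3))

lemma ex_nonneg:
  assumes "0 \<le> p" "p \<le> 1" "\<And>h. valid n i h \<Longrightarrow> 0 \<le> f h"
  shows "0 \<le> ex n p i f"
  using ex_mono[OF assms(1,2), of n i "\<lambda>_. 0" f] assms(3) by (simp add: ex_const)

text \<open>A mean never exceeds the largest value, and in each phase a best choice exists because
  the free blocks have finitely many subsets.\<close>

lemma ex_attained:
  assumes "0 \<le> p" "p \<le> 1"
  shows "\<exists>h. valid n i h \<and> ex n p i f \<le> f h"
proof (rule ccontr)
  assume "\<not> ?thesis"
  then have less: "\<And>h. valid n i h \<Longrightarrow> f h < ex n p i f" by force
  show False
    using less
  proof (induction i arbitrary: f)
    case 0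
    from 0[of "\<lambda>_. {}"] show ?case by (simp add: valid_def)
  next
    case (Suc i)
    let ?g = "\<lambda>h. bite p (free n i h) (\<lambda>W. f (h(i := W)))"
    have "?g h < ex n p i ?g" if v: "valid n i h" for h
    proof -
      let ?F = "free n i h"
      obtain W where W: "W \<in> Pow ?F" "\<And>W'. W' \<in> Pow ?F \<Longrightarrow> f (h(i := W')) \<le> f (h(i := W))"
        using finite_arg_max[of "Pow ?F" "\<lambda>W. f (h(i := W))"] by (metis Pow_not_empty finite_Pow_iff finite_free)
      have "?g h \<le> bite p ?F (\<lambda>_. f (h(i := W)))"
        using W(2) by (intro bite_mono assms) auto
      also have "\<dots> = f (h(i := W))" by (simp add: bite_const)
      also have "\<dots> < ex n p (Suc i) f" using W(1) v by (intro Suc.prems valid_upd) auto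
      finally show ?thesis by simp
    qed
    then show ?case by (rule Suc.IH)
  qed
qed

text \<open>\<open>lab\<close> prescribes the phase in which each member of \<open>S\<close> is
  accepted. Whatever the history, the members labelled \<open>i\<close> cost one factor
  \<open>p\<close> each in phase \<open>i\<close>, so the bound follows phase by phase.\<close>

lemma ex_phases_le:
  assumes p: "0 \<le> p" "p \<le> 1" and S: "finite S"
  shows "ex n p i (\<lambda>h. of_bool (\<forall>b\<in>S. lab b < i \<and> b \<in> h (lab b))) \<le> p ^ card S"
  using S
proof (induction i arbitrary: S)
  case 0
  then show ?case using p by (auto simp: of_bool_def)
next
  case (Suc i)
  let ?N = "{b \<in> S. lab b = i}" and ?O = "{b \<in> S. lab b \<noteq> i}"
  have "bite p (free n i h) (\<lambda>W. of_bool (\<forall>b\<in>S. lab b < Suc i \<and> b \<in> (h(i := W)) (lab b)))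
        \<le> p ^ card ?N * of_bool (\<forall>b\<in>?O. lab b < i \<and> b \<in> h (lab b))" for h
  proof (cases "?N \<subseteq> free n i h \<and> (\<forall>b\<in>?O. lab b < i \<and> b \<in> h (lab b))")
    case True
    have "bite p (free n i h) (\<lambda>W. of_bool (\<forall>b\<in>S. lab b < Suc i \<and> b \<in> (h(i := W)) (lab b)))
          \<le> bite p (free n i h) (\<lambda>W. of_bool (?N \<subseteq> W \<and> W \<inter> {} = {}))"
      by (intro bite_mono p) (auto simp: of_bool_def split: if_splits)
    also have "\<dots> = p ^ card ?N" using True by (subst bite_event) auto
    finally show ?thesis using True by simp
  next
    case False
    have "bite p (free n i h) (\<lambda>W. of_bool (\<forall>b\<in>S. lab b < Suc i \<and> b \<in> (h(i := W)) (lab b)))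
          \<le> bite p (free n i h) (\<lambda>W. 0)"
      using False by (intro bite_mono p) (auto simp: less_Suc_eq split: if_splits)
    also have "\<dots> = 0" by (simp add: bite_const)
    also have "0 \<le> p ^ card ?N * of_bool (\<forall>b\<in>?O. lab b < i \<and> b \<in> h (lab b))"
      using p by simp
    finally show ?thesis .
  qed
  then have "ex n p (Suc i) (\<lambda>h. of_bool (\<forall>b\<in>S. lab b < Suc i \<and> b \<in> h (lab b)))
      \<le> ex n p i (\<lambda>h. p ^ card ?N * of_bool (\<forall>b\<in>?O. lab b < i \<and> b \<in> h (lab b)))"
    unfolding ex.simps by (rule ex_mono[OF p])
  also have "\<dots> = p ^ card ?N * ex n p i (\<lambda>h. of_bool (\<forall>b\<in>?O. lab b < i \<and> b \<in> h (lab b)))"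
    by (rule ex_cmult)
  also have "\<dots> \<le> p ^ card ?N * p ^ card ?O"
    by (intro mult_left_mono Suc.IH) (use Suc.prems p in auto)
  also have "\<dots> = p ^ card S"
    unfolding power_add[symmetric] using Suc.prems
    by (subst card_Un_disjoint[symmetric]) (auto intro!: arg_cong[where f = "\<lambda>X. p ^ card X"])
  finally show ?case .
qed

text \<open>Union bound over the \<open>i ^ card S\<close> ways to assign phases to the members of
  \<open>S\<close>.\<close>

lemma ex_acc_le:
  assumes p: "0 \<le> p" "p \<le> 1" and S: "finite S"
  shows "ex n p i (\<lambda>h. of_bool (S \<subseteq> acc i h)) \<le> (real i * p) ^ card S"
proof -
  let ?L = "S \<rightarrow>\<^sub>E {..<i}"
  have fL: "finite ?L" using S by (simp add: finite_PiE)
  have "of_bool (S \<subseteq> acc i h) \<le> (\<Sum>lab\<in>?L. of_bool (\<forall>b\<in>S. lab b < i \<and> b \<in> h (lab b)) :: real)" for h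
  proof (cases "S \<subseteq> acc i h")
    case True
    then have "\<forall>b\<in>S. \<exists>r<i. b \<in> h r" by (auto simp: acc_def)
    then obtain lab where lab: "\<forall>b\<in>S. lab b < i \<and> b \<in> h (lab b)" by metis
    define lab' where "lab' = restrict lab S"
    have "lab' \<in> ?L" "\<forall>b\<in>S. lab' b < i \<and> b \<in> h (lab' b)" using lab by (auto simp: lab'_def)
    then show ?thesis
      using member_le_sum[of lab' ?L "\<lambda>lab. of_bool (\<forall>b\<in>S. lab b < i \<and> b \<in> h (lab b)) :: real"] fL True by auto
  qed (auto intro: sum_nonneg)
  then have "ex n p i (\<lambda>h. of_bool (S \<subseteq> acc i h))
      \<le> ex n p i (\<lambda>h. \<Sum>lab\<in>?L. of_bool (\<forall>b\<in>S. lab b < i \<and> b \<in> h (lab b)))"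
    by (intro ex_mono p)
  also have "\<dots> = (\<Sum>lab\<in>?L. ex n p i (\<lambda>h. of_bool (\<forall>b\<in>S. lab b < i \<and> b \<in> h (lab b))))"
    by (rule ex_sum[OF fL])
  also have "\<dots> \<le> (\<Sum>lab\<in>?L. p ^ card S)"
    by (intro sum_mono ex_phases_le p S)
  also have "\<dots> = (real i * p) ^ card S"
    using S by (simp add: card_funcsetE power_mult_distrib)
  finally show ?thesis .
qed

text \<open>Two blocks of the conflict share a phase, which leaves only \<open>R\<close> to the power of \<open>card C - 1\<close>
  possible assignments of phases to its blocks, up to the choice of the two blocks.\<close>

lemma ex_conflict_le:
  assumes p: "0 \<le> p" "p \<le> 1" and C: "conflict C"
  shows "ex n p R (\<lambda>h. of_bool (C \<subseteq> acc R h)) \<le> 64 * real R ^ (card C - 1) * p ^ card C"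
proof -
  have fC: "finite C" and cC: "card C \<le> 8" using C by (auto simp: conflict_def)
  define L where "L = (\<lambda>(x, y). {lab \<in> C \<rightarrow>\<^sub>E {..<R}. lab x = lab y})"
  define I where "I = (SIGMA z:{(x, y). x \<in> C \<and> y \<in> C \<and> x \<noteq> y}. L z)"
  have fz: "finite {(x, y). x \<in> C \<and> y \<in> C \<and> x \<noteq> y}"
    by (rule finite_subset[of _ "C \<times> C"]) (use fC in auto)
  have fI: "finite I" unfolding I_def L_def using fz fC by (auto intro!: finite_SigmaI finite_PiE)
  \<comment> \<open>An assignment with \<open>lab x = lab y\<close> is determined by its restriction
    to \<open>C - {x}\<close>, which saves one factor \<open>R\<close>.\<close>
  have cL: "card (L (x, y)) \<le> R ^ (card C - 1)" if "x \<in> C" "y \<in> C" "x \<noteq> y" for x y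
  proof -
    have "inj_on (\<lambda>lab. restrict lab (C - {x})) (L (x, y))"
    proof (rule inj_onI)
      fix f g assume fg: "f \<in> L (x, y)" "g \<in> L (x, y)" and eq: "restrict f (C - {x}) = restrict g (C - {x})"
      have e: "f z = g z" if "z \<in> C - {x}" for z using fun_cong[OF eq, of z] that by auto
      have "f z = g z" if "z \<in> C" for z
        using e[of z] e[of y] that \<open>y \<in> C\<close> \<open>x \<noteq> y\<close> fg by (cases "z = x") (auto simp: L_def)
      then show "f = g" using fg by (intro PiE_ext[of f C "\<lambda>_. {..<R}" g]) (auto simp: L_def)
    qed
    moreover have "(\<lambda>lab. restrict lab (C - {x})) ` L (x, y) \<subseteq> (C - {x}) \<rightarrow>\<^sub>E {..<R}"
      unfolding L_def by (rule image_subsetI, rule restrict_PiE_iff[THEN iffD2]) (auto simp: PiE_iff)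
    ultimately have "card (L (x, y)) \<le> card ((C - {x}) \<rightarrow>\<^sub>E {..<R})"
      using fC by (intro card_inj_on_le finite_PiE) auto
    then show ?thesis using fC that by (simp add: card_funcsetE)
  qed
  \<comment> \<open>The constant 64 bounds the number of ordered pairs of blocks in a conflict of at
    most eight.\<close>
  have cI: "card I \<le> 64 * R ^ (card C - 1)"
  proof -
    have "card I = (\<Sum>z\<in>{(x, y). x \<in> C \<and> y \<in> C \<and> x \<noteq> y}. card (L z))"
      unfolding I_def using fz fC by (intro card_SigmaI) (auto simp: L_def intro!: finite_PiE)
    also have "\<dots> \<le> (\<Sum>z\<in>{(x, y). x \<in> C \<and> y \<in> C \<and> x \<noteq> y}. R ^ (card C - 1))"
      using cL by (intro sum_mono) auto
    also have "\<dots> = card {(x, y). x \<in> C \<and> y \<in> C \<and> x \<noteq> y} * R ^ (card C - 1)" by simp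
    also have "\<dots> \<le> card (C \<times> C) * R ^ (card C - 1)"
      by (intro mult_right_mono card_mono) (use fC in auto)
    also have "\<dots> \<le> 64 * R ^ (card C - 1)"
      using mult_mono[OF cC cC] by (intro mult_right_mono) (auto simp: card_cartesian_product)
    finally show ?thesis .
  qed
  have "of_bool (C \<subseteq> acc R h) \<le> (\<Sum>(z, lab)\<in>I. of_bool (\<forall>b\<in>C. lab b < R \<and> b \<in> h (lab b)) :: real)"
    if v: "valid n R h" for h
  proof (cases "C \<subseteq> acc R h")
    case True
    obtain r x y where rxy: "r < R" "x \<in> C" "y \<in> C" "x \<noteq> y" "x \<in> h r" "y \<in> h r"
      using conflict_same_phase[OF v C True] by blast
    have "\<forall>b\<in>C. \<exists>r<R. b \<in> h r" using True by (auto simp: acc_def)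
    then obtain l0 where l0: "\<forall>b\<in>C. l0 b < R \<and> b \<in> h (l0 b)" by metis
    define lab where "lab = restrict (l0(x := r, y := r)) C"
    have 1: "\<forall>b\<in>C. lab b < R \<and> b \<in> h (lab b)" "((x, y), lab) \<in> I"
      using l0 rxy by (auto simp: lab_def I_def L_def)
    then show ?thesis
      using member_le_sum[of "((x, y), lab)" I "\<lambda>(z, lab). of_bool (\<forall>b\<in>C. lab b < R \<and> b \<in> h (lab b)) :: real"]
        fI True by auto
  qed (auto intro: sum_nonneg)
  then have "ex n p R (\<lambda>h. of_bool (C \<subseteq> acc R h))
      \<le> ex n p R (\<lambda>h. \<Sum>q\<in>I. of_bool (\<forall>b\<in>C. snd q b < R \<and> b \<in> h (snd q b)))"
    by (intro ex_mono p) (auto simp: case_prod_unfold)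
  also have "\<dots> = (\<Sum>q\<in>I. ex n p R (\<lambda>h. of_bool (\<forall>b\<in>C. snd q b < R \<and> b \<in> h (snd q b))))"
    by (rule ex_sum[OF fI])
  also have "\<dots> \<le> (\<Sum>q\<in>I. p ^ card C)"
    by (intro sum_mono ex_phases_le p fC)
  also have "\<dots> = real (card I) * p ^ card C" by simp
  also have "\<dots> \<le> real (64 * R ^ (card C - 1)) * p ^ card C"
    using cI p by (intro mult_right_mono) (auto simp del: of_nat_mult of_nat_power)
  finally show ?thesis by simp
qed

section \<open>Conflicts attached to a fixed set of blocks\<close>

lemma conflictD:
  assumes "conflict C"
  shows "finite C" "2 \<le> card C" "card C \<le> 8" "card (\<Union>C) \<le> 2 * card C + 2"
    "\<And>D. D \<subset> C \<Longrightarrow> 2 \<le> card D \<Longrightarrow> 2 * card D + 3 \<le> card (\<Union>D)"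
  using assms by (auto simp: conflict_def)

lemma card2: "x \<noteq> y \<Longrightarrow> card {x, y} = 2"
  by simp

text \<open>Proper subfamilies have fewer than two members, so minimality is vacuous here.\<close>

lemma conflict_pair:
  assumes "x \<noteq> y" "card x = 4" "card y = 4" "2 \<le> card (x \<inter> y)"
  shows "conflict {x, y}"
proof -
  have fin: "finite x" "finite y" using assms card_ge_0_finite by fastforce+
  have "card (x \<union> y) + card (x \<inter> y) = 8" using card_Un_Int[OF fin] assms by simp
  moreover have "card D < 2" if "D \<subset> {x, y}" for D
    using psubset_card_mono[OF _ that] assms(1) by simp
  ultimately show ?thesis using assms by (auto simp: conflict_def not_le[symmetric])
qed

definition covered_pairs :: "nat set set \<Rightarrow> nat set set" where
  "covered_pairs S = {f. card f = 2 \<and> (\<exists>x\<in>S. f \<subseteq> x)}"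

text \<open>\<open>SB\<close> is to be free and \<open>SA\<close> to be accepted.  A conflict meeting \<open>SB\<close> in fewer than two blocks, or
  two blocks sharing three vertices, would correlate these events.\<close>

definition good :: "nat set set \<Rightarrow> nat set set \<Rightarrow> bool" where
  "good SB SA \<longleftrightarrow> SB \<inter> SA = {} \<and> (\<forall>x\<in>SB \<union> SA. \<forall>y\<in>SB \<union> SA. x \<noteq> y \<longrightarrow> card (x \<inter> y) \<le> 2) \<and>
     (\<forall>C\<subseteq>SB \<union> SA. conflict C \<longrightarrow> 2 \<le> card (C \<inter> SB))"

text \<open>\<open>generic n V b w P\<close>: the blocks \<open>P\<close> form a conflict with \<open>b\<close>, and outside \<open>b\<close> they meet the vertex set
  \<open>V\<close> nowhere and have the largest possible number of vertices; all other conflicts are negligible in number.  When the blocks of \<open>P\<close> other than \<open>w\<close>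
  are already chosen, selecting \<open>w\<close> removes \<open>b\<close>.\<close>

definition generic :: "nat \<Rightarrow> nat set \<Rightarrow> nat set \<Rightarrow> nat set \<Rightarrow> nat set set \<Rightarrow> bool" where
  "generic n V b w P \<longleftrightarrow> P \<subseteq> blocks n \<and> w \<in> P \<and> b \<notin> P \<and> conflict (insert b P) \<and>
     card (\<Union>(insert b P)) = 2 * card P + 4 \<and> \<Union>P \<inter> V \<subseteq> b"

text \<open>The count \<open>card (\<Union>P - V) = 2 * card P\<close> is the decisive one: about
  \<open>n ^ (2 * card P)\<close> such families can exist, which exactly balances a weight
  \<open>1 / n^2\<close> for each of their blocks.\<close>

lemma genD:
  assumes g: "generic n V b w P" and b: "b \<in> blocks n" "b \<subseteq> V"
  shows "P \<subseteq> blocks n" "w \<in> P" "b \<notin> P" "conflict (insert b P)" "\<Union>P \<inter> V \<subseteq> b"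
    "finite P" "finite (\<Union>P)" "1 \<le> card P" "card P \<le> 7" "card (\<Union>P - V) = 2 * card P"
    "card (\<Union>P) = 2 * card P + card (\<Union>P \<inter> b)"
proof -
  show 1: "P \<subseteq> blocks n" "w \<in> P" "b \<notin> P" "conflict (insert b P)" "\<Union>P \<inter> V \<subseteq> b"
    using g by (auto simp: generic_def)
  show fP: "finite P" using 1(4) by (auto simp: conflict_def)
  have "2 \<le> card (insert b P)" "card (insert b P) \<le> 8" using 1(4) by (auto simp: conflict_def)
  then show "1 \<le> card P" "card P \<le> 7" using fP 1(3) by auto
  show fU: "finite (\<Union>P)" using fP 1(1) blocksD(3) by blast
  have fb: "finite b" "card b = 4" using b blocksD by auto
  have e: "\<Union>P - V = \<Union>P - b" using 1(5) b(2) by blast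
  have "card (\<Union>(insert b P)) = card (b \<union> (\<Union>P - b))" by (rule arg_cong[where f = card]) auto
  also have "\<dots> = 4 + card (\<Union>P - b)" using fb fU by (subst card_Un_disjoint) auto
  finally show "card (\<Union>P - V) = 2 * card P" using g e by (simp add: generic_def)
  then show "card (\<Union>P) = 2 * card P + card (\<Union>P \<inter> b)"
    using e fU by (metis card_Diff_subset_Int card_mono finite_Int inf_le1 le_add_diff_inverse2)
qed

text \<open>Subtract the lower bound for the part from the upper bound for the whole. The vertex
  lost against two per block becomes a factor \<open>1 / n\<close> in every count below.\<close>

lemma conflict_rest:
  assumes C: "conflict C" and S: "S' \<subset> C" "2 \<le> card S'" and fin: "finite (\<Union>C)"
  shows "card (\<Union>C - \<Union>S') + 1 \<le> 2 * card (C - S')"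
proof -
  have fC: "finite C" using C by (auto simp: conflict_def)
  have "card (\<Union>C - \<Union>S') = card (\<Union>C) - card (\<Union>S')"
    using finite_subset[OF Union_mono fin, of S'] S by (intro card_Diff_subset) auto
  moreover have "card (C - S') = card C - card S'"
    using fC S by (intro card_Diff_subset) (auto intro: finite_subset)
  moreover have "card S' < card C" using fC S by (auto intro: psubset_card_mono)
  ultimately show ?thesis using conflictD(4)[OF C] conflictD(5)[OF C S] by linarith
qed

text \<open>Together with \<open>b\<close>, the blocks of \<open>N\<close> form a proper part of the
  conflict, so minimality applies; only four of the vertices counted belong to
  \<open>b\<close>.\<close>

lemma generic_part:
  assumes g: "generic n V b w P" and b: "b \<in> blocks n" "b \<subseteq> V" and N: "N \<subset> P" "N \<noteq> {}"
  shows "2 * card N + 1 \<le> card (\<Union>N - V)"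
proof -
  note G = genD[OF g b]
  have fN: "finite N" using N G(6) by (auto intro: finite_subset)
  have fb: "finite b" "card b = 4" using b blocksD by auto
  have fUN: "finite (\<Union>N)" using N G(7) by (meson Union_mono finite_subset psubset_imp_subset)
  have "insert b N \<subset> insert b P" using N(1) G(3) by auto
  moreover have bN: "b \<notin> N" using N G(3) by blast
  then have "card (insert b N) = card N + 1" using fN by simp
  moreover have "card N > 0" using N fN by (simp add: card_gt_0_iff)
  ultimately have "2 * (card N + 1) + 3 \<le> card (\<Union>(insert b N))"
    using conflictD(5)[OF G(4), of "insert b N"] by simp
  also have "\<Union>(insert b N) = b \<union> (\<Union>N - V)" using N G(5) b(2) by blast
  also have "card \<dots> \<le> card b + card (\<Union>N - V)" by (rule card_Un_le)
  finally show ?thesis using fb by simp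
qed

text \<open>The danger is a new conflict \<open>D\<close> with fewer than two free blocks. New
  blocks bring at least two vertices outside \<open>V\<close> each, so \<open>D\<close> has at most
  one old block \<open>x\<close>. Without an old block, \<open>D\<close> would be a proper part of
  the generic conflict. Otherwise \<open>D\<close> is \<open>P\<close> with \<open>x\<close> added:
  if \<open>x = b\<close>, both \<open>b\<close> and \<open>w\<close> are free; if not,
  \<open>P = {w}\<close> and \<open>x\<close> contains the pair \<open>b \<inter> w\<close>, so
  \<open>{x, b}\<close> is a conflict of the old template, which forces \<open>x\<close> to be
  free.\<close>

lemma good_ext:
  assumes good: "good SB SA" and S: "SB \<union> SA \<subseteq> blocks n" and V: "\<Union>(SB \<union> SA) \<subseteq> V"
    and b: "b \<in> SB" and g: "generic n V b w P"
  shows "good (insert w SB) (SA \<union> (P - {w}))" "P \<inter> (SB \<union> SA) = {}"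
proof -
  have bb: "b \<in> blocks n" "b \<subseteq> V" using S V b by auto
  note G = genD[OF g bb]
  let ?S = "SB \<union> SA"
  let ?C = "insert b P"
  show PS: "P \<inter> ?S = {}"
  proof (rule ccontr)
    assume "P \<inter> ?S \<noteq> {}"
    then obtain y where y: "y \<in> P" "y \<in> ?S" by blast
    then have "y \<subseteq> b" using G(5) V by blast
    moreover have "card y = card b" "finite b" using y S bb blocksD by auto
    ultimately have "y = b" by (metis card_subset_eq)
    then show False using y G(3) by simp
  qed
  have c4: "card x = 4" "finite x" if "x \<in> ?S \<union> P" for x using that S G(1) blocksD by auto
  have ov: "card (b \<inter> y) \<le> 2" if y: "y \<in> P" for y
  proof (cases "P = {y}")
    case True
    have "card (b \<union> y) = 6" using g True by (simp add: generic_def)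
    moreover have "card (b \<union> y) + card (b \<inter> y) = card b + card y"
      using c4 b y by (intro card_Un_Int[symmetric]) auto
    ultimately show ?thesis using c4 b y by auto
  next
    case False
    have "{b, y} \<subset> ?C" using False y G(3) by auto
    moreover have "card {b, y} = 2" by (rule card2) (use y G(3) in auto)
    ultimately have "7 \<le> card (b \<union> y)" using conflictD(5)[OF G(4), of "{b, y}"] by simp
    moreover have "card (b \<union> y) + card (b \<inter> y) = card b + card y"
      using c4 b y by (intro card_Un_Int[symmetric]) auto
    ultimately show ?thesis using c4 b y by auto
  qed
  have ov2: "card (x \<inter> y) \<le> 2" if "x \<in> ?S" "y \<in> P" for x y
  proof -
    have "x \<inter> y \<subseteq> b \<inter> y" using that V G(5) by blast
    then have "card (x \<inter> y) \<le> card (b \<inter> y)" using c4 b by (intro card_mono) auto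
    then show ?thesis using ov[OF that(2)] by linarith
  qed
  have ov3: "card (x \<inter> y) \<le> 2" if "x \<in> P" "y \<in> P" "x \<noteq> y" for x y
  proof -
    have "{x, y} \<subset> ?C" using that G(3) by auto
    then have "7 \<le> card (x \<union> y)" using conflictD(5)[OF G(4), of "{x, y}"] that by simp
    moreover have "card (x \<union> y) + card (x \<inter> y) = card x + card y"
      using c4 that by (intro card_Un_Int[symmetric]) auto
    ultimately show ?thesis using c4 that by auto
  qed
  have conf: "2 \<le> card (D \<inter> insert w SB)" if D: "D \<subseteq> ?S \<union> P" "conflict D" for D
  proof (cases "D \<inter> P = {}")
    case True
    then have "D \<subseteq> ?S" using D(1) by blast
    then have "2 \<le> card (D \<inter> SB)" using D(2) good unfolding good_def by blast
    also have "\<dots> \<le> card (D \<inter> insert w SB)"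
      using conflictD(1)[OF D(2)] by (intro card_mono) auto
    finally show ?thesis .
  next
    case False
    let ?N = "D \<inter> P" and ?S' = "D \<inter> ?S"
    have fD: "finite D" using D(2) conflictD by auto
    have DS: "D = ?S' \<union> ?N" using D(1) by blast
    have cD: "card D = card ?S' + card ?N"
      by (subst (1) DS, rule card_Un_disjoint) (use fD PS in auto)
    obtain y where y: "y \<in> D" "y \<in> P" "y \<notin> ?S" using False PS by blast
    then have psub: "?S' \<subset> D" by auto
    have fUD: "finite (\<Union>D)" using fD D(1) c4(2) by blast
    have UD: "card (\<Union>?S') + card (\<Union>?N - V) \<le> card (\<Union>D)"
    proof -
      have "card (\<Union>?S') + card (\<Union>?N - V) = card (\<Union>?S' \<union> (\<Union>?N - V))"
        using fUD V by (intro card_Un_disjoint[symmetric]) (auto intro: finite_subset[OF _ fUD])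
      also have "\<dots> \<le> card (\<Union>D)" using fUD by (intro card_mono) auto
      finally show ?thesis .
    qed
    have le: "card (\<Union>D) \<le> 2 * card D + 2" using conflictD[OF D(2)] by simp
    have newN: "2 * card ?N + (if ?N = P then 0 else 1) \<le> card (\<Union>?N - V)"
      using generic_part[OF g bb, of ?N] False G(10) by (cases "?N = P") auto
    have s2: "2 * card ?S' + 3 \<le> card (\<Union>?S')" if "2 \<le> card ?S'"
      using conflictD(5)[OF D(2) psub that] .
    have "card ?S' < 2" using s2 UD le newN cD by (cases "2 \<le> card ?S'") (auto split: if_splits)
    then consider "card ?S' = 0" | "card ?S' = 1" by linarith
    then show ?thesis
    proof cases
      case 1
      then have "D \<subset> ?C" using fD DS G(3) by auto
      then show ?thesis using conflictD(5)[OF G(4) _ conflictD(2)[OF D(2)]] conflictD(4)[OF D(2)] by force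
    next
      case 2
      then obtain x where x: "?S' = {x}" by (auto simp: card_1_singleton_iff)
      then have xS: "x \<in> ?S" by auto
      \<comment> \<open>The single block \<open>x\<close> has exactly \<open>2 * 1 + 2\<close>
        vertices, so there is no room for the extra vertex that a proper part of \<open>P\<close>
        would bring.\<close>
      have NP: "?N = P" using newN UD le cD x c4[of x] xS by (auto split: if_splits)
      have DxP: "D = insert x P" using DS x NP by auto
      show ?thesis
      proof (cases "x = b")
        case True
        then have "{b, w} \<subseteq> D \<inter> insert w SB" using DxP G(2) b by auto
        moreover have "card {b, w} = 2" by (rule card2) (use G(2,3) in auto)
        ultimately show ?thesis using fD by (metis card_mono finite_Int)
      next
        case False
        \<comment> \<open>A vertex of \<open>P\<close> in \<open>b\<close> but outside
          \<open>x\<close> would again be one vertex too many.\<close>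
        have sub: "x \<union> (\<Union>P \<inter> b) \<subseteq> x"
        proof (rule ccontr)
          assume "\<not> ?thesis"
          then have "x \<subset> x \<union> (\<Union>P \<inter> b)" by blast
          then have "card x < card (x \<union> (\<Union>P \<inter> b))"
            using c4[of x] xS G(7) by (intro psubset_card_mono) auto
          moreover have "card (x \<union> (\<Union>P \<inter> b)) + card (\<Union>P - V) = card ((x \<union> (\<Union>P \<inter> b)) \<union> (\<Union>P - V))"
            using c4[of x] xS G(7) V bb by (intro card_Un_disjoint[symmetric]) auto
          moreover have "\<dots> \<le> card (\<Union>D)" using fUD DxP by (intro card_mono) auto
          moreover have "card D = card P + 1" using cD x NP by simp
          moreover have "card x = 4" using c4[of x] xS by blast
          ultimately show False using le G(10) by linarith
        qed
        then have "card (\<Union>P \<inter> b) \<le> card (b \<inter> x)" using c4[of b] b by (intro card_mono) auto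
        also have bx: "card (b \<inter> x) \<le> 2" using good b xS False by (auto simp: good_def)
        finally have P2: "card (\<Union>P \<inter> b) \<le> 2" .
        have "card P = 1"
        proof (rule ccontr)
          assume "card P \<noteq> 1"
          then have "2 * card P + 3 \<le> card (\<Union>P)"
            using conflictD(5)[OF G(4), of P] G(3,8) by auto
          then show False using G(11) P2 by simp
        qed
        then have Pw: "P = {w}" using G(2) by (auto simp: card_1_singleton_iff)
        have "card (b \<union> w) = 6" using g Pw by (simp add: generic_def)
        moreover have "card (b \<union> w) + card (b \<inter> w) = card b + card w"
          using c4 b G(2) by (intro card_Un_Int[symmetric]) auto
        ultimately have "card (b \<inter> w) = 2" using c4 b G(2) by auto
        moreover have "b \<inter> w \<subseteq> b \<inter> x" using sub Pw by auto
        ultimately have "2 \<le> card (b \<inter> x)" using c4[of b] b by (metis UnI1 card_mono finite_Int)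
        then have "conflict {x, b}" using False c4[of b] c4[of x] b xS
          by (intro conflict_pair) (auto simp: Int_commute)
        then have c2x: "2 \<le> card ({x, b} \<inter> SB)" using good xS b by (auto simp: good_def)
        have "x \<in> SB"
        proof (rule ccontr)
          assume "x \<notin> SB"
          then have "{x, b} \<inter> SB = {b}" using b by auto
          then show False using c2x by simp
        qed
        then have "{x, w} \<subseteq> D \<inter> insert w SB" using DxP G(2) by auto
        moreover have "x \<noteq> w" using xS G(2) PS by auto
        then have "card {x, w} = 2" by auto
        ultimately show ?thesis using fD by (metis card_mono finite_Int)
      qed
    qed
  qed
  have US: "insert w SB \<union> (SA \<union> (P - {w})) = ?S \<union> P" using G(2) by blast
  have "insert w SB \<inter> (SA \<union> (P - {w})) = {}"
    using good PS G(2) by (auto simp: good_def)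
  moreover have "card (x \<inter> y) \<le> 2" if xy: "x \<in> ?S \<union> P" "y \<in> ?S \<union> P" "x \<noteq> y" for x y
  proof -
    have "card (x \<inter> y) \<le> 2" if "x \<in> ?S" "y \<in> ?S"
      using good xy(3) that unfolding good_def by blast
    moreover have "y \<inter> x = x \<inter> y" by (rule Int_commute)
    ultimately show ?thesis using ov2[of x y] ov2[of y x] ov3[of x y] xy by (metis Un_iff)
  qed
  ultimately show "good (insert w SB) (SA \<union> (P - {w}))"
    unfolding good_def US using conf by (intro conjI ballI impI allI) auto
qed

lemma finite_covered_pairs: "finite S \<Longrightarrow> S \<subseteq> blocks n \<Longrightarrow> finite (covered_pairs S)"
  by (rule finite_subset[of _ "\<Union>(Pow ` S)"]) (auto simp: covered_pairs_def dest: blocksD)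

lemma card_covered_pairs_single: "card w = 4 \<Longrightarrow> card (covered_pairs {w}) = 6"
proof -
  assume w: "card w = 4"
  then have "finite w" using card_ge_0_finite by force
  moreover have "covered_pairs {w} = {f. f \<subseteq> w \<and> card f = 2}" by (auto simp: covered_pairs_def)
  ultimately show ?thesis using n_subsets[of w 2] w by (simp add: binomial_eq_0 numeral_eq_Suc)
qed

lemma covered_pairs_Un: "covered_pairs (S \<union> T) = covered_pairs S \<union> covered_pairs T"
  by (auto simp: covered_pairs_def)

text \<open>If \<open>P = {w}\<close>, the only old pair in \<open>w\<close> is
  \<open>b \<inter> w\<close>. Otherwise \<open>{b, w}\<close> is a proper part of a conflict and
  shares at most one vertex. This is the origin of the exponents 5 and 6 in
  \<open>rate\<close>.\<close>

lemma card_covered_pairs_ext: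
  assumes S: "SB \<subseteq> blocks n" "finite SB" and V: "\<Union>SB \<subseteq> V" and b: "b \<in> SB" and g: "generic n V b w P"
  shows "card (covered_pairs (insert w SB)) = card (covered_pairs SB) + (if card P = 1 then 5 else 6)"
proof -
  have bb: "b \<in> blocks n" "b \<subseteq> V" using S V b by auto
  note G = genD[OF g bb]
  have wb: "w \<in> blocks n" using G by auto
  have f: "finite (covered_pairs SB)" "finite (covered_pairs {w})" using S wb by (auto intro!: finite_covered_pairs)
  have I: "covered_pairs SB \<inter> covered_pairs {w} = {f. card f = 2 \<and> f \<subseteq> b \<inter> w}"
  proof (intro equalityI subsetI)
    fix f assume "f \<in> covered_pairs SB \<inter> covered_pairs {w}"
    then obtain x where x: "x \<in> SB" "f \<subseteq> x" "f \<subseteq> w" "card f = 2" by (auto simp: covered_pairs_def)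
    then have "f \<subseteq> \<Union>P \<inter> V" using V G(2) by blast
    then have "f \<subseteq> b" using G(5) by blast
    then show "f \<in> {f. card f = 2 \<and> f \<subseteq> b \<inter> w}" using x by auto
  qed (use b in \<open>auto simp: covered_pairs_def\<close>)
  have Un: "card (b \<union> w) + card (b \<inter> w) = 8"
    using bb wb blocksD by (subst card_Un_Int[symmetric]) auto
  have "card (covered_pairs SB \<inter> covered_pairs {w}) = (if card P = 1 then 1 else 0)"
  proof (cases "card P = 1")
    case True
    then have "P = {w}" using G(2) by (auto simp: card_1_singleton_iff)
    then have c2: "card (b \<inter> w) = 2" using g Un by (simp add: generic_def)
    moreover have fbw: "finite (b \<inter> w)" using wb blocksD(3) by blast
    ultimately have e: "f = b \<inter> w" if "card f = 2" "f \<subseteq> b \<inter> w" for f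
      using card_subset_eq[OF fbw that(2)] that(1) by simp
    have "covered_pairs SB \<inter> covered_pairs {w} = {b \<inter> w}"
      unfolding I
    proof (intro equalityI subsetI)
      fix f assume "f \<in> {f. card f = 2 \<and> f \<subseteq> b \<inter> w}"
      then have "card f = 2" "f \<subseteq> b \<inter> w" by simp_all
      then show "f \<in> {b \<inter> w}" by (simp only: e singleton_iff)
    qed (simp add: c2)
    then show ?thesis using True by simp
  next
    case False
    then have "{b, w} \<subset> insert b P" using G(2,3) by (auto simp: card_1_singleton_iff)
    moreover have "card {b, w} = 2" by (rule card2) (use G(2,3) in auto)
    ultimately have "7 \<le> card (b \<union> w)" using conflictD(5)[OF G(4), of "{b, w}"] by simp
    then have "card (b \<inter> w) \<le> 1" using Un by simp
    moreover have fbw: "finite (b \<inter> w)" using wb blocksD(3) by blast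
    ultimately have "card f \<noteq> 2" if "f \<subseteq> b \<inter> w" for f
      using card_mono[OF fbw that] by simp
    then have "covered_pairs SB \<inter> covered_pairs {w} = {}"
      unfolding I by blast
    then show ?thesis using False by simp
  qed
  moreover have "card (covered_pairs SB \<union> covered_pairs {w}) + card (covered_pairs SB \<inter> covered_pairs {w}) = card (covered_pairs SB) + card (covered_pairs {w})"
    using card_Un_Int[OF f] by simp
  moreover have "card (covered_pairs {w}) = 6" using wb blocksD by (intro card_covered_pairs_single) auto
  moreover have "covered_pairs (insert w SB) = covered_pairs SB \<union> covered_pairs {w}" using covered_pairs_Un[of SB "{w}"] by simp
  ultimately show ?thesis by (cases "card P = 1") simp_all
qed

text \<open>If \<open>P\<close> and \<open>P'\<close> have no common block, the shared vertex is
  counted twice. If they do, the common blocks with \<open>b'\<close> form a proper part of the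
  second conflict and \<open>conflict_rest\<close> loses the vertex.\<close>

lemma generic_overlap:
  assumes g: "generic n V b w P" and b: "b \<in> blocks n" "b \<subseteq> V"
    and g': "generic n V b' w' P'" and b': "b' \<in> blocks n" "b' \<subseteq> V"
    and ns: "\<not> P' \<subseteq> P" and hit: "\<Union>P' \<inter> \<Union>P - V \<noteq> {}"
  shows "card (\<Union>(P \<union> P') - V) + 1 \<le> 2 * card (P \<union> P')"
proof -
  note G = genD[OF g b] and G' = genD[OF g' b']
  let ?A = "\<Union>P' - V - \<Union>P"
  have fA: "finite ?A" using G'(7) by auto
  have 1: "card ?A + 1 \<le> 2 * card (P' - P)"
  proof (cases "P' \<inter> P = {}")
    case True
    have "?A \<subset> \<Union>P' - V" using hit by auto
    then have "card ?A < card (\<Union>P' - V)" using G'(7) by (intro psubset_card_mono) auto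
    moreover have "P' - P = P'" using True by blast
    ultimately show ?thesis using G'(10) by simp
  next
    case False
    let ?S' = "insert b' (P' \<inter> P)"
    have "card (P' \<inter> P) > 0" using False G'(6) by (simp add: card_gt_0_iff)
    then have c2: "2 \<le> card ?S'" using G'(3,6) by simp
    have ps: "?S' \<subset> insert b' P'" using ns G'(3) by auto
    have fU: "finite (\<Union>(insert b' P'))" using G'(7) b'(1) blocksD(3) by auto
    have "card ?A \<le> card (\<Union>(insert b' P') - \<Union>?S')"
      using fU b'(2) by (intro card_mono) auto
    moreover have "insert b' P' - ?S' = P' - P" using G'(3) by blast
    ultimately show ?thesis using conflict_rest[OF G'(4) ps c2 fU] by simp
  qed
  have "card (\<Union>(P \<union> P') - V) \<le> card ((\<Union>P - V) \<union> ?A)"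
    using G(7) fA by (intro card_mono) auto
  also have "\<dots> \<le> 2 * card P + card ?A" using card_Un_le[of "\<Union>P - V" ?A] G(10) by simp
  finally have "card (\<Union>(P \<union> P') - V) + 1 \<le> 2 * (card P + card (P' - P))" using 1 by simp
  also have "card P + card (P' - P) = card (P \<union> P')"
    using G(6) G'(6) by (subst card_Un_disjoint[symmetric]) (auto intro: arg_cong[where f = card])
  finally show ?thesis .
qed

text \<open>A conflict fails to be generic by containing a second block of the template, by having
  fewer vertices than possible, or by meeting the template outside \<open>b\<close>. Each costs at
  least one new vertex.\<close>

lemma not_generic_overlap:
  assumes C: "conflict C" "b \<in> C" "w \<in> C" "b \<noteq> w" and S: "b \<in> S" "S \<subseteq> blocks n" "w \<notin> S" and Cb: "C \<subseteq> blocks n"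
    and ng: "\<not> generic n (\<Union>S) b w (C - {b})"
  shows "card (\<Union>(C - S) - \<Union>S) + 1 \<le> 2 * card (C - S)"
proof -
  have fC: "finite C" using C by (auto simp: conflict_def)
  have fU: "finite (\<Union>C)" using fC Cb blocksD by blast
  have bb: "card b = 4" "finite b" using S blocksD by auto
  show ?thesis
  proof (cases "C \<inter> S = {b}")
    case True
    then have CS: "C - S = C - {b}" using C by blast
    have ins: "insert b (C - {b}) = C" using C by blast
    have CbS: "C - {b} \<subseteq> blocks n" using Cb by blast
    have cC: "card C = card (C - {b}) + 1" using card_Suc_Diff1[OF fC C(2)] by linarith
    have le: "card (\<Union>C) \<le> 2 * card (C - {b}) + 4" using conflictD(4)[OF C(1)] cC by simp
    have "card (\<Union>(C - {b}) - \<Union>S) < 2 * card (C - {b})"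
    proof (cases "card (\<Union>C) = 2 * card (C - {b}) + 4")
      case True
      then have "\<not> \<Union>(C - {b}) \<inter> \<Union>S \<subseteq> b"
        using ng C CbS unfolding generic_def ins by simp
      then obtain v where v: "v \<in> \<Union>(C - {b}) \<inter> \<Union>S" "v \<notin> b" by (meson subsetI)
      then have "v \<in> \<Union>C - b" "v \<notin> \<Union>(C - {b}) - \<Union>S" by auto
      moreover have "\<Union>(C - {b}) - \<Union>S \<subseteq> \<Union>C - b" using S(1) by auto
      ultimately have "\<Union>(C - {b}) - \<Union>S \<subset> \<Union>C - b" by (metis psubsetI)
      then have "card (\<Union>(C - {b}) - \<Union>S) < card (\<Union>C - b)" using fU by (intro psubset_card_mono) auto
      also have "card (\<Union>C - b) = 2 * card (C - {b})"
        using True bb fU C(2) by (subst card_Diff_subset) auto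
      finally show ?thesis .
    next
      case False
      have "card (\<Union>(C - {b}) - \<Union>S) \<le> card (\<Union>C - b)" using fU S(1) by (intro card_mono) auto
      also have "card (\<Union>C - b) = card (\<Union>C) - 4"
        using bb fU C(2) by (subst card_Diff_subset) auto
      finally show ?thesis using False le cC conflictD(2)[OF C(1)] by linarith
    qed
    then show ?thesis unfolding CS by simp
  next
    case False
    then obtain y where y: "y \<in> C \<inter> S" "y \<noteq> b" using C S by blast
    have "card {b, y} \<le> card (C \<inter> S)" using y C S fC by (intro card_mono) auto
    then have c2: "2 \<le> card (C \<inter> S)" using y by simp
    have ps: "C \<inter> S \<subset> C" using C S by auto
    have "card (\<Union>(C - S) - \<Union>S) \<le> card (\<Union>C - \<Union>(C \<inter> S))" using fU by (intro card_mono) auto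
    moreover have "C - C \<inter> S = C - S" by blast
    ultimately show ?thesis using conflict_rest[OF C(1) ps c2 fU] by simp
  qed
qed

section \<open>Counting families of blocks by their new vertices\<close>

definition FC :: "nat \<Rightarrow> nat \<Rightarrow> nat" where
  "FC K v = 2 * 2 ^ 2 ^ (K + v)"

lemma FC_mono: "v \<le> v' \<Longrightarrow> FC K v \<le> FC K v'"
  by (simp add: FC_def)

lemma of_nat_le_mult_power: "a \<le> b * n ^ v \<Longrightarrow> real a \<le> real b * real n ^ v"
  using of_nat_mono[of a "b * n ^ v", where ?'a = real] by simp

text \<open>A nonempty set with at most \<open>v\<close> elements is the image of a map from
  \<open>{..<v}\<close>; the summand 1 stands for the empty set.\<close>

lemma card_small_subsets: "card {S. S \<subseteq> {..<n} \<and> card S \<le> v} \<le> n ^ v + (1::nat)"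
proof -
  let ?F = "{..<v} \<rightarrow>\<^sub>E {..<n}"
  have fF: "finite ?F" by (simp add: finite_PiE)
  have "S \<in> insert {} ((\<lambda>f. f ` {..<v}) ` ?F)" if S: "S \<subseteq> {..<n}" "card S \<le> v" for S
  proof (cases "S = {}")
    case False
    have fS: "finite S" using S(1) by (rule finite_subset) simp
    obtain g where g: "bij_betw g {..<card S} S"
      using ex_bij_betw_nat_finite[OF fS] by (auto simp: atLeast0LessThan)
    have c0: "0 < card S" using False fS by (simp add: card_gt_0_iff)
    \<comment> \<open>The minimum repeats the last element when \<open>S\<close> has fewer than
      \<open>v\<close> elements.\<close>
    define f where "f = restrict (\<lambda>i. g (min i (card S - 1))) {..<v}"
    have gS: "g i \<in> S" if "i < card S" for i using g that by (auto simp: bij_betw_def)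
    have "f ` {..<v} = S"
    proof (intro equalityI subsetI)
      fix x assume "x \<in> f ` {..<v}"
      then show "x \<in> S" using c0 by (auto simp: f_def intro!: gS)
    next
      fix x assume "x \<in> S"
      then obtain i where i: "i < card S" "x = g i" using g by (auto simp: bij_betw_def)
      then have "x = f i" "i < v" using S(2) by (auto simp: f_def min_def)
      then show "x \<in> f ` {..<v}" by auto
    qed
    moreover have "f \<in> ?F"
      unfolding f_def restrict_PiE_iff using S(1) c0 gS by (auto simp: subset_iff)
    ultimately show ?thesis by auto
  qed simp
  then have "{S. S \<subseteq> {..<n} \<and> card S \<le> v} \<subseteq> insert {} ((\<lambda>f. f ` {..<v}) ` ?F)" by auto
  then have "card {S. S \<subseteq> {..<n} \<and> card S \<le> v} \<le> card (insert {} ((\<lambda>f. f ` {..<v}) ` ?F))"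
    using fF by (intro card_mono) auto
  also have "\<dots> \<le> Suc (card ?F)"
    using fF card_image_le[OF fF, of "\<lambda>f. f ` {..<v}"] by (simp add: card_insert_if le_SucI)
  finally show ?thesis by (simp add: card_funcsetE)
qed

text \<open>\<open>FC K v\<close> has two factors: there are at most
  \<open>n ^ v + 1 \<le> 2 * n ^ v\<close> sets of new vertices, and at most
  \<open>2 ^ 2 ^ (K + v)\<close> families of subsets of a set of \<open>K + v\<close>
  vertices.\<close>

lemma card_families:
  assumes n: "1 \<le> n" and V: "finite V" "card V \<le> K"
  shows "card {P. P \<subseteq> blocks n \<and> card (\<Union>P - V) \<le> v} \<le> FC K v * n ^ v"
proof -
  let ?VV = "{S. S \<subseteq> {..<n} \<and> card S \<le> v}"
  have fVV: "finite ?VV" by (rule finite_subset[of _ "Pow {..<n}"]) auto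
  have "{P. P \<subseteq> blocks n \<and> card (\<Union>P - V) \<le> v} \<subseteq> (\<Union>S\<in>?VV. Pow (Pow (V \<union> S)))"
  proof
    fix P assume P: "P \<in> {P. P \<subseteq> blocks n \<and> card (\<Union>P - V) \<le> v}"
    then have "\<Union>P - V \<in> ?VV" using blocksD(1) by blast
    moreover have "P \<in> Pow (Pow (V \<union> (\<Union>P - V)))" by auto
    ultimately show "P \<in> (\<Union>S\<in>?VV. Pow (Pow (V \<union> S)))" by blast
  qed
  then have "card {P. P \<subseteq> blocks n \<and> card (\<Union>P - V) \<le> v} \<le> card (\<Union>S\<in>?VV. Pow (Pow (V \<union> S)))"
    using fVV V by (intro card_mono finite_UN_I) (auto intro: finite_subset)
  also have "\<dots> \<le> (\<Sum>S\<in>?VV. card (Pow (Pow (V \<union> S))))" by (rule card_UN_le[OF fVV])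
  also have "\<dots> \<le> (\<Sum>S\<in>?VV. 2 ^ 2 ^ (K + v))"
  proof (rule sum_mono)
    fix S assume S: "S \<in> ?VV"
    then have fS: "finite S" by (auto intro: finite_subset)
    have "card (V \<union> S) \<le> K + v" using card_Un_le[of V S] V S by auto
    then show "card (Pow (Pow (V \<union> S))) \<le> 2 ^ 2 ^ (K + v)"
      using V fS by (simp add: card_Pow power_increasing)
  qed
  also have "\<dots> = card ?VV * 2 ^ 2 ^ (K + v)" by simp
  also have "\<dots> \<le> (2 * n ^ v) * 2 ^ 2 ^ (K + v)"
  proof (rule mult_right_mono)
    have "1 \<le> n ^ v" using n by simp
    then show "card ?VV \<le> 2 * n ^ v" using card_small_subsets[of n v] by linarith
  qed simp
  finally show ?thesis by (simp add: FC_def mult_ac)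
qed

lemma finite_families: "finite {P. P \<subseteq> blocks n \<and> Q P}"
  by (rule finite_subset[of _ "Pow (blocks n)"]) auto

lemma card_fibres:
  assumes "finite Q" "\<And>q. q \<in> Q \<Longrightarrow> U q \<in> F" "finite F" "\<And>P. card {q \<in> Q. U q = P} \<le> m"
  shows "card Q \<le> m * card F"
proof -
  have "Q = (\<Union>P\<in>F. {q \<in> Q. U q = P})" using assms(2) by auto
  then have "card Q \<le> (\<Sum>P\<in>F. card {q \<in> Q. U q = P})"
    using card_UN_le[OF assms(3)] by metis
  also have "\<dots> \<le> (\<Sum>P\<in>F. m)" using assms(4) by (rule sum_mono)
  finally show ?thesis by (simp add: mult.commute)
qed

text \<open>Group the configurations by the number \<open>v\<close> of new vertices: at most a
  constant times \<open>n ^ v\<close> of them occur, each of weight at most a constant times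
  \<open>n ^ - (v + 1)\<close>. A single missing vertex thus makes a whole sum of order
  \<open>1 / n\<close>.\<close>

lemma negligible_sum:
  fixes wt :: "'q \<Rightarrow> real"
  assumes n: "1 \<le> n" and V: "finite V" "card V \<le> K" and Q: "finite Q"
    and U: "\<And>q. q \<in> Q \<Longrightarrow> U q \<subseteq> blocks n" "\<And>q. q \<in> Q \<Longrightarrow> card (\<Union>(U q) - V) \<le> vm"
    and fib: "\<And>P. card {q \<in> Q. U q = P} \<le> m" and B: "0 \<le> B"
    and wt: "\<And>q. q \<in> Q \<Longrightarrow> wt q \<le> B * (1 / real n) ^ (card (\<Union>(U q) - V) + 1)"
  shows "(\<Sum>q\<in>Q. wt q) \<le> B * real (m * (vm + 1) * FC K vm) / real n"
proof -
  let ?v = "\<lambda>q. card (\<Union>(U q) - V)"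
  have "(\<Sum>q\<in>Q. wt q) \<le> (\<Sum>q\<in>Q. B * (1 / real n) ^ (?v q + 1))" using wt by (rule sum_mono)
  also have "\<dots> = (\<Sum>v\<le>vm. \<Sum>q\<in>{q \<in> Q. ?v q = v}. B * (1 / real n) ^ (?v q + 1))"
    by (rule sum.group[symmetric]) (use Q U in auto)
  also have "\<dots> \<le> (\<Sum>v\<le>vm. B * real (m * FC K vm) / real n)"
  proof (rule sum_mono)
    fix v assume v: "v \<in> {..vm}"
    let ?Q = "{q \<in> Q. ?v q = v}"
    let ?F = "{P. P \<subseteq> blocks n \<and> card (\<Union>P - V) \<le> v}"
    have fQ: "finite ?Q" using Q by simp
    have fib': "card {q \<in> ?Q. U q = P} \<le> m" for P
      by (rule order_trans[OF card_mono fib[of P]]) (use Q in auto)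
    have "card ?Q \<le> m * card ?F"
      by (rule card_fibres[OF fQ _ finite_families fib']) (use U in auto)
    also have "\<dots> \<le> m * (FC K vm * n ^ v)"
    proof (rule mult_left_mono)
      have "card ?F \<le> FC K v * n ^ v" by (rule card_families[OF n V])
      also have "\<dots> \<le> FC K vm * n ^ v" using v FC_mono by (intro mult_right_mono) auto
      finally show "card ?F \<le> FC K vm * n ^ v" .
    qed simp
    finally have "card ?Q \<le> (m * FC K vm) * n ^ v" by (simp only: mult.assoc)
    then have c: "real (card ?Q) \<le> real (m * FC K vm) * real n ^ v" by (rule of_nat_le_mult_power)
    have "(\<Sum>q\<in>?Q. B * (1 / real n) ^ (?v q + 1)) = (\<Sum>q\<in>?Q. B * (1 / real n) ^ (v + 1))"
      by (rule sum.cong) auto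
    also have "\<dots> = real (card ?Q) * (B * (1 / real n) ^ (v + 1))" by simp
    also have "\<dots> \<le> (real (m * FC K vm) * real n ^ v) * (B * (1 / real n) ^ (v + 1))"
      using c B by (intro mult_right_mono) auto
    also have "\<dots> = B * real (m * FC K vm) / real n"
      using n by (simp add: field_simps)
    finally show "(\<Sum>q\<in>?Q. B * (1 / real n) ^ (?v q + 1)) \<le> B * real (m * FC K vm) / real n" .
  qed
  also have "\<dots> = B * real (m * (vm + 1) * FC K vm) / real n" by (simp add: field_simps)
  finally show ?thesis .
qed

section \<open>Symmetry under relabelling and the densities of conflicts\<close>

lemma conflict_image:
  assumes C: "conflict C" and inj: "inj_on f (\<Union>C)"
  shows "conflict ((`) f ` C)"
proof -
  have injS: "inj_on ((`) f) (Pow (\<Union>C))" using inj by (rule inj_on_image_Pow)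
  have cS: "card ((`) f ` D) = card D" "card (\<Union>((`) f ` D)) = card (\<Union>D)" if "D \<subseteq> C" for D
  proof -
    show "card ((`) f ` D) = card D"
      by (rule card_image, rule inj_on_subset[OF injS]) (use that in blast)
    have "\<Union>((`) f ` D) = f ` \<Union>D" by (rule image_Union[symmetric])
    then show "card (\<Union>((`) f ` D)) = card (\<Union>D)"
      using card_image[OF inj_on_subset[OF inj Union_mono[OF that]]] by simp
  qed
  have "2 * card D + 3 \<le> card (\<Union>D)" if D: "D \<subset> (`) f ` C" "2 \<le> card D" for D
  proof -
    obtain D0 where D0: "D0 \<subseteq> C" "D = (`) f ` D0" using D(1) by (metis psubsetE subset_imageE)
    then have "D0 \<subset> C" using D(1) by auto
    then show ?thesis using conflictD(5)[OF C, of D0] cS[of D0] D(2) D0 by simp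
  qed
  then show ?thesis
    using conflictD[OF C] cS[of C] unfolding conflict_def by simp
qed

definition conflict_items :: "nat \<Rightarrow> nat set \<Rightarrow> nat set \<Rightarrow> nat \<Rightarrow> (nat set \<times> nat set set) set" where
  "conflict_items n V b m = {(w, P). generic n V b w P \<and> card P = m}"

lemma conflict_items_subset: "conflict_items n V b m \<subseteq> blocks n \<times> Pow (blocks n)"
  by (auto simp: conflict_items_def generic_def)

lemma finite_conflict_items [simp]: "finite (conflict_items n V b m)"
  by (rule finite_subset[OF conflict_items_subset]) simp

text \<open>A permutation of the vertices that carries \<open>b\<close> to \<open>b'\<close> carries
  the conflicts at \<open>b\<close> to conflicts at \<open>b'\<close>. By symmetry the number does
  not depend on the block.\<close>

lemma card_conflict_items_le:
  assumes b: "b \<in> blocks n" and b': "b' \<in> blocks n"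
  shows "card (conflict_items n b b m) \<le> card (conflict_items n b' b' m)"
proof -
  have fb: "finite b" "finite b'" "card b = card b'" using b b' blocksD by auto
  obtain g where g: "bij_betw g b b'" using finite_same_card_bij[OF fb] by blast
  let ?A = "{..<n} - b" and ?A' = "{..<n} - b'"
  have sub: "b \<subseteq> {..<n}" "b' \<subseteq> {..<n}" using b b' blocksD by auto
  then have "card ?A = card ?A'" using fb by (simp add: card_Diff_subset)
  then obtain h where h: "bij_betw h ?A ?A'" using finite_same_card_bij[of ?A ?A'] by auto
  define f where "f x = (if x \<in> b then g x else h x)" for x
  have "bij_betw f (b \<union> ?A) (b' \<union> ?A')"
  proof (rule bij_betw_combine)
    show "bij_betw f b b'" using g by (rule bij_betw_cong[THEN iffD1, rotated]) (simp add: f_def)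
    show "bij_betw f ?A ?A'" using h by (rule bij_betw_cong[THEN iffD1, rotated]) (simp add: f_def)
  qed auto
  moreover have "b \<union> ?A = {..<n}" "b' \<union> ?A' = {..<n}" using sub by auto
  ultimately have f: "bij_betw f {..<n} {..<n}" by simp
  have inj: "inj_on f {..<n}" using f by (rule bij_betw_imp_inj_on)
  have fbb: "f ` b = b'" using g by (auto simp: f_def bij_betw_def)
  have injP: "inj_on ((`) f) (Pow {..<n})" using inj by (rule inj_on_image_Pow)
  have injPP: "inj_on ((`) ((`) f)) (Pow (Pow {..<n}))" using injP by (rule inj_on_image_Pow)
  have fbl: "f ` x \<in> blocks n" if "x \<in> blocks n" for x
  proof -
    have "f ` x \<subseteq> f ` {..<n}" using that blocksD(1) by blast
    then have "f ` x \<subseteq> {..<n}" using f by (simp add: bij_betw_def)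
    moreover have "card (f ` x) = 4"
      using that blocksD by (subst card_image[OF inj_on_subset[OF inj]]) auto
    ultimately show ?thesis by (simp add: blocks_def)
  qed
  let ?m = "\<lambda>(w, P). (f ` w, (`) f ` P)"
  have "?m ` conflict_items n b b m \<subseteq> conflict_items n b' b' m"
  proof (rule image_subsetI, clarify)
    fix w P assume "(w, P) \<in> conflict_items n b b m"
    then have generic: "generic n b b w P" and cP: "card P = m" by (auto simp: conflict_items_def)
    note G = genD[OF generic b order_refl]
    have sub: "insert b P \<subseteq> Pow {..<n}" using G(1) b blocksD(1) by auto
    then have Usub: "\<Union>(insert b P) \<subseteq> {..<n}" by blast
    have ins: "insert b' ((`) f ` P) = (`) f ` insert b P" using fbb by simp
    have "conflict ((`) f ` insert b P)"
      by (rule conflict_image[OF G(4) inj_on_subset[OF inj Usub]])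
    moreover have "card (\<Union>((`) f ` insert b P)) = card (\<Union>(insert b P))"
      unfolding image_Union[symmetric] by (rule card_image[OF inj_on_subset[OF inj Usub]])
    moreover have cim: "card ((`) f ` P) = card P"
      by (rule card_image, rule inj_on_subset[OF injP]) (use sub in simp)
    moreover have "b' \<notin> (`) f ` P"
    proof
      assume "b' \<in> (`) f ` P"
      then obtain x where x: "b' = f ` x" "x \<in> P" by (rule imageE)
      have "f ` x = f ` b" using x(1) fbb by simp
      moreover have "x \<in> Pow {..<n}" "b \<in> Pow {..<n}" using sub x(2) by auto
      ultimately have "x = b" by (rule inj_onD[OF injP])
      then show False using G(3) x(2) by simp
    qed
    moreover have "(`) f ` P \<subseteq> blocks n"
      by (rule image_subsetI, rule fbl) (use G(1) in auto)
    moreover have "\<Union>((`) f ` P) \<inter> b' \<subseteq> b'" by (rule Int_lower2)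
    moreover have "f ` w \<in> (`) f ` P" using G(2) by (rule imageI)
    ultimately have "generic n b' b' (f ` w) ((`) f ` P)"
      unfolding generic_def ins using generic by (simp add: generic_def)
    then show "(f ` w, (`) f ` P) \<in> conflict_items n b' b' m" using cim cP by (simp add: conflict_items_def)
  qed
  moreover have "inj_on ?m (conflict_items n b b m)"
  proof (rule inj_onI, clarify)
    fix w P w' P'
    assume q: "(w, P) \<in> conflict_items n b b m" "(w', P') \<in> conflict_items n b b m"
      and eq: "f ` w = f ` w'" "(`) f ` P = (`) f ` P'"
    have "w \<in> Pow {..<n}" "w' \<in> Pow {..<n}" "P \<in> Pow (Pow {..<n})" "P' \<in> Pow (Pow {..<n})"
      using q conflict_items_subset[of n b b m] blocksD(1) by blast+
    then show "w = w' \<and> P = P'" using eq injP injPP by (simp add: inj_on_eq_iff)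
  qed
  ultimately show ?thesis by (intro card_inj_on_le[of ?m]) auto
qed

text \<open>A conflict counts once for every choice of its last block \<open>w\<close>. The density
  may vary with \<open>n\<close>: all that enters is that it is nonnegative and bounded.\<close>

definition conflict_density :: "nat \<Rightarrow> nat \<Rightarrow> real" where
  "conflict_density n m = real (card (conflict_items n {..<4} {..<4} m)) / real n ^ (2 * m)"

lemma card_pairs_families:
  assumes n: "1 \<le> n" and V: "finite V" "card V \<le> K" and m: "m \<le> 7"
    and Q: "\<And>w P. (w, P) \<in> Q \<Longrightarrow> w \<in> P \<and> P \<subseteq> blocks n \<and> card P = m \<and> card (\<Union>P - V) \<le> v"
  shows "card Q \<le> 7 * FC K v * n ^ v"
proof -
  let ?F = "{P. P \<subseteq> blocks n \<and> card (\<Union>P - V) \<le> v}"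
  have Q': "fst q \<in> snd q" "snd q \<subseteq> blocks n" "card (snd q) = m" "card (\<Union>(snd q) - V) \<le> v"
    if "q \<in> Q" for q using Q[of "fst q" "snd q"] that by auto
  have "Q \<subseteq> blocks n \<times> Pow (blocks n)"
  proof
    fix q assume "q \<in> Q"
    from Q'[OF this] show "q \<in> blocks n \<times> Pow (blocks n)" by (auto simp: mem_Times_iff)
  qed
  then have fQ: "finite Q" by (rule finite_subset) simp
  have "card {q \<in> Q. snd q = P} \<le> 7" for P
  proof (cases "\<exists>q\<in>Q. snd q = P")
    case True
    then obtain q where q: "q \<in> Q" "snd q = P" by blast
    have P: "P \<subseteq> blocks n" "card P = m" using Q'(2,3)[OF q(1)] q(2) by simp_all
    then have fP: "finite P" by (meson finite_blocks finite_subset)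
    have "{q \<in> Q. snd q = P} \<subseteq> P \<times> {P}"
    proof
      fix q assume "q \<in> {q \<in> Q. snd q = P}"
      then show "q \<in> P \<times> {P}" using Q'(1)[of q] by (auto simp: mem_Times_iff)
    qed
    then have "card {q \<in> Q. snd q = P} \<le> card (P \<times> {P})" using fP by (intro card_mono) auto
    then show ?thesis using P m by (simp add: card_cartesian_product)
  next
    case False
    then have "{q \<in> Q. snd q = P} = {}" by auto
    then show ?thesis by (simp only: card.empty)
  qed
  note fib = this
  have "card Q \<le> 7 * card ?F"
  proof (rule card_fibres[OF fQ _ finite_families fib])
    fix q assume "q \<in> Q"
    from Q'[OF this] show "snd q \<in> ?F" by simp
  qed
  also have "\<dots> \<le> 7 * (FC K v * n ^ v)" using card_families[OF n V] by (rule mult_left_mono) simp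
  finally show ?thesis by simp
qed

lemma conflict_density_nonneg: "0 \<le> conflict_density n m"
  by (simp add: conflict_density_def)

lemma conflict_density_le:
  assumes n: "4 \<le> n" and m: "m \<le> 7"
  shows "conflict_density n m \<le> real (7 * FC 4 14)"
proof -
  have b: "{..<4} \<in> blocks n" using n by (auto simp: blocks_def)
  have "card (conflict_items n {..<4} {..<4} m) \<le> 7 * FC 4 (2 * m) * n ^ (2 * m)"
  proof (rule card_pairs_families)
    fix w P assume "(w, P) \<in> conflict_items n {..<4} {..<4} m"
    then have generic: "generic n {..<4} {..<4} w P" and cP: "card P = m" by (auto simp: conflict_items_def)
    note G = genD[OF generic b order_refl]
    show "w \<in> P \<and> P \<subseteq> blocks n \<and> card P = m \<and> card (\<Union>P - {..<4}) \<le> 2 * m"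
      using G cP by simp
  qed (use n m in auto)
  also have "\<dots> \<le> 7 * FC 4 14 * n ^ (2 * m)" using m FC_mono by simp
  finally have "real (card (conflict_items n {..<4} {..<4} m)) \<le> real (7 * FC 4 14) * real n ^ (2 * m)"
    by (rule of_nat_le_mult_power)
  then show ?thesis unfolding conflict_density_def using n by (simp add: divide_le_eq)
qed

text \<open>Conflicts that are generic for \<open>b\<close> alone but not for \<open>V\<close> have
  a further vertex in \<open>V\<close>, so there are only about \<open>n ^ (2 * m - 1)\<close> of
  them.\<close>

lemma conflict_items_count:
  assumes n: "4 \<le> n" and m: "1 \<le> m" "m \<le> 7" and b: "b \<in> blocks n" "b \<subseteq> V"
    and V: "finite V" "card V \<le> K"
  shows "\<bar>real (card (conflict_items n V b m)) / real n ^ (2 * m) - conflict_density n m\<bar> \<le> real (7 * FC K 14) / real n"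
    and "real (card (conflict_items n V b m)) / real n ^ (2 * m) \<le> real (7 * FC K 14)"
proof -
  have b0: "{..<4} \<in> blocks n" using n by (auto simp: blocks_def)
  let ?D = "conflict_items n b b m - conflict_items n V b m"
  have sub: "conflict_items n V b m \<subseteq> conflict_items n b b m" by (auto simp: conflict_items_def generic_def)
  have eq: "card (conflict_items n b b m) = card (conflict_items n {..<4} {..<4} m)"
    by (intro antisym card_conflict_items_le b b0)
  have cD: "card ?D \<le> 7 * FC K (2 * m - 1) * n ^ (2 * m - 1)"
  proof (rule card_pairs_families[OF _ V m(2)])
    fix w P assume wP: "(w, P) \<in> ?D"
    then have generic: "generic n b b w P" and cP: "card P = m" by (auto simp: conflict_items_def)
    note G = genD[OF generic b(1) order_refl]
    have "\<not> \<Union>P \<inter> V \<subseteq> b" using wP generic by (auto simp: conflict_items_def generic_def)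
    then obtain v where v: "v \<in> \<Union>P \<inter> V" "v \<notin> b" by (meson subsetI)
    have "card (\<Union>P - V) < card (\<Union>P - b)"
      using G(7) by (intro psubset_card_mono) (use v b in auto)
    then have "card (\<Union>P - V) \<le> 2 * m - 1" using G(10) cP by simp
    then show "w \<in> P \<and> P \<subseteq> blocks n \<and> card P = m \<and> card (\<Union>P - V) \<le> 2 * m - 1"
      using G cP by simp
  qed (use n in auto)
  have n0: "real n > 0" using n by simp
  have "real (card ?D) \<le> real (7 * FC K 14) * real n ^ (2 * m - 1)"
  proof -
    have "7 * FC K (2 * m - 1) * n ^ (2 * m - 1) \<le> 7 * FC K 14 * n ^ (2 * m - 1)"
      using m FC_mono by (intro mult_right_mono mult_left_mono) auto
    then have "card ?D \<le> 7 * FC K 14 * n ^ (2 * m - 1)" using cD by linarith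
    then show ?thesis by (rule of_nat_le_mult_power)
  qed
  then have "real (card ?D) / real n ^ (2 * m) \<le> real (7 * FC K 14) * real n ^ (2 * m - 1) / real n ^ (2 * m)"
    by (rule divide_right_mono) simp
  also have "\<dots> = real (7 * FC K 14) / real n"
  proof -
    have "real n ^ (2 * m) = real n ^ (2 * m - 1) * real n"
      using m(1) by (simp flip: power_Suc2)
    then show ?thesis using n0 by simp
  qed
  finally have 1: "real (card ?D) / real n ^ (2 * m) \<le> real (7 * FC K 14) / real n" .
  have "card (conflict_items n b b m) = card (conflict_items n V b m) + card ?D"
    using sub by (metis add_diff_inverse_nat card_Diff_subset card_mono finite_conflict_items finite_subset not_less)
  then have "conflict_density n m = real (card (conflict_items n V b m)) / real n ^ (2 * m) + real (card ?D) / real n ^ (2 * m)"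
    unfolding conflict_density_def eq[symmetric] by (simp add: add_divide_distrib)
  then show "\<bar>real (card (conflict_items n V b m)) / real n ^ (2 * m) - conflict_density n m\<bar> \<le> real (7 * FC K 14) / real n"
    using 1 by simp
  have "card (conflict_items n V b m) \<le> 7 * FC K (2 * m) * n ^ (2 * m)"
  proof (rule card_pairs_families[OF _ V m(2)])
    fix w P assume "(w, P) \<in> conflict_items n V b m"
    then have generic: "generic n V b w P" and cP: "card P = m" by (auto simp: conflict_items_def)
    note G = genD[OF generic b]
    show "w \<in> P \<and> P \<subseteq> blocks n \<and> card P = m \<and> card (\<Union>P - V) \<le> 2 * m" using G cP by simp
  qed (use n in auto)
  also have "\<dots> \<le> 7 * FC K 14 * n ^ (2 * m)" using m FC_mono by simp
  finally have "real (card (conflict_items n V b m)) \<le> real (7 * FC K 14) * real n ^ (2 * m)"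
    by (rule of_nat_le_mult_power)
  then show "real (card (conflict_items n V b m)) / real n ^ (2 * m) \<le> real (7 * FC K 14)"
    using n by (simp add: divide_le_eq)
qed

section \<open>Templates\<close>

lemma card_covered_pairs_le:
  assumes "finite S" "S \<subseteq> blocks n"
  shows "card (covered_pairs S) \<le> 6 * card S"
proof -
  have "covered_pairs S = (\<Union>x\<in>S. covered_pairs {x})" by (auto simp: covered_pairs_def)
  then have "card (covered_pairs S) \<le> (\<Sum>x\<in>S. card (covered_pairs {x}))" using card_UN_le[OF assms(1)] by metis
  also have "\<dots> = (\<Sum>x\<in>S. 6)" using assms(2) blocksD(2) by (intro sum.cong card_covered_pairs_single) auto
  finally show ?thesis by simp
qed

text \<open>The block \<open>b\<close> is not recorded: when several blocks of \<open>B\<close>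
  contain the pair in which \<open>w\<close> meets the template, the item still counts once. This is
  why covered pairs, not blocks, are counted for items of one block.\<close>

definition items :: "nat \<Rightarrow> nat set set \<Rightarrow> nat set \<Rightarrow> (nat set \<times> nat set set) set" where
  "items n B V = {q. \<exists>b\<in>B. generic n V b (fst q) (snd q)}"

lemma items_subset: "items n B V \<subseteq> blocks n \<times> Pow (blocks n)"
  by (auto simp: items_def generic_def mem_Times_iff)

lemma finite_items [simp]: "finite (items n B V)"
  by (rule finite_subset[OF items_subset]) simp

lemma itemE:
  assumes "q \<in> items n B V" "B \<subseteq> blocks n" "\<Union>B \<subseteq> V"
  obtains b where "b \<in> B" "b \<in> blocks n" "b \<subseteq> V" "generic n V b (fst q) (snd q)"
proof -
  obtain b where b: "b \<in> B" "generic n V b (fst q) (snd q)" using assms(1) by (auto simp: items_def)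
  then have "b \<in> blocks n" "b \<subseteq> V" using assms(2,3) by auto
  with b show thesis by (intro that)
qed

lemma card_blocks_trace:
  assumes V: "V \<subseteq> {..<n}" and e: "e \<subseteq> V" "card e = 2"
  shows "card {w \<in> blocks n. w \<inter> V = e} = (n - card V) choose 2"
proof -
  let ?F = "{f. f \<subseteq> {..<n} - V \<and> card f = 2}"
  have fV: "finite V" using V by (rule finite_subset) simp
  have fe: "finite e" using e(1) fV by (rule finite_subset)
  have "bij_betw (\<lambda>f. e \<union> f) ?F {w \<in> blocks n. w \<inter> V = e}"
  proof (rule bij_betwI[where g = "\<lambda>w. w - V"])
    show "(\<lambda>f. e \<union> f) \<in> ?F \<rightarrow> {w \<in> blocks n. w \<inter> V = e}"
    proof
      fix f assume f: "f \<in> ?F"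
      then have "finite f" by (auto intro: finite_subset)
      then have "card (e \<union> f) = 4" using f e fe by (subst card_Un_disjoint) auto
      then show "e \<union> f \<in> {w \<in> blocks n. w \<inter> V = e}" using f e V by (auto simp: blocks_def)
    qed
    show "(\<lambda>w. w - V) \<in> {w \<in> blocks n. w \<inter> V = e} \<rightarrow> ?F"
    proof
      fix w assume w: "w \<in> {w \<in> blocks n. w \<inter> V = e}"
      then have fw: "finite w" "card w = 4" "w \<subseteq> {..<n}" using blocksD by auto
      have "w - V = w - e" using w by auto
      moreover have "card (w - e) = 2" using w fw e fe by (subst card_Diff_subset) auto
      ultimately show "w - V \<in> ?F" using fw by auto
    qed
  qed (use e in auto)
  then have "card {w \<in> blocks n. w \<inter> V = e} = card ?F" by (rule bij_betw_same_card[symmetric])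
  also have "\<dots> = card ({..<n} - V) choose 2" by (rule n_subsets) simp
  also have "card ({..<n} - V) = n - card V" using V fV by (subst card_Diff_subset) auto
  finally show ?thesis .
qed

text \<open>A generic conflict of two blocks is given by the pair in which \<open>w\<close> meets
  \<open>V\<close>, which must be covered, and by two vertices outside \<open>V\<close>.\<close>

lemma card_items_1:
  assumes B: "B \<subseteq> blocks n" "finite B" and V: "V \<subseteq> {..<n}" "\<Union>B \<subseteq> V"
  shows "card {q \<in> items n B V. card (snd q) = 1} = card (covered_pairs B) * ((n - card V) choose 2)"
proof -
  let ?W = "\<lambda>e. (\<lambda>w. (w, {w})) ` {w \<in> blocks n. w \<inter> V = e}"
  have eq: "{q \<in> items n B V. card (snd q) = 1} = (\<Union>e\<in>covered_pairs B. ?W e)"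
  proof (intro equalityI subsetI)
    fix q assume q: "q \<in> {q \<in> items n B V. card (snd q) = 1}"
    then obtain b where b: "b \<in> B" "b \<in> blocks n" "b \<subseteq> V" and g: "generic n V b (fst q) (snd q)"
      using B(1) V(2) by (auto elim: itemE)
    note G = genD[OF g b(2,3)]
    have P: "snd q = {fst q}" using q G(2) by (auto simp: card_1_singleton_iff)
    have w: "fst q \<in> blocks n" using G(1) P by simp
    have c6: "card (b \<union> fst q) = 6" using g P by (simp add: generic_def)
    have "card (b \<union> fst q) + card (b \<inter> fst q) = 8"
      using b w blocksD by (subst card_Un_Int[symmetric]) auto
    then have c2: "card (b \<inter> fst q) = 2" using c6 by simp
    have tr: "fst q \<inter> V = b \<inter> fst q" using G(5) P b(3) by auto
    have "b \<inter> fst q \<in> covered_pairs B" using b(1) c2 by (auto simp: covered_pairs_def)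
    moreover have "q = (fst q, {fst q})" using P by (metis prod.collapse)
    ultimately show "q \<in> (\<Union>e\<in>covered_pairs B. ?W e)" using w tr by blast
  next
    fix q assume "q \<in> (\<Union>e\<in>covered_pairs B. ?W e)"
    then obtain e w where ew: "e \<in> covered_pairs B" "w \<in> blocks n" "w \<inter> V = e" "q = (w, {w})" by auto
    then obtain b where b: "b \<in> B" "e \<subseteq> b" "card e = 2" by (auto simp: covered_pairs_def)
    have bb: "b \<in> blocks n" "b \<subseteq> V" using b B V by auto
    have bw: "b \<inter> w = e" using ew b bb by auto
    have "card (b \<union> w) + card (b \<inter> w) = 8"
      using bb ew blocksD by (subst card_Un_Int[symmetric]) auto
    then have c6: "card (b \<union> w) = 6" using bw b by simp
    have bw_ne: "b \<noteq> w" using bw b bb blocksD(2) by auto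
    then have "conflict {b, w}" using bb ew blocksD bw b by (intro conflict_pair) auto
    then have "generic n V b w {w}" using bw_ne c6 ew b bw by (auto simp: generic_def)
    then show "q \<in> {q \<in> items n B V. card (snd q) = 1}" using ew b by (auto simp: items_def)
  qed
  have "card (\<Union>e\<in>covered_pairs B. ?W e) = (\<Sum>e\<in>covered_pairs B. card (?W e))"
    by (rule card_UN_disjoint) (use finite_covered_pairs[OF B(2,1)] in auto)
  also have "\<dots> = (\<Sum>e\<in>covered_pairs B. (n - card V) choose 2)"
  proof (rule sum.cong)
    fix e assume e: "e \<in> covered_pairs B"
    have "card (?W e) = card {w \<in> blocks n. w \<inter> V = e}"
      by (rule card_image) (auto intro: inj_onI)
    also have "\<dots> = (n - card V) choose 2"
      by (rule card_blocks_trace[OF V(1)]) (use e V(2) in \<open>auto simp: covered_pairs_def\<close>)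
    finally show "card (?W e) = (n - card V) choose 2" .
  qed simp
  finally show ?thesis unfolding eq by simp
qed

text \<open>For \<open>m \<ge> 2\<close> the item determines \<open>b\<close>: as a proper part of
  the conflict, \<open>P\<close> spans at least \<open>2 * m + 3\<close> vertices, so it meets
  \<open>b\<close> in three or more, whereas two blocks of \<open>B\<close> share at most
  two.\<close>

lemma card_items_m:
  assumes B: "B \<subseteq> blocks n" "finite B" and V: "\<Union>B \<subseteq> V" and m: "2 \<le> m"
    and ov: "\<And>x y. x \<in> B \<Longrightarrow> y \<in> B \<Longrightarrow> x \<noteq> y \<Longrightarrow> card (x \<inter> y) \<le> 2"
  shows "card {q \<in> items n B V. card (snd q) = m} = (\<Sum>b\<in>B. card (conflict_items n V b m))"
proof -
  have "{q \<in> items n B V. card (snd q) = m} = (\<Union>b\<in>B. conflict_items n V b m)"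
    by (auto simp: items_def conflict_items_def)
  moreover have "conflict_items n V b m \<inter> conflict_items n V b' m = {}" if b: "b \<in> B" "b' \<in> B" "b \<noteq> b'" for b b'
  proof (rule ccontr)
    assume "\<not> ?thesis"
    then obtain w P where g: "generic n V b w P" "generic n V b' w P" "card P = m" by (auto simp: conflict_items_def)
    have bb: "b \<in> blocks n" "b \<subseteq> V" "b' \<in> blocks n" "b' \<subseteq> V" using b B V by auto
    note G = genD[OF g(1) bb(1,2)] and G' = genD[OF g(2) bb(3,4)]
    have "P \<subset> insert b P" using G(3) by auto
    then have "2 * card P + 3 \<le> card (\<Union>P)" using conflictD(5)[OF G(4), of P] m g(3) by simp
    then have "3 \<le> card (\<Union>P \<inter> b)" using G(11) by simp
    also have "\<Union>P \<inter> b \<subseteq> b \<inter> b'" using G'(5) bb by auto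
    then have "card (\<Union>P \<inter> b) \<le> card (b \<inter> b')" using bb blocksD(3) by (intro card_mono) auto
    finally show False using ov[OF b] by simp
  qed
  ultimately show ?thesis using B(2) by (simp add: card_UN_disjoint)
qed

definition CI :: "nat \<Rightarrow> real" where
  "CI K = 6 * real K * (8 * real K + 1) + 42 * real K * real (FC (4 * K) 14)"

lemma choose2_approx:
  assumes "k \<le> n" "1 \<le> n" "k \<le> K"
  shows "\<bar>real ((n - k) choose 2) / real n ^ 2 - 1 / 2\<bar> \<le> (2 * real K + 1) / real n"
proof -
  have "real ((n - k) choose 2) = (real n - real k) * (real n - real k - 1) / 2"
  proof (cases "n = k")
    case False
    have "even ((n - k) * (n - k - 1))" by (cases "n - k") auto
    then have "2 * ((n - k) choose 2) = (n - k) * (n - k - 1)"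
      unfolding choose_two by (rule dvd_mult_div_cancel)
    then have "2 * real ((n - k) choose 2) = real (n - k) * real (n - k - 1)"
      by (metis of_nat_mult of_nat_numeral)
    also have "real (n - k - 1) = real n - real k - 1" using assms False by (simp add: of_nat_diff)
    also have "real (n - k) = real n - real k" using assms by (simp add: of_nat_diff)
    finally show ?thesis by simp
  qed simp
  then have "real ((n - k) choose 2) / real n ^ 2 - 1 / 2
      = - (real n * (2 * real k + 1) - real k * (real k + 1)) / (2 * real n ^ 2)"
    using assms by (simp add: field_simps power2_eq_square)
  then have "\<bar>real ((n - k) choose 2) / real n ^ 2 - 1 / 2\<bar>
      = \<bar>real n * (2 * real k + 1) - real k * (real k + 1)\<bar> / (2 * real n ^ 2)"
    by (simp only: abs_divide abs_minus_cancel) simp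
  moreover have "\<bar>real n * (2 * real k + 1) - real k * (real k + 1)\<bar> \<le> real n * (2 * real K + 1)"
  proof -
    have "real k * (real k + 1) \<le> real n * (2 * real k + 1)" using assms by (intro mult_mono) auto
    moreover have "real n * (2 * real k + 1) \<le> real n * (2 * real K + 1)" using assms by (intro mult_left_mono) auto
    moreover have "0 \<le> real k * (real k + 1)" by simp
    ultimately show ?thesis by linarith
  qed
  ultimately have "\<bar>real ((n - k) choose 2) / real n ^ 2 - 1 / 2\<bar> \<le> real n * (2 * real K + 1) / (2 * real n ^ 2)"
    by (simp add: divide_right_mono)
  also have "\<dots> = ((2 * real K + 1) / real n) / 2" using assms by (simp add: power2_eq_square)
  also have "\<dots> \<le> (2 * real K + 1) / real n"
  proof -
    have half: "x / 2 \<le> x" if "0 \<le> x" for x :: real using that by simp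
    show ?thesis by (rule half) simp
  qed
  finally show ?thesis .
qed

text \<open>Items of one block contribute about \<open>n^2 / 2\<close> per covered pair, longer ones
  about \<open>conflict_density n m * n ^ (2 * m)\<close> per block of \<open>B\<close>. The two
  kinds stay separate because the first drives \<open>u\<close> and the second only
  \<open>c\<close>.\<close>

lemma items_sum:
  assumes n: "4 \<le> n" and B: "B \<subseteq> blocks n" "finite B" "card B \<le> K"
    and V: "V \<subseteq> {..<n}" "\<Union>B \<subseteq> V" "card V \<le> 4 * K"
    and ov: "\<And>x y. x \<in> B \<Longrightarrow> y \<in> B \<Longrightarrow> x \<noteq> y \<Longrightarrow> card (x \<inter> y) \<le> 2"
    and r: "\<And>m. \<bar>r m\<bar> \<le> \<rho>"
  shows "\<bar>(\<Sum>q\<in>items n B V. r (card (snd q)) / real n ^ (2 * card (snd q)))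
      - (real (card (covered_pairs B)) / 2 * r 1 + real (card B) * (\<Sum>m=2..7. conflict_density n m * r m))\<bar> \<le> CI K * \<rho> / real n"
proof -
  let ?I = "\<lambda>m. {q \<in> items n B V. card (snd q) = m}"
  have fV: "finite V" using V(1) by (rule finite_subset) simp
  have \<rho>: "0 \<le> \<rho>" using r[of 0] by linarith
  have rng: "card (snd q) \<in> insert 1 {2..7}" if q: "q \<in> items n B V" for q
  proof -
    obtain b where b: "b \<in> B" "b \<in> blocks n" "b \<subseteq> V" "generic n V b (fst q) (snd q)"
      by (rule itemE[OF q B(1) V(2)])
    show ?thesis using genD(8,9)[OF b(4,2,3)] by auto
  qed
  have "(\<Sum>q\<in>items n B V. r (card (snd q)) / real n ^ (2 * card (snd q)))
      = (\<Sum>m\<in>insert 1 {2..7}. \<Sum>q\<in>?I m. r (card (snd q)) / real n ^ (2 * card (snd q)))"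
  proof (rule sum.group[symmetric])
    show "(\<lambda>q. card (snd q)) ` items n B V \<subseteq> insert 1 {2..7}" by (rule image_subsetI, rule rng)
  qed auto
  also have "\<dots> = (\<Sum>m\<in>insert 1 {2..7}. real (card (?I m)) / real n ^ (2 * m) * r m)"
    by (rule sum.cong) auto
  also have "\<dots> = real (card (?I 1)) / real n ^ 2 * r 1 + (\<Sum>m=2..7. real (card (?I m)) / real n ^ (2 * m) * r m)"
    by (subst sum.insert) auto
  also have "(\<Sum>m=2..7. real (card (?I m)) / real n ^ (2 * m) * r m)
      = (\<Sum>m=2..7. \<Sum>b\<in>B. real (card (conflict_items n V b m)) / real n ^ (2 * m) * r m)"
    by (rule sum.cong)
      (use card_items_m[OF B(1,2) V(2) _ ov] in \<open>auto simp: sum_divide_distrib sum_distrib_right\<close>)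
  finally have eq: "(\<Sum>q\<in>items n B V. r (card (snd q)) / real n ^ (2 * card (snd q)))
      = real (card (?I 1)) / real n ^ 2 * r 1 + (\<Sum>m=2..7. \<Sum>b\<in>B. real (card (conflict_items n V b m)) / real n ^ (2 * m) * r m)" .
  have 1: "\<bar>real (card (?I 1)) / real n ^ 2 * r 1 - real (card (covered_pairs B)) / 2 * r 1\<bar> \<le> 6 * real K * (8 * real K + 1) * \<rho> / real n"
  proof -
    let ?c = "real ((n - card V) choose 2) / real n ^ 2 - 1 / 2"
    have "card V \<le> n" using V(1) card_mono[of "{..<n}" V] by simp
    then have c: "\<bar>?c\<bar> \<le> (2 * real (4 * K) + 1) / real n" using n V(3) by (intro choose2_approx) auto
    have p6: "card (covered_pairs B) \<le> 6 * K" using card_covered_pairs_le[OF B(2,1)] B(3) by linarith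
    have "real (card (?I 1)) / real n ^ 2 * r 1 - real (card (covered_pairs B)) / 2 * r 1 = real (card (covered_pairs B)) * ?c * r 1"
      unfolding card_items_1[OF B(1,2) V(1,2)] by (simp add: field_simps)
    also have "\<bar>\<dots>\<bar> \<le> real (6 * K) * ((2 * real (4 * K) + 1) / real n) * \<rho>"
      unfolding abs_mult using c r[of 1] p6 by (intro mult_mono) auto
    also have "\<dots> = 6 * real K * (8 * real K + 1) * \<rho> / real n" by simp
    finally show ?thesis .
  qed
  have 2: "\<bar>(\<Sum>m=2..7. \<Sum>b\<in>B. real (card (conflict_items n V b m)) / real n ^ (2 * m) * r m)
      - real (card B) * (\<Sum>m=2..7. conflict_density n m * r m)\<bar> \<le> 42 * real K * real (FC (4 * K) 14) * \<rho> / real n"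
  proof -
    have "real (card B) * (\<Sum>m=2..7. conflict_density n m * r m) = (\<Sum>m=2..7. \<Sum>b\<in>B. conflict_density n m * r m)"
      by (simp add: sum_distrib_left)
    then have "(\<Sum>m=2..7. \<Sum>b\<in>B. real (card (conflict_items n V b m)) / real n ^ (2 * m) * r m)
      - real (card B) * (\<Sum>m=2..7. conflict_density n m * r m)
      = (\<Sum>m=2..7. \<Sum>b\<in>B. (real (card (conflict_items n V b m)) / real n ^ (2 * m) - conflict_density n m) * r m)"
      by (simp add: sum_subtractf left_diff_distrib)
    also have "\<bar>\<dots>\<bar> \<le> (\<Sum>m=2..7. \<Sum>b\<in>B. \<bar>(real (card (conflict_items n V b m)) / real n ^ (2 * m) - conflict_density n m) * r m\<bar>)"
      by (rule order_trans[OF sum_abs], rule sum_mono, rule sum_abs)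
    also have "\<dots> \<le> (\<Sum>m=(2::nat)..7. \<Sum>b\<in>B. real (7 * FC (4 * K) 14) / real n * \<rho>)"
    proof (intro sum_mono)
      fix m b assume "m \<in> {2..7::nat}" "b \<in> B"
      then have "\<bar>real (card (conflict_items n V b m)) / real n ^ (2 * m) - conflict_density n m\<bar> \<le> real (7 * FC (4 * K) 14) / real n"
        using B V by (intro conflict_items_count[OF n _ _ _ _ fV]) auto
      then show "\<bar>(real (card (conflict_items n V b m)) / real n ^ (2 * m) - conflict_density n m) * r m\<bar> \<le> real (7 * FC (4 * K) 14) / real n * \<rho>"
        unfolding abs_mult using r[of m] by (intro mult_mono) auto
    qed
    also have "\<dots> = real (card B) * (42 * FC (4 * K) 14 * \<rho> / real n)" by simp
    also have "\<dots> \<le> real K * (42 * FC (4 * K) 14 * \<rho> / real n)"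
      using B(3) \<rho> by (intro mult_right_mono) auto
    finally show ?thesis by (simp add: mult_ac)
  qed
  have "CI K * \<rho> / real n = 6 * real K * (8 * real K + 1) * \<rho> / real n + 42 * real K * real (FC (4 * K) 14) * \<rho> / real n"
    unfolding CI_def by (simp only: distrib_right add_divide_distrib)
  with eq 1 2 show ?thesis by linarith
qed

section \<open>Predicted probabilities and the expected number of destroying blocks\<close>

definition predicted :: "real \<Rightarrow> real \<Rightarrow> real \<Rightarrow> nat set set \<Rightarrow> nat set set \<Rightarrow> real" where
  "predicted u c a SB SA = u ^ card (covered_pairs SB) * c ^ card SB * a ^ card SA"

text \<open>The factor by which \<open>predicted\<close> changes when an item of \<open>m\<close>
  blocks joins the template: one more free block with five or six new pairs, and
  \<open>m - 1\<close> more accepted blocks.\<close>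

definition rate :: "real \<Rightarrow> real \<Rightarrow> real \<Rightarrow> nat \<Rightarrow> real" where
  "rate u c a m = (if m = 1 then u ^ 5 * c else u ^ 6 * c * a ^ (m - 1))"

text \<open>The predicted value of \<open>card (kill n i h B) / n^2\<close>.\<close>

definition kill_rate :: "nat \<Rightarrow> real \<Rightarrow> real \<Rightarrow> real \<Rightarrow> nat set set \<Rightarrow> real" where
  "kill_rate n u c a B = real (card (covered_pairs B)) / 2 * (u ^ 5 * c)
     + real (card B) * (\<Sum>m=2..7. conflict_density n m * (u ^ 6 * c * a ^ (m - 1)))"

definition scaled_prob :: "nat \<Rightarrow> real \<Rightarrow> nat \<Rightarrow> nat set set \<Rightarrow> nat set set \<Rightarrow> real" where
  "scaled_prob n p i SB SA = real n ^ (2 * card SA) * ex n p i (\<lambda>h. of_bool (SB \<subseteq> free n i h \<and> SA \<subseteq> acc i h))"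

lemma predicted_ext:
  assumes good: "good SB SA" and S: "SB \<union> SA \<subseteq> blocks n" and V: "\<Union>(SB \<union> SA) \<subseteq> V"
    and b: "b \<in> SB" and g: "generic n V b w P"
  shows "predicted u c a (insert w SB) (SA \<union> (P - {w})) = predicted u c a SB SA * rate u c a (card P)"
    "card (SA \<union> (P - {w})) + 1 = card SA + card P"
    "card (insert w SB \<union> (SA \<union> (P - {w}))) \<le> card (SB \<union> SA) + 7"
    "insert w SB \<union> (SA \<union> (P - {w})) \<subseteq> blocks n"
    "\<Union>(insert w SB \<union> (SA \<union> (P - {w}))) = \<Union>(SB \<union> SA) \<union> \<Union>P"
proof -
  have bb: "b \<in> blocks n" "b \<subseteq> V" using S V b by auto
  note G = genD[OF g bb]
  have fin: "finite SB" "finite SA" using S by (auto intro: finite_subset[OF _ finite_blocks])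
  have PS: "P \<inter> (SB \<union> SA) = {}" by (rule good_ext(2)[OF good S V b g])
  have pr: "card (covered_pairs (insert w SB)) = card (covered_pairs SB) + (if card P = 1 then 5 else 6)"
    by (rule card_covered_pairs_ext[OF _ fin(1) _ b g]) (use S V in auto)
  have cB: "card (insert w SB) = card SB + 1" using fin PS G(2) by (subst card_insert_disjoint) auto
  have "card (P - {w}) = card P - 1" using G(2) by simp
  then have "card (SA \<union> (P - {w})) = card SA + (card P - 1)"
    using fin G(6) PS by (subst card_Un_disjoint) auto
  then have cA: "card (SA \<union> (P - {w})) + 1 = card SA + card P" "card (SA \<union> (P - {w})) = card SA + (card P - 1)"
    using G(8) by auto
  then show "card (SA \<union> (P - {w})) + 1 = card SA + card P" by simp
  show "predicted u c a (insert w SB) (SA \<union> (P - {w})) = predicted u c a SB SA * rate u c a (card P)"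
    unfolding predicted_def rate_def pr cB cA(2) by (simp add: power_add)
  have eq: "insert w SB \<union> (SA \<union> (P - {w})) = (SB \<union> SA) \<union> P" using G(2) by auto
  show "card (insert w SB \<union> (SA \<union> (P - {w}))) \<le> card (SB \<union> SA) + 7"
    unfolding eq using card_Un_le[of "SB \<union> SA" P] G(9) by linarith
  show "insert w SB \<union> (SA \<union> (P - {w})) \<subseteq> blocks n" unfolding eq using S G(1) by simp
  show "\<Union>(insert w SB \<union> (SA \<union> (P - {w}))) = \<Union>(SB \<union> SA) \<union> \<Union>P" unfolding eq by simp
qed

definition CB :: "nat \<Rightarrow> real" where
  "CB K = 3 * real K + 6 * real K * (7 * real (FC 4 14)) * 3 ^ 6 + CI K"

lemma card_Union_blocks: "S \<subseteq> blocks n \<Longrightarrow> card (\<Union>S) \<le> 4 * card S"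
proof -
  assume S: "S \<subseteq> blocks n"
  then have "finite S" by (rule finite_subset) simp
  then have "card (\<Union>S) \<le> (\<Sum>x\<in>S. card x)" using card_UN_le[of S "\<lambda>x. x"] by simp
  also have "\<dots> = (\<Sum>x\<in>S. 4)" using S blocksD(2) by (intro sum.cong) auto
  finally show ?thesis by simp
qed

text \<open>The cap 3 on \<open>a\<close> is respected along the whole trajectory, where
  \<open>3 * a \<le> 8 * (1 - u)\<close>.\<close>

lemma kill_rate_bounds:
  assumes n: "4 \<le> n" and B: "B \<subseteq> blocks n" "finite B" "card B \<le> K"
    and uca: "0 \<le> u" "u \<le> 1" "0 \<le> c" "c \<le> 1" "0 \<le> a" "a \<le> 3"
  shows "0 \<le> kill_rate n u c a B" "kill_rate n u c a B \<le> CB K"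
proof -
  show "0 \<le> kill_rate n u c a B"
    unfolding kill_rate_def using uca conflict_density_nonneg by (intro add_nonneg_nonneg mult_nonneg_nonneg sum_nonneg) auto
  have uc5: "u ^ 5 * c \<le> 1" and uc6: "u ^ 6 * c \<le> 1"
    using uca by (auto intro!: mult_le_one power_le_one)
  have p6: "card (covered_pairs B) \<le> 6 * K" using card_covered_pairs_le[OF B(2,1)] B(3) by linarith
  have "real (card (covered_pairs B)) / 2 * (u ^ 5 * c) \<le> (3 * real K) * 1"
    using p6 uc5 uca by (intro mult_mono) auto
  moreover have "(\<Sum>m=2..7. conflict_density n m * (u ^ 6 * c * a ^ (m - 1))) \<le> (\<Sum>m=2..7::nat. real (7 * FC 4 14) * 3 ^ 6)"
  proof (rule sum_mono)
    fix m :: nat assume m: "m \<in> {2..7}"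
    have "a ^ (m - 1) \<le> 3 ^ (m - 1)" using uca by (intro power_mono) auto
    also have "\<dots> \<le> 3 ^ 6" using m by (intro power_increasing) auto
    finally have "u ^ 6 * c * a ^ (m - 1) \<le> 1 * 3 ^ 6" using uc6 uca by (intro mult_mono) auto
    then show "conflict_density n m * (u ^ 6 * c * a ^ (m - 1)) \<le> real (7 * FC 4 14) * 3 ^ 6"
      using conflict_density_le[OF n, of m] conflict_density_nonneg m uca by (intro mult_mono) auto
  qed
  then have "real (card B) * (\<Sum>m=2..7. conflict_density n m * (u ^ 6 * c * a ^ (m - 1))) \<le> real K * (6 * (real (7 * FC 4 14) * 3 ^ 6))"
    using B(3) uca conflict_density_nonneg by (intro mult_mono sum_nonneg mult_nonneg_nonneg) auto
  moreover have "0 \<le> CI K" by (simp add: CI_def)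
  ultimately show "kill_rate n u c a B \<le> CB K" unfolding kill_rate_def CB_def by simp
qed

lemma rate_bounds:
  assumes "0 \<le> u" "u \<le> 1" "0 \<le> c" "c \<le> 1" "0 \<le> a" "a \<le> 3"
  shows "0 \<le> rate u c a m" "m \<le> 7 \<Longrightarrow> rate u c a m \<le> 3 ^ 6"
proof -
  show "0 \<le> rate u c a m" using assms by (simp add: rate_def)
  assume m: "m \<le> 7"
  have uc: "u ^ 5 * c \<le> 1" "u ^ 6 * c \<le> 1" using assms by (auto intro!: mult_le_one power_le_one)
  have "a ^ (m - 1) \<le> 3 ^ (m - 1)" using assms by (intro power_mono) auto
  also have "\<dots> \<le> 3 ^ 6" using m by (intro power_increasing) auto
  finally have "u ^ 6 * c * a ^ (m - 1) \<le> 1 * 3 ^ 6" using uc assms by (intro mult_mono) auto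
  then show "rate u c a m \<le> 3 ^ 6" using uc by (simp add: rate_def)
qed

lemma predicted_bounds:
  assumes "0 \<le> u" "u \<le> 1" "0 \<le> c" "c \<le> 1" "0 \<le> a" "a \<le> 3" "card SA \<le> K"
  shows "0 \<le> predicted u c a SB SA" "predicted u c a SB SA \<le> 3 ^ K"
proof -
  show "0 \<le> predicted u c a SB SA" using assms by (simp add: predicted_def)
  have "u ^ card (covered_pairs SB) * c ^ card SB \<le> 1" using assms by (intro mult_le_one power_le_one) auto
  moreover have "a ^ card SA \<le> 3 ^ card SA" using assms by (intro power_mono) auto
  then have "a ^ card SA \<le> 3 ^ K"
    by (rule order_trans) (use assms in \<open>auto intro: power_increasing\<close>)
  ultimately have "u ^ card (covered_pairs SB) * c ^ card SB * a ^ card SA \<le> 1 * 3 ^ K"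
    using assms by (intro mult_mono) auto
  then show "predicted u c a SB SA \<le> 3 ^ K" by (simp add: predicted_def)
qed

text \<open>Each item enlarges the template by at most seven blocks to one that is good again, so
  \<open>IH\<close> evaluates the corresponding term; the predicted terms are then summed by
  \<open>items_sum\<close>.\<close>

lemma first_moment:
  assumes n: "4 \<le> n" and good: "good SB SA" and S: "SB \<union> SA \<subseteq> blocks n" "card (SB \<union> SA) \<le> K" and B: "B \<subseteq> SB"
    and uca: "0 \<le> u" "u \<le> 1" "0 \<le> c" "c \<le> 1" "0 \<le> a" "a \<le> 3"
    and \<epsilon>: "0 \<le> \<epsilon>"
    and IH: "\<And>SB' SA'. good SB' SA' \<Longrightarrow> SB' \<union> SA' \<subseteq> blocks n \<Longrightarrow> card (SB' \<union> SA') \<le> K + 7 \<Longrightarrow>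
       \<bar>scaled_prob n p i SB' SA' - predicted u c a SB' SA'\<bar> \<le> \<epsilon>"
  shows "\<bar>(\<Sum>q\<in>items n B (\<Union>(SB \<union> SA)). predicted u c a SB SA * rate u c a (card (snd q)) / real n ^ (2 * card (snd q)))
      - predicted u c a SB SA * kill_rate n u c a B\<bar> \<le> CI K * 3 ^ (K + 6) / real n"
    and "\<bar>(\<Sum>q\<in>items n B (\<Union>(SB \<union> SA)). scaled_prob n p i (insert (fst q) SB) (SA \<union> (snd q - {fst q})) / real n ^ (2 * card (snd q)))
      - predicted u c a SB SA * kill_rate n u c a B\<bar> \<le> CB K * \<epsilon> + CI K * 3 ^ (K + 6) / real n"
    and "(\<Sum>q\<in>items n B (\<Union>(SB \<union> SA)). 1 / real n ^ (2 * card (snd q))) \<le> CB K"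
proof -
  let ?V = "\<Union>(SB \<union> SA)"
  let ?I = "items n B ?V"
  have fin: "finite SB" "finite SA" using S by (auto intro: finite_subset[OF _ finite_blocks])
  have Bb: "B \<subseteq> blocks n" "finite B" using B S fin by (auto intro: finite_subset)
  have cB: "card B \<le> K" using B S fin card_mono[of "SB \<union> SA" B] by (auto simp: le_supI1)
  have V: "?V \<subseteq> {..<n}" "\<Union>B \<subseteq> ?V" "card ?V \<le> 4 * K"
  proof -
    show "?V \<subseteq> {..<n}" using S(1) blocksD(1) by blast
    show "\<Union>B \<subseteq> ?V" using B by blast
    show "card ?V \<le> 4 * K" using card_Union_blocks[OF S(1)] S(2) by linarith
  qed
  have ov: "card (x \<inter> y) \<le> 2" if "x \<in> B" "y \<in> B" "x \<noteq> y" for x y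
    using good B that unfolding good_def by blast
  note IS = items_sum[OF n Bb cB V]
  have "\<bar>(\<Sum>q\<in>?I. 1 / real n ^ (2 * card (snd q))) - (real (card (covered_pairs B)) / 2 * 1 + real (card B) * (\<Sum>m=2..7. conflict_density n m * 1))\<bar> \<le> CI K * 1 / real n"
    by (rule IS) (auto intro: ov)
  moreover have "real (card (covered_pairs B)) / 2 * 1 + real (card B) * (\<Sum>m=2..7. conflict_density n m * 1) \<le> 3 * real K + 6 * real K * (7 * real (FC 4 14)) * 3 ^ 6"
  proof (rule add_mono)
    show "real (card (covered_pairs B)) / 2 * 1 \<le> 3 * real K" using card_covered_pairs_le[OF Bb(2,1)] cB by simp
    have "(\<Sum>m=2..7. conflict_density n m * 1) \<le> (\<Sum>m=2..7::nat. real (7 * FC 4 14))"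
      using conflict_density_le[OF n] by (intro sum_mono) auto
    also have "\<dots> \<le> 6 * (7 * FC 4 14) * 3 ^ 6" by simp
    finally have "real (card B) * (\<Sum>m=2..7. conflict_density n m * 1) \<le> real K * (6 * (7 * FC 4 14) * 3 ^ 6)"
      using cB conflict_density_nonneg by (intro mult_mono sum_nonneg) auto
    then show "real (card B) * (\<Sum>m=2..7. conflict_density n m * 1) \<le> 6 * real K * (7 * real (FC 4 14)) * 3 ^ 6" by simp
  qed
  moreover have "CI K / real n \<le> CI K / 1"
    by (rule divide_left_mono) (use n in \<open>auto simp: CI_def\<close>)
  ultimately show CBs: "(\<Sum>q\<in>?I. 1 / real n ^ (2 * card (snd q))) \<le> CB K"
    unfolding CB_def by simp
  \<comment> \<open>\<open>items_sum\<close> asks for a bound valid for all \<open>m\<close>; items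
    have at most seven blocks, so the value 0 beyond 7 changes nothing.\<close>
  define r where "r m = (if m \<le> 7 then predicted u c a SB SA * rate u c a m else 0)" for m
  have rb: "\<bar>r m\<bar> \<le> 3 ^ (K + 6)" for m
  proof -
    have "card SA \<le> K" using S fin card_mono[of "SB \<union> SA" SA] by auto
    then have "predicted u c a SB SA * rate u c a m \<le> 3 ^ K * 3 ^ 6" if "m \<le> 7"
      using predicted_bounds[OF uca] rate_bounds[OF uca] that by (intro mult_mono) auto
    moreover have "0 \<le> predicted u c a SB SA * rate u c a m"
      using predicted_bounds[OF uca] rate_bounds[OF uca] \<open>card SA \<le> K\<close> by simp
    ultimately show ?thesis by (auto simp: r_def power_add)
  qed
  have IS2: "\<bar>(\<Sum>q\<in>?I. r (card (snd q)) / real n ^ (2 * card (snd q)))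
      - (real (card (covered_pairs B)) / 2 * r 1 + real (card B) * (\<Sum>m=2..7. conflict_density n m * r m))\<bar> \<le> CI K * 3 ^ (K + 6) / real n"
    by (rule IS[OF _ rb]) (rule ov)
  have e1: "(\<Sum>m=2..7. conflict_density n m * r m) = predicted u c a SB SA * (\<Sum>m=2..7. conflict_density n m * (u ^ 6 * c * a ^ (m - 1)))"
    by (subst sum_distrib_left, rule sum.cong) (auto simp: r_def rate_def)
  have e2: "r 1 = predicted u c a SB SA * (u ^ 5 * c)" by (simp add: r_def rate_def)
  have rm: "real (card (covered_pairs B)) / 2 * r 1 + real (card B) * (\<Sum>m=2..7. conflict_density n m * r m) = predicted u c a SB SA * kill_rate n u c a B"
    unfolding kill_rate_def e1 e2 by (simp only: distrib_left mult_ac)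
  have "(\<Sum>q\<in>?I. r (card (snd q)) / real n ^ (2 * card (snd q)))
      = (\<Sum>q\<in>?I. predicted u c a SB SA * rate u c a (card (snd q)) / real n ^ (2 * card (snd q)))"
  proof (rule sum.cong)
    fix q assume q: "q \<in> ?I"
    obtain b where b: "b \<in> B" "b \<in> blocks n" "b \<subseteq> ?V" "generic n ?V b (fst q) (snd q)"
      by (rule itemE[OF q Bb(1) V(2)])
    then show "r (card (snd q)) / real n ^ (2 * card (snd q))
        = predicted u c a SB SA * rate u c a (card (snd q)) / real n ^ (2 * card (snd q))"
      using genD(9)[OF b(4,2,3)] by (simp add: r_def)
  qed simp
  then show "\<bar>(\<Sum>q\<in>?I. predicted u c a SB SA * rate u c a (card (snd q)) / real n ^ (2 * card (snd q)))
      - predicted u c a SB SA * kill_rate n u c a B\<bar> \<le> CI K * 3 ^ (K + 6) / real n"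
    using IS2 rm by simp
  have "\<bar>(\<Sum>q\<in>?I. scaled_prob n p i (insert (fst q) SB) (SA \<union> (snd q - {fst q})) / real n ^ (2 * card (snd q)))
      - (\<Sum>q\<in>?I. r (card (snd q)) / real n ^ (2 * card (snd q)))\<bar>
      \<le> (\<Sum>q\<in>?I. \<epsilon> * (1 / real n ^ (2 * card (snd q))))"
    unfolding sum_subtractf[symmetric]
  proof (rule order_trans[OF sum_abs], rule sum_mono)
    fix q assume q: "q \<in> ?I"
    obtain b where b: "b \<in> B" "b \<in> blocks n" "b \<subseteq> ?V" "generic n ?V b (fst q) (snd q)"
      by (rule itemE[OF q Bb(1) V(2)])
    have bSB: "b \<in> SB" using b B by auto
    note E = predicted_ext[OF good S(1) order_refl bSB b(4)]
    have "\<bar>scaled_prob n p i (insert (fst q) SB) (SA \<union> (snd q - {fst q})) - r (card (snd q))\<bar> \<le> \<epsilon>"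
      using IH[OF good_ext(1)[OF good S(1) order_refl bSB b(4)] E(4)] E(1)[of u c a] E(3) S(2) genD(9)[OF b(4,2,3)]
      by (simp add: r_def)
    then show "\<bar>scaled_prob n p i (insert (fst q) SB) (SA \<union> (snd q - {fst q})) / real n ^ (2 * card (snd q))
        - r (card (snd q)) / real n ^ (2 * card (snd q))\<bar> \<le> \<epsilon> * (1 / real n ^ (2 * card (snd q)))"
      unfolding diff_divide_distrib[symmetric] abs_divide by (simp add: divide_right_mono)
  qed
  also have "\<dots> = \<epsilon> * (\<Sum>q\<in>?I. 1 / real n ^ (2 * card (snd q)))" by (rule sum_distrib_left[symmetric])
  also have "\<dots> \<le> \<epsilon> * CB K" using CBs \<epsilon> by (rule mult_left_mono)
  finally show "\<bar>(\<Sum>q\<in>?I. scaled_prob n p i (insert (fst q) SB) (SA \<union> (snd q - {fst q})) / real n ^ (2 * card (snd q)))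
      - predicted u c a SB SA * kill_rate n u c a B\<bar> \<le> CB K * \<epsilon> + CI K * 3 ^ (K + 6) / real n"
    using IS2 unfolding rm by (simp add: mult.commute)
qed

section \<open>Templates and items as random variables\<close>

definition scaled_ind :: "nat \<Rightarrow> nat \<Rightarrow> nat set set \<Rightarrow> nat set set \<Rightarrow> (nat \<Rightarrow> nat set set) \<Rightarrow> real" where
  "scaled_ind n i SB SA h = real n ^ (2 * card SA) * of_bool (SB \<subseteq> free n i h \<and> SA \<subseteq> acc i h)"

definition active :: "nat \<Rightarrow> nat \<Rightarrow> nat set \<times> nat set set \<Rightarrow> (nat \<Rightarrow> nat set set) \<Rightarrow> real" where
  "active n i q h = of_bool (fst q \<in> free n i h \<and> snd q - {fst q} \<subseteq> acc i h)"

lemma scaled_prob_scaled_ind: "scaled_prob n p i SB SA = ex n p i (scaled_ind n i SB SA)"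
  unfolding scaled_prob_def scaled_ind_def by (simp add: ex_cmult)

lemma scaled_ind_nonneg: "0 \<le> scaled_ind n i SB SA h"
  by (simp add: scaled_ind_def)

lemma active_01: "0 \<le> active n i q h" "active n i q h \<le> 1" "active n i q h * active n i q h = active n i q h"
  by (auto simp: active_def)

text \<open>Fourteen new blocks have at most 56 vertices, so 57 values are possible for the number
  of new vertices.\<close>

definition NE :: "nat \<Rightarrow> nat \<Rightarrow> nat \<Rightarrow> real" where
  "NE i K m = (1 + real i) ^ (K + 14) * real (m * 57 * FC (4 * K) 56)"

lemma NE_nonneg: "0 \<le> NE i K m"
  by (simp add: NE_def)

locale bite_params =
  fixes n :: nat and d p :: real and i :: nat
  assumes n: "4 \<le> n" and d: "0 \<le> d" "d \<le> 1" and p: "p = d / real n ^ 2"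
begin

lemma p01: "0 \<le> p" "p \<le> 1"
proof -
  show "0 \<le> p" using d by (simp add: p)
  have "1 \<le> real n ^ 2" using n by (simp add: one_le_power)
  then show "p \<le> 1" using d by (simp add: p divide_le_eq)
qed

text \<open>Dropping the condition on free blocks leaves the union bound \<open>ex_acc_le\<close>:
  the scaling absorbs the blocks of \<open>SA\<close>, and each further accepted block costs
  \<open>1 / n^2\<close> up to a constant.\<close>

lemma ex_scaled_ind_acc_le:
  assumes S: "SA \<subseteq> blocks n" "D \<subseteq> blocks n" "D \<inter> SA = {}" and K: "card SA + card D \<le> K'"
  shows "ex n p i (\<lambda>h. scaled_ind n i SB SA h * of_bool (D \<subseteq> acc i h)) \<le> (1 + real i) ^ K' * (1 / real n) ^ (2 * card D)"
proof -
  have fin: "finite SA" "finite D" using S by (auto intro: finite_subset[OF _ finite_blocks])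
  have c: "card (SA \<union> D) = card SA + card D" using fin S by (subst card_Un_disjoint) auto
  have n0: "0 < real n" using n by simp
  have "ex n p i (\<lambda>h. scaled_ind n i SB SA h * of_bool (D \<subseteq> acc i h))
      \<le> ex n p i (\<lambda>h. real n ^ (2 * card SA) * of_bool (SA \<union> D \<subseteq> acc i h))"
    by (intro ex_mono p01) (auto simp: scaled_ind_def)
  also have "\<dots> = real n ^ (2 * card SA) * ex n p i (\<lambda>h. of_bool (SA \<union> D \<subseteq> acc i h))" by (rule ex_cmult)
  also have "\<dots> \<le> real n ^ (2 * card SA) * (real i * p) ^ card (SA \<union> D)"
    using fin by (intro mult_left_mono ex_acc_le p01) auto
  also have "(real i * p) ^ card (SA \<union> D) = (real i * d) ^ (card SA + card D) * (1 / real n) ^ (2 * (card SA + card D))"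
    unfolding c p by (simp add: power_mult_distrib power_divide flip: power_mult)
  also have "(1 / real n) ^ (2 * (card SA + card D)) = (1 / real n) ^ (2 * card SA) * (1 / real n) ^ (2 * card D)"
    by (simp add: power_add distrib_left)
  also have "real n ^ (2 * card SA) * ((real i * d) ^ (card SA + card D) * ((1 / real n) ^ (2 * card SA) * (1 / real n) ^ (2 * card D)))
      = (real i * d) ^ (card SA + card D) * (1 / real n) ^ (2 * card D)"
    using n0 by (simp add: power_divide)
  also have "\<dots> \<le> (1 + real i) ^ K' * (1 / real n) ^ (2 * card D)"
  proof (rule mult_right_mono)
    have "real i * d \<le> real i * 1" using d by (intro mult_left_mono) auto
    then have "(real i * d) ^ (card SA + card D) \<le> (1 + real i) ^ (card SA + card D)"
      using d by (intro power_mono) auto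
    also have "\<dots> \<le> (1 + real i) ^ K'" using K by (intro power_increasing) auto
    finally show "(real i * d) ^ (card SA + card D) \<le> (1 + real i) ^ K'" .
  qed simp
  finally show ?thesis .
qed

text \<open>\<open>U q\<close> are the new blocks of a configuration, \<open>D q\<close> those that
  must be accepted, and the divisor \<open>n ^ (2 * s)\<close> pays for \<open>s\<close> blocks that
  need not be. By \<open>ineq\<close>, one vertex is missing against two per block paid for, so the
  total is of order \<open>1 / n\<close>.\<close>

lemma negligible_ex:
  fixes Q :: "'q set"
  assumes S: "SB \<union> SA \<subseteq> blocks n" "card (SB \<union> SA) \<le> K" and Q: "finite Q"
    and U: "\<And>q. q \<in> Q \<Longrightarrow> U q \<subseteq> blocks n" "\<And>q. q \<in> Q \<Longrightarrow> card (U q) \<le> 14"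
    and D: "\<And>q. q \<in> Q \<Longrightarrow> D q \<subseteq> blocks n" "\<And>q. q \<in> Q \<Longrightarrow> D q \<inter> SA = {}" "\<And>q. q \<in> Q \<Longrightarrow> card (D q) \<le> 14"
    and ineq: "\<And>q. q \<in> Q \<Longrightarrow> card (\<Union>(U q) - \<Union>(SB \<union> SA)) + 1 \<le> 2 * s + 2 * card (D q)"
    and fib: "\<And>P. card {q \<in> Q. U q = P} \<le> m"
    and g: "\<And>q h. q \<in> Q \<Longrightarrow> valid n i h \<Longrightarrow> g q h \<le> scaled_ind n i SB SA h * of_bool (D q \<subseteq> acc i h)"
  shows "(\<Sum>q\<in>Q. ex n p i (g q) / real n ^ (2 * s)) \<le> NE i K m / real n"
proof -
  let ?V = "\<Union>(SB \<union> SA)"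
  have fin: "finite SB" "finite SA" using S by (auto intro: finite_subset[OF _ finite_blocks])
  have fV: "finite ?V" using S(1) fin blocksD(3) by blast
  have cV: "card ?V \<le> 4 * K" using card_Union_blocks[OF S(1)] S(2) by linarith
  have cSA: "card SA \<le> K" using S(2) fin card_mono[of "SB \<union> SA" SA] by auto
  have n1: "1 \<le> n" using n by simp
  have "(\<Sum>q\<in>Q. ex n p i (g q) / real n ^ (2 * s)) \<le> (1 + real i) ^ (K + 14) * real (m * (56 + 1) * FC (4 * K) 56) / real n"
  proof (rule negligible_sum[OF n1 fV cV Q U(1) _ fib])
    fix q assume q: "q \<in> Q"
    have "card (\<Union>(U q) - ?V) \<le> card (\<Union>(U q))"
      using U(1)[OF q] by (intro card_mono) (auto intro: finite_subset[OF _ finite_blocks] dest: blocksD(3))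
    also have "\<dots> \<le> 4 * card (U q)" by (rule card_Union_blocks[OF U(1)[OF q]])
    finally show "card (\<Union>(U q) - ?V) \<le> 56" using U(2)[OF q] by simp
    have "ex n p i (g q) \<le> ex n p i (\<lambda>h. scaled_ind n i SB SA h * of_bool (D q \<subseteq> acc i h))"
      by (intro ex_mono p01 g q)
    also have "\<dots> \<le> (1 + real i) ^ (K + 14) * (1 / real n) ^ (2 * card (D q))"
      using S D[OF q] cSA by (intro ex_scaled_ind_acc_le) auto
    finally have "ex n p i (g q) / real n ^ (2 * s) \<le> (1 + real i) ^ (K + 14) * (1 / real n) ^ (2 * card (D q)) / real n ^ (2 * s)"
      by (rule divide_right_mono) simp
    also have "\<dots> = (1 + real i) ^ (K + 14) * (1 / real n) ^ (2 * s + 2 * card (D q))"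
      by (simp add: power_add power_divide)
    also have "\<dots> \<le> (1 + real i) ^ (K + 14) * (1 / real n) ^ (card (\<Union>(U q) - ?V) + 1)"
      using ineq[OF q] n1 by (intro mult_left_mono power_decreasing) auto
    finally show "ex n p i (g q) / real n ^ (2 * s) \<le> (1 + real i) ^ (K + 14) * (1 / real n) ^ (card (\<Union>(U q) - ?V) + 1)" .
  qed auto
  then show ?thesis by (simp add: NE_def)
qed

end

text \<open>\<open>B\<close> consists of the blocks that must survive the next phase. It is smaller
  than \<open>SB\<close> when some blocks that are free now are to be accepted in that
  phase.\<close>

locale template = bite_params +
  fixes SB SA :: "nat set set" and K :: nat and B :: "nat set set"
  assumes good: "good SB SA" and S: "SB \<union> SA \<subseteq> blocks n" "card (SB \<union> SA) \<le> K" and B: "B \<subseteq> SB"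
begin

abbreviation V where "V \<equiv> \<Union>(SB \<union> SA)"

lemma fin: "finite SB" "finite SA" "finite B"
  using S B by (auto intro: finite_subset[OF _ finite_blocks] finite_subset)

lemma BV: "B \<subseteq> blocks n" "\<Union>B \<subseteq> V"
  using S B by auto

lemma item:
  assumes "q \<in> items n B V"
  obtains b where "b \<in> B" "b \<in> SB" "b \<in> blocks n" "b \<subseteq> V" "generic n V b (fst q) (snd q)"
proof -
  obtain b where b: "b \<in> B" "b \<in> blocks n" "b \<subseteq> V" "generic n V b (fst q) (snd q)"
    by (rule itemE[OF assms BV])
  with B show thesis by (intro that) auto
qed

lemma item_props:
  assumes q: "q \<in> items n B V"
  shows "snd q \<subseteq> blocks n" "fst q \<in> snd q" "finite (snd q)" "1 \<le> card (snd q)" "card (snd q) \<le> 7"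
    "card (\<Union>(snd q) - V) = 2 * card (snd q)" "snd q \<inter> (SB \<union> SA) = {}" "\<not> fst q \<subseteq> V"
    "card (snd q - {fst q}) = card (snd q) - 1"
proof -
  obtain b where b: "b \<in> B" "b \<in> SB" "b \<in> blocks n" "b \<subseteq> V" "generic n V b (fst q) (snd q)"
    by (rule item[OF q])
  note G = genD[OF b(5,3,4)]
  show "snd q \<subseteq> blocks n" "fst q \<in> snd q" "finite (snd q)" "1 \<le> card (snd q)" "card (snd q) \<le> 7"
    "card (\<Union>(snd q) - V) = 2 * card (snd q)" by (fact G)+
  show "snd q \<inter> (SB \<union> SA) = {}" by (rule good_ext(2)[OF good S(1) order_refl b(2,5)])
  show "\<not> fst q \<subseteq> V"
  proof
    assume "fst q \<subseteq> V"
    then have "fst q \<subseteq> b" using G(2,5) by auto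
    moreover have "card (fst q) = card b" "finite b" using G(1,2) b(3) blocksD by auto
    ultimately have "fst q = b" by (metis card_subset_eq)
    then show False using G(2,3) by simp
  qed
  show "card (snd q - {fst q}) = card (snd q) - 1" using G(2) by simp
qed

lemma ext_template:
  assumes q: "q \<in> items n B V"
  shows "template n d p (insert (fst q) SB) (SA \<union> (snd q - {fst q})) (K + 7) B"
    "\<Union>(insert (fst q) SB \<union> (SA \<union> (snd q - {fst q}))) = V \<union> \<Union>(snd q)"
    "predicted u c a (insert (fst q) SB) (SA \<union> (snd q - {fst q})) = predicted u c a SB SA * rate u c a (card (snd q))"
proof -
  obtain b where b: "b \<in> B" "b \<in> SB" "b \<in> blocks n" "b \<subseteq> V" "generic n V b (fst q) (snd q)"
    by (rule item[OF q])
  note E = predicted_ext[OF good S(1) order_refl b(2,5)]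
  show "template n d p (insert (fst q) SB) (SA \<union> (snd q - {fst q})) (K + 7) B"
    using good_ext(1)[OF good S(1) order_refl b(2,5)] E(3,4) S(2) B
    by unfold_locales auto
  show "\<Union>(insert (fst q) SB \<union> (SA \<union> (snd q - {fst q}))) = V \<union> \<Union>(snd q)" by (rule E(5))
  show "predicted u c a (insert (fst q) SB) (SA \<union> (snd q - {fst q})) = predicted u c a SB SA * rate u c a (card (snd q))"
    by (rule E(1))
qed

lemma scaled_ind_ext:
  assumes q: "q \<in> items n B V"
  shows "scaled_ind n i (insert (fst q) SB) (SA \<union> (snd q - {fst q})) h = real n ^ (2 * card (snd q)) / real n ^ 2 * (scaled_ind n i SB SA h * active n i q h)"
proof -
  obtain b where b: "b \<in> B" "b \<in> SB" "b \<in> blocks n" "b \<subseteq> V" "generic n V b (fst q) (snd q)"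
    by (rule item[OF q])
  note E = predicted_ext[OF good S(1) order_refl b(2,5)]
  have "2 * card (SA \<union> (snd q - {fst q})) + 2 = 2 * card SA + 2 * card (snd q)" using E(2) by simp
  then have "real n ^ (2 * card (SA \<union> (snd q - {fst q}))) * real n ^ 2 = real n ^ (2 * card SA) * real n ^ (2 * card (snd q))"
    by (metis power_add)
  then have "real n ^ (2 * card (SA \<union> (snd q - {fst q}))) = real n ^ (2 * card SA) * (real n ^ (2 * card (snd q)) / real n ^ 2)"
    using n by (simp add: field_simps)
  then show ?thesis by (auto simp: scaled_ind_def active_def)
qed

lemma scaled_prob_ext:
  assumes q: "q \<in> items n B V"
  shows "scaled_prob n p i (insert (fst q) SB) (SA \<union> (snd q - {fst q})) / real n ^ (2 * card (snd q))
    = ex n p i (\<lambda>h. scaled_ind n i SB SA h * active n i q h) / real n ^ 2"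
  unfolding scaled_prob_scaled_ind scaled_ind_ext[OF q] ex_cmult using n by simp

end

text \<open>This is the statement carried through the induction over the phases: the product formula
  with error \<open>\<epsilon>\<close> for all good templates of at most \<open>K\<close>
  blocks.\<close>

definition close :: "nat \<Rightarrow> real \<Rightarrow> nat \<Rightarrow> real \<Rightarrow> real \<Rightarrow> real \<Rightarrow> real \<Rightarrow> nat \<Rightarrow> bool" where
  "close n p i u c a \<epsilon> K \<longleftrightarrow> (\<forall>SB SA. good SB SA \<longrightarrow> SB \<union> SA \<subseteq> blocks n \<longrightarrow> card (SB \<union> SA) \<le> K \<longrightarrow>
     \<bar>scaled_prob n p i SB SA - predicted u c a SB SA\<bar> \<le> \<epsilon>)"

lemma closeD:
  assumes "close n p i u c a \<epsilon> K" "good SB SA" "SB \<union> SA \<subseteq> blocks n" "card (SB \<union> SA) \<le> K"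
  shows "\<bar>scaled_prob n p i SB SA - predicted u c a SB SA\<bar> \<le> \<epsilon>"
  using assms unfolding close_def by blast

lemma close_mono: "close n p i u c a \<epsilon> K \<Longrightarrow> K' \<le> K \<Longrightarrow> close n p i u c a \<epsilon> K'"
  unfolding close_def by (meson order_trans)

text \<open>\<open>E1\<close> to \<open>E5\<close>, \<open>CI\<close>, \<open>CB\<close>, \<open>NE\<close> and \<open>FC\<close> are error constants; what matters is that they do not depend on \<open>n\<close>.\<close>

definition E1 :: "nat \<Rightarrow> real" where "E1 K = CB K + CI K * 3 ^ (K + 6)"
text \<open>Bounds the number of pairs of items whose blocks together form a given set of at most 14
  blocks: each item is one of these blocks with a subset of them.\<close>

definition MM :: nat where "MM = (14 * 2 ^ 14) ^ 2"
definition E2 :: "nat \<Rightarrow> nat \<Rightarrow> real" where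
  "E2 i K = CB K * E1 (K + 7) + CB K * (CI K * 3 ^ (K + 6)) + NE i K MM"
definition E3 :: "nat \<Rightarrow> nat \<Rightarrow> real" where
  "E3 i K = E2 i K + 2 * CB K * E1 K + CB K ^ 2"

lemma consts_nonneg: "0 \<le> CI K" "0 \<le> CB K" "0 \<le> E1 K" "0 \<le> E2 i K" "0 \<le> E3 i K"
proof -
  show CI: "0 \<le> CI K" for K by (simp add: CI_def)
  show CB: "0 \<le> CB K" for K using CI[of K] by (simp add: CB_def)
  show E1: "0 \<le> E1 K" for K using CI[of K] CB[of K] by (simp add: E1_def)
  show E2: "0 \<le> E2 i K" using CI[of K] CB[of K] E1[of "K + 7"] NE_nonneg by (simp add: E2_def)
  show "0 \<le> E3 i K" using E2 CB[of K] E1[of K] by (simp add: E3_def)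
qed

lemma card_pair_fibres:
  fixes Q :: "((nat set \<times> nat set set) \<times> (nat set \<times> nat set set)) set"
  assumes "\<And>q q'. (q, q') \<in> Q \<Longrightarrow> fst q \<in> snd q \<and> fst q' \<in> snd q' \<and> finite (snd q \<union> snd q') \<and> card (snd q \<union> snd q') \<le> 14"
  shows "card {z \<in> Q. snd (fst z) \<union> snd (snd z) = X} \<le> MM"
proof (cases "{z \<in> Q. snd (fst z) \<union> snd (snd z) = X} = {}")
  case False
  then obtain q q' where "(q, q') \<in> Q" "snd q \<union> snd q' = X" by auto
  then have X: "finite X" "card X \<le> 14" using assms[of q q'] by auto
  let ?R = "(X \<times> Pow X) \<times> (X \<times> Pow X)"
  have "{z \<in> Q. snd (fst z) \<union> snd (snd z) = X} \<subseteq> ?R"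
  proof
    fix z assume z: "z \<in> {z \<in> Q. snd (fst z) \<union> snd (snd z) = X}"
    then have "fst (fst z) \<in> snd (fst z)" "fst (snd z) \<in> snd (snd z)"
      using assms[of "fst z" "snd z"] by auto
    then show "z \<in> ?R" using z by (auto simp: mem_Times_iff)
  qed
  then have "card {z \<in> Q. snd (fst z) \<union> snd (snd z) = X} \<le> card ?R" using X by (intro card_mono) auto
  also have "\<dots> = (card X * 2 ^ card X) ^ 2" using X by (simp add: card_cartesian_product card_Pow power2_eq_square)
  also have "\<dots> \<le> MM" unfolding MM_def using X by (intro power_mono mult_mono power_increasing) auto
  finally show ?thesis .
qed (simp only: card.empty)

context template
begin

definition M :: "(nat \<Rightarrow> nat set set) \<Rightarrow> real" where
  "M h = (\<Sum>q\<in>items n B V. active n i q h)"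

lemma active_le: "active n i q h * active n i q' h \<le> of_bool ((snd q - {fst q}) \<union> (snd q' - {fst q'}) \<subseteq> acc i h)"
  by (auto simp: active_def)

lemma pair_props:
  assumes q: "q \<in> items n B V" "q' \<in> items n B V"
  shows "snd q \<union> snd q' \<subseteq> blocks n" "card (snd q \<union> snd q') \<le> 14" "finite (snd q \<union> snd q')"
    "(snd q - {fst q}) \<union> (snd q' - {fst q'}) \<subseteq> blocks n" "((snd q - {fst q}) \<union> (snd q' - {fst q'})) \<inter> SA = {}"
    "card ((snd q - {fst q}) \<union> (snd q' - {fst q'})) \<le> 14"
proof -
  note P = item_props[OF q(1)] and P' = item_props[OF q(2)]
  show "snd q \<union> snd q' \<subseteq> blocks n" "finite (snd q \<union> snd q')" using P P' by auto
  show c: "card (snd q \<union> snd q') \<le> 14" using card_Un_le[of "snd q" "snd q'"] P(5) P'(5) by linarith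
  show "(snd q - {fst q}) \<union> (snd q' - {fst q'}) \<subseteq> blocks n" using P(1) P'(1) by auto
  show "((snd q - {fst q}) \<union> (snd q' - {fst q'})) \<inter> SA = {}" using P(7) P'(7) by auto
  have "card ((snd q - {fst q}) \<union> (snd q' - {fst q'})) \<le> card (snd q \<union> snd q')"
    using P(3) P'(3) by (intro card_mono) auto
  then show "card ((snd q - {fst q}) \<union> (snd q' - {fst q'})) \<le> 14" using c by linarith
qed

lemma overlap_items:
  assumes q: "q \<in> items n B V" "q' \<in> items n B V" and ns: "\<not> snd q' \<subseteq> snd q"
    and hit: "\<Union>(snd q') \<inter> \<Union>(snd q) - V \<noteq> {}"
  shows "card (\<Union>(snd q \<union> snd q') - V) + 1 \<le> 2 * card (snd q \<union> snd q')"
proof -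
  obtain b where b: "b \<in> B" "b \<in> SB" "b \<in> blocks n" "b \<subseteq> V" "generic n V b (fst q) (snd q)"
    by (rule item[OF q(1)])
  obtain b' where b': "b' \<in> B" "b' \<in> SB" "b' \<in> blocks n" "b' \<subseteq> V" "generic n V b' (fst q') (snd q')"
    by (rule item[OF q(2)])
  show ?thesis by (rule generic_overlap[OF b(5,3,4) b'(5,3,4) ns hit])
qed

text \<open>If the second item is not generic over the template enlarged by the first, its blocks
  are among those of the first or the two meet outside \<open>V\<close>; either way too few vertices
  remain. Here \<open>s = 2\<close>, for the two distinguished blocks.\<close>

lemma nonmutual_sum:
  "(\<Sum>q\<in>items n B V. \<Sum>q'\<in>items n B V - items n B (V \<union> \<Union>(snd q)).
     ex n p i (\<lambda>h. scaled_ind n i SB SA h * active n i q h * active n i q' h) / real n ^ 4) \<le> NE i K MM / real n"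
proof -
  let ?I = "items n B V"
  let ?Q = "SIGMA q:?I. ?I - items n B (V \<union> \<Union>(snd q))"
  have "(\<Sum>q\<in>?I. \<Sum>q'\<in>?I - items n B (V \<union> \<Union>(snd q)).
     ex n p i (\<lambda>h. scaled_ind n i SB SA h * active n i q h * active n i q' h) / real n ^ 4)
    = (\<Sum>z\<in>?Q. ex n p i (\<lambda>h. scaled_ind n i SB SA h * active n i (fst z) h * active n i (snd z) h) / real n ^ (2 * 2))"
    by (subst sum.Sigma) (auto simp: case_prod_unfold)
  also have "\<dots> \<le> NE i K MM / real n"
  proof (rule negligible_ex[OF S, where U = "\<lambda>z. snd (fst z) \<union> snd (snd z)" and
        D = "\<lambda>z. (snd (fst z) - {fst (fst z)}) \<union> (snd (snd z) - {fst (snd z)})"])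
    show "finite ?Q" by (intro finite_SigmaI) auto
    fix z assume z: "z \<in> ?Q"
    then have q: "fst z \<in> ?I" "snd z \<in> ?I" and ni: "snd z \<notin> items n B (V \<union> \<Union>(snd (fst z)))"
      by (auto simp: mem_Sigma_iff)
    note PP = pair_props[OF q]
    note P = item_props[OF q(1)] and P' = item_props[OF q(2)]
    show "snd (fst z) \<union> snd (snd z) \<subseteq> blocks n" "card (snd (fst z) \<union> snd (snd z)) \<le> 14"
      "(snd (fst z) - {fst (fst z)}) \<union> (snd (snd z) - {fst (snd z)}) \<subseteq> blocks n"
      "((snd (fst z) - {fst (fst z)}) \<union> (snd (snd z) - {fst (snd z)})) \<inter> SA = {}"
      "card ((snd (fst z) - {fst (fst z)}) \<union> (snd (snd z) - {fst (snd z)})) \<le> 14"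
      using PP by blast+
    let ?P = "snd (fst z)" and ?P' = "snd (snd z)"
    let ?D = "(?P - {fst (fst z)}) \<union> (?P' - {fst (snd z)})"
    have fD: "finite ?D" using P(3) P'(3) by auto
    show "card (\<Union>(?P \<union> ?P') - V) + 1 \<le> 2 * 2 + 2 * card ?D"
    proof (cases "?P' \<subseteq> ?P")
      case True
      then have "?P \<union> ?P' = ?P" by auto
      moreover have "card (?P - {fst (fst z)}) \<le> card ?D" using fD by (intro card_mono) auto
      ultimately show ?thesis using P(4,6,9) by simp
    next
      case False
      obtain b where b: "b \<in> B" "generic n V b (fst (snd z)) ?P'" by (rule item[OF q(2)])
      have "\<not> \<Union>?P' \<inter> (V \<union> \<Union>?P) \<subseteq> b" using ni b by (auto simp: items_def generic_def)
      then obtain v where v: "v \<in> \<Union>?P' \<inter> (V \<union> \<Union>?P)" "v \<notin> b" by (meson subsetI)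
      have "\<Union>?P' \<inter> V \<subseteq> b" using b(2) by (simp add: generic_def)
      then have "v \<in> \<Union>?P' \<inter> \<Union>?P - V" using v by auto
      then have "card (\<Union>(?P \<union> ?P') - V) + 1 \<le> 2 * card (?P \<union> ?P')"
        by (intro overlap_items[OF q False]) auto
      moreover have "card (?P \<union> ?P') \<le> card ?D + 2"
      proof -
        have "card (?P \<union> ?P') \<le> card (?D \<union> {fst (fst z), fst (snd z)})" using fD by (intro card_mono) auto
        also have "\<dots> \<le> card ?D + card {fst (fst z), fst (snd z)}" by (rule card_Un_le)
        also have "\<dots> \<le> card ?D + 2" by (simp add: card_insert_if)
        finally show ?thesis .
      qed
      ultimately show ?thesis by linarith
    qed
    fix h assume "valid n i h"
    show "scaled_ind n i SB SA h * active n i (fst z) h * active n i (snd z) h \<le> scaled_ind n i SB SA h * of_bool (?D \<subseteq> acc i h)"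
      unfolding mult.assoc by (intro mult_left_mono active_le scaled_ind_nonneg)
  next
    fix X
    show "card {z \<in> ?Q. snd (fst z) \<union> snd (snd z) = X} \<le> MM"
    proof (rule card_pair_fibres)
      fix q q' assume "(q, q') \<in> ?Q"
      then have q: "q \<in> ?I" "q' \<in> ?I" by auto
      show "fst q \<in> snd q \<and> fst q' \<in> snd q' \<and> finite (snd q \<union> snd q') \<and> card (snd q \<union> snd q') \<le> 14"
        using pair_props[OF q] item_props(2)[OF q(1)] item_props(2)[OF q(2)] by simp
    qed
  qed
  finally show ?thesis .
qed

lemma ex_M: "ex n p i (\<lambda>h. scaled_ind n i SB SA h * M h) / real n ^ 2
    = (\<Sum>q\<in>items n B V. scaled_prob n p i (insert (fst q) SB) (SA \<union> (snd q - {fst q})) / real n ^ (2 * card (snd q)))"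
  unfolding M_def sum_distrib_left
  by (subst ex_sum) (auto simp: sum_divide_distrib scaled_prob_ext intro!: sum.cong)

end

locale close_template = template +
  fixes u c a \<epsilon> :: real
  assumes uca: "0 \<le> u" "u \<le> 1" "0 \<le> c" "c \<le> 1" "0 \<le> a" "a \<le> 3" and eps: "0 \<le> \<epsilon>"
    and cl: "close n p i u c a \<epsilon> (K + 7)"
begin

abbreviation \<mu> where "\<mu> \<equiv> kill_rate n u c a B"
abbreviation \<eta> where "\<eta> \<equiv> \<epsilon> + 1 / real n"

lemma FM:
  "\<bar>(\<Sum>q\<in>items n B V. predicted u c a SB SA * rate u c a (card (snd q)) / real n ^ (2 * card (snd q)))
      - predicted u c a SB SA * \<mu>\<bar> \<le> CI K * 3 ^ (K + 6) / real n"
  "\<bar>ex n p i (\<lambda>h. scaled_ind n i SB SA h * M h) / real n ^ 2 - predicted u c a SB SA * \<mu>\<bar> \<le> E1 K * \<eta>"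
  "(\<Sum>q\<in>items n B V. 1 / real n ^ (2 * card (snd q))) \<le> CB K"
proof -
  have IH: "\<bar>scaled_prob n p i SB' SA' - predicted u c a SB' SA'\<bar> \<le> \<epsilon>"
    if "good SB' SA'" "SB' \<union> SA' \<subseteq> blocks n" "card (SB' \<union> SA') \<le> K + 7" for SB' SA'
    using closeD[OF cl that(1,2)] that(3) by simp
  note F = first_moment[OF n good S B uca eps IH]
  show "\<bar>(\<Sum>q\<in>items n B V. predicted u c a SB SA * rate u c a (card (snd q)) / real n ^ (2 * card (snd q)))
      - predicted u c a SB SA * \<mu>\<bar> \<le> CI K * 3 ^ (K + 6) / real n" by (rule F(1))
  show "(\<Sum>q\<in>items n B V. 1 / real n ^ (2 * card (snd q))) \<le> CB K" by (rule F(3))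
  have "CB K * \<epsilon> + CI K * 3 ^ (K + 6) / real n \<le> E1 K * \<eta>"
  proof -
    have "E1 K * \<eta> = (CB K * \<epsilon> + CI K * 3 ^ (K + 6) / real n) + (CI K * 3 ^ (K + 6) * \<epsilon> + CB K / real n)"
      by (simp add: E1_def distrib_left distrib_right add_divide_distrib)
    moreover have "0 \<le> CI K * 3 ^ (K + 6) * \<epsilon> + CB K / real n" using consts_nonneg eps by simp
    ultimately show ?thesis by linarith
  qed
  then show "\<bar>ex n p i (\<lambda>h. scaled_ind n i SB SA h * M h) / real n ^ 2 - predicted u c a SB SA * \<mu>\<bar> \<le> E1 K * \<eta>"
    unfolding ex_M using F(2) by linarith
qed

lemma kill_rate_b: "0 \<le> \<mu>" "\<mu> \<le> CB K"
proof -
  have "card B \<le> K" using B S fin card_mono[of "SB \<union> SA" B] by (auto simp: le_supI1)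
  then show "0 \<le> \<mu>" "\<mu> \<le> CB K" using kill_rate_bounds[OF n BV(1) fin(3) _ uca] by auto
qed

end

section \<open>One phase of the process\<close>

text \<open>\<open>inv_into\<close> picks one representative for each value; every other element
  collides with its representative.\<close>

lemma card_le_image_collisions:
  assumes "finite A"
  shows "card A \<le> card (f ` A) + card {(x, y). x \<in> A \<and> y \<in> A \<and> x \<noteq> y \<and> f x = f y}"
proof -
  let ?N = "{(x, y). x \<in> A \<and> y \<in> A \<and> x \<noteq> y \<and> f x = f y}"
  let ?g = "inv_into A f"
  let ?R = "?g ` f ` A"
  have fN: "finite ?N" by (rule finite_subset[of _ "A \<times> A"]) (use assms in auto)
  have R: "?R \<subseteq> A" by (auto intro: inv_into_into)
  have "inj_on (\<lambda>x. (x, ?g (f x))) (A - ?R)" by (auto intro: inj_onI)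
  moreover have "(\<lambda>x. (x, ?g (f x))) ` (A - ?R) \<subseteq> ?N"
  proof (rule image_subsetI)
    fix x assume x: "x \<in> A - ?R"
    then have "?g (f x) \<in> A" "f (?g (f x)) = f x" by (auto intro: inv_into_into f_inv_into_f)
    moreover have "x \<noteq> ?g (f x)" using x by (metis DiffE imageI)
    ultimately show "(x, ?g (f x)) \<in> ?N" using x by auto
  qed
  ultimately have "card (A - ?R) \<le> card ?N" using fN by (rule card_inj_on_le)
  moreover have "card ?R \<le> card (f ` A)" using assms by (intro card_image_le) auto
  moreover have "card A = card ?R + card (A - ?R)"
    using R assms by (metis card_Diff_subset card_mono finite_subset le_add_diff_inverse)
  ultimately show ?thesis by linarith
qed

lemma items_antimono: "V \<subseteq> V' \<Longrightarrow> items n B V' \<subseteq> items n B V"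
proof
  fix q assume V: "V \<subseteq> V'" and "q \<in> items n B V'"
  then obtain b where b: "b \<in> B" "generic n V' b (fst q) (snd q)" by (auto simp: items_def)
  have "\<Union>(snd q) \<inter> V \<subseteq> \<Union>(snd q) \<inter> V'" using V by auto
  then have "generic n V b (fst q) (snd q)" using b(2) unfolding generic_def by (meson order_trans)
  then show "q \<in> items n B V" using b(1) by (auto simp: items_def)
qed

context close_template
begin

text \<open>The square is a sum over pairs of items. For a fixed first item, the second items
  generic over the enlarged template are summed by the first moment of that template, whose rate
  \<open>\<mu>\<close> is the old one because \<open>B\<close> is unchanged. Two extensions by seven
  blocks give \<open>K + 14\<close>.\<close>

lemma second_moment:
  assumes cl2: "close n p i u c a \<epsilon> (K + 14)"
  shows "\<bar>ex n p i (\<lambda>h. scaled_ind n i SB SA h * M h * M h) / real n ^ 4 - predicted u c a SB SA * \<mu> ^ 2\<bar> \<le> E2 i K * \<eta>"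
proof -
  let ?I = "items n B V"
  let ?J = "\<lambda>q. items n B (V \<union> \<Union>(snd q))"
  let ?e = "\<lambda>q q'. ex n p i (\<lambda>h. scaled_ind n i SB SA h * active n i q h * active n i q' h) / real n ^ 4"
  let ?A = "\<lambda>q. \<Sum>q'\<in>?J q. ?e q q'"
  let ?w = "\<lambda>q. 1 / real n ^ (2 * card (snd q))"
  let ?v = "predicted u c a SB SA"
  have JI: "?J q \<subseteq> ?I" for q by (rule items_antimono) auto
  have "ex n p i (\<lambda>h. scaled_ind n i SB SA h * M h * M h) = ex n p i (\<lambda>h. \<Sum>q\<in>?I. \<Sum>q'\<in>?I. scaled_ind n i SB SA h * active n i q h * active n i q' h)"
    unfolding M_def by (simp add: sum_distrib_left sum_distrib_right mult_ac)
  also have "\<dots> = (\<Sum>q\<in>?I. \<Sum>q'\<in>?I. ex n p i (\<lambda>h. scaled_ind n i SB SA h * active n i q h * active n i q' h))"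
    by (subst ex_sum, simp, rule sum.cong[OF refl], rule ex_sum) simp
  finally have "ex n p i (\<lambda>h. scaled_ind n i SB SA h * M h * M h) / real n ^ 4 = (\<Sum>q\<in>?I. \<Sum>q'\<in>?I. ?e q q')"
    by (simp add: sum_divide_distrib)
  \<comment> \<open>The second items are split into those still generic over the template enlarged
    by \<open>q\<close> and the negligible rest.\<close>
  also have "\<dots> = (\<Sum>q\<in>?I. ?A q + (\<Sum>q'\<in>?I - ?J q. ?e q q'))"
    by (rule sum.cong[OF refl], subst add.commute, rule sum.subset_diff[OF JI]) simp
  finally have tot: "ex n p i (\<lambda>h. scaled_ind n i SB SA h * M h * M h) / real n ^ 4
      = (\<Sum>q\<in>?I. ?A q) + (\<Sum>q\<in>?I. \<Sum>q'\<in>?I - ?J q. ?e q q')"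
    by (simp add: sum.distrib)
  have rest: "0 \<le> (\<Sum>q\<in>?I. \<Sum>q'\<in>?I - ?J q. ?e q q')" "(\<Sum>q\<in>?I. \<Sum>q'\<in>?I - ?J q. ?e q q') \<le> NE i K MM / real n"
  proof -
    have "0 \<le> ex n p i (\<lambda>h. scaled_ind n i SB SA h * active n i q h * active n i q' h)" for q q'
      by (intro ex_nonneg p01 mult_nonneg_nonneg scaled_ind_nonneg active_01)
    then show "0 \<le> (\<Sum>q\<in>?I. \<Sum>q'\<in>?I - ?J q. ?e q q')" by (intro sum_nonneg divide_nonneg_nonneg) auto
  qed (rule nonmutual_sum)
  have A: "\<bar>?A q - \<mu> * (?v * rate u c a (card (snd q)) / real n ^ (2 * card (snd q)))\<bar> \<le> E1 (K + 7) * \<eta> * ?w q"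
    if q: "q \<in> ?I" for q
  proof -
    let ?SB = "insert (fst q) SB" and ?SA = "SA \<union> (snd q - {fst q})"
    interpret T: template n d p i ?SB ?SA "K + 7" B by (rule ext_template(1)[OF q])
    have "K + 7 + 7 = K + 14" by simp
    then have "close n p i u c a \<epsilon> (K + 7 + 7)" using cl2 by (simp only:)
    then interpret T: close_template n d p i ?SB ?SA "K + 7" B u c a \<epsilon>
      using uca eps by unfold_locales auto
    have TM: "T.M h = (\<Sum>q'\<in>?J q. active n i q' h)" for h unfolding T.M_def ext_template(2)[OF q] ..
    have n0: "real n \<noteq> 0" using n by simp
    have "ex n p i (\<lambda>h. scaled_ind n i ?SB ?SA h * T.M h)
        = ex n p i (\<lambda>h. real n ^ (2 * card (snd q)) / real n ^ 2 * (\<Sum>q'\<in>?J q. scaled_ind n i SB SA h * active n i q h * active n i q' h))"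
      unfolding scaled_ind_ext[OF q] TM by (simp add: sum_distrib_left mult.assoc)
    also have "\<dots> = real n ^ (2 * card (snd q)) / real n ^ 2 * (\<Sum>q'\<in>?J q. ex n p i (\<lambda>h. scaled_ind n i SB SA h * active n i q h * active n i q' h))"
      unfolding ex_cmult by (subst ex_sum) auto
    finally have e0: "ex n p i (\<lambda>h. scaled_ind n i ?SB ?SA h * T.M h)
      = real n ^ (2 * card (snd q)) / real n ^ 2 * (\<Sum>q'\<in>?J q. ex n p i (\<lambda>h. scaled_ind n i SB SA h * active n i q h * active n i q' h))" .
    have n4: "real n ^ 4 = real n ^ 2 * real n ^ 2" by (simp flip: power_add)
    have eq: "ex n p i (\<lambda>h. scaled_ind n i ?SB ?SA h * T.M h) / real n ^ 2 = real n ^ (2 * card (snd q)) * ?A q"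
      unfolding e0 n4 sum_divide_distrib[symmetric] by simp
    have "\<bar>real n ^ (2 * card (snd q)) * ?A q - ?v * rate u c a (card (snd q)) * \<mu>\<bar> \<le> E1 (K + 7) * \<eta>"
      using T.FM(2) unfolding eq ext_template(3)[OF q] .
    then have f1: "\<bar>real n ^ (2 * card (snd q)) * ?A q - ?v * rate u c a (card (snd q)) * \<mu>\<bar> * ?w q \<le> E1 (K + 7) * \<eta> * ?w q"
      by (rule mult_right_mono) simp
    have f2: "\<bar>real n ^ (2 * card (snd q)) * ?A q - ?v * rate u c a (card (snd q)) * \<mu>\<bar> * ?w q
        = \<bar>(real n ^ (2 * card (snd q)) * ?A q - ?v * rate u c a (card (snd q)) * \<mu>) * ?w q\<bar>"
      by (simp add: abs_mult)
    have f3: "(real n ^ (2 * card (snd q)) * ?A q - ?v * rate u c a (card (snd q)) * \<mu>) * ?w q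
        = ?A q - \<mu> * (?v * rate u c a (card (snd q)) / real n ^ (2 * card (snd q)))"
      using n0 by (simp add: field_simps)
    show ?thesis using f1 unfolding f2 f3 .
  qed
  let ?W = "\<Sum>q\<in>?I. ?v * rate u c a (card (snd q)) / real n ^ (2 * card (snd q))"
  have "\<bar>(\<Sum>q\<in>?I. ?A q) - \<mu> * ?W\<bar> \<le> (\<Sum>q\<in>?I. E1 (K + 7) * \<eta> * ?w q)"
    unfolding sum_distrib_left sum_subtractf[symmetric]
    by (rule order_trans[OF sum_abs], rule sum_mono, rule A)
  also have "\<dots> = E1 (K + 7) * \<eta> * (\<Sum>q\<in>?I. ?w q)" by (rule sum_distrib_left[symmetric])
  also have "\<dots> \<le> E1 (K + 7) * \<eta> * CB K"
    using FM(3) consts_nonneg(3) eps by (intro mult_left_mono) auto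
  finally have 1: "\<bar>(\<Sum>q\<in>?I. ?A q) - \<mu> * ?W\<bar> \<le> CB K * E1 (K + 7) * \<eta>" by (simp add: mult_ac)
  have "\<bar>\<mu> * ?W - \<mu> * (?v * \<mu>)\<bar> = \<mu> * \<bar>?W - ?v * \<mu>\<bar>"
    using kill_rate_b(1) by (simp add: abs_mult flip: right_diff_distrib)
  also have "\<dots> \<le> CB K * (CI K * 3 ^ (K + 6) / real n)"
    using FM(1) kill_rate_b consts_nonneg by (intro mult_mono) auto
  finally have 2: "\<bar>\<mu> * ?W - ?v * \<mu> ^ 2\<bar> \<le> CB K * (CI K * 3 ^ (K + 6)) / real n"
    by (simp add: power2_eq_square mult_ac)
  have "E2 i K * \<eta> = CB K * E1 (K + 7) * \<eta> + (CB K * (CI K * 3 ^ (K + 6)) / real n + NE i K MM / real n)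
      + (CB K * (CI K * 3 ^ (K + 6)) + NE i K MM) * \<epsilon>"
    by (simp add: E2_def distrib_left distrib_right add_divide_distrib)
  moreover have "0 \<le> (CB K * (CI K * 3 ^ (K + 6)) + NE i K MM) * \<epsilon>"
    using consts_nonneg NE_nonneg eps by simp
  ultimately show ?thesis using tot rest 1 2 by linarith
qed

text \<open>When the square is expanded, the main terms \<open>1 - 2 + 1\<close> times
  \<open>predicted u c a SB SA * \<mu>^2\<close> cancel and only errors remain.\<close>

lemma deviation:
  assumes cl2: "close n p i u c a \<epsilon> (K + 14)"
  shows "ex n p i (\<lambda>h. scaled_ind n i SB SA h * (M h / real n ^ 2 - \<mu>) ^ 2) \<le> E3 i K * \<eta>"
proof -
  let ?j = "scaled_ind n i SB SA" and ?v = "predicted u c a SB SA"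
  have n4: "real n ^ 4 = real n ^ 2 * real n ^ 2" by (simp flip: power_add)
  have "?j h * (M h / real n ^ 2 - \<mu>) ^ 2
      = 1 / real n ^ 4 * (?j h * M h * M h) + ((- 2 * \<mu> / real n ^ 2) * (?j h * M h) + \<mu> ^ 2 * ?j h)" for h
    unfolding n4 by (simp add: power2_diff power_divide power2_eq_square algebra_simps add_divide_distrib)
  then have "ex n p i (\<lambda>h. ?j h * (M h / real n ^ 2 - \<mu>) ^ 2)
      = 1 / real n ^ 4 * ex n p i (\<lambda>h. ?j h * M h * M h)
        + ((- 2 * \<mu> / real n ^ 2) * ex n p i (\<lambda>h. ?j h * M h) + \<mu> ^ 2 * ex n p i ?j)"
    by (simp only: ex_add ex_cmult)
  then have "ex n p i (\<lambda>h. ?j h * (M h / real n ^ 2 - \<mu>) ^ 2)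
      = ex n p i (\<lambda>h. ?j h * M h * M h) / real n ^ 4 - 2 * \<mu> * (ex n p i (\<lambda>h. ?j h * M h) / real n ^ 2) + \<mu> ^ 2 * scaled_prob n p i SB SA"
    unfolding scaled_prob_scaled_ind by simp
  also have "\<dots> \<le> (?v * \<mu> ^ 2 + E2 i K * \<eta>) - 2 * \<mu> * (?v * \<mu> - E1 K * \<eta>) + \<mu> ^ 2 * (?v + \<epsilon>)"
  proof (intro add_mono diff_mono mult_left_mono)
    show "ex n p i (\<lambda>h. ?j h * M h * M h) / real n ^ 4 \<le> ?v * \<mu> ^ 2 + E2 i K * \<eta>"
      using second_moment[OF cl2] by linarith
    show "?v * \<mu> - E1 K * \<eta> \<le> ex n p i (\<lambda>h. ?j h * M h) / real n ^ 2" using FM(2) by linarith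
    have "\<bar>scaled_prob n p i SB SA - ?v\<bar> \<le> \<epsilon>" using closeD[OF cl good S(1)] S(2) by simp
    then show "scaled_prob n p i SB SA \<le> ?v + \<epsilon>" by linarith
  qed (use kill_rate_b in auto)
  also have "\<dots> = E2 i K * \<eta> + 2 * \<mu> * (E1 K * \<eta>) + \<mu> ^ 2 * \<epsilon>"
    by (simp add: power2_eq_square algebra_simps)
  also have "\<dots> \<le> E2 i K * \<eta> + 2 * CB K * (E1 K * \<eta>) + CB K ^ 2 * \<eta>"
    using kill_rate_b consts_nonneg eps by (intro add_mono mult_mono power_mono order_refl) auto
  also have "\<dots> = E3 i K * \<eta>" by (simp add: E3_def algebra_simps)
  finally show ?thesis .
qed

end

definition E4 :: "nat \<Rightarrow> nat \<Rightarrow> real" where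
  "E4 i K = real K * (1 + real i) ^ K + NE i K MM + NE i K (8 * K * 2 ^ K)"

context template
begin

lemma active_kill:
  assumes q: "q \<in> items n B V" and a: "fst q \<in> free n i h" "snd q - {fst q} \<subseteq> acc i h"
  shows "fst q \<in> kill n i h B"
proof -
  obtain b where b: "b \<in> B" "b \<in> SB" "b \<in> blocks n" "b \<subseteq> V" "generic n V b (fst q) (snd q)"
    by (rule item[OF q])
  note G = genD[OF b(5,3,4)]
  have "insert b (snd q) - {b, fst q} \<subseteq> acc i h" using a(2) G(3) by auto
  moreover have "b \<noteq> fst q" using G(2,3) by auto
  ultimately have "threat (acc i h) b (fst q)" unfolding threat_def using G(2,4) by blast
  then show ?thesis using a(1) b(1) by (auto simp: kill_def)
qed

definition Q2 where "Q2 = {z \<in> items n B V \<times> items n B V. fst z \<noteq> snd z \<and> fst (fst z) = fst (snd z)}"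

definition NG where "NG = {(b, w, C). b \<in> B \<and> w \<notin> SB \<union> SA \<and> C \<subseteq> blocks n \<and> conflict C \<and> b \<in> C \<and> w \<in> C
   \<and> \<not> generic n V b w (C - {b})}"

lemma finite_NG: "finite NG"
  by (rule finite_subset[of _ "B \<times> blocks n \<times> Pow (blocks n)"]) (use fin in \<open>auto simp: NG_def\<close>)

text \<open>\<open>kill\<close> counts blocks \<open>w\<close>, whereas \<open>M\<close> counts
  items. \<open>M\<close> can be larger through items sharing \<open>w\<close>, collected in
  \<open>Q2\<close>; \<open>kill\<close> can be larger through the blocks of the template itself and
  through conflicts that are not generic, collected in \<open>NG\<close>.\<close>

lemma kill_M_pointwise:
  assumes v: "valid n i h"
  shows "\<bar>real (card (kill n i h B)) - M h\<bar>
    \<le> real K + ((\<Sum>z\<in>Q2. active n i (fst z) h * active n i (snd z) h)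
      + (\<Sum>(b, w, C)\<in>NG. of_bool (C - {b, w} \<subseteq> acc i h)))"
proof -
  let ?I = "items n B V"
  define A where "A = {q \<in> ?I. fst q \<in> free n i h \<and> snd q - {fst q} \<subseteq> acc i h}"
  have fA: "finite A" by (auto simp: A_def)
  have MA: "M h = real (card A)"
    unfolding M_def active_def A_def by (simp add: of_bool_def sum.If_cases Int_def)
  have fQ2: "finite Q2" by (auto simp: Q2_def)
  have nn: "0 \<le> (\<Sum>z\<in>Q2. active n i (fst z) h * active n i (snd z) h)"
    "0 \<le> (\<Sum>(b, w, C)\<in>NG. of_bool (C - {b, w} \<subseteq> acc i h) :: real)"
    by (auto intro!: sum_nonneg mult_nonneg_nonneg active_01)
  have fk: "finite (kill n i h B)" by (auto simp: kill_def)
  have imk: "fst ` A \<subseteq> kill n i h B" using active_kill by (auto simp: A_def)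
  have low: "M h \<le> real (card (kill n i h B)) + (\<Sum>z\<in>Q2. active n i (fst z) h * active n i (snd z) h)"
  proof -
    let ?N = "{(x, y). x \<in> A \<and> y \<in> A \<and> x \<noteq> y \<and> fst x = fst y}"
    have NQ: "?N \<subseteq> Q2" by (auto simp: A_def Q2_def)
    have "real (card ?N) = (\<Sum>z\<in>?N. active n i (fst z) h * active n i (snd z) h)"
    proof -
      have "(\<Sum>z\<in>?N. active n i (fst z) h * active n i (snd z) h) = (\<Sum>z\<in>?N. 1)"
        by (rule sum.cong) (auto simp: A_def active_def)
      then show ?thesis by simp
    qed
    also have "\<dots> \<le> (\<Sum>z\<in>Q2. active n i (fst z) h * active n i (snd z) h)"
      by (rule sum_mono2[OF fQ2 NQ]) (auto intro: mult_nonneg_nonneg active_01)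
    finally have "real (card ?N) \<le> (\<Sum>z\<in>Q2. active n i (fst z) h * active n i (snd z) h)" .
    moreover have "card A \<le> card (fst ` A) + card ?N" by (rule card_le_image_collisions[OF fA])
    moreover have "card (fst ` A) \<le> card (kill n i h B)" using imk fk by (rule card_mono[rotated])
    ultimately show ?thesis unfolding MA by linarith
  qed
  have high: "real (card (kill n i h B)) \<le> M h + real K + (\<Sum>(b, w, C)\<in>NG. of_bool (C - {b, w} \<subseteq> acc i h))"
  proof -
    let ?NA = "{z \<in> NG. case z of (b, w, C) \<Rightarrow> C - {b, w} \<subseteq> acc i h}"
    have "kill n i h B \<subseteq> fst ` A \<union> (SB \<union> SA) \<union> (\<lambda>(b, w, C). w) ` ?NA"
    proof
      fix w assume w: "w \<in> kill n i h B"
      show "w \<in> fst ` A \<union> (SB \<union> SA) \<union> (\<lambda>(b, w, C). w) ` ?NA"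
      proof (cases "w \<in> SB \<union> SA")
        case False
        then have "w \<notin> B" using B by auto
        then obtain b where b: "b \<in> B" "threat (acc i h) b w" and wf: "w \<in> free n i h"
          using w by (auto simp: kill_def)
        then obtain C where C: "conflict C" "b \<in> C" "w \<in> C" "b \<noteq> w" "C - {b, w} \<subseteq> acc i h"
          by (auto simp: threat_def)
        have "b \<in> blocks n" "w \<in> blocks n" using b(1) BV(1) wf free_subset_blocks by blast+
        then have Cb: "C \<subseteq> blocks n" using C(5) valid_acc_blocks[OF v] by auto
        show ?thesis
        proof (cases "generic n V b w (C - {b})")
          case True
          then have "(w, C - {b}) \<in> ?I" using b(1) by (auto simp: items_def)
          moreover have "C - {b} - {w} \<subseteq> acc i h" using C(5) by auto
          ultimately have "(w, C - {b}) \<in> A" using wf by (simp add: A_def)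
          then show ?thesis by (force simp: image_iff)
        next
          case ng: False
          then have "(b, w, C) \<in> ?NA" using b(1) False C Cb by (simp add: NG_def)
          then have "w \<in> (\<lambda>(b, w, C). w) ` ?NA" by (rule rev_image_eqI) simp
          then show ?thesis by simp
        qed
      qed simp
    qed
    then have "card (kill n i h B) \<le> card (fst ` A \<union> (SB \<union> SA) \<union> (\<lambda>(b, w, C). w) ` ?NA)"
      using fA fin finite_NG by (intro card_mono) auto
    also have "\<dots> \<le> card (fst ` A) + card (SB \<union> SA) + card ((\<lambda>(b, w, C). w) ` ?NA)"
      by (rule order_trans[OF card_Un_le add_right_mono[OF card_Un_le]])
    also have "\<dots> \<le> card A + K + card ?NA"
      using fA finite_NG S(2) by (intro add_mono card_image_le) auto
    finally have "real (card (kill n i h B)) \<le> M h + real K + real (card ?NA)" unfolding MA by linarith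
    moreover have "real (card ?NA) = (\<Sum>(b, w, C)\<in>NG. of_bool (C - {b, w} \<subseteq> acc i h))"
      using finite_NG by (simp add: of_bool_def case_prod_unfold sum.If_cases Int_def)
    ultimately show ?thesis by simp
  qed
  show ?thesis using low high nn by linarith
qed

lemma Q2_sum: "(\<Sum>z\<in>Q2. ex n p i (\<lambda>h. scaled_ind n i SB SA h * (active n i (fst z) h * active n i (snd z) h)) / real n ^ (2 * 1)) \<le> NE i K MM / real n"
proof (rule negligible_ex[OF S, where U = "\<lambda>z. snd (fst z) \<union> snd (snd z)" and
      D = "\<lambda>z. (snd (fst z) - {fst (fst z)}) \<union> (snd (snd z) - {fst (snd z)})"])
  show "finite Q2" by (auto simp: Q2_def)
  fix z assume z: "z \<in> Q2"
  then have q: "fst z \<in> items n B V" "snd z \<in> items n B V" and ne: "fst z \<noteq> snd z" and w: "fst (fst z) = fst (snd z)"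
    by (auto simp: Q2_def)
  note PP = pair_props[OF q]
  note P = item_props[OF q(1)] and P' = item_props[OF q(2)]
  show "snd (fst z) \<union> snd (snd z) \<subseteq> blocks n" "card (snd (fst z) \<union> snd (snd z)) \<le> 14"
    "(snd (fst z) - {fst (fst z)}) \<union> (snd (snd z) - {fst (snd z)}) \<subseteq> blocks n"
    "((snd (fst z) - {fst (fst z)}) \<union> (snd (snd z) - {fst (snd z)})) \<inter> SA = {}"
    "card ((snd (fst z) - {fst (fst z)}) \<union> (snd (snd z) - {fst (snd z)})) \<le> 14"
    using PP by blast+
  let ?P = "snd (fst z)" and ?P' = "snd (snd z)" and ?w = "fst (fst z)"
  have wP: "?w \<in> ?P" "?w \<in> ?P'" using P(2) P'(2) w by auto
  have DU: "(?P - {fst (fst z)}) \<union> (?P' - {fst (snd z)}) = (?P \<union> ?P') - {?w}" using w by auto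
  have "card ((?P \<union> ?P') - {?w}) = card (?P \<union> ?P') - 1" using wP by simp
  moreover have "0 < card (?P \<union> ?P')" using wP P(3) P'(3) by (auto simp: card_gt_0_iff)
  moreover have "card (\<Union>(?P \<union> ?P') - V) + 1 \<le> 2 * card (?P \<union> ?P')"
  proof -
    have "\<not> ?w \<subseteq> V" by (rule P(8))
    then obtain x where x: "x \<in> ?w" "x \<notin> V" by blast
    then have "x \<in> \<Union>?P \<inter> \<Union>?P' - V" using wP by auto
    then have hit: "\<Union>?P' \<inter> \<Union>?P - V \<noteq> {}" "\<Union>?P \<inter> \<Union>?P' - V \<noteq> {}" by auto
    have "?P \<noteq> ?P'" using ne w by (metis prod_eqI)
    then consider "\<not> ?P' \<subseteq> ?P" | "\<not> ?P \<subseteq> ?P'" by auto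
    then show ?thesis
    proof cases
      case 1
      then show ?thesis by (rule overlap_items[OF q _ hit(1)])
    next
      case 2
      have "?P \<union> ?P' = ?P' \<union> ?P" by (rule Un_commute)
      then show ?thesis using overlap_items[OF q(2,1) 2 hit(2)] by simp
    qed
  qed
  ultimately show "card (\<Union>(?P \<union> ?P') - V) + 1 \<le> 2 * 1 + 2 * card ((?P - {fst (fst z)}) \<union> (?P' - {fst (snd z)}))"
    unfolding DU by linarith
  fix h
  show "scaled_ind n i SB SA h * (active n i (fst z) h * active n i (snd z) h)
     \<le> scaled_ind n i SB SA h * of_bool ((?P - {fst (fst z)}) \<union> (?P' - {fst (snd z)}) \<subseteq> acc i h)"
    by (intro mult_left_mono active_le scaled_ind_nonneg)
next
  fix X
  show "card {z \<in> Q2. snd (fst z) \<union> snd (snd z) = X} \<le> MM"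
  proof (rule card_pair_fibres)
    fix q q' assume "(q, q') \<in> Q2"
    then have q: "q \<in> items n B V" "q' \<in> items n B V" by (auto simp: Q2_def)
    show "fst q \<in> snd q \<and> fst q' \<in> snd q' \<and> finite (snd q \<union> snd q') \<and> card (snd q \<union> snd q') \<le> 14"
      using pair_props[OF q] item_props(2)[OF q(1)] item_props(2)[OF q(2)] by simp
  qed
qed

text \<open>\<open>C\<close> is recovered from its new part \<open>X\<close> and its trace on the
  template, \<open>b\<close> is one of at most \<open>K\<close> blocks, and \<open>w\<close> lies in
  \<open>Y\<close> or among the at most eight blocks of \<open>X\<close>.\<close>

lemma card_triple_fibres:
  assumes F: "finite F" "\<And>b w C. (b, w, C) \<in> F \<Longrightarrow> b \<in> B \<and> w \<in> Y \<union> (C - (SB \<union> SA)) \<and> conflict C" and Y: "Y \<subseteq> SB \<union> SA" "card Y \<le> y"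
  shows "card {z \<in> F. snd (snd z) - (SB \<union> SA) = X} \<le> (8 + y) * K * 2 ^ K"
proof (cases "{z \<in> F. snd (snd z) - (SB \<union> SA) = X} = {}")
  case False
  then obtain b w C where "(b, w, C) \<in> F" and CX: "C - (SB \<union> SA) = X" by auto
  then have "conflict C" using F(2) by blast
  then have fC: "finite C" "card C \<le> 8" by (auto simp: conflict_def)
  have X: "finite X" "card X \<le> 8"
    using fC card_mono[OF fC(1), of X] CX by auto
  let ?S = "SB \<union> SA"
  have fY: "finite Y" using Y fin by (auto intro: finite_subset)
  let ?R = "B \<times> (Y \<union> X) \<times> ((\<lambda>T. X \<union> T) ` Pow ?S)"
  have "{z \<in> F. snd (snd z) - ?S = X} \<subseteq> ?R"
  proof
    fix z assume z: "z \<in> {z \<in> F. snd (snd z) - ?S = X}"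
    obtain b w C where zz: "z = (b, w, C)" by (cases z)
    have "C = X \<union> (C \<inter> ?S)" using z zz by auto
    then have "C \<in> (\<lambda>T. X \<union> T) ` Pow ?S" by blast
    then show "z \<in> ?R" using F(2)[of b w C] z zz by auto
  qed
  then have "card {z \<in> F. snd (snd z) - ?S = X} \<le> card ?R" using X fY fin by (intro card_mono) auto
  also have "\<dots> = card B * (card (Y \<union> X) * card ((\<lambda>T. X \<union> T) ` Pow ?S))" by (simp add: card_cartesian_product)
  also have "\<dots> \<le> K * ((8 + y) * 2 ^ K)"
  proof (intro mult_mono)
    show "card B \<le> K" using B S fin card_mono[of ?S B] by (auto simp: le_supI1)
    show "card (Y \<union> X) \<le> 8 + y" using card_Un_le[of Y X] X Y by linarith
    have "card ((\<lambda>T. X \<union> T) ` Pow ?S) \<le> card (Pow ?S)" using fin by (intro card_image_le) auto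
    also have "\<dots> = 2 ^ card ?S" using fin by (simp add: card_Pow)
    also have "\<dots> \<le> 2 ^ K" using S(2) by (intro power_increasing) auto
    finally show "card ((\<lambda>T. X \<union> T) ` Pow ?S) \<le> 2 ^ K" .
  qed auto
  finally show ?thesis by (simp add: mult_ac)
qed (simp only: card.empty)

lemma NG_sum: "(\<Sum>z\<in>NG. ex n p i (\<lambda>h. scaled_ind n i SB SA h * of_bool (snd (snd z) - {fst z, fst (snd z)} \<subseteq> acc i h)) / real n ^ (2 * 1))
   \<le> NE i K (8 * K * 2 ^ K) / real n"
proof (rule negligible_ex[OF S finite_NG, where U = "\<lambda>z. snd (snd z) - (SB \<union> SA)" and
      D = "\<lambda>z. snd (snd z) - (SB \<union> SA) - {fst (snd z)}"])
  fix z assume z: "z \<in> NG"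
  let ?b = "fst z" and ?w = "fst (snd z)" and ?C = "snd (snd z)" and ?S = "SB \<union> SA"
  have N: "?b \<in> B" "?w \<notin> ?S" "?C \<subseteq> blocks n" "conflict ?C" "?b \<in> ?C" "?w \<in> ?C" "\<not> generic n V ?b ?w (?C - {?b})"
    using z by (auto simp: NG_def)
  have bS: "?b \<in> ?S" using N(1) B by auto
  have fC: "finite ?C" "card ?C \<le> 8" using N(4) by (auto simp: conflict_def)
  have cU: "card (?C - ?S) \<le> 8" using fC card_mono[OF fC(1), of "?C - ?S"] by auto
  show "?C - ?S \<subseteq> blocks n" "?C - ?S - {?w} \<subseteq> blocks n" using N(3) by auto
  show "card (?C - ?S) \<le> 14" using cU by simp
  have wU: "?w \<in> ?C - ?S" using N by simp
  then have cD: "card (?C - ?S - {?w}) = card (?C - ?S) - 1" by simp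
  show "card (?C - ?S - {?w}) \<le> 14" using cD cU by simp
  show "(?C - ?S - {?w}) \<inter> SA = {}" by auto
  have "?b \<noteq> ?w" using bS N(2) by auto
  then have "card (\<Union>(?C - ?S) - V) + 1 \<le> 2 * card (?C - ?S)"
    by (rule not_generic_overlap[OF N(4,5,6) _ bS S(1) N(2,3,7)])
  moreover have "0 < card (?C - ?S)" using wU fC by (auto simp: card_gt_0_iff)
  ultimately show "card (\<Union>(?C - ?S) - V) + 1 \<le> 2 * 1 + 2 * card (?C - ?S - {?w})" using cD by linarith
  fix h
  have "?C - ?S - {?w} \<subseteq> ?C - {?b, ?w}" using bS by auto
  then have "(of_bool (?C - {?b, ?w} \<subseteq> acc i h) :: real) \<le> of_bool (?C - ?S - {?w} \<subseteq> acc i h)"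
    by (auto simp: of_bool_def)
  then show "scaled_ind n i SB SA h * of_bool (?C - {?b, ?w} \<subseteq> acc i h) \<le> scaled_ind n i SB SA h * of_bool (?C - ?S - {?w} \<subseteq> acc i h)"
    by (intro mult_left_mono scaled_ind_nonneg)
next
  fix X
  show "card {z \<in> NG. snd (snd z) - (SB \<union> SA) = X} \<le> 8 * K * 2 ^ K"
    using card_triple_fibres[OF finite_NG, of "{}" 0 X] by (auto simp: NG_def)
qed

lemma kill_M: "ex n p i (\<lambda>h. scaled_ind n i SB SA h * \<bar>real (card (kill n i h B)) - M h\<bar>) / real n ^ 2 \<le> E4 i K / real n"
proof -
  let ?j = "scaled_ind n i SB SA"
  have n2: "real n \<le> real n ^ 2" using n by (simp add: power2_eq_square)
  have "ex n p i (\<lambda>h. ?j h * \<bar>real (card (kill n i h B)) - M h\<bar>)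
    \<le> ex n p i (\<lambda>h. real K * ?j h + ((\<Sum>z\<in>Q2. ?j h * (active n i (fst z) h * active n i (snd z) h))
      + (\<Sum>z\<in>NG. ?j h * of_bool (snd (snd z) - {fst z, fst (snd z)} \<subseteq> acc i h))))"
  proof (intro ex_mono p01)
    fix h assume "valid n i h"
    from mult_left_mono[OF kill_M_pointwise[OF this] scaled_ind_nonneg[of n i SB SA h]]
    show "?j h * \<bar>real (card (kill n i h B)) - M h\<bar> \<le> real K * ?j h + ((\<Sum>z\<in>Q2. ?j h * (active n i (fst z) h * active n i (snd z) h))
      + (\<Sum>z\<in>NG. ?j h * of_bool (snd (snd z) - {fst z, fst (snd z)} \<subseteq> acc i h)))"
      by (simp add: distrib_left sum_distrib_left case_prod_unfold mult_ac)
  qed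
  also have "\<dots> = real K * ex n p i ?j + ((\<Sum>z\<in>Q2. ex n p i (\<lambda>h. ?j h * (active n i (fst z) h * active n i (snd z) h)))
      + (\<Sum>z\<in>NG. ex n p i (\<lambda>h. ?j h * of_bool (snd (snd z) - {fst z, fst (snd z)} \<subseteq> acc i h))))"
  proof -
    have fQ2: "finite Q2" by (auto simp: Q2_def)
    show ?thesis by (simp only: ex_add ex_cmult ex_sum[OF fQ2] ex_sum[OF finite_NG])
  qed
  finally have "ex n p i (\<lambda>h. ?j h * \<bar>real (card (kill n i h B)) - M h\<bar>) / real n ^ 2
    \<le> real K * ex n p i ?j / real n ^ 2 + ((\<Sum>z\<in>Q2. ex n p i (\<lambda>h. ?j h * (active n i (fst z) h * active n i (snd z) h)) / real n ^ (2 * 1))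
      + (\<Sum>z\<in>NG. ex n p i (\<lambda>h. ?j h * of_bool (snd (snd z) - {fst z, fst (snd z)} \<subseteq> acc i h)) / real n ^ (2 * 1)))"
    by (simp add: divide_right_mono sum_divide_distrib[symmetric] flip: add_divide_distrib)
  also have "\<dots> \<le> real K * (1 + real i) ^ K / real n + (NE i K MM / real n + NE i K (8 * K * 2 ^ K) / real n)"
  proof (intro add_mono Q2_sum NG_sum)
    have "ex n p i ?j \<le> ex n p i (\<lambda>h. ?j h * of_bool ({} \<subseteq> acc i h))" by simp
    also have "\<dots> \<le> (1 + real i) ^ K * (1 / real n) ^ (2 * card ({} :: nat set set))"
      using S fin card_mono[of "SB \<union> SA" SA] by (intro ex_scaled_ind_acc_le) auto
    finally have "ex n p i ?j \<le> (1 + real i) ^ K" by simp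
    moreover have "0 \<le> ex n p i ?j" by (intro ex_nonneg p01 scaled_ind_nonneg)
    ultimately show "real K * ex n p i ?j / real n ^ 2 \<le> real K * (1 + real i) ^ K / real n"
      using n n2 by (intro frac_le mult_left_mono mult_nonneg_nonneg) auto
  qed
  also have "\<dots> = E4 i K / real n" by (simp add: E4_def add_divide_distrib)
  finally show ?thesis .
qed

text \<open>\<open>N\<close> holds the blocks to be accepted in the coming phase. A conflict through
  which one of them endangers \<open>B\<close> must leave the template, yet it has two blocks
  inside, so \<open>conflict_rest\<close> yields the factor \<open>1 / n\<close>.\<close>

lemma kill_within_template:
  assumes two: "\<And>C. C \<subseteq> SB \<union> SA \<Longrightarrow> conflict C \<Longrightarrow> 2 \<le> card (C \<inter> B)" and N: "N \<subseteq> SB" "N \<inter> B = {}"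
  shows "ex n p i (\<lambda>h. scaled_ind n i SB SA h * of_bool (N \<inter> kill n i h B \<noteq> {})) \<le> NE i K ((8 + K) * K * 2 ^ K) / real n"
proof -
  let ?S = "SB \<union> SA" and ?j = "scaled_ind n i SB SA"
  let ?F = "{(b, w, C). b \<in> B \<and> w \<in> N \<and> C \<subseteq> blocks n \<and> conflict C \<and> b \<in> C \<and> w \<in> C \<and> \<not> C \<subseteq> ?S}"
  have fN: "finite N" using N fin by (auto intro: finite_subset)
  have fF: "finite ?F" by (rule finite_subset[of _ "B \<times> N \<times> Pow (blocks n)"]) (use fin fN in auto)
  have "?j h * of_bool (N \<inter> kill n i h B \<noteq> {}) \<le> (\<Sum>z\<in>?F. ?j h * of_bool (snd (snd z) - ?S \<subseteq> acc i h))"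
    if v: "valid n i h" for h
  proof (cases "N \<inter> kill n i h B \<noteq> {} \<and> SB \<subseteq> free n i h")
    case True
    then obtain w where w: "w \<in> N" "w \<in> kill n i h B" by auto
    then have "w \<notin> B" using N by auto
    then obtain b where b: "b \<in> B" "threat (acc i h) b w" using w by (auto simp: kill_def)
    then obtain C where C: "conflict C" "b \<in> C" "w \<in> C" "b \<noteq> w" "C - {b, w} \<subseteq> acc i h" by (auto simp: threat_def)
    have bw: "b \<in> ?S" "w \<in> ?S" using b w N B by auto
    have Cb: "C \<subseteq> blocks n"
    proof
      fix x assume "x \<in> C"
      then consider "x \<in> ?S" | "x \<in> acc i h" using C(5) bw by auto
      then show "x \<in> blocks n" using S(1) valid_acc_blocks[OF v] by cases auto
    qed
    \<comment> \<open>Inside the template, \<open>C\<close> would contain a second block of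
      \<open>B\<close>, which would have to be free and accepted at once.\<close>
    have "\<not> C \<subseteq> ?S"
    proof
      assume "C \<subseteq> ?S"
      then have "2 \<le> card (C \<inter> B)" using two C(1) by blast
      then have "\<not> C \<inter> B \<subseteq> {b}" using card_mono[of "{b}" "C \<inter> B"] by auto
      then obtain x where x: "x \<in> C" "x \<in> B" "x \<noteq> b" by blast
      then have "x \<in> acc i h" using C(5) \<open>w \<notin> B\<close> by auto
      moreover have "x \<in> free n i h" using x B True by auto
      ultimately show False using valid_acc_free[OF v] by auto
    qed
    then have z: "(b, w, C) \<in> ?F" using b w C Cb by simp
    have "?j h * of_bool (N \<inter> kill n i h B \<noteq> {}) = ?j h * of_bool (C - ?S \<subseteq> acc i h)"
    proof -
      have "C - ?S \<subseteq> acc i h" using C(5) bw by auto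
      then show ?thesis using True by simp
    qed
    also have "\<dots> \<le> (\<Sum>z\<in>?F. ?j h * of_bool (snd (snd z) - ?S \<subseteq> acc i h))"
      using member_le_sum[OF z, of "\<lambda>z. ?j h * of_bool (snd (snd z) - ?S \<subseteq> acc i h)"] fF
      by (simp add: scaled_ind_nonneg)
    finally show ?thesis .
  next
    case False
    then have "?j h * of_bool (N \<inter> kill n i h B \<noteq> {}) = 0" by (auto simp: scaled_ind_def)
    moreover have "0 \<le> (\<Sum>z\<in>?F. ?j h * of_bool (snd (snd z) - ?S \<subseteq> acc i h))"
      by (intro sum_nonneg mult_nonneg_nonneg scaled_ind_nonneg) auto
    ultimately show ?thesis by linarith
  qed
  then have "ex n p i (\<lambda>h. ?j h * of_bool (N \<inter> kill n i h B \<noteq> {}))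
      \<le> ex n p i (\<lambda>h. \<Sum>z\<in>?F. ?j h * of_bool (snd (snd z) - ?S \<subseteq> acc i h))"
    by (intro ex_mono p01)
  also have "\<dots> = (\<Sum>z\<in>?F. ex n p i (\<lambda>h. ?j h * of_bool (snd (snd z) - ?S \<subseteq> acc i h)) / real n ^ (2 * 0))"
    by (subst ex_sum[OF fF]) simp
  also have "\<dots> \<le> NE i K ((8 + K) * K * 2 ^ K) / real n"
  proof (rule negligible_ex[OF S fF, where U = "\<lambda>z. snd (snd z) - ?S" and D = "\<lambda>z. snd (snd z) - ?S"])
    fix z assume z: "z \<in> ?F"
    let ?b = "fst z" and ?w = "fst (snd z)" and ?C = "snd (snd z)"
    have F: "?b \<in> B" "?w \<in> N" "?C \<subseteq> blocks n" "conflict ?C" "?b \<in> ?C" "?w \<in> ?C" "\<not> ?C \<subseteq> ?S"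
      using z by auto
    have fC: "finite ?C" "card ?C \<le> 8" using F(4) by (auto simp: conflict_def)
    have cU: "card (?C - ?S) \<le> 8" using fC card_mono[OF fC(1), of "?C - ?S"] by auto
    show "?C - ?S \<subseteq> blocks n" "?C - ?S \<subseteq> blocks n" using F(3) by auto
    show "card (?C - ?S) \<le> 14" "card (?C - ?S) \<le> 14" using cU by auto
    show "(?C - ?S) \<inter> SA = {}" by auto
    have fUC: "finite (\<Union>?C)" using fC(1) F(3) blocksD(3) by blast
    have ne: "?b \<noteq> ?w" using F(1,2) N by auto
    have "card {?b, ?w} \<le> card (?C \<inter> ?S)" using fC F B N by (intro card_mono) auto
    then have c2: "2 \<le> card (?C \<inter> ?S)" using ne by simp
    obtain y where y: "y \<in> ?C" "y \<notin> ?S" using F(7) by blast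
    then have ps: "?C \<inter> ?S \<subset> ?C" by auto
    have "card (\<Union>(?C - ?S) - V) \<le> card (\<Union>?C - \<Union>(?C \<inter> ?S))" using fUC by (intro card_mono) auto
    moreover have "?C - ?C \<inter> ?S = ?C - ?S" by auto
    ultimately show "card (\<Union>(?C - ?S) - V) + 1 \<le> 2 * 0 + 2 * card (?C - ?S)"
      using conflict_rest[OF F(4) ps c2 fUC] by simp
  next
    fix X
    have "card N \<le> card ?S" using N(1) fin by (intro card_mono) auto
    then show "card {z \<in> ?F. snd (snd z) - ?S = X} \<le> (8 + K) * K * 2 ^ K"
      using N(1) S(2) by (intro card_triple_fibres[OF fF, of N]) auto
  qed auto
  finally show ?thesis .
qed

end

definition E5 :: "nat \<Rightarrow> nat \<Rightarrow> real" where
  "E5 i K = 1 + 2 * E4 i K + ((1 + real i) ^ K + E3 i K) + 2 * CB K * (1 + real i) ^ K + NE i K ((8 + K) * K * 2 ^ K)"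

lemma E4_nonneg: "0 \<le> E4 i K"
  using NE_nonneg by (simp add: E4_def)

lemma E5_nonneg: "0 \<le> E5 i K"
  using NE_nonneg E4_nonneg[of i K] consts_nonneg(2)[of K] consts_nonneg(5)[of i K] by (simp add: E5_def)

lemma abs_exp_diff_le:
  fixes x y :: real
  assumes "0 \<le> x" "0 \<le> y"
  shows "\<bar>exp (- x) - exp (- y)\<bar> \<le> \<bar>x - y\<bar>"
proof -
  have *: "exp (- x) - exp (- y) \<le> y - x" if "0 \<le> x" "x \<le> y" for x y :: real
  proof -
    have e: "1 - exp (- (y - x)) \<le> y - x" using exp_ge_add_one_self[of "- (y - x)"] by linarith
    have "exp (- x) - exp (- y) = exp (- x) * (1 - exp (- (y - x)))"
      by (simp add: right_diff_distrib flip: exp_add)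
    also have "exp (- x) * (1 - exp (- (y - x))) \<le> 1 * (1 - exp (- (y - x)))"
      using that by (intro mult_right_mono) auto
    also have "\<dots> \<le> y - x" using e by (simp only: mult_1)
    finally show ?thesis .
  qed
  show ?thesis
  proof (cases "x \<le> y")
    case True
    then have "exp (- y) \<le> exp (- x)" by simp
    then show ?thesis using *[of x y] True assms by (simp add: abs_if)
  next
    case False
    then have "exp (- x) \<le> exp (- y)" by simp
    then show ?thesis using *[of y x] False assms by (simp add: abs_if)
  qed
qed

text \<open>\<open>N\<close> stands for \<open>n^2\<close>. From
  \<open>- p - 2 * p^2 \<le> ln (1 - p) \<le> - p\<close> the power is near
  \<open>exp (- (k * p))\<close>, and \<open>k * p = d * (k / N)\<close>.\<close>

lemma power_exp_approx:
  fixes p d \<mu> N :: real and k :: nat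
  assumes p: "0 \<le> p" "p \<le> 1 / 2" and d: "0 \<le> d" "d \<le> 1" and N: "0 < N" "p = d / N" and \<mu>: "0 \<le> \<mu>"
  shows "\<bar>(1 - p) ^ k - exp (- (d * \<mu>))\<bar> \<le> 2 * \<bar>real k / N - \<mu>\<bar> + 2 * p * \<mu>"
proof -
  have p2: "- p - 2 * p ^ 2 \<le> ln (1 - p)" using ln_one_minus_pos_lower_bound[OF p] .
  have pw: "(1 - p) ^ k = exp (real k * ln (1 - p))"
    using p by (simp add: exp_of_nat_mult)
  have ub: "(1 - p) ^ k \<le> exp (- (real k * p))"
  proof -
    have "ln (1 - p) \<le> - p" using ln_add_one_self_le_self2[of "- p"] p by simp
    then have "real k * ln (1 - p) \<le> real k * (- p)" by (intro mult_left_mono) auto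
    then show ?thesis unfolding pw by simp
  qed
  have lb: "exp (- (real k * p + 2 * (real k * p ^ 2))) \<le> (1 - p) ^ k"
  proof -
    have "real k * (- p - 2 * p ^ 2) \<le> real k * ln (1 - p)" using p2 by (intro mult_left_mono) auto
    then show ?thesis unfolding pw by (simp add: algebra_simps)
  qed
  have "\<bar>exp (- (real k * p)) - exp (- (real k * p + 2 * (real k * p ^ 2)))\<bar> \<le> \<bar>real k * p - (real k * p + 2 * (real k * p ^ 2))\<bar>"
    using p by (intro abs_exp_diff_le) auto
  also have "\<dots> = 2 * (p * (real k * p))" using p by (simp add: power2_eq_square mult_ac abs_mult)
  finally have 1: "\<bar>(1 - p) ^ k - exp (- (real k * p))\<bar> \<le> 2 * (p * (real k * p))" using ub lb by linarith
  have kp: "real k * p = d * (real k / N)" using N by simp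
  have "\<bar>exp (- (real k * p)) - exp (- (d * \<mu>))\<bar> \<le> \<bar>real k * p - d * \<mu>\<bar>"
    using p d \<mu> by (intro abs_exp_diff_le) auto
  also have "real k * p - d * \<mu> = d * (real k / N - \<mu>)" unfolding kp by (rule right_diff_distrib[symmetric])
  also have "\<bar>d * (real k / N - \<mu>)\<bar> = d * \<bar>real k / N - \<mu>\<bar>" using d by (simp add: abs_mult)
  also have "\<dots> \<le> 1 * \<bar>real k / N - \<mu>\<bar>" using d by (intro mult_right_mono) auto
  finally have 2: "\<bar>exp (- (real k * p)) - exp (- (d * \<mu>))\<bar> \<le> \<bar>real k / N - \<mu>\<bar>" by simp
  have "p * (real k * p) \<le> p * (\<bar>real k / N - \<mu>\<bar> + \<mu>)"
  proof (rule mult_left_mono)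
    have "real k * p \<le> 1 * (real k / N)" unfolding kp using d N by (intro mult_right_mono) auto
    then show "real k * p \<le> \<bar>real k / N - \<mu>\<bar> + \<mu>" by linarith
  qed (use p in auto)
  then have 3: "2 * (p * (real k * p)) \<le> 2 * (p * \<bar>real k / N - \<mu>\<bar>) + 2 * p * \<mu>" by (simp add: distrib_left)
  have "p * \<bar>real k / N - \<mu>\<bar> \<le> 1 / 2 * \<bar>real k / N - \<mu>\<bar>" using p by (intro mult_right_mono) auto
  moreover have "\<bar>(1 - p) ^ k - exp (- (d * \<mu>))\<bar> \<le> \<bar>(1 - p) ^ k - exp (- (real k * p))\<bar> + \<bar>exp (- (real k * p)) - exp (- (d * \<mu>))\<bar>"
    using abs_triangle_ineq[of "(1 - p) ^ k - exp (- (real k * p))" "exp (- (real k * p)) - exp (- (d * \<mu>))"] by simp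
  ultimately show ?thesis using 1 2 3 by linarith
qed

context close_template
begin

text \<open>Given the history, \<open>(1 - p) ^ card (kill n i h B)\<close> is the chance that no
  destroying block is accepted. It is compared with \<open>exp (- (d * \<mu>))\<close> by way of
  \<open>M\<close>; the condition on \<open>N\<close> costs only
  \<open>kill_within_template\<close>.\<close>

lemma survive:
  assumes cl2: "close n p i u c a \<epsilon> (K + 14)" and \<eta>: "\<eta> \<le> 1"
    and two: "\<And>C. C \<subseteq> SB \<union> SA \<Longrightarrow> conflict C \<Longrightarrow> 2 \<le> card (C \<inter> B)" and N: "N \<subseteq> SB" "N \<inter> B = {}"
  shows "\<bar>ex n p i (\<lambda>h. scaled_ind n i SB SA h * (of_bool (N \<inter> kill n i h B = {}) * (1 - p) ^ card (kill n i h B)))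
      - predicted u c a SB SA * exp (- (d * \<mu>))\<bar> \<le> E5 i K * sqrt \<eta>"
proof -
  let ?j = "scaled_ind n i SB SA" and ?v = "predicted u c a SB SA" and ?k = "\<lambda>h. kill n i h B"
  let ?X = "exp (- (d * \<mu>))"
  \<comment> \<open>Only the second moment of \<open>z = M h / n^2 - \<mu>\<close> is controlled, by
    a multiple of \<open>\<eta>\<close>. The inequality
    \<open>2 * \<bar>z\<bar> \<le> z^2 / \<theta> + \<theta>\<close> is balanced by this choice,
    which puts the square root into the error.\<close>
  define \<theta> where "\<theta> = sqrt \<eta>"
  have n0: "0 < real n" using n by simp
  have \<eta>0: "0 < \<eta>" using n0 eps by (simp add: add_nonneg_pos)
  have \<theta>: "0 < \<theta>" "\<theta> * \<theta> = \<eta>" "\<eta> \<le> \<theta>" "1 / real n \<le> \<theta>" "\<epsilon> \<le> \<theta>"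
  proof -
    show "0 < \<theta>" "\<theta> * \<theta> = \<eta>" using \<eta>0 by (auto simp: \<theta>_def)
    have "\<theta> \<le> 1" using \<eta> by (simp add: \<theta>_def)
    then show "\<eta> \<le> \<theta>" using \<open>0 < \<theta>\<close> \<open>\<theta> * \<theta> = \<eta>\<close> mult_left_mono[of \<theta> 1 \<theta>] by simp
    then show "1 / real n \<le> \<theta>" "\<epsilon> \<le> \<theta>" using eps n0 by (auto intro: order_trans[rotated])
  qed
  have p2: "p \<le> 1 / 2"
  proof -
    have "2 \<le> real n ^ 2" using n power_mono[of 4 "real n" 2] by simp
    then show ?thesis using d n0 unfolding p by (simp add: divide_le_eq)
  qed
  have pn: "p \<le> 1 / real n"
  proof -
    have "p \<le> 1 / real n ^ 2" unfolding p using d by (intro divide_right_mono) auto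
    also have "\<dots> \<le> 1 / real n" using n by (intro divide_left_mono) (auto simp: power2_eq_square)
    finally show ?thesis .
  qed
  have tj: "ex n p i ?j \<le> (1 + real i) ^ K"
  proof -
    have "ex n p i ?j \<le> ex n p i (\<lambda>h. ?j h * of_bool ({} \<subseteq> acc i h))" by simp
    also have "\<dots> \<le> (1 + real i) ^ K * (1 / real n) ^ (2 * card ({} :: nat set set))"
      using S fin card_mono[of "SB \<union> SA" SA] by (intro ex_scaled_ind_acc_le) auto
    finally show ?thesis by simp
  qed
  have tj0: "0 \<le> ex n p i ?j" by (intro ex_nonneg p01 scaled_ind_nonneg)
  have pt: "\<bar>(1 - p) ^ card (?k h) - ?X\<bar>
      \<le> 2 / real n ^ 2 * \<bar>real (card (?k h)) - M h\<bar> + (1 / \<theta> * (M h / real n ^ 2 - \<mu>) ^ 2 + (\<theta> + 2 * p * \<mu>))" for h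
  proof -
    have "\<bar>(1 - p) ^ card (?k h) - ?X\<bar> \<le> 2 * \<bar>real (card (?k h)) / real n ^ 2 - \<mu>\<bar> + 2 * p * \<mu>"
      using p01 p2 d p n0 kill_rate_b by (intro power_exp_approx) auto
    moreover have "\<bar>real (card (?k h)) / real n ^ 2 - \<mu>\<bar> \<le> \<bar>real (card (?k h)) - M h\<bar> / real n ^ 2 + \<bar>M h / real n ^ 2 - \<mu>\<bar>"
    proof -
      have "real (card (?k h)) / real n ^ 2 - \<mu> = (real (card (?k h)) - M h) / real n ^ 2 + (M h / real n ^ 2 - \<mu>)"
        by (simp add: diff_divide_distrib)
      then show ?thesis using abs_triangle_ineq[of "(real (card (?k h)) - M h) / real n ^ 2" "M h / real n ^ 2 - \<mu>"]
        by (simp add: abs_divide)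
    qed
    moreover have "2 * \<bar>z\<bar> \<le> 1 / \<theta> * z ^ 2 + \<theta>" for z
    proof -
      have "0 \<le> (\<bar>z\<bar> - \<theta>) ^ 2 / \<theta>" using \<theta>(1) by simp
      also have "\<dots> = 1 / \<theta> * z ^ 2 + \<theta> - 2 * \<bar>z\<bar>"
        using \<theta>(1) by (simp add: power2_eq_square field_simps)
      finally show ?thesis by linarith
    qed
    from this[of "M h / real n ^ 2 - \<mu>"]
    have "2 * \<bar>M h / real n ^ 2 - \<mu>\<bar> \<le> 1 / \<theta> * (M h / real n ^ 2 - \<mu>) ^ 2 + \<theta>" .
    ultimately show ?thesis by (simp add: algebra_simps)
  qed
  have "\<bar>ex n p i (\<lambda>h. ?j h * (1 - p) ^ card (?k h)) - ?X * ex n p i ?j\<bar>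
      \<le> ex n p i (\<lambda>h. ?j h * \<bar>(1 - p) ^ card (?k h) - ?X\<bar>)"
  proof -
    have "ex n p i (\<lambda>h. ?j h * (1 - p) ^ card (?k h)) - ?X * ex n p i ?j
        = ex n p i (\<lambda>h. ?j h * ((1 - p) ^ card (?k h) - ?X))"
      unfolding ex_cmult[symmetric] ex_diff[symmetric] by (simp add: right_diff_distrib mult.commute)
    moreover have "\<bar>ex n p i (\<lambda>h. ?j h * ((1 - p) ^ card (?k h) - ?X))\<bar> \<le> ex n p i (\<lambda>h. ?j h * \<bar>(1 - p) ^ card (?k h) - ?X\<bar>)"
    proof (rule abs_leI)
      show "ex n p i (\<lambda>h. ?j h * ((1 - p) ^ card (?k h) - ?X)) \<le> ex n p i (\<lambda>h. ?j h * \<bar>(1 - p) ^ card (?k h) - ?X\<bar>)"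
        by (intro ex_mono p01 mult_left_mono scaled_ind_nonneg) auto
      have "- ex n p i (\<lambda>h. ?j h * ((1 - p) ^ card (?k h) - ?X)) = ex n p i (\<lambda>h. - 1 * (?j h * ((1 - p) ^ card (?k h) - ?X)))"
        unfolding ex_cmult by simp
      also have "\<dots> \<le> ex n p i (\<lambda>h. ?j h * \<bar>(1 - p) ^ card (?k h) - ?X\<bar>)"
      proof (intro ex_mono p01)
        fix h
        have "?j h * - ((1 - p) ^ card (?k h) - ?X) \<le> ?j h * \<bar>(1 - p) ^ card (?k h) - ?X\<bar>"
          by (intro mult_left_mono scaled_ind_nonneg) auto
        then show "- 1 * (?j h * ((1 - p) ^ card (?k h) - ?X)) \<le> ?j h * \<bar>(1 - p) ^ card (?k h) - ?X\<bar>"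
          by (simp only: mult_minus_left mult_minus_right mult_1)
      qed
      finally show "- ex n p i (\<lambda>h. ?j h * ((1 - p) ^ card (?k h) - ?X)) \<le> ex n p i (\<lambda>h. ?j h * \<bar>(1 - p) ^ card (?k h) - ?X\<bar>)" .
    qed
    ultimately show ?thesis by simp
  qed
  also have "\<dots> \<le> ex n p i (\<lambda>h. 2 / real n ^ 2 * (?j h * \<bar>real (card (?k h)) - M h\<bar>)
      + (1 / \<theta> * (?j h * (M h / real n ^ 2 - \<mu>) ^ 2) + (\<theta> + 2 * p * \<mu>) * ?j h))"
  proof (intro ex_mono p01)
    fix h
    from mult_left_mono[OF pt[of h] scaled_ind_nonneg[of n i SB SA h]]
    show "?j h * \<bar>(1 - p) ^ card (?k h) - ?X\<bar> \<le> 2 / real n ^ 2 * (?j h * \<bar>real (card (?k h)) - M h\<bar>)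
      + (1 / \<theta> * (?j h * (M h / real n ^ 2 - \<mu>) ^ 2) + (\<theta> + 2 * p * \<mu>) * ?j h)"
      by (simp only: distrib_left mult_ac)
  qed
  also have "\<dots> = 2 * (ex n p i (\<lambda>h. ?j h * \<bar>real (card (?k h)) - M h\<bar>) / real n ^ 2)
      + (ex n p i (\<lambda>h. ?j h * (M h / real n ^ 2 - \<mu>) ^ 2) / \<theta> + (\<theta> + 2 * p * \<mu>) * ex n p i ?j)"
    by (simp only: ex_add ex_cmult) simp
  also have "\<dots> \<le> 2 * (E4 i K / real n) + (E3 i K * \<eta> / \<theta> + (\<theta> + 2 * (1 / real n) * CB K) * (1 + real i) ^ K)"
    using \<theta>(1) n0 pn p01 kill_rate_b consts_nonneg tj tj0
    by (intro add_mono mult_left_mono divide_right_mono kill_M deviation[OF cl2] mult_mono add_nonneg_nonneg) auto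
  also have "\<dots> \<le> 2 * (E4 i K * \<theta>) + (E3 i K * \<theta> + (\<theta> + 2 * \<theta> * CB K) * (1 + real i) ^ K)"
  proof (intro add_mono mult_left_mono mult_right_mono order_refl)
    show "E4 i K / real n \<le> E4 i K * \<theta>" using mult_left_mono[OF \<theta>(4) E4_nonneg[of i K]] by simp
    have "E3 i K * \<eta> / \<theta> = E3 i K * \<theta>" using \<theta>(1) by (simp flip: \<theta>(2))
    then show "E3 i K * \<eta> / \<theta> \<le> E3 i K * \<theta>" by simp
  qed (use \<theta> consts_nonneg in auto)
  finally have A: "\<bar>ex n p i (\<lambda>h. ?j h * (1 - p) ^ card (?k h)) - ?X * ex n p i ?j\<bar>
      \<le> 2 * (E4 i K * \<theta>) + (E3 i K * \<theta> + (\<theta> + 2 * \<theta> * CB K) * (1 + real i) ^ K)" .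
  have "\<bar>scaled_prob n p i SB SA - ?v\<bar> \<le> \<epsilon>" using closeD[OF cl good S(1)] S(2) by simp
  then have "?X * \<bar>ex n p i ?j - ?v\<bar> \<le> 1 * \<theta>"
    using \<theta> d kill_rate_b unfolding scaled_prob_scaled_ind by (intro mult_mono) auto
  then have Bq: "\<bar>?X * ex n p i ?j - ?v * ?X\<bar> \<le> \<theta>"
  proof -
    have "?X * ex n p i ?j - ?v * ?X = ?X * (ex n p i ?j - ?v)" by (simp only: right_diff_distrib mult.commute)
    with \<open>?X * \<bar>ex n p i ?j - ?v\<bar> \<le> 1 * \<theta>\<close> show ?thesis by (simp only: abs_mult abs_exp_cancel mult_1)
  qed
  have "ex n p i (\<lambda>h. ?j h * (1 - p) ^ card (?k h)) - ex n p i (\<lambda>h. ?j h * (of_bool (N \<inter> ?k h = {}) * (1 - p) ^ card (?k h)))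
      = ex n p i (\<lambda>h. ?j h * (of_bool (N \<inter> ?k h \<noteq> {}) * (1 - p) ^ card (?k h)))"
    unfolding ex_diff[symmetric] by (rule arg_cong[where f = "ex n p i"]) (auto simp: fun_eq_iff)
  moreover have "0 \<le> ex n p i (\<lambda>h. ?j h * (of_bool (N \<inter> ?k h \<noteq> {}) * (1 - p) ^ card (?k h)))"
    using p01 by (intro ex_nonneg p01 mult_nonneg_nonneg scaled_ind_nonneg) auto
  moreover have "ex n p i (\<lambda>h. ?j h * (of_bool (N \<inter> ?k h \<noteq> {}) * (1 - p) ^ card (?k h)))
      \<le> ex n p i (\<lambda>h. ?j h * of_bool (N \<inter> ?k h \<noteq> {}))"
    using p01 by (intro ex_mono p01 mult_left_mono scaled_ind_nonneg mult_left_le power_le_one) auto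
  moreover have "ex n p i (\<lambda>h. ?j h * of_bool (N \<inter> ?k h \<noteq> {})) \<le> NE i K ((8 + K) * K * 2 ^ K) / real n"
    by (rule kill_within_template[OF two N])
  moreover have "NE i K ((8 + K) * K * 2 ^ K) / real n \<le> NE i K ((8 + K) * K * 2 ^ K) * \<theta>"
    using mult_left_mono[OF \<theta>(4) NE_nonneg] by simp
  moreover have "E5 i K * \<theta> = \<theta> + (2 * (E4 i K * \<theta>) + (E3 i K * \<theta> + (\<theta> + 2 * \<theta> * CB K) * (1 + real i) ^ K))
      + NE i K ((8 + K) * K * 2 ^ K) * \<theta>"
    unfolding E5_def by (simp only: distrib_left distrib_right mult_ac mult_1)
  ultimately show ?thesis using A Bq unfolding \<theta>_def[symmetric] by linarith
qed

end

lemma bite_cong: "(\<And>W. W \<subseteq> F \<Longrightarrow> f W = g W) \<Longrightarrow> bite p F f = bite p F g"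
  unfolding bite_def by (rule sum.cong) auto

lemma bite_sum: "finite I \<Longrightarrow> bite p F (\<lambda>W. \<Sum>x\<in>I. f x W) = (\<Sum>x\<in>I. bite p F (f x))"
  unfolding bite_def by (simp add: sum_distrib_left sum.swap[of _ I])

text \<open>In a good template an accepted block shares no pair with any other block: the two would
  form a conflict with at most one free member.\<close>

lemma card_covered_pairs_Un:
  assumes good: "good SB SA" and S: "SB \<union> SA \<subseteq> blocks n" and S1: "S1 \<subseteq> SA"
  shows "card (covered_pairs (SB \<union> S1)) = card (covered_pairs SB) + 6 * card S1"
proof -
  have fin: "finite SB" "finite SA" using S by (auto intro: finite_subset[OF _ finite_blocks])
  have "finite S1" using S1 fin(2) by (rule finite_subset)
  then show ?thesis using S1
  proof (induction S1 rule: finite_induct)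
    case (insert x F)
    have x: "x \<in> SA" "x \<in> blocks n" "x \<notin> SB" using insert.prems S good by (auto simp: good_def)
    have F: "SB \<union> F \<subseteq> blocks n" using insert.prems S by auto
    have "covered_pairs (SB \<union> F) \<inter> covered_pairs {x} = {}"
    proof (rule ccontr)
      assume "\<not> ?thesis"
      then obtain f y where f: "card f = 2" "f \<subseteq> x" "y \<in> SB \<union> F" "f \<subseteq> y" by (auto simp: covered_pairs_def)
      have y: "y \<in> SB \<union> SA" "y \<noteq> x" "y \<in> blocks n" using f(3) insert x S by auto
      have "card f \<le> card (x \<inter> y)" using f blocksD(3)[OF x(2)] by (intro card_mono) auto
      then have "conflict {x, y}" using f y x blocksD by (intro conflict_pair) auto
      then have "2 \<le> card ({x, y} \<inter> SB)" using good x(1) y(1) by (auto simp: good_def)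
      moreover have "{x, y} \<inter> SB \<subseteq> {y}" using x by auto
      then have "card ({x, y} \<inter> SB) \<le> card {y}" by (intro card_mono) auto
      ultimately show False by simp
    qed
    then have "card (covered_pairs (SB \<union> F) \<union> covered_pairs {x}) = card (covered_pairs (SB \<union> F)) + card (covered_pairs {x})"
      using F x insert.hyps fin by (intro card_Un_disjoint finite_covered_pairs) auto
    moreover have "covered_pairs (SB \<union> insert x F) = covered_pairs (SB \<union> F) \<union> covered_pairs {x}"
      unfolding covered_pairs_Un[symmetric] by (rule arg_cong[where f = covered_pairs]) auto
    ultimately show ?case using insert x card_covered_pairs_single[OF blocksD(2)[OF x(2)]] by simp
  qed simp
qed

text \<open>\<open>kill_rate\<close> is a sum over covered pairs and over blocks, so
  \<open>exp (- (d * kill_rate n u c a SB))\<close> splits into one factor for each covered pair,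
  absorbed here, and one for each block, absorbed in \<open>next_c\<close>.\<close>

definition next_u :: "real \<Rightarrow> real \<Rightarrow> real \<Rightarrow> real" where
  "next_u d u c = u * exp (- (d * (u ^ 5 * c) / 2))"

definition next_c :: "nat \<Rightarrow> real \<Rightarrow> real \<Rightarrow> real \<Rightarrow> real \<Rightarrow> real" where
  "next_c n d u c a = c * exp (- (d * (\<Sum>m=2..7. conflict_density n m * (u ^ 6 * c * a ^ (m - 1)))))"

definition next_a :: "real \<Rightarrow> real \<Rightarrow> real \<Rightarrow> real \<Rightarrow> real" where
  "next_a d u c a = a + d * (u ^ 6 * c)"

text \<open>\<open>S1\<close> are the blocks accepted in this very phase. Before it they were free
  and covered six pairs each, which gives \<open>d * u^6 * c\<close> per block; the sum over
  \<open>S1\<close> is then a binomial expansion.\<close>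

lemma predicted_step:
  assumes good: "good SB SA" and S: "SB \<union> SA \<subseteq> blocks n"
  shows "(\<Sum>S1\<in>Pow SA. d ^ card S1 * (predicted u c a (SB \<union> S1) (SA - S1) * exp (- (d * kill_rate n u c a SB))))
     = predicted (next_u d u c) (next_c n d u c a) (next_a d u c a) SB SA"
proof -
  have fin: "finite SB" "finite SA" using S by (auto intro: finite_subset[OF _ finite_blocks])
  define y where "y = (\<Sum>m=2..7. conflict_density n m * (u ^ 6 * c * a ^ (m - 1)))"
  have X: "exp (- (d * kill_rate n u c a SB)) = exp (- (d * (u ^ 5 * c) / 2)) ^ card (covered_pairs SB) * exp (- (d * y)) ^ card SB"
    unfolding kill_rate_def y_def[symmetric]
    by (simp add: field_simps flip: exp_of_nat_mult exp_add)
  have "d ^ card S1 * (predicted u c a (SB \<union> S1) (SA - S1) * exp (- (d * kill_rate n u c a SB)))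
      = (next_u d u c ^ card (covered_pairs SB) * next_c n d u c a ^ card SB) * ((d * (u ^ 6 * c)) ^ card S1 * a ^ card (SA - S1))"
    if S1: "S1 \<in> Pow SA" for S1
  proof -
    have S1': "S1 \<subseteq> SA" using S1 by simp
    have cS: "card (SB \<union> S1) = card SB + card S1"
      using fin S1' good finite_subset[OF S1' fin(2)] by (intro card_Un_disjoint) (auto simp: good_def)
    show ?thesis
      unfolding predicted_def card_covered_pairs_Un[OF good S S1'] cS X next_u_def next_c_def y_def[symmetric]
        power_add power_mult power_mult_distrib
      by (simp only: mult_ac)
  qed
  then have "(\<Sum>S1\<in>Pow SA. d ^ card S1 * (predicted u c a (SB \<union> S1) (SA - S1) * exp (- (d * kill_rate n u c a SB))))
      = (next_u d u c ^ card (covered_pairs SB) * next_c n d u c a ^ card SB) * (\<Sum>S1\<in>Pow SA. (d * (u ^ 6 * c)) ^ card S1 * a ^ card (SA - S1))"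
    unfolding sum_distrib_left by (rule sum.cong[OF refl])
  also have "(\<Sum>S1\<in>Pow SA. (d * (u ^ 6 * c)) ^ card S1 * a ^ card (SA - S1)) = next_a d u c a ^ card SA"
    using prod_add[OF fin(2), of "\<lambda>_. d * (u ^ 6 * c)" "\<lambda>_. a"] by (simp add: next_a_def add.commute)
  finally show ?thesis by (simp add: predicted_def)
qed

context bite_params
begin

text \<open>The event is split by the set \<open>S1\<close> of members of \<open>SA\<close> accepted
  in this phase. The scaling of these blocks meets their probability in
  \<open>n^2 * p = d\<close>.\<close>

lemma scaled_prob_Suc:
  assumes good: "good SB SA" and S: "SB \<union> SA \<subseteq> blocks n"
  shows "scaled_prob n p (Suc i) SB SA = (\<Sum>S1\<in>Pow SA. d ^ card S1 *
    ex n p i (\<lambda>h. scaled_ind n i (SB \<union> S1) (SA - S1) h * (of_bool (S1 \<inter> kill n i h SB = {}) * (1 - p) ^ card (kill n i h SB))))"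
proof -
  have fin: "finite SB" "finite SA" using S by (auto intro: finite_subset[OF _ finite_blocks])
  have fP: "finite (Pow SA)" using fin by simp
  have pt: "real n ^ (2 * card SA) * bite p (free n i h) (\<lambda>W. of_bool (SB \<subseteq> free n (Suc i) (h(i := W)) \<and> SA \<subseteq> acc (Suc i) (h(i := W))))
    = (\<Sum>S1\<in>Pow SA. d ^ card S1 *
      (scaled_ind n i (SB \<union> S1) (SA - S1) h * (of_bool (S1 \<inter> kill n i h SB = {}) * (1 - p) ^ card (kill n i h SB))))"
    if v: "valid n i h" for h
  proof -
    let ?F = "free n i h" and ?A = "acc i h" and ?k = "kill n i h SB"
    let ?g = "\<lambda>S1 W. (of_bool (SB \<union> S1 \<subseteq> ?F \<and> SA - S1 \<subseteq> ?A) * of_bool (S1 \<subseteq> W \<and> W \<inter> ?k = {}) :: real)"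
    have AF: "?A \<inter> ?F = {}" by (rule valid_acc_free[OF v])
    have kF: "?k \<subseteq> ?F" by (auto simp: kill_def)
    have "of_bool (SB \<subseteq> free n (Suc i) (h(i := W)) \<and> SA \<subseteq> acc (Suc i) (h(i := W))) = (\<Sum>S1\<in>Pow SA. ?g S1 W)"
      if W: "W \<subseteq> ?F" for W
    proof -
      \<comment> \<open>Accepted and free blocks are disjoint, so only
        \<open>S1 = SA \<inter> W\<close> contributes.\<close>
      have "?g S1 W = (if S1 = SA \<inter> W then ?g (SA \<inter> W) W else 0)" if "S1 \<in> Pow SA" for S1
      proof (cases "SA - S1 \<subseteq> ?A \<and> S1 \<subseteq> W")
        case True
        then have "S1 = SA \<inter> W" using that W AF by blast
        then show ?thesis by simp
      next
        case False
        then have "?g S1 W = 0" by auto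
        moreover have "?g (SA \<inter> W) W = 0" if "S1 = SA \<inter> W" using False that by auto
        ultimately show ?thesis by simp
      qed
      then have "(\<Sum>S1\<in>Pow SA. ?g S1 W) = (\<Sum>S1\<in>Pow SA. if S1 = SA \<inter> W then ?g (SA \<inter> W) W else 0)"
        by (rule sum.cong[OF refl])
      also have "\<dots> = ?g (SA \<inter> W) W" using fP by (simp add: sum.delta)
      also have "\<dots> = of_bool (SB \<subseteq> free n (Suc i) (h(i := W)) \<and> SA \<subseteq> acc (Suc i) (h(i := W)))"
      proof (cases "SB \<subseteq> ?F")
        case True
        have "SA \<subseteq> acc (Suc i) (h(i := W)) \<longleftrightarrow> SA - (SA \<inter> W) \<subseteq> ?A" by (auto simp: acc_Suc)
        moreover have "SB \<union> (SA \<inter> W) \<subseteq> ?F" using True W by auto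
        ultimately show ?thesis unfolding subset_free_Suc[OF True W] by auto
      next
        case False
        then have "\<not> SB \<subseteq> free n (Suc i) (h(i := W))" by auto
        with False show ?thesis by auto
      qed
      finally show ?thesis by simp
    qed
    then have "bite p ?F (\<lambda>W. of_bool (SB \<subseteq> free n (Suc i) (h(i := W)) \<and> SA \<subseteq> acc (Suc i) (h(i := W))))
        = bite p ?F (\<lambda>W. \<Sum>S1\<in>Pow SA. ?g S1 W)"
      by (rule bite_cong)
    also have "\<dots> = (\<Sum>S1\<in>Pow SA. of_bool (SB \<union> S1 \<subseteq> ?F \<and> SA - S1 \<subseteq> ?A) * bite p ?F (\<lambda>W. of_bool (S1 \<subseteq> W \<and> W \<inter> ?k = {})))"
      unfolding bite_sum[OF fP] by (simp only: bite_cmult)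
    finally have b: "bite p ?F (\<lambda>W. of_bool (SB \<subseteq> free n (Suc i) (h(i := W)) \<and> SA \<subseteq> acc (Suc i) (h(i := W))))
        = (\<Sum>S1\<in>Pow SA. of_bool (SB \<union> S1 \<subseteq> ?F \<and> SA - S1 \<subseteq> ?A) * bite p ?F (\<lambda>W. of_bool (S1 \<subseteq> W \<and> W \<inter> ?k = {})))" .
    show ?thesis
      unfolding b sum_distrib_left
    proof (rule sum.cong[OF refl])
      fix S1 assume S1: "S1 \<in> Pow SA"
      let ?b = "bite p ?F (\<lambda>W. of_bool (S1 \<subseteq> W \<and> W \<inter> ?k = {}))"
      show "real n ^ (2 * card SA) * (of_bool (SB \<union> S1 \<subseteq> ?F \<and> SA - S1 \<subseteq> ?A) * ?b)
        = d ^ card S1 * (scaled_ind n i (SB \<union> S1) (SA - S1) h * (of_bool (S1 \<inter> ?k = {}) * (1 - p) ^ card ?k))"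
      proof (cases "SB \<union> S1 \<subseteq> ?F \<and> SA - S1 \<subseteq> ?A")
        case True
        have fS1: "finite S1" using S1 fin by (auto intro: finite_subset)
        have "?b = p ^ card S1 * (of_bool (S1 \<inter> ?k = {}) * (1 - p) ^ card ?k)"
        proof (cases "S1 \<inter> ?k = {}")
          case F: True
          then show ?thesis using True kF by (subst bite_event) auto
        next
          case F: False
          then have "?b = bite p ?F (\<lambda>W. 0)" by (intro bite_cong) auto
          then show ?thesis using F by (simp add: bite_const)
        qed
        moreover have "card SA = card (SA - S1) + card S1"
          using S1 fin fS1 card_Diff_subset[of S1 SA] card_mono[of SA S1] by simp
        then have "real n ^ (2 * card SA) = real n ^ (2 * card (SA - S1)) * (real n ^ 2) ^ card S1"
          by (simp add: power_add distrib_left flip: power_mult)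
        moreover have "(real n ^ 2) ^ card S1 * p ^ card S1 = d ^ card S1"
          using n unfolding p by (simp flip: power_mult_distrib)
        ultimately show ?thesis using True by (simp add: scaled_ind_def mult_ac)
      qed (auto simp: scaled_ind_def)
    qed
  qed
  have "scaled_prob n p (Suc i) SB SA = ex n p i (\<lambda>h. real n ^ (2 * card SA) * bite p (free n i h) (\<lambda>W. of_bool (SB \<subseteq> free n (Suc i) (h(i := W)) \<and> SA \<subseteq> acc (Suc i) (h(i := W)))))"
    unfolding scaled_prob_def ex.simps ex_cmult ..
  also have "\<dots> = ex n p i (\<lambda>h. \<Sum>S1\<in>Pow SA. d ^ card S1 *
      (scaled_ind n i (SB \<union> S1) (SA - S1) h * (of_bool (S1 \<inter> kill n i h SB = {}) * (1 - p) ^ card (kill n i h SB))))"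
    by (rule ex_cong[OF p01 pt])
  also have "\<dots> = (\<Sum>S1\<in>Pow SA. d ^ card S1 *
    ex n p i (\<lambda>h. scaled_ind n i (SB \<union> S1) (SA - S1) h * (of_bool (S1 \<inter> kill n i h SB = {}) * (1 - p) ^ card (kill n i h SB))))"
    unfolding ex_sum[OF fP] ex_cmult ..
  finally show ?thesis .
qed

lemma close_Suc:
  assumes uca: "0 \<le> u" "u \<le> 1" "0 \<le> c" "c \<le> 1" "0 \<le> a" "a \<le> 3" and eps: "0 \<le> \<epsilon>" "\<epsilon> + 1 / real n \<le> 1"
    and cl: "close n p i u c a \<epsilon> (K + 14)"
  shows "close n p (Suc i) (next_u d u c) (next_c n d u c a) (next_a d u c a) (2 ^ K * (E5 i K * sqrt (\<epsilon> + 1 / real n))) K"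
  unfolding close_def
proof (intro allI impI)
  fix SB SA assume good: "good SB SA" and S: "SB \<union> SA \<subseteq> blocks n" "card (SB \<union> SA) \<le> K"
  have fin: "finite SB" "finite SA" using S by (auto intro: finite_subset[OF _ finite_blocks])
  let ?e = "E5 i K * sqrt (\<epsilon> + 1 / real n)"
  let ?x = "\<lambda>S1. ex n p i (\<lambda>h. scaled_ind n i (SB \<union> S1) (SA - S1) h * (of_bool (S1 \<inter> kill n i h SB = {}) * (1 - p) ^ card (kill n i h SB)))"
  let ?y = "\<lambda>S1. predicted u c a (SB \<union> S1) (SA - S1) * exp (- (d * kill_rate n u c a SB))"
  have e0: "0 \<le> ?e" using E5_nonneg eps by simp
  have t: "\<bar>d ^ card S1 * ?x S1 - d ^ card S1 * ?y S1\<bar> \<le> ?e" if S1: "S1 \<in> Pow SA" for S1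
  proof -
    have U: "(SB \<union> S1) \<union> (SA - S1) = SB \<union> SA" using S1 by auto
    have two: "2 \<le> card (C \<inter> SB)" if "C \<subseteq> SB \<union> SA" "conflict C" for C using good that by (auto simp: good_def)
    have g1: "good (SB \<union> S1) (SA - S1)"
      unfolding good_def U
    proof (intro conjI allI impI)
      show "(SB \<union> S1) \<inter> (SA - S1) = {}" using good by (auto simp: good_def)
      show "\<forall>x\<in>SB \<union> SA. \<forall>y\<in>SB \<union> SA. x \<noteq> y \<longrightarrow> card (x \<inter> y) \<le> 2" using good unfolding good_def by blast
      fix C assume C: "C \<subseteq> SB \<union> SA" "conflict C"
      have "card (C \<inter> SB) \<le> card (C \<inter> (SB \<union> S1))"
        using conflictD(1)[OF C(2)] by (intro card_mono) auto
      then show "2 \<le> card (C \<inter> (SB \<union> S1))" using two[OF C] by linarith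
    qed
    interpret T: close_template n d p i "SB \<union> S1" "SA - S1" K SB u c a \<epsilon>
    proof unfold_locales
      show "close n p i u c a \<epsilon> (K + 7)" using cl by (rule close_mono) simp
    qed (use g1 S U uca eps in auto)
    have A: "\<bar>?x S1 - ?y S1\<bar> \<le> ?e"
    proof (rule T.survive[OF cl eps(2)])
      fix C assume "C \<subseteq> (SB \<union> S1) \<union> (SA - S1)" "conflict C"
      then show "2 \<le> card (C \<inter> SB)" unfolding U by (rule two)
    next
      show "S1 \<subseteq> SB \<union> S1" "S1 \<inter> SB = {}" using S1 good by (auto simp: good_def)
    qed
    have Bd: "\<bar>d ^ card S1 * ?x S1 - d ^ card S1 * ?y S1\<bar> = d ^ card S1 * \<bar>?x S1 - ?y S1\<bar>"
      using d by (simp add: abs_mult flip: right_diff_distrib)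
    have Cd: "d ^ card S1 * \<bar>?x S1 - ?y S1\<bar> \<le> 1 * \<bar>?x S1 - ?y S1\<bar>"
      using d by (intro mult_right_mono power_le_one) auto
    show ?thesis unfolding Bd by (rule order_trans[OF Cd]) (simp only: mult_1 A)
  qed
  have "\<bar>scaled_prob n p (Suc i) SB SA - predicted (next_u d u c) (next_c n d u c a) (next_a d u c a) SB SA\<bar>
      \<le> (\<Sum>S1\<in>Pow SA. ?e)"
    unfolding scaled_prob_Suc[OF good S(1)] predicted_step[OF good S(1), symmetric] sum_subtractf[symmetric]
    by (rule order_trans[OF sum_abs], rule sum_mono, rule t)
  also have "\<dots> = 2 ^ card SA * ?e" using fin by (simp add: card_Pow)
  also have "\<dots> \<le> 2 ^ K * ?e"
  proof (rule mult_right_mono[OF _ e0])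
    have "card SA \<le> K" using S fin card_mono[of "SB \<union> SA" SA] by auto
    then show "(2::real) ^ card SA \<le> 2 ^ K" by (intro power_increasing) auto
  qed
  finally show "\<bar>scaled_prob n p (Suc i) SB SA - predicted (next_u d u c) (next_c n d u c a) (next_a d u c a) SB SA\<bar> \<le> 2 ^ K * ?e" .
qed

end

section \<open>The trajectory\<close>

primrec trajectory :: "nat \<Rightarrow> real \<Rightarrow> nat \<Rightarrow> real \<times> real \<times> real" where
  "trajectory n d 0 = (1, 1, 0)"
| "trajectory n d (Suc i) = (case trajectory n d i of (u, c, a) \<Rightarrow> (next_u d u c, next_c n d u c a, next_a d u c a))"

text \<open>Bounds the sum of \<open>conflict_density n m * a ^ (m - 1)\<close> over the six values
  \<open>m = 2..7\<close>, for \<open>a\<close> at most 3.\<close>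

definition rate_bound :: real where "rate_bound = 6 * (real (7 * FC 4 14) * 3 ^ 6)"

text \<open>The factor \<open>3 / 4\<close> is what yields \<open>3 * a \<le> 8 * (1 - u)\<close>,
  which keeps \<open>a\<close> below 3; the quadratic Taylor polynomial is precise enough for
  it.\<close>

lemma one_minus_exp_ge:
  fixes x :: real
  assumes "0 \<le> x" "x \<le> 1 / 2"
  shows "3 / 4 * x \<le> 1 - exp (- x)"
proof -
  have pos: "0 < 1 + x" using assms by simp
  have "1 + x \<le> exp x" by (rule exp_ge_add_one_self)
  have "(1 - 3 / 4 * x) * (1 + x + x ^ 2 / 2) \<ge> 1"
  proof -
    have "(1 - 3 / 4 * x) * (1 + x + x ^ 2 / 2) = 1 + x / 4 - x ^ 2 / 4 - 3 / 8 * x ^ 3"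
      by (simp add: power2_eq_square power3_eq_cube algebra_simps)
    moreover have "x ^ 2 \<le> 1 / 2 * x" unfolding power2_eq_square using assms by (intro mult_right_mono) auto
    moreover have "x ^ 3 \<le> 1 / 4 * x"
    proof -
      have "x * x \<le> 1 / 2 * (1 / 2)" using assms by (intro mult_mono) auto
      then have "x * x * x \<le> 1 / 4 * x" using assms by (intro mult_right_mono) auto
      then show ?thesis by (simp add: power3_eq_cube)
    qed
    ultimately show ?thesis using assms by linarith
  qed
  moreover have "1 + x + x ^ 2 / 2 \<le> exp x" using assms by (intro exp_lower_Taylor_quadratic) auto
  moreover have "0 \<le> 1 - 3 / 4 * x" using assms by simp
  ultimately have "1 \<le> (1 - 3 / 4 * x) * exp x" by (meson mult_left_mono order_trans)
  then have "exp (- x) \<le> (1 - 3 / 4 * x) * exp x * exp (- x)" by (simp add: mult_right_mono)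
  then show ?thesis by (simp add: mult.assoc flip: exp_add)
qed

lemma FC_pos: "0 < FC K v"
  by (simp add: FC_def)

text \<open>In one step \<open>a\<close> grows by \<open>2 * w\<close> with
  \<open>w = u0 * x\<close>, and \<open>u\<close> falls by some \<open>z\<close> between
  \<open>3 / 4 * w\<close> and \<open>w\<close>, so both comparisons of \<open>a\<close> with
  \<open>1 - u\<close> persist. The exponent lost by \<open>c\<close> is at most
  \<open>rate_bound\<close> times the growth of \<open>a\<close>; since \<open>a\<close> is bounded,
  \<open>c\<close> never gets near 0.\<close>

lemma trajectory_bounds:
  assumes n: "4 \<le> n" and d: "0 \<le> d" "d \<le> 1" and trajectory: "trajectory n d i = (u, c, a)"
  shows "0 < u \<and> u \<le> 1 \<and> 0 < c \<and> c \<le> 1 \<and> 0 \<le> a \<and> 3 * a \<le> 8 * (1 - u) \<and> 2 * (1 - u) \<le> a \<and> exp (- (rate_bound * a)) \<le> c"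
  using trajectory
proof (induction i arbitrary: u c a)
  case (Suc i)
  obtain u0 c0 a0 where p0: "trajectory n d i = (u0, c0, a0)" by (cases "trajectory n d i")
  note IH = Suc.IH[OF p0]
  have eqs: "u = next_u d u0 c0" "c = next_c n d u0 c0 a0" "a = next_a d u0 c0 a0" using Suc.prems p0 by auto
  define x where "x = d * (u0 ^ 5 * c0) / 2"
  define \<alpha> where "\<alpha> = d * (u0 ^ 6 * c0)"
  define y where "y = (\<Sum>m=2..7. conflict_density n m * (u0 ^ 6 * c0 * a0 ^ (m - 1)))"
  have u5: "u0 ^ 5 * c0 \<le> 1" using IH by (intro mult_le_one power_le_one) auto
  have x0: "0 \<le> x" "x \<le> 1 / 2"
    using d IH mult_mono[OF d(2) u5] by (auto simp: x_def)
  have \<alpha>: "\<alpha> = 2 * (u0 * x)" "0 \<le> \<alpha>" using d IH by (simp_all add: \<alpha>_def x_def eval_nat_numeral)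
  have u: "u = u0 * exp (- x)" unfolding eqs next_u_def x_def ..
  have a: "a = a0 + \<alpha>" unfolding eqs next_a_def \<alpha>_def ..
  have c: "c = c0 * exp (- (d * y))" unfolding eqs next_c_def y_def ..
  have e1: "3 / 4 * x \<le> 1 - exp (- x)" by (rule one_minus_exp_ge[OF x0])
  have e2: "1 - exp (- x) \<le> x" using exp_ge_add_one_self[of "- x"] by simp
  have m1: "u0 * (3 / 4 * x) \<le> u0 * (1 - exp (- x))" using e1 IH by (intro mult_left_mono) auto
  have m2: "u0 * (1 - exp (- x)) \<le> u0 * x" using e2 IH by (intro mult_left_mono) auto
  have uu: "u = u0 - u0 * (1 - exp (- x))" unfolding u by (simp add: algebra_simps)
  have y0: "0 \<le> y" unfolding y_def using IH conflict_density_nonneg by (intro sum_nonneg mult_nonneg_nonneg) auto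
  have dy: "d * y \<le> rate_bound * \<alpha>"
  proof -
    have "y = (u0 ^ 6 * c0) * (\<Sum>m=2..7. conflict_density n m * a0 ^ (m - 1))"
      unfolding y_def sum_distrib_left by (rule sum.cong) auto
    moreover have "(\<Sum>m=2..7. conflict_density n m * a0 ^ (m - 1)) \<le> (\<Sum>m=2..7::nat. real (7 * FC 4 14) * 3 ^ 6)"
    proof (rule sum_mono)
      fix m :: nat assume m: "m \<in> {2..7}"
      have "a0 ^ (m - 1) \<le> 3 ^ (m - 1)" using IH by (intro power_mono) auto
      also have "\<dots> \<le> 3 ^ 6" using m by (intro power_increasing) auto
      finally show "conflict_density n m * a0 ^ (m - 1) \<le> real (7 * FC 4 14) * 3 ^ 6"
        using conflict_density_le[OF n, of m] conflict_density_nonneg m IH by (intro mult_mono) auto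
    qed
    then have "(\<Sum>m=2..7. conflict_density n m * a0 ^ (m - 1)) \<le> rate_bound" by (simp add: rate_bound_def)
    ultimately have "y \<le> (u0 ^ 6 * c0) * rate_bound" using IH by (simp add: mult_left_mono)
    then have "d * y \<le> d * ((u0 ^ 6 * c0) * rate_bound)" using d by (intro mult_left_mono)
    then show ?thesis by (simp add: \<alpha>_def mult_ac)
  qed
  have "0 < u" "0 < c" using IH by (simp_all add: u c)
  moreover have "u \<le> 1" unfolding u using IH x0 by (intro mult_le_one) auto
  moreover have "c \<le> 1" unfolding c using IH d y0 by (intro mult_le_one) auto
  moreover have "0 \<le> a" "3 * a \<le> 8 * (1 - u)" "2 * (1 - u) \<le> a"
  proof -
    have ih: "0 \<le> a0" "3 * a0 \<le> 8 * (1 - u0)" "2 * (1 - u0) \<le> a0" using IH by auto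
    define z where "z = u0 * (1 - exp (- x))"
    define w where "w = u0 * x"
    have z: "3 / 4 * w \<le> z" "z \<le> w" using m1 m2 by (simp_all add: z_def w_def mult_ac)
    have e: "u = u0 - z" "a = a0 + 2 * w" using uu a \<alpha>(1) by (simp_all add: z_def w_def)
    show "0 \<le> a" using a ih \<alpha>(2) by linarith
    show "3 * a \<le> 8 * (1 - u)" unfolding e using ih z by argo
    show "2 * (1 - u) \<le> a" unfolding e using ih z by argo
  qed
  moreover have "exp (- (rate_bound * a)) \<le> c"
  proof -
    have "exp (- (rate_bound * a)) = exp (- (rate_bound * a0)) * exp (- (rate_bound * \<alpha>))"
      unfolding a by (simp add: distrib_left flip: exp_add)
    also have "\<dots> \<le> c0 * exp (- (d * y))" using IH dy by (intro mult_mono) auto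
    finally show ?thesis unfolding c .
  qed
  ultimately show ?case by blast
qed auto

lemma rate_bound_nonneg: "0 \<le> rate_bound" by (simp add: rate_bound_def)

text \<open>While \<open>u\<close> exceeds \<open>\<theta>\<close>, the lower bound for
  \<open>c\<close> makes each step multiply \<open>u\<close> by at most a fixed factor.\<close>

lemma trajectory_decay:
  assumes n: "4 \<le> n" and d: "0 \<le> d" "d \<le> 1" and \<theta>: "0 < \<theta>"
  shows "fst (trajectory n d i) \<le> \<theta> \<or> fst (trajectory n d i) \<le> exp (- (real i * d * (\<theta> ^ 5 * exp (- (3 * rate_bound)) / 2)))"
proof (induction i)
  case (Suc i)
  obtain u0 c0 a0 where p0: "trajectory n d i = (u0, c0, a0)" by (cases "trajectory n d i")
  note P = trajectory_bounds[OF n d p0]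
  define x where "x = d * (u0 ^ 5 * c0) / 2"
  have x0: "0 \<le> x" using d P by (simp add: x_def)
  have f: "fst (trajectory n d (Suc i)) = u0 * exp (- x)" using p0 by (simp add: next_u_def x_def)
  show ?case
  proof (cases "u0 \<le> \<theta>")
    case True
    have "u0 * exp (- x) \<le> u0 * 1" using P x0 by (intro mult_left_mono) auto
    then show ?thesis using True f by simp
  next
    case False
    let ?k = "\<theta> ^ 5 * exp (- (3 * rate_bound)) / 2"
    have "exp (- (3 * rate_bound)) \<le> exp (- (rate_bound * a0))" using P rate_bound_nonneg mult_left_mono[of a0 3 rate_bound] by simp
    then have "exp (- (3 * rate_bound)) \<le> c0" using P by linarith
    then have "\<theta> ^ 5 * exp (- (3 * rate_bound)) \<le> u0 ^ 5 * c0" using False \<theta> by (intro mult_mono power_mono) auto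
    then have "d * ?k \<le> x" unfolding x_def using d mult_left_mono[of "\<theta> ^ 5 * exp (- (3 * rate_bound))" "u0 ^ 5 * c0" d] by simp
    moreover have "u0 \<le> exp (- (real i * d * ?k))" using Suc False p0 by simp
    ultimately have "u0 * exp (- x) \<le> exp (- (real i * d * ?k)) * exp (- (d * ?k))"
      using P by (intro mult_mono) auto
    also have "\<dots> = exp (- (real (Suc i) * d * ?k))" by (simp add: algebra_simps flip: exp_add)
    finally show ?thesis using f by simp
  qed
qed simp

text \<open>At the start all blocks are free and none is accepted, hence the values 1, 1, 0.\<close>

lemma close_0: "close n p 0 1 1 0 0 K"
  unfolding close_def
proof (intro allI impI)
  fix SB SA assume S: "SB \<union> SA \<subseteq> blocks n"
  then have fS: "finite SA" by (auto intro: finite_subset[OF _ finite_blocks])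
  show "\<bar>scaled_prob n p 0 SB SA - predicted 1 1 0 SB SA\<bar> \<le> 0"
  proof (cases "SA = {}")
    case True
    then show ?thesis using S by (simp add: scaled_prob_def predicted_def acc_def)
  next
    case False
    then have "0 < card SA" using fS by (simp add: card_gt_0_iff)
    then show ?thesis using False by (simp add: scaled_prob_def predicted_def acc_def zero_power)
  qed
qed

text \<open>Each phase uses up 14 blocks of the hypothesis, so the induction runs over all
  \<open>K\<close> together; the threshold for \<open>n\<close> may depend on the number of phases,
  which is fixed.\<close>

lemma close_eventually:
  assumes d: "0 \<le> d" "d \<le> 1"
  shows "0 < \<epsilon> \<Longrightarrow> \<exists>N. \<forall>n\<ge>N. \<forall>u c a. trajectory n d i = (u, c, a) \<longrightarrow> close n (d / real n ^ 2) i u c a \<epsilon> K"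
proof (induction i arbitrary: \<epsilon> K)
  case 0
  have "close n p 0 1 1 0 \<epsilon> K" for n p
    using close_0[of n p K] 0 unfolding close_def by fastforce
  then show ?case by auto
next
  case (Suc i)
  define \<theta> where "\<theta> = min 1 (\<epsilon> / (2 ^ K * (E5 i K + 1)))"
  have E: "0 < E5 i K + 1" using E5_nonneg[of i K] by simp
  have \<theta>: "0 < \<theta>" "\<theta> \<le> 1" "2 ^ K * (E5 i K * \<theta>) \<le> \<epsilon>"
  proof -
    show "0 < \<theta>" "\<theta> \<le> 1" using Suc.prems E by (auto simp: \<theta>_def)
    have "2 ^ K * (E5 i K * \<theta>) \<le> 2 ^ K * ((E5 i K + 1) * (\<epsilon> / (2 ^ K * (E5 i K + 1))))"
      using E5_nonneg[of i K] \<open>0 < \<theta>\<close> by (intro mult_left_mono mult_mono) (auto simp: \<theta>_def)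
    also have "\<dots> = \<epsilon>" using E by simp
    finally show "2 ^ K * (E5 i K * \<theta>) \<le> \<epsilon>" .
  qed
  \<comment> \<open>The previous error and \<open>1 / n\<close> are each made at most half of
    \<open>\<theta>^2\<close>, so that the square root in \<open>close_Suc\<close> is at most
    \<open>\<theta>\<close>.\<close>
  define \<epsilon>1 where "\<epsilon>1 = \<theta> ^ 2 / 2"
  have \<epsilon>1: "0 < \<epsilon>1" using \<theta> by (simp add: \<epsilon>1_def)
  obtain N where N: "\<forall>n\<ge>N. \<forall>u c a. trajectory n d i = (u, c, a) \<longrightarrow> close n (d / real n ^ 2) i u c a \<epsilon>1 (K + 14)"
    using Suc.IH[OF \<epsilon>1] by blast
  obtain N2 :: nat where N2: "1 / \<epsilon>1 \<le> real N2" using real_arch_simple by blast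
  show ?case
  proof (intro exI[of _ "max 4 (max N N2)"] allI impI)
    fix n u c a assume nn: "max 4 (max N N2) \<le> n" and trajectory: "trajectory n d (Suc i) = (u, c, a)"
    obtain u0 c0 a0 where p0: "trajectory n d i = (u0, c0, a0)" by (cases "trajectory n d i")
    have n4: "4 \<le> n" and nN: "N \<le> n" "real N2 \<le> real n" using nn by auto
    note P = trajectory_bounds[OF n4 d p0]
    interpret bite_params n d "d / real n ^ 2" i using n4 d by unfold_locales auto
    have "1 / \<epsilon>1 \<le> real n" using N2 nN(2) by linarith
    then have n1: "1 / real n \<le> \<epsilon>1" using \<epsilon>1 n4 by (simp add: field_simps)
    then have le: "\<epsilon>1 + 1 / real n \<le> \<theta> ^ 2" by (simp add: \<epsilon>1_def)
    moreover have "\<theta> ^ 2 \<le> 1" using \<theta> by (intro power_le_one) auto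
    ultimately have le1: "\<epsilon>1 + 1 / real n \<le> 1" by linarith
    have "close n (d / real n ^ 2) (Suc i) (next_u d u0 c0) (next_c n d u0 c0 a0) (next_a d u0 c0 a0)
        (2 ^ K * (E5 i K * sqrt (\<epsilon>1 + 1 / real n))) K"
    proof (rule close_Suc)
      show "close n (d / (real n)\<^sup>2) i u0 c0 a0 \<epsilon>1 (K + 14)" using N p0 nN(1) by blast
    qed (use P \<epsilon>1 le1 in auto)
    moreover have "2 ^ K * (E5 i K * sqrt (\<epsilon>1 + 1 / real n)) \<le> \<epsilon>"
    proof -
      have "sqrt (\<epsilon>1 + 1 / real n) \<le> \<theta>" using real_sqrt_le_mono[OF le] \<theta> by simp
      then have "2 ^ K * (E5 i K * sqrt (\<epsilon>1 + 1 / real n)) \<le> 2 ^ K * (E5 i K * \<theta>)"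
        using E5_nonneg by (intro mult_left_mono) auto
      then show ?thesis using \<theta>(3) by linarith
    qed
    ultimately have "close n (d / real n ^ 2) (Suc i) (next_u d u0 c0) (next_c n d u0 c0 a0) (next_a d u0 c0 a0) \<epsilon> K"
      unfolding close_def by (meson order_trans)
    then show "close n (d / real n ^ 2) (Suc i) u c a \<epsilon> K" using trajectory p0 by simp
  qed
qed

text \<open>A smallest violating family would be a conflict.\<close>

lemma sparse_of_conflict_free:
  assumes F: "F \<subseteq> blocks n" "\<And>C. C \<subseteq> F \<Longrightarrow> \<not> conflict C"
    and Q: "Q \<subseteq> F" "2 \<le> card Q" "card Q \<le> 8"
  shows "2 * card Q + 3 \<le> card (\<Union>Q)"
  using Q
proof (induction "card Q" arbitrary: Q rule: less_induct)
  case less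
  have fQ: "finite Q" using less.prems F by (meson finite_blocks finite_subset)
  show ?case
  proof (rule ccontr)
    assume neg: "\<not> ?case"
    have "2 * card D + 3 \<le> card (\<Union>D)" if D: "D \<subset> Q" "2 \<le> card D" for D
    proof -
      have "card D < card Q" using fQ D(1) by (rule psubset_card_mono)
      then show ?thesis using less.hyps[of D] D less.prems by auto
    qed
    then have "conflict Q" using neg less.prems fQ unfolding conflict_def by auto
    then show False using F(2) less.prems by blast
  qed
qed

lemma choose4_ge: "1 \<le> n \<Longrightarrow> real n ^ 4 - 6 * real n ^ 3 \<le> 24 * real (n choose 4)"
proof (cases "n < 4")
  case True
  assume "1 \<le> n"
  have "real n ^ 3 * real n \<le> real n ^ 3 * 6" using True by (intro mult_left_mono) auto
  then show ?thesis by (simp add: eval_nat_numeral mult_ac)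
next
  case False
  assume n1: "1 \<le> n"
  have "real (n choose 4) = (\<Prod>i = 0..<4. real (n - i)) / fact 4"
    unfolding binomial_altdef_of_nat[OF leI[OF False]] by (simp add: eval_nat_numeral of_nat_diff)
  then have "24 * real (n choose 4) = real n * (real n - 1) * (real n - 2) * (real n - 3)"
    using False by (simp add: eval_nat_numeral of_nat_diff)
  also have "\<dots> = real n ^ 4 - 6 * real n ^ 3 + (11 * real n ^ 2 - 6 * real n)"
    by (simp add: eval_nat_numeral algebra_simps)
  finally have eq: "24 * real (n choose 4) = real n ^ 4 - 6 * real n ^ 3 + (11 * real n ^ 2 - 6 * real n)" .
  have "0 \<le> 11 * real n ^ 2 - 6 * real n"
  proof -
    have "real n * 1 \<le> real n * real n" using n1 by (intro mult_left_mono) auto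
    then show ?thesis by (simp add: power2_eq_square)
  qed
  with eq show ?thesis by linarith
qed

text \<open>There are about \<open>n ^ (2 * j + 2)\<close> possible conflicts of \<open>j\<close>
  blocks, each with probability about \<open>R ^ (j - 1) * p ^ j\<close>. With
  \<open>p = d / n^2\<close> and \<open>R * d = T\<close> this gives
  \<open>n^2 * T ^ (j - 1) * d\<close>: the shared phase leaves one factor \<open>d\<close> over.
  Here \<open>448 = 7 * 64\<close>, for seven values of \<open>j\<close>, and
  \<open>18 = 2 * 8 + 2\<close>.\<close>

lemma expected_conflicts:
  assumes n: "4 \<le> n" and p: "p = d / real n ^ 2" and d: "0 \<le> d" "d \<le> 1" and T: "1 \<le> T" "real R * d = T"
  shows "(\<Sum>C\<in>{C. C \<subseteq> blocks n \<and> conflict C}. ex n p R (\<lambda>h. of_bool (C \<subseteq> acc R h)))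
     \<le> real n ^ 2 * (448 * real (FC 0 18) * T ^ 7 * d)"
proof -
  let ?C = "{C. C \<subseteq> blocks n \<and> conflict C}"
  have fC: "finite ?C" by (rule finite_families)
  interpret bite_params n d p R using n p d by unfold_locales auto
  have n0: "0 < real n" using n by simp
  have j: "card C \<in> {2..8}" if "C \<in> ?C" for C using that by (auto simp: conflict_def)
  have "(\<Sum>C\<in>?C. ex n p R (\<lambda>h. of_bool (C \<subseteq> acc R h))) \<le> (\<Sum>C\<in>?C. 64 * real R ^ (card C - 1) * p ^ card C)"
    by (intro sum_mono ex_conflict_le p01) auto
  also have "\<dots> = (\<Sum>j\<in>{2..8}. \<Sum>C\<in>{C \<in> ?C. card C = j}. 64 * real R ^ (card C - 1) * p ^ card C)"
    by (rule sum.group[symmetric]) (use fC j in auto)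
  also have "\<dots> \<le> (\<Sum>j\<in>{2..8::nat}. real n ^ 2 * (64 * real (FC 0 18) * T ^ 7 * d))"
  proof (rule sum_mono)
    fix j :: nat assume j: "j \<in> {2..8}"
    have "card {C \<in> ?C. card C = j} \<le> card {P. P \<subseteq> blocks n \<and> card (\<Union>P - {}) \<le> 2 * j + 2}"
      by (rule card_mono[OF finite_families]) (auto simp: conflict_def)
    also have "\<dots> \<le> FC 0 (2 * j + 2) * n ^ (2 * j + 2)" using n by (intro card_families) auto
    also have "\<dots> \<le> FC 0 18 * n ^ (2 * j + 2)" using j FC_mono by (intro mult_right_mono) auto
    finally have c: "real (card {C \<in> ?C. card C = j}) \<le> real (FC 0 18) * real n ^ (2 * j + 2)"
      by (rule of_nat_le_mult_power)
    have pj: "real n ^ (2 * j + 2) * p ^ j = real n ^ 2 * d ^ j"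
    proof -
      have e1: "(real n ^ 2) ^ j * p ^ j = d ^ j" using n0 unfolding p by (simp flip: power_mult_distrib)
      have "real n ^ (2 * j + 2) = (real n ^ 2) ^ j * real n ^ 2" by (simp only: power_add power_mult)
      then have "real n ^ (2 * j + 2) * p ^ j = real n ^ 2 * ((real n ^ 2) ^ j * p ^ j)" by (simp only: mult_ac)
      then show ?thesis unfolding e1 .
    qed
    have dj: "real R ^ (j - 1) * d ^ j = T ^ (j - 1) * d"
    proof -
      have "d ^ j = d ^ (j - 1) * d" using j by (simp flip: power_Suc2)
      then show ?thesis unfolding T(2)[symmetric] by (simp add: power_mult_distrib)
    qed
    have "(\<Sum>C\<in>{C \<in> ?C. card C = j}. 64 * real R ^ (card C - 1) * p ^ card C)
        = (\<Sum>C\<in>{C \<in> ?C. card C = j}. 64 * real R ^ (j - 1) * p ^ j)" by (rule sum.cong) auto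
    also have "\<dots> = real (card {C \<in> ?C. card C = j}) * (64 * real R ^ (j - 1) * p ^ j)" by simp
    also have "\<dots> \<le> (real (FC 0 18) * real n ^ (2 * j + 2)) * (64 * real R ^ (j - 1) * p ^ j)"
      using c p01 by (intro mult_right_mono) auto
    also have "\<dots> = 64 * real (FC 0 18) * real R ^ (j - 1) * (real n ^ (2 * j + 2) * p ^ j)" by (simp only: mult_ac)
    also have "\<dots> = real n ^ 2 * (64 * real (FC 0 18) * (real R ^ (j - 1) * d ^ j))" unfolding pj by (simp only: mult_ac)
    also have "\<dots> = real n ^ 2 * (64 * real (FC 0 18) * (T ^ (j - 1) * d))" unfolding dj ..
    also have "\<dots> \<le> real n ^ 2 * (64 * real (FC 0 18) * (T ^ 7 * d))"
      using T j d by (intro mult_left_mono mult_right_mono power_increasing) auto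
    finally show "(\<Sum>C\<in>{C \<in> ?C. card C = j}. 64 * real R ^ (card C - 1) * p ^ card C)
        \<le> real n ^ 2 * (64 * real (FC 0 18) * T ^ 7 * d)" by (simp only: mult.assoc)
  qed
  also have "\<dots> = real n ^ 2 * (448 * real (FC 0 18) * T ^ 7 * d)" by simp
  finally show ?thesis .
qed

theorem sparse_family:
  fixes \<epsilon> :: real
  assumes \<epsilon>: "0 < \<epsilon>" "\<epsilon> \<le> 1"
  shows "\<exists>N. \<forall>n\<ge>N. \<exists>F\<subseteq>blocks n. (1 - \<epsilon>) * real n ^ 2 / 12 \<le> real (card F) \<and>
    (\<forall>Q\<subseteq>F. 2 \<le> card Q \<longrightarrow> card Q \<le> 8 \<longrightarrow> 2 * card Q + 3 \<le> card (\<Union>Q))"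
proof -
  define \<theta> where "\<theta> = min (\<epsilon> / 4) 1"
  have \<theta>: "0 < \<theta>" "\<theta> \<le> \<epsilon> / 4" "\<theta> \<le> 1" using \<epsilon> by (auto simp: \<theta>_def)
  define k where "k = \<theta> ^ 5 * exp (- (3 * rate_bound)) / 2"
  have k: "0 < k" using \<theta> by (simp add: k_def)
  \<comment> \<open>The total length of the process after which \<open>u\<close> has fallen to
    \<open>\<theta>\<close>; the lower bound 1 makes the powers of \<open>T\<close>
    comparable.\<close>
  define T where "T = max 1 (ln (1 / \<theta>) / k)"
  have T: "1 \<le> T" "exp (- (T * k)) \<le> \<theta>"
  proof -
    have "ln (1 / \<theta>) / k \<le> T" by (simp add: T_def)
    then have "ln (1 / \<theta>) \<le> T * k" using k by (simp add: divide_le_eq)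
    then have "exp (- (T * k)) \<le> exp (- ln (1 / \<theta>))" by simp
    also have "\<dots> = \<theta>" using \<theta> by (simp add: ln_div)
    finally show "exp (- (T * k)) \<le> \<theta>" .
  qed (simp add: T_def)
  define G where "G = 448 * real (FC 0 18) * T ^ 7"
  have T0: "0 < T" using T(1) by linarith
  have G: "0 < G" unfolding G_def by (intro mult_pos_pos zero_less_power T0) (simp_all add: FC_pos)
  \<comment> \<open>Enough phases to make \<open>d = T / R\<close> so small that at most
    \<open>\<epsilon> / 48 * n^2\<close> conflicts are expected among the accepted blocks.\<close>
  obtain R :: nat where R: "T * (48 * G / \<epsilon> + 1) \<le> real R" using real_arch_simple by blast
  have "T * 1 \<le> T * (48 * G / \<epsilon> + 1)" using T G \<epsilon> by (intro mult_left_mono) auto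
  then have RT: "T \<le> real R" using R by linarith
  then have R0: "0 < real R" using T by linarith
  define d where "d = T / real R"
  have dd: "0 \<le> d" "d \<le> 1" "real R * d = T" using T RT R0 by (auto simp: d_def)
  have Gd: "48 * (G * d) \<le> \<epsilon>"
  proof -
    have "T * (48 * G / \<epsilon>) \<le> T * (48 * G / \<epsilon> + 1)" using T by (intro mult_left_mono) auto
    then have "T * (48 * G / \<epsilon>) \<le> real R" using R by linarith
    then have "T * (48 * G) \<le> real R * \<epsilon>" using \<epsilon> by (simp add: field_simps)
    then show ?thesis using R0 by (simp add: d_def field_simps)
  qed
  have e2: "0 < \<epsilon> / 2" using \<epsilon> by simp
  obtain N1 where N1: "\<forall>n\<ge>N1. \<forall>u c a. trajectory n d R = (u, c, a) \<longrightarrow> close n (d / real n ^ 2) R u c a (\<epsilon> / 2) 1"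
    using close_eventually[OF dd(1,2) e2] by blast
  obtain N2 :: nat where N2: "24 / \<epsilon> \<le> real N2" using real_arch_simple by blast
  show ?thesis
  proof (intro exI[of _ "max 7 (max N1 N2)"] allI impI)
    fix n assume "max 7 (max N1 N2) \<le> n"
    then have n4: "4 \<le> n" and n7: "7 \<le> n" and nN: "N1 \<le> n" "real N2 \<le> real n" by auto
    define p where "p = d / real n ^ 2"
    interpret bite_params n d p R using n4 dd by unfold_locales (auto simp: p_def)
    obtain u c a where trajectory: "trajectory n d R = (u, c, a)" by (cases "trajectory n d R")
    note P = trajectory_bounds[OF n4 dd(1,2) trajectory]
    have "u \<le> \<theta>"
    proof -
      have "u \<le> \<theta> \<or> u \<le> exp (- (real R * d * k))"
        using trajectory_decay[OF n4 dd(1,2) \<theta>(1), of R] trajectory by (simp add: k_def)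
      then show ?thesis using T(2) unfolding dd(3) by linarith
    qed
    moreover have "2 * (1 - u) \<le> a" using P by blast
    ultimately have a: "2 - \<epsilon> / 2 \<le> a" using \<theta>(2) by argo
    have n0: "0 < real n" using n4 by simp
    have cl: "close n p R u c a (\<epsilon> / 2) 1" using N1 trajectory nN(1) unfolding p_def by blast
    have Pb: "(a - \<epsilon> / 2) / real n ^ 2 \<le> ex n p R (\<lambda>h. of_bool (b \<in> acc R h))" if b: "b \<in> blocks n" for b
    proof -
      have "good {} {b}"
        unfolding good_def
      proof (intro conjI allI impI)
        fix C assume "C \<subseteq> {} \<union> {b}" "conflict C"
        then have "card C \<le> card {b}" by (intro card_mono) auto
        then show "2 \<le> card (C \<inter> {})" using conflictD(2)[OF \<open>conflict C\<close>] by simp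
      qed auto
      then have t: "\<bar>scaled_prob n p R {} {b} - predicted u c a {} {b}\<bar> \<le> \<epsilon> / 2" using b by (intro closeD[OF cl]) auto
      have v: "predicted u c a {} {b} = a" by (simp add: predicted_def covered_pairs_def)
      have tn: "scaled_prob n p R {} {b} = real n ^ 2 * ex n p R (\<lambda>h. of_bool (b \<in> acc R h))" by (simp add: scaled_prob_def)
      have "a - \<epsilon> / 2 \<le> real n ^ 2 * ex n p R (\<lambda>h. of_bool (b \<in> acc R h))" using t unfolding v tn by linarith
      then show ?thesis using n0 by (simp add: divide_le_eq mult.commute)
    qed
    let ?C = "{C. C \<subseteq> blocks n \<and> conflict C}"
    have fC: "finite ?C" by (rule finite_families)
    \<comment> \<open>Accepted blocks minus conflicts among them: this many blocks survive when one
      block of every conflict is deleted.\<close>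
    let ?f = "\<lambda>h. (\<Sum>b\<in>blocks n. of_bool (b \<in> acc R h)) - (\<Sum>C\<in>?C. of_bool (C \<subseteq> acc R h)) :: real"
    have E: "real n ^ 2 * ((1 - \<epsilon>) / 12) \<le> ex n p R ?f"
    proof -
      have "real (card (blocks n)) * ((a - \<epsilon> / 2) / real n ^ 2) - real n ^ 2 * (G * d) \<le> ex n p R ?f"
      proof -
        have "ex n p R ?f = (\<Sum>b\<in>blocks n. ex n p R (\<lambda>h. of_bool (b \<in> acc R h))) - (\<Sum>C\<in>?C. ex n p R (\<lambda>h. of_bool (C \<subseteq> acc R h)))"
          unfolding ex_diff ex_sum[OF finite_blocks] ex_sum[OF fC] ..
        moreover have "(\<Sum>b\<in>blocks n. (a - \<epsilon> / 2) / real n ^ 2) \<le> (\<Sum>b\<in>blocks n. ex n p R (\<lambda>h. of_bool (b \<in> acc R h)))"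
          by (intro sum_mono Pb)
        moreover have "(\<Sum>C\<in>?C. ex n p R (\<lambda>h. of_bool (C \<subseteq> acc R h))) \<le> real n ^ 2 * (G * d)"
          unfolding G_def by (rule expected_conflicts[OF n4 p_def dd(1,2) T(1) dd(3)])
        ultimately show ?thesis by simp
      qed
      moreover have "real n ^ 2 * ((1 - \<epsilon>) / 12) \<le> real (card (blocks n)) * ((a - \<epsilon> / 2) / real n ^ 2) - real n ^ 2 * (G * d)"
      proof -
        have nn: "6 / real n \<le> \<epsilon> / 4"
        proof -
          have "24 / \<epsilon> \<le> real n" using N2 nN(2) by linarith
          then show ?thesis using \<epsilon> n0 by (simp add: field_simps)
        qed
        have "real n ^ 2 * (1 - 6 / real n) / 24 = (real n ^ 4 - 6 * real n ^ 3) / 24 / real n ^ 2"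
          using n0 by (simp add: field_simps eval_nat_numeral)
        also have "\<dots> \<le> real (n choose 4) / real n ^ 2"
          using choose4_ge[of n] n4 by (intro divide_right_mono) auto
        finally have c4: "real n ^ 2 * (1 - 6 / real n) / 24 \<le> real (card (blocks n)) / real n ^ 2" unfolding card_blocks .
        have h1: "real n ^ 2 * (1 - 6 / real n) / 24 * (2 - \<epsilon>) \<le> real (card (blocks n)) / real n ^ 2 * (a - \<epsilon> / 2)"
          using c4 a \<epsilon> n7 by (intro mult_mono) auto
        have h2: "real n ^ 2 * ((1 - \<epsilon>) / 12) + real n ^ 2 * (G * d) \<le> real n ^ 2 * ((1 - 6 / real n) / 24 * (2 - \<epsilon>))"
        proof -
          have "(1 - \<epsilon>) / 12 + G * d \<le> (1 - \<epsilon> / 4) / 24 * (2 - \<epsilon>)"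
          proof -
            have "(1 - \<epsilon> / 4) / 24 * (2 - \<epsilon>) = 1 / 12 - \<epsilon> / 16 + \<epsilon> * \<epsilon> / 96" by (simp add: field_simps)
            moreover have "0 \<le> \<epsilon> * \<epsilon> / 96" by simp
            moreover have "G * d \<le> \<epsilon> / 48" using Gd by simp
            ultimately show ?thesis by argo
          qed
          also have "\<dots> \<le> (1 - 6 / real n) / 24 * (2 - \<epsilon>)" using nn \<epsilon> by (intro mult_right_mono) auto
          finally have "real n ^ 2 * ((1 - \<epsilon>) / 12 + G * d) \<le> real n ^ 2 * ((1 - 6 / real n) / 24 * (2 - \<epsilon>))"
            by (intro mult_left_mono) auto
          then show ?thesis by (simp add: distrib_left)
        qed
        have "real n ^ 2 * (1 - 6 / real n) / 24 * (2 - \<epsilon>) = real n ^ 2 * ((1 - 6 / real n) / 24 * (2 - \<epsilon>))"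
          "real (card (blocks n)) / real n ^ 2 * (a - \<epsilon> / 2) = real (card (blocks n)) * ((a - \<epsilon> / 2) / real n ^ 2)"
          by simp_all
        then show ?thesis using h1 h2 by linarith
      qed
      ultimately show ?thesis by linarith
    qed
    obtain h where h: "valid n R h" "real n ^ 2 * ((1 - \<epsilon>) / 12) \<le> ?f h"
      using ex_attained[OF p01, of n R ?f] E by (meson order_trans)
    let ?A = "acc R h"
    have A: "?A \<subseteq> blocks n" by (rule valid_acc_blocks[OF h(1)])
    have fA: "finite ?A" using A by (rule finite_subset) simp
    define D where "D = {C. C \<subseteq> ?A \<and> conflict C}"
    have fD: "finite D" unfolding D_def by (rule finite_subset[of _ "Pow ?A"]) (use fA in auto)
    have "?f h = real (card ?A) - real (card D)"
    proof -
      have "(\<Sum>b\<in>blocks n. of_bool (b \<in> ?A) :: real) = real (card (blocks n \<inter> ?A))"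
        by (simp add: of_bool_def sum.If_cases)
      moreover have "blocks n \<inter> ?A = ?A" using A by auto
      moreover have "(\<Sum>C\<in>?C. of_bool (C \<subseteq> ?A) :: real) = real (card (?C \<inter> {C. C \<subseteq> ?A}))"
        using fC by (simp add: of_bool_def sum.If_cases)
      moreover have "?C \<inter> {C. C \<subseteq> ?A} = D" using A by (auto simp: D_def)
      ultimately show ?thesis by simp
    qed
    then have big: "(1 - \<epsilon>) * real n ^ 2 / 12 \<le> real (card ?A) - real (card D)" using h(2) by (simp add: mult.commute)
    have "\<forall>C\<in>D. \<exists>x. x \<in> C" by (auto simp: D_def conflict_def)
    then obtain g where g: "\<And>C. C \<in> D \<Longrightarrow> g C \<in> C" by metis
    define F where "F = ?A - g ` D"
    have FA: "F \<subseteq> ?A" by (auto simp: F_def)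
    have "card ?A - card (g ` D) \<le> card F" unfolding F_def using fD by (intro diff_card_le_card_Diff) auto
    then have "real (card ?A) - real (card D) \<le> real (card F)" using card_image_le[OF fD, of g] by linarith
    moreover have noc: "\<not> conflict C" if "C \<subseteq> F" for C
    proof
      assume "conflict C"
      then have "C \<in> D" using that FA by (auto simp: D_def)
      then have "g C \<in> C" "g C \<in> g ` D" using g by auto
      then show False using that by (auto simp: F_def)
    qed
    ultimately show "\<exists>F\<subseteq>blocks n. (1 - \<epsilon>) * real n ^ 2 / 12 \<le> real (card F) \<and>
        (\<forall>Q\<subseteq>F. 2 \<le> card Q \<longrightarrow> card Q \<le> 8 \<longrightarrow> 2 * card Q + 3 \<le> card (\<Union>Q))"
      using big FA A sparse_of_conflict_free[of F n] by (intro exI[of _ F]) auto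
  qed
qed

section \<open>Sparse systems of four-element sets\<close>

text \<open>Members are indices, since different items may have the same support. The vertex
  \<open>v\<close> of the starting item is kept because the removal is organised vertex by
  vertex.\<close>

inductive builtv :: "('a \<Rightarrow> nat set) \<Rightarrow> 'a set \<Rightarrow> nat \<Rightarrow> 'a set \<Rightarrow> bool"
  for supp :: "'a \<Rightarrow> nat set" and I :: "'a set" and v :: nat where
  start: "x \<in> I \<Longrightarrow> v \<in> supp x \<Longrightarrow> builtv supp I v {x}"
| step: "builtv supp I v S \<Longrightarrow> y \<in> I \<Longrightarrow> y \<notin> S \<Longrightarrow> 2 \<le> card (supp y \<inter> \<Union>(supp ` S)) \<Longrightarrow>
    builtv supp I v (insert y S)"

lemma card_Un_le_Int: "finite A \<Longrightarrow> finite B \<Longrightarrow> card (A \<union> B) + card (A \<inter> B) = card A + card B"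
  using card_Un_Int[of A B] by simp

text \<open>Every added item brings at most two new vertices. Stopping the construction early gives
  built subsets of every smaller size.\<close>

lemma builtv_props:
  assumes "builtv supp I v S" and fin: "\<And>x. x \<in> I \<Longrightarrow> finite (supp x) \<and> card (supp x) \<le> 4"
  shows "S \<subseteq> I \<and> finite S \<and> v \<in> \<Union>(supp ` S) \<and> 1 \<le> card S \<and> card (\<Union>(supp ` S)) \<le> 2 * card S + 2 \<and>
    (\<forall>j. 1 \<le> j \<longrightarrow> j \<le> card S \<longrightarrow> (\<exists>S'\<subseteq>S. builtv supp I v S' \<and> card S' = j))"
  using assms(1)
proof induction
  case (start x)
  have "builtv supp I v {x}" using start by (rule builtv.start)
  moreover have "card (supp x) \<le> 4" using fin[OF start(1)] by simp
  moreover have "j = card {x}" if "1 \<le> j" "j \<le> card {x}" for j using that by simp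
  ultimately show ?case using start by (intro conjI allI impI) auto
next
  case (step S y)
  let ?U = "\<Union>(supp ` S)"
  have fU: "finite ?U" using step.IH fin by auto
  have U: "\<Union>(supp ` insert y S) = supp y \<union> ?U" by simp
  have "card (supp y \<union> ?U) + card (supp y \<inter> ?U) = card (supp y) + card ?U"
    using fin[OF step(2)] fU by (intro card_Un_le_Int) auto
  moreover have "card (supp y) \<le> 4" using fin[OF step(2)] by simp
  ultimately have c: "card (\<Union>(supp ` insert y S)) \<le> 2 * card (insert y S) + 2"
    unfolding U using step.IH step.hyps by simp
  have new: "builtv supp I v (insert y S)" using step.hyps by (rule builtv.step)
  have "\<exists>S'\<subseteq>insert y S. builtv supp I v S' \<and> card S' = j" if j: "1 \<le> j" "j \<le> card (insert y S)" for j
  proof (cases "j \<le> card S")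
    case True
    then obtain S' where "S' \<subseteq> S" "builtv supp I v S'" "card S' = j" using step.IH j(1) by blast
    then show ?thesis by blast
  next
    case False
    then have "j = card (insert y S)" using j step by simp
    then show ?thesis using new by blast
  qed
  moreover have "insert y S \<subseteq> I" "finite (insert y S)" "v \<in> \<Union>(supp ` insert y S)" "1 \<le> card (insert y S)"
    using step by auto
  ultimately show ?case using c by blast
qed

text \<open>For every vertex, a largest set of at most seven items through it with too few vertices is removed.
  A second such set at the same vertex could be glued to the first one, contradicting maximality or,
  when cut down to the right size, giving eight items on eighteen vertices.\<close>

lemma cleaning:
  fixes supp :: "'a \<Rightarrow> nat set"
  assumes I: "finite I" and supp: "\<And>x. x \<in> I \<Longrightarrow> supp x \<subseteq> {..<n} \<and> card (supp x) \<le> 4"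
    and P8: "\<And>Q. Q \<subseteq> I \<Longrightarrow> card Q = 8 \<Longrightarrow> 19 \<le> card (\<Union>(supp ` Q))"
  shows "\<exists>I'\<subseteq>I. card I \<le> card I' + 7 * n \<and>
    (\<forall>v S. builtv supp I' v S \<longrightarrow> card (\<Union>(supp ` S)) = 2 * card S + 2)"
proof -
  define DD where "DD v = {D. D \<subseteq> I \<and> card D \<le> 7 \<and> (D = {} \<or> v \<in> \<Union>(supp ` D) \<and> card (\<Union>(supp ` D)) \<le> 2 * card D + 1)}" for v
  have fDD: "finite (DD v)" for v unfolding DD_def by (rule finite_subset[of _ "Pow I"]) (use I in auto)
  have neDD: "{} \<in> DD v" for v by (simp add: DD_def)
  have "\<exists>D\<in>DD v. \<forall>D'\<in>DD v. card D' \<le> card D" for v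
  proof -
    have "Max (card ` DD v) \<in> card ` DD v" using fDD neDD by (intro Max_in) auto
    then obtain D where D: "D \<in> DD v" "card D = Max (card ` DD v)" by auto
    then show ?thesis using fDD by (intro bexI[of _ D]) auto
  qed
  then obtain D where D: "\<And>v. D v \<in> DD v" "\<And>v D'. D' \<in> DD v \<Longrightarrow> card D' \<le> card (D v)" by metis
  define I' where "I' = I - (\<Union>v<n. D v)"
  have DI: "D v \<subseteq> I" "finite (D v)" "card (D v) \<le> 7" for v
    using D(1)[of v] I by (auto simp: DD_def intro: finite_subset)
  have "card (\<Union>v<n. D v) \<le> (\<Sum>v<n. card (D v))" by (rule card_UN_le) simp
  also have "\<dots> \<le> (\<Sum>v<n. 7)" using DI by (intro sum_mono) auto
  finally have "card (\<Union>v<n. D v) \<le> 7 * n" by simp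
  moreover have "card I \<le> card I' + card (\<Union>v<n. D v)"
  proof -
    have "card I \<le> card (I' \<union> (\<Union>v<n. D v))" using I DI by (intro card_mono) (auto simp: I'_def)
    also have "\<dots> \<le> card I' + card (\<Union>v<n. D v)" by (rule card_Un_le)
    finally show ?thesis .
  qed
  ultimately have cI: "card I \<le> card I' + 7 * n" by linarith
  have I'I: "I' \<subseteq> I" by (auto simp: I'_def)
  have fin: "finite (supp x) \<and> card (supp x) \<le> 4" if "x \<in> I" for x
    using supp[OF that] by (auto intro: finite_subset)
  have "card (\<Union>(supp ` S)) = 2 * card S + 2" if b: "builtv supp I' v S" for v S
  proof (rule ccontr)
    assume ne: "card (\<Union>(supp ` S)) \<noteq> 2 * card S + 2"
    have bp: "T \<subseteq> I' \<and> finite T \<and> v \<in> \<Union>(supp ` T) \<and> 1 \<le> card T \<and> card (\<Union>(supp ` T)) \<le> 2 * card T + 2 \<and>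
      (\<forall>j. 1 \<le> j \<longrightarrow> j \<le> card T \<longrightarrow> (\<exists>S'\<subseteq>T. builtv supp I' v S' \<and> card S' = j))" if "builtv supp I' v T" for T
      by (rule builtv_props[OF that]) (use fin I'I in auto)
    note P = bp[OF b]
    have S1: "card (\<Union>(supp ` S)) \<le> 2 * card S + 1" using P ne by linarith
    obtain x where x: "x \<in> S" "v \<in> supp x" using P by auto
    have "v < n" using supp[of x] x P I'I by auto
    then have dis: "D v \<inter> I' = {}" by (auto simp: I'_def)
    \<comment> \<open>The common vertex \<open>v\<close> saves one. The slack \<open>e\<close> is 0
      for a set with too few vertices and 1 for an arbitrary built set.\<close>
    have glue: "card (\<Union>(supp ` (D v \<union> T))) \<le> 2 * (card (D v) + card T) + 1 + e \<and> card (D v \<union> T) = card (D v) + card T"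
      if T: "T \<subseteq> I'" "finite T" "v \<in> \<Union>(supp ` T)" "card (\<Union>(supp ` T)) \<le> 2 * card T + 1 + e" for T e
    proof (cases "D v = {}")
      case False
      then have Dv: "v \<in> \<Union>(supp ` D v)" "card (\<Union>(supp ` D v)) \<le> 2 * card (D v) + 1"
        using D(1)[of v] by (auto simp: DD_def)
      have fU: "finite (\<Union>(supp ` D v))" "finite (\<Union>(supp ` T))" using DI[of v] T I'I fin by blast+
      have "card {v} \<le> card (\<Union>(supp ` D v) \<inter> \<Union>(supp ` T))" using Dv T fU by (intro card_mono) auto
      moreover have "card (\<Union>(supp ` D v) \<union> \<Union>(supp ` T)) + card (\<Union>(supp ` D v) \<inter> \<Union>(supp ` T))
          = card (\<Union>(supp ` D v)) + card (\<Union>(supp ` T))" by (rule card_Un_le_Int[OF fU])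
      moreover have "\<Union>(supp ` (D v \<union> T)) = \<Union>(supp ` D v) \<union> \<Union>(supp ` T)" by auto
      moreover have "card (D v \<union> T) = card (D v) + card T"
        using DI(2)[of v] T dis by (intro card_Un_disjoint) auto
      ultimately show ?thesis using Dv T by simp
    next
      case True
      then show ?thesis using T(4) by simp
    qed
    show False
    proof (cases "card (D v) + card S \<le> 7")
      case True
      have g: "card (\<Union>(supp ` (D v \<union> S))) \<le> 2 * (card (D v) + card S) + 1 + 0 \<and> card (D v \<union> S) = card (D v) + card S"
        by (rule glue) (use P S1 in auto)
      have "D v \<union> S \<in> DD v" unfolding DD_def using g True DI(1)[of v] P I'I by auto
      then show False using D(2)[of "D v \<union> S" v] g P by linarith
    next
      case False
      then have j: "1 \<le> 8 - card (D v)" "8 - card (D v) \<le> card S" using DI(3)[of v] by auto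
      then obtain S' where S': "S' \<subseteq> S" "builtv supp I' v S'" "card S' = 8 - card (D v)" using P by blast
      note P' = bp[OF S'(2)]
      have g: "card (\<Union>(supp ` (D v \<union> S'))) \<le> 2 * (card (D v) + card S') + 1 + 1 \<and> card (D v \<union> S') = card (D v) + card S'"
        by (rule glue) (use P' in auto)
      have "card (D v) + card S' = 8" using S'(3) DI(3)[of v] by simp
      then show False using g P8[of "D v \<union> S'"] DI(1)[of v] P' I'I by auto
    qed
  qed
  then show ?thesis using I'I cI by blast
qed

text \<open>The two vertices in which the new block attaches may lie in different earlier
  blocks.\<close>

inductive built :: "nat set set \<Rightarrow> nat set set \<Rightarrow> bool" for H where
  start: "x \<in> H \<Longrightarrow> built H {x}"
| step: "built H S \<Longrightarrow> y \<in> H \<Longrightarrow> y \<notin> S \<Longrightarrow> 2 \<le> card (y \<inter> \<Union>S) \<Longrightarrow> built H (insert y S)"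

lemma built_image:
  assumes "built (supp ` I) S" and ne: "\<And>x. x \<in> I \<Longrightarrow> supp x \<noteq> {}"
  shows "\<exists>v T. builtv supp I v T \<and> finite T \<and> supp ` T = S \<and> card T = card S"
  using assms(1)
proof induction
  case (start x)
  then obtain t where t: "t \<in> I" "x = supp t" by auto
  then obtain v where "v \<in> supp t" using ne by blast
  then have "builtv supp I v {t}" using t by (intro builtv.start)
  then show ?case using t by (intro exI[of _ v] exI[of _ "{t}"]) simp
next
  case (step S y)
  then obtain v T where T: "builtv supp I v T" "finite T" "supp ` T = S" "card T = card S" by blast
  obtain t where t: "t \<in> I" "y = supp t" using step(2) by auto
  have tT: "t \<notin> T" using T(3) t step(3) by auto
  have "builtv supp I v (insert t T)" using T t tT step(4) by (intro builtv.step) auto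
  moreover have "finite S" using T by auto
  then have "card (insert t T) = card (insert y S)" using T tT step(3) by simp
  ultimately show ?case using T t by (intro exI[of _ v] exI[of _ "insert t T"]) simp
qed

locale sparse_system =
  fixes H :: "nat set set" and n :: nat
  assumes H: "\<And>x. x \<in> H \<Longrightarrow> x \<subseteq> {..<n} \<and> card x = 4"
    and exact: "\<And>S. built H S \<Longrightarrow> card (\<Union>S) = 2 * card S + 2"
    and no8: "\<And>Q. Q \<subseteq> H \<Longrightarrow> card Q = 8 \<Longrightarrow> 19 \<le> card (\<Union>Q)"
begin

lemma fH: "finite H" by (rule finite_subset[of _ "Pow {..<n}"]) (use H in auto)

lemma fx: "x \<in> H \<Longrightarrow> finite x" "x \<in> H \<Longrightarrow> card x = 4"
  using H[of x] by (auto intro: finite_subset)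

lemma built_sub:
  assumes "built H S" shows "S \<subseteq> H" "finite S" "S \<noteq> {}" "finite (\<Union>S)"
proof -
  have "S \<subseteq> H \<and> S \<noteq> {}" using assms by induction auto
  then show SH: "S \<subseteq> H" and "S \<noteq> {}" by auto
  show fS: "finite S" using SH fH by (rule finite_subset)
  show "finite (\<Union>S)" using fS SH fx(1) by (intro finite_Union) auto
qed

text \<open>Blocks are added one at a time, so a larger set would pass through eight blocks, which
  would span exactly 18 vertices.\<close>

lemma built_le7: "built H S \<Longrightarrow> card S \<le> 7"
proof (induction rule: built.induct)
  case (step S y)
  have b: "built H (insert y S)" using step by (intro built.step)
  have "card (insert y S) \<le> 8" using step built_sub(2)[OF step(1)] by simp
  moreover have "card (insert y S) \<noteq> 8"
    using no8[OF built_sub(1)[OF b]] exact[OF b] by auto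
  ultimately show ?case by linarith
qed simp

text \<open>The exact vertex count leaves room for precisely two new vertices.\<close>

lemma add_block:
  assumes "built H S" "y \<in> H" "y \<notin> S" "2 \<le> card (y \<inter> \<Union>S)"
  shows "built H (insert y S)" "card (y \<inter> \<Union>S) = 2" "card (insert y S) = card S + 1"
proof -
  show b: "built H (insert y S)" using assms by (rule built.step)
  show c: "card (insert y S) = card S + 1" using built_sub(2)[OF assms(1)] assms(3) by simp
  have "card (y \<union> \<Union>S) + card (y \<inter> \<Union>S) = card y + card (\<Union>S)"
    using fx(1)[OF assms(2)] built_sub(4)[OF assms(1)] by (rule card_Un_le_Int)
  moreover have "card (y \<union> \<Union>S) = 2 * card (insert y S) + 2" using exact[OF b] by simp
  ultimately show "card (y \<inter> \<Union>S) = 2" using exact[OF assms(1)] c fx(2)[OF assms(2)] by simp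
qed

lemma in_of_3: "built H S \<Longrightarrow> y \<in> H \<Longrightarrow> 3 \<le> card (y \<inter> \<Union>S) \<Longrightarrow> y \<in> S"
  using add_block(2)[of S y] by (cases "y \<in> S") auto

lemma inter_le2: "x \<in> H \<Longrightarrow> y \<in> H \<Longrightarrow> x \<noteq> y \<Longrightarrow> card (x \<inter> y) \<le> 2"
  using in_of_3[OF built.start, of x y] by (cases "card (x \<inter> y) \<le> 2") (auto simp: Int_commute)

section \<open>Heavy pairs, crossing pairs and clusters\<close>

definition star :: "nat set \<Rightarrow> nat set set" where "star e = {x \<in> H. e \<subseteq> x}"
definition heavy :: "nat set \<Rightarrow> bool" where "heavy e \<longleftrightarrow> card e = 2 \<and> 2 \<le> card (star e)"
text \<open>These pairs join two different blocks of the star outside \<open>e\<close>; those lying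
  in no block at all are the pairs that compensate for the multiplicity of \<open>e\<close>.\<close>

definition crossing :: "nat set \<Rightarrow> nat set set" where
  "crossing e = {f. f \<subseteq> \<Union>(star e) \<and> card f = 2 \<and> \<not> (\<exists>x\<in>star e. f \<subseteq> x)}"
definition strong :: "nat set \<Rightarrow> bool" where "strong f \<longleftrightarrow> (\<exists>x\<in>H. f \<subseteq> x)"
definition block_of :: "nat set \<Rightarrow> nat set" where "block_of f = (SOME x. x \<in> H \<and> f \<subseteq> x)"
definition strong_crossing :: "nat set \<Rightarrow> nat set set" where "strong_crossing e = {f \<in> crossing e. strong f}"
text \<open>For a crossing pair \<open>f\<close>, the two blocks of the star that it joins.\<close>

definition tree :: "nat set \<Rightarrow> nat set \<Rightarrow> nat set set" where "tree e f = {x \<in> star e. x \<inter> f \<noteq> {}}"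
definition hosts :: "nat set \<Rightarrow> nat set set" where "hosts f = {e. heavy e \<and> f \<in> crossing e}"
text \<open>An upper bound on the vertices is enough here: disjoint clusters with a common pair
  unite to a cluster whether or not the union is built, and one of eight blocks is
  impossible.\<close>

definition cluster :: "nat \<Rightarrow> nat set set \<Rightarrow> bool" where
  "cluster k A \<longleftrightarrow> A \<subseteq> H \<and> finite A \<and> card A = k \<and> card (\<Union>A) \<le> 2 * k + 2"

lemma star_sub: "star e \<subseteq> H" "finite (star e)" using fH by (auto simp: star_def)

lemma fin2: "card e = 2 \<Longrightarrow> finite e" by (rule card_ge_0_finite) simp

lemma star_built:
  assumes e: "card e = 2" and T: "T \<subseteq> star e" "T \<noteq> {}"
  shows "built H T"
proof -
  have "finite T" using T star_sub(2) by (auto intro: finite_subset)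
  then show ?thesis using T(2,1)
  proof (induction T rule: finite_ne_induct)
    case (singleton x)
    then show ?case by (auto simp: star_def intro: built.start)
  next
    case (insert x F)
    have b: "built H F" using insert by simp
    obtain y where "y \<in> F" using insert by auto
    then have "e \<subseteq> x \<inter> \<Union>F" using insert.prems by (auto simp: star_def)
    then have "2 \<le> card (x \<inter> \<Union>F)" using card_mono[of "x \<inter> \<Union>F" e] built_sub(4)[OF b] e by simp
    moreover have "x \<in> H" using insert.prems by (auto simp: star_def)
    ultimately show ?case using b insert.hyps by (intro built.step)
  qed
qed

lemma star_inter: "card e = 2 \<Longrightarrow> x \<in> star e \<Longrightarrow> y \<in> star e \<Longrightarrow> x \<noteq> y \<Longrightarrow> x \<inter> y = e"
  using inter_le2[of x y] fx[of x] by (intro card_seteq[symmetric]) (auto simp: star_def)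

text \<open>The two vertices of \<open>f\<close> are counted on both sides, which removes one of the
  two surplus terms \<open>+ 2\<close>.\<close>

lemma glue:
  assumes A: "cluster k A" and B: "cluster l B" and d: "A \<inter> B = {}" and f: "card f = 2" "f \<subseteq> \<Union>A" "f \<subseteq> \<Union>B"
  shows "cluster (k + l) (A \<union> B)"
proof -
  have fU: "finite (\<Union>A)" "finite (\<Union>B)" using A B fx unfolding cluster_def by blast+
  have "card (\<Union>A \<union> \<Union>B) + card (\<Union>A \<inter> \<Union>B) = card (\<Union>A) + card (\<Union>B)" by (rule card_Un_le_Int[OF fU])
  moreover have "card f \<le> card (\<Union>A \<inter> \<Union>B)" using f fU by (intro card_mono) auto
  moreover have "\<Union>(A \<union> B) = \<Union>A \<union> \<Union>B" by auto
  ultimately have "card (\<Union>(A \<union> B)) \<le> 2 * (k + l) + 2" using A B f unfolding cluster_def by simp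
  moreover have "card (A \<union> B) = k + l" using A B d unfolding cluster_def by (simp add: card_Un_disjoint)
  ultimately show ?thesis using A B unfolding cluster_def by simp
qed

lemma no_cl8: "\<not> cluster 8 A"
  using no8[of A] by (auto simp: cluster_def)

lemma cluster_built: "built H S \<Longrightarrow> cluster (card S) S"
  using built_sub[of S] exact[of S] by (simp add: cluster_def)

text \<open>Neither end of \<open>f\<close> lies in \<open>e\<close>, else a block of the star would
  contain \<open>f\<close>. Outside \<open>e\<close> the blocks of the star are disjoint, so each
  end determines its block.\<close>

lemma tree_E:
  assumes e: "card e = 2" and f: "f \<in> crossing e"
  obtains x y where "tree e f = {x, y}" "x \<noteq> y" "x \<in> star e" "y \<in> star e" "x \<inter> f \<noteq> {}" "y \<inter> f \<noteq> {}" "f \<inter> e = {}" "f \<subseteq> x \<union> y" "x \<inter> y = e"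
proof -
  obtain u v where uv: "f = {u, v}" "u \<noteq> v" using f by (auto simp: crossing_def card_2_iff)
  obtain x where x: "x \<in> star e" "u \<in> x" using f uv by (auto simp: crossing_def)
  obtain y where y: "y \<in> star e" "v \<in> y" using f uv by (auto simp: crossing_def)
  have no: "\<not> (u \<in> z \<and> v \<in> z)" if "z \<in> star e" for z using f that uv by (auto simp: crossing_def)
  have ne: "x \<noteq> y" using no[OF x(1)] x y by auto
  have ee: "e \<subseteq> z" if "z \<in> star e" for z using that by (auto simp: star_def)
  have fe: "u \<notin> e" "v \<notin> e" using ee[OF x(1)] ee[OF y(1)] no x y by blast+
  have "z = x" if "z \<in> star e" "u \<in> z" for z using star_inter[OF e that(1) x(1)] that x fe by blast
  moreover have "z = y" if "z \<in> star e" "v \<in> z" for z using star_inter[OF e that(1) y(1)] that y fe by blast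
  ultimately have "z \<in> {x, y}" if "z \<in> tree e f" for z using that unfolding tree_def uv by blast
  moreover have "x \<in> tree e f" "y \<in> tree e f" using x y unfolding tree_def uv by blast+
  ultimately have "tree e f = {x, y}" by blast
  then show thesis using that[of x y] ne x y uv fe star_inter[OF e x(1) y(1) ne] by auto
qed

lemma tree_props:
  assumes e: "card e = 2" and f: "f \<in> crossing e"
  shows "tree e f \<subseteq> star e" "card (tree e f) = 2" "built H (tree e f)" "f \<subseteq> \<Union>(tree e f)" "cluster 2 (tree e f)" "\<Inter>(tree e f) = e"
proof -
  obtain x y where xy: "tree e f = {x, y}" "x \<noteq> y" "x \<in> star e" "y \<in> star e" "x \<inter> f \<noteq> {}" "y \<inter> f \<noteq> {}" "f \<inter> e = {}" "f \<subseteq> x \<union> y" "x \<inter> y = e"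
    by (rule tree_E[OF e f])
  show s: "tree e f \<subseteq> star e" by (auto simp: tree_def)
  show c: "card (tree e f) = 2" using xy by simp
  show b: "built H (tree e f)" using xy by (intro star_built[OF e s]) auto
  show "f \<subseteq> \<Union>(tree e f)" "\<Inter>(tree e f) = e" using xy by auto
  show "cluster 2 (tree e f)" using cluster_built[OF b] c by simp
qed

text \<open>If one block meets the union in two vertices, it can be added to \<open>S\<close>. The
  other block then has \<open>e\<close> inside the new union, and a third vertex there would force
  it into \<open>S\<close>.\<close>

lemma two_blocks_outside:
  assumes S: "built H S" and e: "card e = 2" and x: "x \<in> star e" and y: "y \<in> star e" and xS: "x \<notin> S" and yS: "y \<notin> S" and ne: "x \<noteq> y"
  shows "card ((x \<union> y) \<inter> \<Union>S) \<le> 2"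
proof -
  have one: "card ((x \<union> y) \<inter> \<Union>S) \<le> 2" if x: "x \<in> star e" and y: "y \<in> star e" and xS: "x \<notin> S" and yS: "y \<notin> S" and ne: "x \<noteq> y"
    and c2: "2 \<le> card (x \<inter> \<Union>S)" for x y
  proof -
    have xH: "x \<in> H" "y \<in> H" "e \<subseteq> x" "e \<subseteq> y" using x y by (auto simp: star_def)
    note A = add_block[OF S xH(1) xS c2]
    have "(y - x) \<inter> \<Union>S = {}"
    proof (rule ccontr)
      assume "\<not> ?thesis"
      then obtain z where z: "z \<in> y" "z \<notin> x" "z \<in> \<Union>S" by auto
      have "z \<notin> e" using z xH by auto
      then have "card (insert z e) = 3" using e fin2[OF e] by simp
      moreover have "card (insert z e) \<le> card (y \<inter> \<Union>(insert x S))"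
        using z xH fx(1)[OF xH(2)] by (intro card_mono) auto
      ultimately have "y \<in> insert x S" using in_of_3[OF A(1) xH(2)] by simp
      then show False using yS ne by simp
    qed
    then have "(x \<union> y) \<inter> \<Union>S = x \<inter> \<Union>S" by auto
    then show ?thesis using A(2) by simp
  qed
  show ?thesis
  proof (cases "2 \<le> card (x \<inter> \<Union>S)")
    case True
    then show ?thesis using one x y xS yS ne by blast
  next
    case x2: False
    show ?thesis
    proof (cases "2 \<le> card (y \<inter> \<Union>S)")
      case True
      then have "card ((y \<union> x) \<inter> \<Union>S) \<le> 2" using one x y xS yS ne by blast
      then show ?thesis by (simp add: Un_commute)
    next
      case False
      have "(x \<union> y) \<inter> \<Union>S = (x \<inter> \<Union>S) \<union> (y \<inter> \<Union>S)" by auto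
      then have "card ((x \<union> y) \<inter> \<Union>S) \<le> card (x \<inter> \<Union>S) + card (y \<inter> \<Union>S)" using card_Un_le by metis
      then show ?thesis using x2 False by linarith
    qed
  qed
qed

lemma tree_outside:
  assumes S: "built H S" and e: "card e = 2" and f: "f \<in> crossing e" and d: "tree e f \<inter> S = {}"
  shows "card (\<Union>(tree e f) \<inter> \<Union>S) \<le> 2"
proof -
  obtain x y where xy: "tree e f = {x, y}" "x \<noteq> y" "x \<in> star e" "y \<in> star e" by (rule tree_E[OF e f])
  then show ?thesis using two_blocks_outside[OF S e xy(3,4) _ _ xy(2)] d by auto
qed

text \<open>If \<open>S\<close> contains one of the two blocks, its union contains \<open>e\<close>;
  the other block also has an end of \<open>f\<close> in it, hence three vertices, and so belongs to
  \<open>S\<close>.\<close>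

lemma tree_cases:
  assumes S: "built H S" and e: "card e = 2" and f: "f \<in> crossing e" "f \<subseteq> \<Union>S"
  shows "tree e f \<subseteq> S \<or> tree e f \<inter> S = {}"
proof -
  have key: "y \<in> S" if x: "x \<in> S" "x \<in> star e" and y: "y \<in> star e" "y \<inter> f \<noteq> {}" "f \<inter> e = {}" for x y
  proof -
    obtain z where z: "z \<in> y" "z \<in> f" "z \<notin> e" using y by auto
    have "e \<subseteq> \<Union>S" "e \<subseteq> y" "y \<in> H" using x y by (auto simp: star_def)
    then have "card (insert z e) \<le> card (y \<inter> \<Union>S)" using z f(2) fx(1) by (intro card_mono) auto
    then show ?thesis using in_of_3[OF S \<open>y \<in> H\<close>] z e fin2[OF e] by simp
  qed
  obtain x y where xy: "tree e f = {x, y}" "x \<noteq> y" "x \<in> star e" "y \<in> star e" "x \<inter> f \<noteq> {}" "y \<inter> f \<noteq> {}" "f \<inter> e = {}"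
    by (rule tree_E[OF e f(1)])
  show ?thesis using key[of x y] key[of y x] xy by auto
qed

lemma tree_meet:
  assumes S: "built H S" and e: "card e = 2" and f: "f \<in> crossing e" "f \<subseteq> \<Union>S" and d: "tree e f \<inter> S = {}"
  shows "\<Union>(tree e f) \<inter> \<Union>S = f"
proof -
  have "card (\<Union>(tree e f) \<inter> \<Union>S) \<le> card f" using tree_outside[OF S e f(1) d] f(1) by (simp add: crossing_def)
  moreover have "f \<subseteq> \<Union>(tree e f) \<inter> \<Union>S" using tree_props(4)[OF e f(1)] f(2) by auto
  moreover have "finite (\<Union>(tree e f) \<inter> \<Union>S)" using built_sub(4)[OF S] by auto
  ultimately show ?thesis by (metis card_seteq)
qed

lemma hosts_D: "e \<in> hosts f \<Longrightarrow> card e = 2 \<and> f \<in> crossing e \<and> heavy e"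
  by (auto simp: hosts_def heavy_def)

lemma star_heavy: "heavy e \<Longrightarrow> card e = 2 \<and> star e \<noteq> {} \<and> built H (star e)"
  using star_built[of e "star e"] unfolding heavy_def by force

text \<open>If they met, both blocks of the tree would lie in the star of \<open>e\<close> and
  intersect in \<open>e\<close>, whereas they intersect in \<open>e'\<close>.\<close>

lemma tree_star_disjoint:
  assumes e: "e \<in> hosts f" and e': "e' \<in> hosts f'" "e \<noteq> e'" and f': "f' \<subseteq> \<Union>S" and S: "S \<subseteq> star e" "S \<noteq> {}"
  shows "tree e' f' \<inter> S = {}"
proof (rule ccontr)
  assume c: "tree e' f' \<inter> S \<noteq> {}"
  have E: "card e = 2" "card e' = 2" "f' \<in> crossing e'" using hosts_D[OF e] hosts_D[OF e'(1)] by auto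
  have "tree e' f' \<subseteq> S" using tree_cases[OF star_built[OF E(1) S] E(2,3) f'] c by auto
  moreover obtain x y where xy: "tree e' f' = {x, y}" "x \<noteq> y" "x \<inter> y = e'" by (rule tree_E[OF E(2,3)])
  ultimately have "x \<in> star e" "y \<in> star e" using S by auto
  then show False using star_inter[OF E(1) _ _ xy(2)] xy(3) e'(2) by simp
qed

lemma tree_disjoint:
  assumes "e \<in> hosts f" "e' \<in> hosts f" "e \<noteq> e'"
  shows "tree e' f \<inter> tree e f = {}"
proof -
  have E: "card e = 2" "f \<in> crossing e" using hosts_D[OF assms(1)] by auto
  note P = tree_props[OF E]
  have "tree e f \<noteq> {}" using P(2) by auto
  then show ?thesis by (rule tree_star_disjoint[OF assms P(4,1)])
qed

lemma cluster_TTs: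
  assumes "finite E" "E \<noteq> {}" "E \<subseteq> hosts f" and f: "card f = 2"
  shows "cluster (2 * card E) (\<Union>e\<in>E. tree e f) \<and> f \<subseteq> \<Union>(\<Union>e\<in>E. tree e f)"
  using assms(1-3)
proof (induction E rule: finite_ne_induct)
  case (singleton e)
  then show ?case using tree_props[of e f] hosts_D[of e f] by simp
next
  case (insert e E)
  have E: "card e = 2" "f \<in> crossing e" "e \<in> hosts f" using hosts_D[of e f] insert by auto
  note P = tree_props[OF E(1,2)]
  have "tree e f \<inter> (\<Union>e\<in>E. tree e f) = {}" using tree_disjoint insert E by blast
  then have "cluster (2 + 2 * card E) (tree e f \<union> (\<Union>e\<in>E. tree e f))" using P insert f by (intro glue[where f = f]) auto
  then show ?case using insert P by auto
qed

lemma hosts_finite: "finite (hosts f)"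
proof (rule finite_subset)
  show "hosts f \<subseteq> Pow {..<n}"
  proof
    fix e assume "e \<in> hosts f"
    then have "heavy e" by (simp add: hosts_def)
    then have "star e \<noteq> {}" by (auto simp: heavy_def)
    then show "e \<in> Pow {..<n}" using H by (force simp: star_def)
  qed
qed simp

text \<open>Four hosts would give four disjoint trees of two blocks each, glued along
  \<open>f\<close> to a cluster of eight.\<close>

lemma hosts_le3:
  assumes f: "card f = 2" shows "card (hosts f) \<le> 3"
proof (rule ccontr)
  assume "\<not> ?thesis"
  then obtain E where E: "E \<subseteq> hosts f" "card E = 4" "finite E"
    using obtain_subset_with_card_n[of 4 "hosts f"] by auto
  then show False using cluster_TTs[of E f] no_cl8 f by fastforce
qed

lemma block_of: "strong f \<Longrightarrow> block_of f \<in> H \<and> f \<subseteq> block_of f"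
  unfolding block_of_def strong_def by (rule someI_ex) auto

lemma WkD: "f \<in> crossing e \<Longrightarrow> f \<subseteq> \<Union>(star e) \<and> card f = 2"
  by (auto simp: crossing_def)

lemma block_of_meet:
  assumes e: "heavy e" and f: "f \<in> strong_crossing e"
  shows "block_of f \<in> H" "f \<subseteq> block_of f" "block_of f \<notin> star e" "block_of f \<inter> \<Union>(star e) = f"
proof -
  have f': "f \<in> crossing e" "strong f" using f by (auto simp: strong_crossing_def)
  show b: "block_of f \<in> H" "f \<subseteq> block_of f" using block_of[OF f'(2)] by auto
  show n: "block_of f \<notin> star e" using f' b by (auto simp: crossing_def)
  have S: "built H (star e)" using star_heavy[OF e] by simp
  have sub: "f \<subseteq> block_of f \<inter> \<Union>(star e)" using b WkD[OF f'(1)] by auto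
  then have "2 \<le> card (block_of f \<inter> \<Union>(star e))"
    using card_mono[OF _ sub] fx(1)[OF b(1)] WkD[OF f'(1)] by simp
  then have "card (block_of f \<inter> \<Union>(star e)) = 2" by (rule add_block(2)[OF S b(1) n])
  then show "block_of f \<inter> \<Union>(star e) = f"
    using sub fx(1)[OF b(1)] WkD[OF f'(1)] by (metis card_seteq finite_Int order_refl)
qed

lemma block_of_inj: "heavy e \<Longrightarrow> f \<in> strong_crossing e \<Longrightarrow> f' \<in> strong_crossing e \<Longrightarrow> block_of f = block_of f' \<Longrightarrow> f = f'"
  using block_of_meet(4) by metis

text \<open>The block of a strong crossing pair \<open>f\<close> meets the star exactly in
  \<open>f\<close>, so different pairs have different blocks, and these can be attached one after
  another.\<close>

lemma strong_crossing_built: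
  assumes e: "heavy e" and F: "F \<subseteq> strong_crossing e" "finite F"
  shows "built H (star e \<union> block_of ` F) \<and> card (star e \<union> block_of ` F) = card (star e) + card F"
  using F(2,1)
proof (induction F rule: finite_induct)
  case empty
  then show ?case using star_heavy[OF e] by simp
next
  case (insert f F)
  let ?S = "star e \<union> block_of ` F"
  have b: "built H ?S" "card ?S = card (star e) + card F" using insert by auto
  have f: "f \<in> strong_crossing e" using insert by auto
  note M = block_of_meet[OF e f]
  have "block_of f \<notin> block_of ` F"
  proof
    assume "block_of f \<in> block_of ` F"
    then obtain g where "g \<in> F" "block_of f = block_of g" by auto
    then show False using block_of_inj[OF e f] insert by auto
  qed
  then have n: "block_of f \<notin> ?S" using M(3) by auto
  have "f \<subseteq> block_of f \<inter> \<Union>?S" using M(2,4) by auto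
  then have "2 \<le> card (block_of f \<inter> \<Union>?S)"
    using card_mono[of "block_of f \<inter> \<Union>?S" f] fx(1)[OF M(1)] f WkD[of f e] by (simp add: strong_crossing_def)
  note A = add_block[OF b(1) M(1) n this]
  have "star e \<union> block_of ` insert f F = insert (block_of f) ?S" by auto
  then show ?case using A b(2) insert by simp
qed

lemma strong_crossing_finite: "finite (strong_crossing e)"
proof (rule finite_subset)
  show "strong_crossing e \<subseteq> Pow (\<Union>(star e))" by (auto simp: strong_crossing_def crossing_def)
  have "finite (\<Union>(star e))" using star_sub[of e] fx(1) by (intro finite_Union) auto
  then show "finite (Pow (\<Union>(star e)))" by simp
qed

lemma strong_crossing_le: "heavy e \<Longrightarrow> card (star e) + card (strong_crossing e) \<le> 7"
  using strong_crossing_built[of e "strong_crossing e"] strong_crossing_finite[of e] built_le7 by fastforce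

text \<open>If the block of a strong crossing pair \<open>g\<close> were in the tree, then
  \<open>g\<close> would lie in \<open>f\<close>, so \<open>f\<close> would be strong.\<close>

lemma star_tree_disjoint:
  assumes e: "heavy e" and F: "F \<subseteq> strong_crossing e" and f: "f \<in> crossing e" "\<not> strong f" and e': "e' \<in> hosts f" "e' \<noteq> e"
  shows "tree e' f \<inter> (star e \<union> block_of ` F) = {}" "\<Union>(tree e' f) \<inter> \<Union>(star e) = f"
proof -
  have E': "card e' = 2" "f \<in> crossing e'" using hosts_D[OF e'(1)] by auto
  have eN: "e \<in> hosts f" using e f by (simp add: hosts_def)
  have S: "built H (star e)" "star e \<noteq> {}" using star_heavy[OF e] by auto
  have fS: "f \<subseteq> \<Union>(star e)" using WkD[OF f(1)] by simp
  have d: "tree e' f \<inter> star e = {}" by (rule tree_star_disjoint[OF eN e'(1) _ fS order_refl S(2)]) (use e' in simp)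
  show m: "\<Union>(tree e' f) \<inter> \<Union>(star e) = f" by (rule tree_meet[OF S(1) E' fS d])
  have "block_of g \<notin> tree e' f" if g: "g \<in> F" for g
  proof
    assume b: "block_of g \<in> tree e' f"
    have gS: "g \<in> strong_crossing e" using g F by auto
    have "g \<subseteq> block_of g" "g \<subseteq> \<Union>(star e)" using block_of_meet[OF e gS] by auto
    then have "g \<subseteq> f" using m b by auto
    moreover have "card g = card f" "finite f" using gS WkD[of g e] WkD[OF f(1)] fin2 by (auto simp: strong_crossing_def)
    ultimately have "g = f" by (metis card_subset_eq)
    then show False using gS f(2) by (simp add: strong_crossing_def)
  qed
  then show "tree e' f \<inter> (star e \<union> block_of ` F) = {}" using d by auto
qed

text \<open>A star of \<open>m\<close> blocks spans \<open>2 * m + 2\<close> vertices, and at most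
  \<open>1 + 5 * m\<close> of their pairs lie in a block, \<open>e\<close> being common to all. The
  difference is \<open>2 * m * (m - 1)\<close>.\<close>

lemma card_crossing:
  assumes e: "heavy e" shows "2 * card (star e) * (card (star e) - 1) \<le> card (crossing e)"
proof -
  let ?m = "card (star e)" and ?U = "\<Union>(star e)"
  have S: "built H (star e)" and e2: "card e = 2" using star_heavy[OF e] by auto
  have fU: "finite ?U" by (rule built_sub(4)[OF S])
  have cU: "card ?U = 2 * ?m + 2" by (rule exact[OF S])
  let ?P = "{f. f \<subseteq> ?U \<and> card f = 2}"
  let ?W = "{f. card f = 2 \<and> (\<exists>x\<in>star e. f \<subseteq> x)}"
  have cP: "card ?P = (2 * ?m + 2) choose 2" unfolding cU[symmetric] by (rule n_subsets[OF fU])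
  have six: "card {f. f \<subseteq> x \<and> card f = 2} = 6" if "x \<in> H" for x
    using n_subsets[OF fx(1)[OF that], of 2] fx(2)[OF that] by (simp add: eval_nat_numeral)
  have sub: "?W \<subseteq> insert e (\<Union>x\<in>star e. {f. f \<subseteq> x \<and> card f = 2} - {e})" by auto
  have fin5: "finite {f. f \<subseteq> x \<and> card f = 2}" if "x \<in> star e" for x
    by (rule finite_subset[of _ "Pow x"]) (use that fx star_sub in auto)
  then have fin4: "finite (\<Union>x\<in>star e. {f. f \<subseteq> x \<and> card f = 2} - {e})" using star_sub(2) by auto
  have "card ?W \<le> card (insert e (\<Union>x\<in>star e. {f. f \<subseteq> x \<and> card f = 2} - {e}))"
    using sub fin4 by (intro card_mono) auto
  also have "\<dots> \<le> 1 + card (\<Union>x\<in>star e. {f. f \<subseteq> x \<and> card f = 2} - {e})"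
    unfolding card_insert_if[OF fin4] by simp
  also have "card (\<Union>x\<in>star e. {f. f \<subseteq> x \<and> card f = 2} - {e}) \<le> (\<Sum>x\<in>star e. card ({f. f \<subseteq> x \<and> card f = 2} - {e}))"
    by (rule card_UN_le[OF star_sub(2)])
  also have "\<dots> = (\<Sum>x\<in>star e. 5)"
  proof (rule sum.cong[OF refl])
    fix x assume x: "x \<in> star e"
    then have "e \<in> {f. f \<subseteq> x \<and> card f = 2}" using e2 by (simp add: star_def)
    then show "card ({f. f \<subseteq> x \<and> card f = 2} - {e}) = 5" using six[of x] x by (simp add: star_def)
  qed
  finally have cW: "card ?W \<le> 1 + 5 * ?m" by simp
  have PW: "?P = crossing e \<union> ?W" by (auto simp: crossing_def)
  define Z where "Z = (2 * ?m + 2) * (2 * ?m + 1)"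
  have "card ?P \<le> card (crossing e) + card ?W" unfolding PW by (rule card_Un_le)
  also have "\<dots> \<le> card (crossing e) + (1 + 5 * ?m)" using cW by simp
  finally have "2 * card ?P \<le> 2 * (card (crossing e) + (1 + 5 * ?m))" by simp
  moreover have "2 * card ?P = Z"
    unfolding cP choose_two Z_def by simp
  ultimately have "Z \<le> 2 * (card (crossing e) + (1 + 5 * ?m))" by simp
  moreover have "2 \<le> ?m" using e by (simp add: heavy_def)
  then obtain k where "?m = k + 2" by (metis add.commute le_Suc_ex)
  ultimately show ?thesis by (simp add: algebra_simps Z_def)
qed

text \<open>The star, two blocks at strong crossing pairs and the trees of two further hosts would
  be eight blocks glued along \<open>f\<close>.\<close>

lemma hosts_le2:
  assumes e: "heavy e" "card (star e) = 2" and f: "f \<in> crossing e" "\<not> strong f" and s: "2 \<le> card (strong_crossing e)"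
  shows "card (hosts f) \<le> 2"
proof (rule ccontr)
  assume "\<not> ?thesis"
  moreover have eN: "e \<in> hosts f" using e f by (simp add: hosts_def)
  ultimately have "2 \<le> card (hosts f - {e})" by simp
  then obtain E where E: "E \<subseteq> hosts f - {e}" "card E = 2" "finite E"
    using obtain_subset_with_card_n by metis
  obtain F where F: "F \<subseteq> strong_crossing e" "card F = 2" "finite F" using obtain_subset_with_card_n[OF s] by metis
  let ?S = "star e \<union> block_of ` F"
  have "built H ?S" "card ?S = 4" using strong_crossing_built[OF e(1) F(1,3)] F e by auto
  then have "cluster 4 ?S" using cluster_built by metis
  moreover have c2: "card f = 2" "f \<subseteq> \<Union>(star e)" using WkD[OF f(1)] by auto
  moreover have "E \<noteq> {}" "E \<subseteq> hosts f" using E by auto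
  then have "cluster (2 * card E) (\<Union>e\<in>E. tree e f) \<and> f \<subseteq> \<Union>(\<Union>e\<in>E. tree e f)"
    using cluster_TTs[OF E(3)] c2 by simp
  moreover have "?S \<inter> (\<Union>e\<in>E. tree e f) = {}"
    using star_tree_disjoint(1)[OF e(1) F(1) f] E by blast
  ultimately have "cluster (4 + 2 * card E) (?S \<union> (\<Union>e\<in>E. tree e f))" by (intro glue[where f = f]) auto
  then show False using no_cl8 E by simp
qed

text \<open>Every heavy pair \<open>e\<close> needs a charge of \<open>card (star e) - 1\<close> from the pairs in \<open>crossing e\<close> that lie in no block, and
  each such pair, having at most three hosts, can give at least \<open>1 / 3\<close> to each.  This suffices unless too many crossing
  pairs are strong, which are the two cases below: in the first one, a crossing pair gives everything
  to \<open>e\<close>; in the second one, \<open>e\<close> has a special pair without hosts to itself.\<close>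

definition strong3 :: "nat set \<Rightarrow> bool" where "strong3 e \<longleftrightarrow> heavy e \<and> card (star e) = 2 \<and> card (strong_crossing e) = 3"
definition strong4 :: "nat set \<Rightarrow> bool" where "strong4 e \<longleftrightarrow> heavy e \<and> card (star e) = 2 \<and> 4 \<le> card (strong_crossing e)"

text \<open>The five blocks around \<open>e\<close> and the two of \<open>tree e' f\<close> make
  seven. Any further block sharing two vertices with the tree would be an eighth, so
  \<open>e'\<close> has neither a third block nor a strong crossing pair.\<close>

lemma strong3_partner:
  assumes e: "strong3 e" and f: "f \<in> crossing e" "\<not> strong f" and e': "e' \<in> hosts f" "e' \<noteq> e"
  shows "card (star e') = 2" "strong_crossing e' = {}"
proof -
  have h: "heavy e" "card (star e) = 2" "card (strong_crossing e) = 3" using e by (auto simp: strong3_def)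
  have E': "card e' = 2" "f \<in> crossing e'" "heavy e'" using hosts_D[OF e'(1)] by auto
  let ?S = "star e \<union> block_of ` strong_crossing e"
  have b: "built H ?S" "card ?S = 5" using strong_crossing_built[OF h(1) order_refl strong_crossing_finite] h by auto
  then have c5: "cluster 5 ?S" using cluster_built by metis
  have c2: "card f = 2" "f \<subseteq> \<Union>(star e)" using WkD[OF f(1)] by auto
  then have fS: "f \<subseteq> \<Union>?S" by auto
  note P = tree_props[OF E'(1,2)]
  have d: "tree e' f \<inter> ?S = {}" by (rule star_tree_disjoint(1)[OF h(1) order_refl f e'])
  have m: "\<Union>(tree e' f) \<inter> \<Union>?S = f" by (rule tree_meet[OF b(1) E'(1,2) fS d])
  have fe: "f \<inter> e' = {}" by (rule tree_E[OF E'(1,2)])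
  have nz: False if z: "z \<in> H" "z \<notin> tree e' f" "z \<notin> ?S" "2 \<le> card (z \<inter> \<Union>(tree e' f))" for z
  proof -
    have "built H (insert z (tree e' f))" "card (insert z (tree e' f)) = 3"
      using add_block(1,3)[OF P(3) z(1,2,4)] P(2) by auto
    then have "cluster 3 (insert z (tree e' f))" using cluster_built by metis
    moreover have "insert z (tree e' f) \<inter> ?S = {}" using d z by auto
    moreover have "f \<subseteq> \<Union>(insert z (tree e' f))" using P(4) by auto
    ultimately have "cluster (3 + 5) (insert z (tree e' f) \<union> ?S)" using c5 c2 fS by (intro glue[where f = f]) auto
    then show False using no_cl8 by simp
  qed
  have "star e' \<subseteq> tree e' f"
  proof (rule ccontr)
    assume "\<not> ?thesis"
    then obtain z where z: "z \<in> star e'" "z \<notin> tree e' f" by auto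
    obtain t where t: "t \<in> tree e' f" using P(2) by force
    have "e' \<subseteq> z \<inter> \<Union>(tree e' f)" using z t P(1) by (auto simp: star_def)
    moreover have zH: "z \<in> H" using z by (simp add: star_def)
    ultimately have "2 \<le> card (z \<inter> \<Union>(tree e' f))" using card_mono[of "z \<inter> \<Union>(tree e' f)" e'] fx(1)[OF zH] E' by simp
    moreover have "z \<notin> ?S"
    proof
      assume "z \<in> ?S"
      then have "e' \<subseteq> \<Union>?S" using z by (auto simp: star_def)
      moreover have "e' \<subseteq> \<Union>(tree e' f)" using t P(1) by (auto simp: star_def)
      ultimately have "e' \<subseteq> f" using m by blast
      then have "e' = {}" using fe by blast
      then show False using E'(1) by simp
    qed
    ultimately show False using nz zH z by blast
  qed
  then have steq: "star e' = tree e' f" using P(1) by auto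
  then show "card (star e') = 2" using P(2) by simp
  show "strong_crossing e' = {}"
  proof (rule ccontr)
    assume "strong_crossing e' \<noteq> {}"
    then obtain g where g: "g \<in> strong_crossing e'" by auto
    note M = block_of_meet[OF E'(3) g]
    have gW: "g \<in> crossing e'" "strong g" using g by (auto simp: strong_crossing_def)
    have cg: "card g = 2" using WkD[OF gW(1)] by simp
    have "g = block_of g \<inter> \<Union>(tree e' f)" using M(4) steq by simp
    then have "2 \<le> card (block_of g \<inter> \<Union>(tree e' f))" using cg by simp
    moreover have "block_of g \<notin> ?S"
    proof
      assume "block_of g \<in> ?S"
      then have "g \<subseteq> \<Union>?S" using M(2) by auto
      moreover have "g \<subseteq> \<Union>(tree e' f)" using M(4) steq by auto
      ultimately have "g \<subseteq> f" using m by blast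
      then have "g = f" using cg c2 fin2 by (metis card_subset_eq)
      then show False using gW f by simp
    qed
    ultimately show False using nz M(1,3) steq by blast
  qed
qed

text \<open>The cluster of eight consists of four blocks around \<open>e1\<close>, the star of
  \<open>e'\<close> glued on along \<open>f1\<close>, and the star of \<open>e2\<close> glued on
  along \<open>f2\<close>.\<close>

lemma strong3_unique:
  assumes e': "heavy e'" and f: "f1 \<in> crossing e'" "f2 \<in> crossing e'" "f1 \<noteq> f2" "\<not> strong f1" "\<not> strong f2"
    and e: "strong3 e1" "strong3 e2" "e1 \<noteq> e'" "e2 \<noteq> e'" "f1 \<in> crossing e1" "f2 \<in> crossing e2"
  shows False
proof -
  have N: "e' \<in> hosts f1" "e' \<in> hosts f2" using e' f by (auto simp: hosts_def)
  have h: "heavy e1" "card (star e1) = 2" "card (strong_crossing e1) = 3" "heavy e2" "card (star e2) = 2" using e by (auto simp: strong3_def)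
  have st2: "card (star e') = 2" using strong3_partner(1)[OF e(1,5) f(4) N(1)] e(3) by auto
  have E': "card e' = 2" using e' by (simp add: heavy_def)
  have T: "tree e' f1 = star e'" "tree e' f2 = star e'"
    using tree_props(1,2)[OF E' f(1)] tree_props(1,2)[OF E' f(2)] st2 star_sub(2)[of e'] by (metis card_subset_eq)+
  obtain F where F: "F \<subseteq> strong_crossing e1" "card F = 2" "finite F"
    using obtain_subset_with_card_n[of 2 "strong_crossing e1"] h by auto
  let ?S = "star e1 \<union> block_of ` F"
  have b: "built H ?S" "card ?S = 4" using strong_crossing_built[OF h(1) F(1,3)] F h by auto
  then have c4: "cluster 4 ?S" using cluster_built by metis
  have c: "card f1 = 2" "f1 \<subseteq> \<Union>(star e1)" "card f2 = 2" "f2 \<subseteq> \<Union>(star e2)" "f1 \<subseteq> \<Union>(star e')" "f2 \<subseteq> \<Union>(star e')"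
    using WkD[OF e(5)] WkD[OF e(6)] WkD[OF f(1)] WkD[OF f(2)] by auto
  have d1: "star e' \<inter> ?S = {}"
    using star_tree_disjoint(1)[OF h(1) F(1) e(5) f(4) N(1)] e(3) T by simp
  have d2: "star e' \<inter> star e2 = {}"
    using star_tree_disjoint(1)[OF h(4) empty_subsetI e(6) f(5) N(2)] e(4) T by simp
  have c12: "3 \<le> card (f1 \<union> f2)"
  proof (rule ccontr)
    assume "\<not> ?thesis"
    then have "card (f1 \<union> f2) \<le> card f1" using c by simp
    then have "f1 \<union> f2 = f1" using fin2[OF c(1)] fin2[OF c(3)] by (intro card_seteq[symmetric]) auto
    then show False using f(3) c fin2[OF c(1)] card_subset_eq[of f1 f2] by auto
  qed
  \<comment> \<open>Otherwise the star of \<open>e2\<close> can be built onto \<open>?S\<close>, and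
    the tree at \<open>e'\<close> meets that union in both \<open>f1\<close> and \<open>f2\<close>,
    hence in at least three vertices.\<close>
  have d3: "star e2 \<inter> ?S = {}"
  proof (rule ccontr)
    assume "\<not> ?thesis"
    then obtain x where x: "x \<in> star e2" "x \<in> ?S" by auto
    have E2: "card e2 = 2" using h by (simp add: heavy_def)
    have "built H (?S \<union> star e2)"
    proof -
      have "finite G \<Longrightarrow> G \<subseteq> star e2 \<Longrightarrow> built H (?S \<union> G)" for G
      proof (induction G rule: finite_induct)
        case (insert g G)
        show ?case
        proof (cases "g \<in> ?S \<union> G")
          case True
          then have "?S \<union> insert g G = ?S \<union> G" by auto
          then show ?thesis using insert by simp
        next
          case False
          have bG: "built H (?S \<union> G)" using insert by simp
          have gH: "g \<in> H" "e2 \<subseteq> g" using insert.prems by (auto simp: star_def)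
          have "e2 \<subseteq> g \<inter> \<Union>(?S \<union> G)" using gH x by (auto simp: star_def)
          then have "2 \<le> card (g \<inter> \<Union>(?S \<union> G))" using card_mono[of "g \<inter> \<Union>(?S \<union> G)" e2] fx(1)[OF gH(1)] E2 by simp
          then have "built H (insert g (?S \<union> G))" by (rule built.step[OF bG gH(1) False])
          then show ?thesis by simp
        qed
      qed (use b in simp)
      then show ?thesis using star_sub(2) by blast
    qed
    moreover have "tree e' f1 \<inter> (?S \<union> star e2) = {}" using T d1 d2 by auto
    ultimately have "card (\<Union>(tree e' f1) \<inter> \<Union>(?S \<union> star e2)) \<le> 2" by (rule tree_outside[OF _ E' f(1)])
    moreover have "card (f1 \<union> f2) \<le> card (\<Union>(tree e' f1) \<inter> \<Union>(?S \<union> star e2))"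
    proof (rule card_mono)
      have "built H (star e')" using star_heavy[OF e'] by simp
      then show "finite (\<Union>(tree e' f1) \<inter> \<Union>(?S \<union> star e2))" using T built_sub(4) by auto
      show "f1 \<union> f2 \<subseteq> \<Union>(tree e' f1) \<inter> \<Union>(?S \<union> star e2)" unfolding T using c by auto
    qed
    ultimately show False using c12 by linarith
  qed
  have cl2: "cluster 2 (star e')" "cluster 2 (star e2)"
    using cluster_built star_heavy[OF e'] star_heavy[OF h(4)] st2 h(5) by metis+
  have "cluster (4 + 2) (?S \<union> star e')" using d1 c by (intro glue[OF c4 cl2(1), of f1]) auto
  then have "cluster (4 + 2 + 2) ((?S \<union> star e') \<union> star e2)" using d2 d3 c by (intro glue[OF _ cl2(2), of _ _ f2]) auto
  then show False using no_cl8 by simp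
qed

end

context sparse_system
begin

lemma subset_of_card2: "card f = 2 \<Longrightarrow> 2 \<le> card (f \<inter> x) \<Longrightarrow> f \<subseteq> x"
  using card_seteq[of f "f \<inter> x"] fin2[of f] by auto

lemma two_sets: "card f = 2 \<Longrightarrow> card f' = 2 \<Longrightarrow> f \<noteq> f' \<Longrightarrow> card (f \<inter> f') < 2"
proof (rule ccontr)
  assume f: "card f = 2" "card f' = 2" "f \<noteq> f'" "\<not> card (f \<inter> f') < 2"
  have "f \<subseteq> f'" using subset_of_card2[OF f(1)] f(4) by simp
  then show False using f fin2[OF f(2)] card_subset_eq by metis
qed

lemma SWD: "f \<in> strong_crossing e \<Longrightarrow> f \<in> crossing e \<and> strong f \<and> card f = 2 \<and> f \<subseteq> \<Union>(star e)"
  using WkD[of f e] by (simp add: strong_crossing_def)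

lemma block_of_meet_built:
  assumes e: "heavy e" and f: "f \<in> strong_crossing e" and S: "built H S" "star e \<subseteq> S" "block_of f \<notin> S"
  shows "block_of f \<inter> \<Union>S = f"
proof -
  note M = block_of_meet[OF e f]
  have sub: "f \<subseteq> block_of f \<inter> \<Union>S" using M(2) SWD[OF f] S(2) by blast
  have fin: "finite (block_of f \<inter> \<Union>S)" using fx(1)[OF M(1)] by simp
  have "2 \<le> card (block_of f \<inter> \<Union>S)" using card_mono[OF fin sub] SWD[OF f] by simp
  then have "card (block_of f \<inter> \<Union>S) = 2" by (rule add_block(2)[OF S(1) M(1) S(3)])
  then show ?thesis using card_seteq[OF fin sub] SWD[OF f] by simp
qed

lemma block_of_inter_subset:
  assumes e: "heavy e" and f: "f \<in> strong_crossing e" "f' \<in> strong_crossing e" "f \<noteq> f'"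
  shows "block_of f \<inter> block_of f' \<subseteq> f'"
proof -
  have b: "built H (star e \<union> block_of ` {f})" using strong_crossing_built[OF e, of "{f}"] f by simp
  have "block_of f' \<noteq> block_of f" using block_of_inj[OF e f(1,2)] f(3) by metis
  then have "block_of f' \<notin> star e \<union> block_of ` {f}" using block_of_meet(3)[OF e f(2)] by simp
  then have "block_of f' \<inter> \<Union>(star e \<union> block_of ` {f}) = f'" by (intro block_of_meet_built[OF e f(2) b]) auto
  then show ?thesis by auto
qed

text \<open>The block of a crossing pair \<open>f\<close> meets the star only in \<open>f\<close>,
  which no block of the star contains, and the blocks of \<open>f\<close> and \<open>f'\<close>
  share at most \<open>f \<inter> f'\<close>. So two blocks with a common pair both belong to the
  star.\<close>

lemma pair_in_star:
  assumes e: "heavy e" and F: "F \<subseteq> strong_crossing e" and xy: "x \<in> star e \<union> block_of ` F" "y \<in> star e \<union> block_of ` F" "x \<noteq> y" "2 \<le> card (x \<inter> y)"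
  shows "x \<in> star e \<and> y \<in> star e"
proof -
  have one: False if f: "f \<in> F" and y: "y \<in> star e" "2 \<le> card (block_of f \<inter> y)" for f y
  proof -
    have fS: "f \<in> strong_crossing e" using f F by auto
    have "block_of f \<inter> y \<subseteq> f \<inter> y" using block_of_meet(4)[OF e fS] y(1) by blast
    then have "2 \<le> card (f \<inter> y)" using y(2) SWD[OF fS] fin2 card_mono[of "f \<inter> y" "block_of f \<inter> y"] by fastforce
    then have "f \<subseteq> y" using subset_of_card2 SWD[OF fS] by blast
    then show False using SWD[OF fS] y(1) unfolding crossing_def by blast
  qed
  have two: False if f: "f \<in> F" "f' \<in> F" "f \<noteq> f'" "2 \<le> card (block_of f \<inter> block_of f')" for f f'
  proof -
    have fS: "f \<in> strong_crossing e" "f' \<in> strong_crossing e" using f F by auto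
    have "block_of f \<inter> block_of f' \<subseteq> f \<inter> f'"
      using block_of_inter_subset[OF e fS f(3)] block_of_inter_subset[OF e fS(2,1)] f(3) by blast
    moreover have "finite (f \<inter> f')" using SWD[OF fS(1)] fin2 by auto
    ultimately have "card (block_of f \<inter> block_of f') \<le> card (f \<inter> f')" by (rule card_mono[rotated])
    then show False using two_sets[of f f'] f SWD[OF fS(1)] SWD[OF fS(2)] by simp
  qed
  show ?thesis
  proof (cases "x \<in> star e")
    case x: True
    show ?thesis
    proof (cases "y \<in> star e")
      case False
      then obtain f where "f \<in> F" "y = block_of f" using xy(2) by auto
      then show ?thesis using one[of f x] x xy(4) by (simp add: Int_commute)
    qed (use x in simp)
  next
    case False
    then obtain f where f: "f \<in> F" "x = block_of f" using xy(1) by auto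
    show ?thesis
    proof (cases "y \<in> star e")
      case True
      then show ?thesis using one[of f y] f xy(4) by simp
    next
      case False
      then obtain f' where f': "f' \<in> F" "y = block_of f'" using xy(2) by auto
      then show ?thesis using two[of f f'] f xy(3,4) by auto
    qed
  qed
qed

text \<open>Four strong crossing pairs can use up all crossing pairs of a star of two blocks, so the
  charge must come from elsewhere: from a pair joining a vertex of \<open>block_of f0\<close>
  outside the star to one of the star.\<close>

definition special :: "nat set \<Rightarrow> nat set set \<Rightarrow> nat set \<Rightarrow> nat set \<Rightarrow> bool" where
  "special e F f0 s \<longleftrightarrow> F \<subseteq> strong_crossing e \<and> card F = 4 \<and> f0 \<in> F \<and> card s = 2 \<and> \<not> strong s \<and>
     s \<subseteq> \<Union>(star e) \<union> block_of f0 \<and> \<not> s \<subseteq> \<Union>(star e)"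

lemma D4D: "strong4 e \<Longrightarrow> heavy e \<and> card e = 2 \<and> card (star e) = 2 \<and> 4 \<le> card (strong_crossing e)"
  by (simp add: strong4_def heavy_def)

lemma strong4_built:
  assumes "strong4 e" "F \<subseteq> strong_crossing e" "card F = k" "0 < k"
  shows "built H (star e \<union> block_of ` F)" "card (star e \<union> block_of ` F) = 2 + k"
proof -
  have "finite F" using assms(3,4) card_ge_0_finite by blast
  then show "built H (star e \<union> block_of ` F)" "card (star e \<union> block_of ` F) = 2 + k"
    using strong_crossing_built[of e F] D4D[OF assms(1)] assms(2,3) by auto
qed

text \<open>Join one vertex \<open>p\<close> of the block of \<open>f0\<close> to two vertices
  \<open>b1\<close>, \<open>b2\<close> of the star outside \<open>f0\<close>. If both pairs were
  strong, their blocks would be the seventh and the eighth.\<close>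

lemma strong4_special:
  assumes D: "strong4 e" shows "\<exists>s F f0. special e F f0 s"
proof -
  note d = D4D[OF D]
  have e: "heavy e" using d by simp
  obtain F where F: "F \<subseteq> strong_crossing e" "card F = 4" using obtain_subset_with_card_n[of 4 "strong_crossing e"] d by blast
  then obtain f0 where f0: "f0 \<in> F" by force
  have f0S: "f0 \<in> strong_crossing e" using f0 F by auto
  let ?S = "star e \<union> block_of ` F" and ?g = "block_of f0"
  have b: "built H ?S" "card ?S = 6" using strong4_built[OF D F] by auto
  note M = block_of_meet[OF e f0S]
  note f0D = SWD[OF f0S]
  have "card ?g = 4" "finite ?g" using fx[OF M(1)] by auto
  then have "\<not> ?g \<subseteq> f0" using f0D card_mono[of f0 ?g] fin2[of f0] by auto
  then obtain p where p: "p \<in> ?g" "p \<notin> f0" by auto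
  have pU: "p \<notin> \<Union>(star e)" using M(4) p by blast
  have fU: "finite (\<Union>(star e))" "card (\<Union>(star e)) = 6" using built_sub(4) exact[of "star e"] star_heavy[OF e] d by auto
  have "card (\<Union>(star e) - f0) = 4" using fU f0D fin2[of f0] by (simp add: card_Diff_subset)
  then obtain B where B: "B \<subseteq> \<Union>(star e) - f0" "card B = 2"
    using obtain_subset_with_card_n[of 2 "\<Union>(star e) - f0"] by (metis le_add1 numeral_Bit0 numeral_Bit1 add_2_eq_Suc' one_add_one)
  then obtain b1 b2 where "B = {b1, b2}" and b12: "b1 \<noteq> b2" by (auto simp: card_2_iff)
  then have bb: "b1 \<in> \<Union>(star e) - f0" "b2 \<in> \<Union>(star e) - f0" "b1 \<noteq> b2" using B(1) by blast+
  have only: "x = ?g" if x: "x \<in> ?S" "p \<in> x" for x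
  proof -
    have "x \<notin> star e" using x pU by auto
    then obtain f where f: "f \<in> F" "x = block_of f" using x by auto
    show ?thesis
    proof (rule ccontr)
      assume "x \<noteq> ?g"
      then have ne: "f0 \<noteq> f" using f by auto
      have "p \<in> f" using block_of_inter_subset[OF e f0S _ ne] f F p x by blast
      then show False using SWD[of f e] f F pU by blast
    qed
  qed
  have notS: "h \<notin> ?S" if h: "p \<in> h" "b \<in> h" "b \<in> \<Union>(star e) - f0" for h b
  proof
    assume "h \<in> ?S"
    then have "h = ?g" using only h by simp
    then show False using M(4) h by blast
  qed
  have pS: "p \<in> \<Union>?S" using p f0 by auto
  have "\<not> strong {p, b1} \<or> \<not> strong {p, b2}"
  proof (rule ccontr)
    assume "\<not> ?thesis"
    then obtain h1 h2 where h: "h1 \<in> H" "p \<in> h1" "b1 \<in> h1" "h2 \<in> H" "p \<in> h2" "b2 \<in> h2"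
      by (auto simp: strong_def)
    have pb: "p \<noteq> b1" "p \<noteq> b2" using pU bb by auto
    have n: "h1 \<notin> ?S" "h2 \<notin> ?S" using notS h bb by blast+
    have "card {p, b1} \<le> card (h1 \<inter> \<Union>?S)" using h bb pS fx(1) by (intro card_mono) auto
    then have "2 \<le> card (h1 \<inter> \<Union>?S)" using pb by simp
    note A = add_block(1,3)[OF b(1) h(1) n(1) this]
    have ne: "h1 \<noteq> h2"
    proof
      assume "h1 = h2"
      then have "card {p, b1, b2} \<le> card (h1 \<inter> \<Union>?S)" using h bb pS fx(1) by (intro card_mono) auto
      then have "h1 \<in> ?S" using pb bb(3) by (intro in_of_3[OF b(1) h(1)]) simp
      then show False using n by simp
    qed
    have "card {p, b2} \<le> card (h2 \<inter> \<Union>(insert h1 ?S))" using h bb pS fx(1) by (intro card_mono) auto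
    then have "2 \<le> card (h2 \<inter> \<Union>(insert h1 ?S))" using pb by simp
    moreover have "h2 \<notin> insert h1 ?S" using n ne by simp
    ultimately have "built H (insert h2 (insert h1 ?S))" "card (insert h2 (insert h1 ?S)) = 8"
      using add_block(1,3)[OF A(1) h(4)] A(2) b(2) by auto
    then show False using built_le7 by fastforce
  qed
  then obtain b where b': "b \<in> \<Union>(star e) - f0" "\<not> strong {p, b}" using bb by blast
  have "p \<noteq> b" using b'(1) pU by auto
  then have "special e F f0 {p, b}" unfolding special_def
    using F f0 b' p pU by auto
  then show ?thesis by blast
qed

definition special_pair :: "nat set \<Rightarrow> nat set" where "special_pair e = (SOME s. \<exists>F f0. special e F f0 s)"

lemma special_pair: "strong4 e \<Longrightarrow> \<exists>F f0. special e F f0 (special_pair e)"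
  unfolding special_pair_def by (rule someI_ex[OF strong4_special])

text \<open>The tree of a host is either disjoint from the six blocks, and gluing gives eight, or
  among them. Then \<open>pair_in_star\<close> puts it into the star of \<open>e\<close>, whose
  union does not contain the special pair.\<close>

lemma hosts_special_pair:
  assumes D: "strong4 e" shows "hosts (special_pair e) = {}"
proof (rule ccontr)
  obtain F f0 where s: "special e F f0 (special_pair e)" using special_pair[OF D] by blast
  assume "hosts (special_pair e) \<noteq> {}"
  then obtain e' where e': "e' \<in> hosts (special_pair e)" by auto
  note N = hosts_D[OF e']
  note d = D4D[OF D]
  let ?S = "star e \<union> block_of ` F" and ?T = "tree e' (special_pair e)"
  have F: "F \<subseteq> strong_crossing e" "card F = 4" using s by (auto simp: special_def)
  have b: "built H ?S" "card ?S = 6" using strong4_built[OF D F] by auto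
  then have c6: "cluster 6 ?S" using cluster_built by metis
  have ss: "special_pair e \<subseteq> \<Union>?S" "card (special_pair e) = 2" "\<not> special_pair e \<subseteq> \<Union>(star e)" using s by (auto simp: special_def)
  note P = tree_props[of e' "special_pair e"]
  consider "?T \<subseteq> ?S" | "?T \<inter> ?S = {}" using tree_cases[OF b(1) _ _ ss(1)] N by blast
  then show False
  proof cases
    case 1
    obtain x y where xy: "?T = {x, y}" "x \<noteq> y" "special_pair e \<subseteq> x \<union> y" "x \<inter> y = e'" using tree_E[of e' "special_pair e"] N by metis
    have "x \<in> star e \<and> y \<in> star e" by (rule pair_in_star[of _ F]) (use d F xy 1 N in auto)
    then show False using xy ss by blast
  next
    case 2
    have "cluster (2 + 6) (?T \<union> ?S)" using P N 2 c6 ss by (intro glue[of _ _ _ _ "special_pair e"]) auto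
    then show False using no_cl8 by simp
  qed
qed

text \<open>The cases are how many of the two blocks at \<open>e'\<close> belong to the six blocks
  of \<open>e\<close>. Both: they share only \<open>e\<close>, so \<open>e = e'\<close>. One: the
  other is a seventh block, and the block of any \<open>f\<close> in \<open>F'\<close> would be an
  eighth. None: gluing the star of \<open>e'\<close> to the six blocks gives eight.\<close>

lemma strong4_disjoint:
  assumes D: "strong4 e" "strong4 e'" "e \<noteq> e'" and F: "F \<subseteq> strong_crossing e" "card F = 4" "F' \<subseteq> strong_crossing e'" "card F' = 4"
  shows "(star e \<union> block_of ` F) \<inter> (star e' \<union> block_of ` F') = {}"
proof (rule ccontr)
  let ?S = "star e \<union> block_of ` F"
  assume ne: "?S \<inter> (star e' \<union> block_of ` F') \<noteq> {}"
  note d = D4D[OF D(1)] and d' = D4D[OF D(2)]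
  have h': "heavy e'" using d' by simp
  have b: "built H ?S" "card ?S = 6" using strong4_built[OF D(1) F(1,2)] by auto
  obtain x y where xy: "star e' = {x, y}" "x \<noteq> y" using d' by (auto simp: card_2_iff)
  have xy': "x \<in> star e'" "y \<in> star e'" using xy by auto
  have xye: "x \<inter> y = e'" using star_inter[OF _ xy' xy(2)] d' by simp
  have split: False if x: "x \<in> ?S" "y \<notin> ?S" "x \<in> star e'" "y \<in> star e'" "star e' = {x, y}" for x y
  proof -
    have ee: "e' \<subseteq> x" "e' \<subseteq> y" "y \<in> H" using x by (auto simp: star_def)
    have sub: "e' \<subseteq> y \<inter> \<Union>?S" using ee x(1) by blast
    have fin: "finite (y \<inter> \<Union>?S)" using fx(1)[OF ee(3)] by simp
    have c2: "2 \<le> card (y \<inter> \<Union>?S)" using card_mono[OF fin sub] d' by simp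
    note A = add_block[OF b(1) ee(3) x(2) c2]
    have ye: "y \<inter> \<Union>?S = e'" using card_seteq[OF fin sub] A(2) d' by simp
    have "F' \<noteq> {}" using F by auto
    then obtain f where f: "f \<in> F'" by auto
    have fS: "f \<in> strong_crossing e'" using f F by auto
    note M = block_of_meet[OF h' fS]
    note fD = SWD[OF fS]
    have "\<Union>(star e') \<subseteq> \<Union>(insert y ?S)" using x by auto
    then have "f \<subseteq> block_of f \<inter> \<Union>(insert y ?S)" using M(2) fD by blast
    then have "card f \<le> card (block_of f \<inter> \<Union>(insert y ?S))" using fx(1)[OF M(1)] by (intro card_mono) auto
    then have c: "2 \<le> card (block_of f \<inter> \<Union>(insert y ?S))" using fD by simp
    have "block_of f \<in> insert y ?S"
    proof (rule ccontr)
      assume n: "block_of f \<notin> insert y ?S"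
      show False using add_block(1,3)[OF A(1) M(1) n c] built_le7 A(3) b(2) by fastforce
    qed
    then have "block_of f \<in> ?S" using M(3) x(4) by auto
    then have "f \<subseteq> \<Union>?S" using M(2) by blast
    moreover have "f \<subseteq> x \<union> y" using fD x(5) by simp
    moreover have "\<not> f \<subseteq> x" using fD x(3) unfolding crossing_def by blast
    then obtain v where v: "v \<in> f" "v \<notin> x" by auto
    ultimately have "v \<in> y \<inter> \<Union>?S" by blast
    then show False using ye ee(1) v(2) by blast
  qed
  consider "x \<in> ?S \<and> y \<in> ?S" | "x \<in> ?S \<and> y \<notin> ?S" | "y \<in> ?S \<and> x \<notin> ?S" | "x \<notin> ?S \<and> y \<notin> ?S" by blast
  then show False
  proof cases
    case 1
    have "x \<in> star e \<and> y \<in> star e" by (rule pair_in_star[of _ F]) (use d d' F 1 xy xye in auto)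
    then have "x \<inter> y = e" using star_inter[of e x y] d xy(2) by simp
    then show False using xye D(3) by simp
  next
    case 2
    then show False using split[of x y] xy xy' by blast
  next
    case 3
    then show False using split[of y x] xy xy' by blast
  next
    case 4
    then have dis: "star e' \<inter> ?S = {}" using xy by simp
    then obtain f where f: "f \<in> F'" "block_of f \<in> ?S" using ne by blast
    have fS: "f \<in> strong_crossing e'" using f F by auto
    have "cluster 6 ?S" "cluster 2 (star e')" using cluster_built b star_heavy[OF h'] d' by metis+
    moreover have "f \<subseteq> \<Union>?S" using block_of_meet(2)[OF h' fS] f(2) by blast
    ultimately have "cluster (2 + 6) (star e' \<union> ?S)" using SWD[OF fS] dis by (intro glue[of _ _ _ _ f]) auto
    then show False using no_cl8 by simp
  qed
qed

lemma special_cluster: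
  assumes D: "strong4 e" and s: "special e F f0 s"
  obtains G where "G \<subseteq> star e \<union> block_of ` F" "cluster 4 G" "s \<subseteq> \<Union>G"
proof -
  have F: "F \<subseteq> strong_crossing e" "card F = 4" "f0 \<in> F" using s by (auto simp: special_def)
  have "finite F" using F by (auto intro: card_ge_0_finite)
  then have "card (F - {f0}) = 3" using F by simp
  then have "F - {f0} \<noteq> {}" by force
  \<comment> \<open>Any further pair serves: it brings the cluster to four blocks, so that two of
    them make eight.\<close>
  then obtain f1 where f1: "f1 \<in> F" "f1 \<noteq> f0" by auto
  let ?G = "star e \<union> block_of ` {f0, f1}"
  have "built H ?G" "card ?G = 2 + 2" using strong4_built[OF D, of "{f0, f1}" 2] F f1 by auto
  then have "cluster 4 ?G" using cluster_built[of ?G] by simp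
  moreover have "?G \<subseteq> star e \<union> block_of ` F" using F f1 by auto
  moreover have "s \<subseteq> \<Union>?G" using s by (auto simp: special_def)
  ultimately show thesis using that by blast
qed

lemma special_pair_inj:
  assumes D: "strong4 e" "strong4 e'" "special_pair e = special_pair e'" shows "e = e'"
proof (rule ccontr)
  assume ne: "e \<noteq> e'"
  obtain F f0 where s: "special e F f0 (special_pair e)" using special_pair[OF D(1)] by blast
  obtain F' f0' where s': "special e' F' f0' (special_pair e)" using special_pair[OF D(2)] D(3) by auto
  obtain G where G: "G \<subseteq> star e \<union> block_of ` F" "cluster 4 G" "special_pair e \<subseteq> \<Union>G" by (rule special_cluster[OF D(1) s])
  obtain G' where G': "G' \<subseteq> star e' \<union> block_of ` F'" "cluster 4 G'" "special_pair e \<subseteq> \<Union>G'" by (rule special_cluster[OF D(2) s'])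
  have "(star e \<union> block_of ` F) \<inter> (star e' \<union> block_of ` F') = {}"
    using strong4_disjoint[OF D(1,2) ne] s s' unfolding special_def by simp
  then have "G \<inter> G' = {}" using Int_mono[OF G(1) G'(1)] by simp
  then have "cluster (4 + 4) (G \<union> G')" using G G' s by (intro glue[of _ _ _ _ "special_pair e"]) (auto simp: special_def)
  then show False using no_cl8 by simp
qed

definition free_pairs :: "nat set set" where "free_pairs = {f. f \<subseteq> {..<n} \<and> card f = 2 \<and> \<not> strong f}"
definition heavy_pairs :: "nat set set" where "heavy_pairs = {e. heavy e}"

text \<open>A pair with a \<open>strong3\<close> host gives nothing to its other hosts. These can
  afford it: they have no strong crossing pairs by \<open>strong3_partner\<close>, and by
  \<open>strong3_unique\<close> each loses at most one of its four crossing pairs in this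
  way.\<close>

definition weight :: "nat set \<Rightarrow> nat set \<Rightarrow> real" where
  "weight e f = (if strong4 e then of_bool (f = special_pair e) else if f \<notin> crossing e then 0 else if strong3 e then 1
     else if \<exists>e1\<in>hosts f. strong3 e1 then 0 else 1 / real (card (hosts f)))"

lemma weight_nonneg: "0 \<le> weight e f" by (simp add: weight_def)

lemma free_pairs_finite: "finite free_pairs"
  by (rule finite_subset[of _ "Pow {..<n}"]) (auto simp: free_pairs_def)

lemma star_Union: "\<Union>(star e) \<subseteq> {..<n}" using H by (auto simp: star_def)

lemma heavy_pairs_sub: "heavy_pairs \<subseteq> {f. f \<subseteq> {..<n} \<and> card f = 2}"
proof
  fix e assume "e \<in> heavy_pairs"
  then have e: "heavy e" by (simp add: heavy_pairs_def)
  then obtain x where "x \<in> star e" using star_heavy by blast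
  then show "e \<in> {f. f \<subseteq> {..<n} \<and> card f = 2}" using H[of x] e by (auto simp: heavy_def star_def)
qed

lemma heavy_pairs_finite: "finite heavy_pairs"
  by (rule finite_subset[OF heavy_pairs_sub]) simp

lemma strong3_donated:
  assumes "strong3 e1" "f \<in> crossing e1" "\<not> strong f" "e \<in> hosts f" "e \<noteq> e1"
  shows "card (star e) = 2 \<and> strong_crossing e = {} \<and> \<not> strong3 e"
  using strong3_partner[OF assms(1-4)] assms(5) by (auto simp: strong3_def)

text \<open>A special pair has no hosts and serves a single \<open>e\<close>; a pair with a
  \<open>strong3\<close> host serves only that one; every other pair divides at most 1 equally among
  its hosts.\<close>

lemma sum_weight_le:
  assumes f: "f \<in> free_pairs" shows "(\<Sum>e\<in>heavy_pairs. weight e f) \<le> 1"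
proof -
  have ns: "\<not> strong f" using f by (simp add: free_pairs_def)
  have single: ?thesis if "\<And>e. e \<in> heavy_pairs \<Longrightarrow> weight e f \<le> of_bool (e = e0)" for e0
  proof -
    have "(\<Sum>e\<in>heavy_pairs. weight e f) \<le> (\<Sum>e\<in>heavy_pairs. of_bool (e = e0))" by (rule sum_mono) (rule that)
    also have "\<dots> \<le> (1::real)" using heavy_pairs_finite by (simp add: of_bool_def)
    finally show ?thesis .
  qed
  consider (a) e0 where "strong4 e0" "f = special_pair e0" | (b) e1 where "\<And>e. strong4 e \<Longrightarrow> f \<noteq> special_pair e" "e1 \<in> hosts f" "strong3 e1"
    | (c) "\<And>e. strong4 e \<Longrightarrow> f \<noteq> special_pair e" "\<And>e. e \<in> hosts f \<Longrightarrow> \<not> strong3 e" by blast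
  then show ?thesis
  proof cases
    case a
    show ?thesis
    proof (rule single[of e0])
      fix e assume e: "e \<in> heavy_pairs"
      have "f \<notin> crossing e" using hosts_special_pair[OF a(1)] e a(2) by (auto simp: hosts_def heavy_pairs_def)
      moreover have "e = e0" if "strong4 e" "f = special_pair e" using special_pair_inj[OF that(1) a(1)] that a by simp
      ultimately show "weight e f \<le> of_bool (e = e0)" by (auto simp: weight_def)
    qed
  next
    case b
    show ?thesis
    proof (rule single[of e1])
      fix e assume e: "e \<in> heavy_pairs"
      have "e = e1" if "f \<in> crossing e" "strong3 e"
      proof (rule ccontr)
        assume ne: "e \<noteq> e1"
        have "e \<in> hosts f" using e that by (simp add: hosts_def heavy_pairs_def)
        then have "\<not> strong3 e" using strong3_donated[OF b(3) _ ns _ ne] hosts_D[OF b(2)] by simp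
        then show False using that(2) by simp
      qed
      then have "e = e1 \<or> f \<notin> crossing e \<or> \<not> strong3 e" by blast
      moreover have "\<exists>e1\<in>hosts f. strong3 e1" using b(2,3) by blast
      moreover have "\<not> strong4 e \<or> f \<noteq> special_pair e" using b(1) by blast
      ultimately show "weight e f \<le> of_bool (e = e1)" unfolding weight_def by (cases "strong4 e"; cases "f \<in> crossing e"; cases "strong3 e") simp_all
    qed
  next
    case c
    have "(\<Sum>e\<in>heavy_pairs. weight e f) \<le> (\<Sum>e\<in>heavy_pairs. of_bool (e \<in> hosts f) * (1 / real (card (hosts f))))"
    proof (rule sum_mono)
      fix e assume e: "e \<in> heavy_pairs"
      then have "f \<in> crossing e \<longleftrightarrow> e \<in> hosts f" by (simp add: hosts_def heavy_pairs_def)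
      then show "weight e f \<le> of_bool (e \<in> hosts f) * (1 / real (card (hosts f)))" using c by (auto simp: weight_def)
    qed
    also have "\<dots> = (\<Sum>e\<in>hosts f. 1 / real (card (hosts f)))"
      using heavy_pairs_finite by (intro sum.mono_neutral_cong_right) (auto simp: hosts_def heavy_pairs_def)
    also have "\<dots> \<le> 1" by simp
    finally show ?thesis .
  qed
qed

text \<open>A star of \<open>m \<ge> 3\<close> blocks has at least
  \<open>2 * m * (m - 1) - (7 - m)\<close> usable crossing pairs, each worth a third. For
  \<open>m = 2\<close> there are at least four crossing pairs. With no strong one, at least three
  thirds remain; with one, three thirds; with two, two halves by \<open>hosts_le2\<close>; with
  three, one whole; with four or more, the special pair.\<close>

lemma sum_weight_ge:
  assumes e: "e \<in> heavy_pairs" shows "real (card (star e)) - 1 \<le> (\<Sum>f\<in>free_pairs. weight e f)"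
proof -
  have he: "heavy e" using e by (simp add: heavy_pairs_def)
  have m2: "2 \<le> card (star e)" using he by (simp add: heavy_def)
  define NW where "NW = crossing e - strong_crossing e"
  have NWs: "NW \<subseteq> free_pairs" using WkD[of _ e] star_Union[of e] by (fastforce simp: NW_def free_pairs_def strong_crossing_def)
  have fNW: "finite NW" using NWs free_pairs_finite by (rule finite_subset)
  have fW: "finite (crossing e)" using fNW strong_crossing_finite[of e] by (simp add: NW_def)
  have SWs: "strong_crossing e \<subseteq> crossing e" by (auto simp: strong_crossing_def)
  have cNW: "card NW = card (crossing e) - card (strong_crossing e)" unfolding NW_def by (rule card_Diff_subset[OF strong_crossing_finite SWs])
  have NWD: "f \<in> crossing e \<and> \<not> strong f \<and> card f = 2 \<and> e \<in> hosts f" if "f \<in> NW" for f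
    using that WkD[of f e] he by (auto simp: NW_def strong_crossing_def hosts_def)
  have low: "real k * x \<le> (\<Sum>f\<in>free_pairs. weight e f)" if X: "X \<subseteq> NW" "k \<le> card X" "0 \<le> x" "\<And>f. f \<in> X \<Longrightarrow> x \<le> weight e f" for X k x
  proof -
    have "real k * x \<le> (\<Sum>f\<in>X. x)" using X by (simp add: mult_right_mono)
    also have "\<dots> \<le> (\<Sum>f\<in>X. weight e f)" using X by (intro sum_mono) auto
    also have "\<dots> \<le> (\<Sum>f\<in>free_pairs. weight e f)" using X NWs free_pairs_finite weight_nonneg by (intro sum_mono2) auto
    finally show ?thesis .
  qed
  have third: "1 / 3 \<le> 1 / real (card (hosts f))" if "f \<in> NW" for f
  proof -
    have "card (hosts f) \<le> 3" using hosts_le3 NWD[OF that] by blast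
    moreover have "0 < card (hosts f)" using NWD[OF that] hosts_finite[of f] by (auto simp: card_gt_0_iff)
    ultimately show ?thesis by (intro divide_left_mono) auto
  qed
  show ?thesis
  proof (cases "strong4 e")
    case True
    obtain F f0 where s: "special e F f0 (special_pair e)" using special_pair[OF True] by blast
    have F: "F \<subseteq> strong_crossing e" "f0 \<in> F" using s by (auto simp: special_def)
    have "block_of f0 \<in> H" using block_of_meet(1)[OF he] F by blast
    then have "block_of f0 \<subseteq> {..<n}" using H by blast
    then have "\<Union>(star e) \<union> block_of f0 \<subseteq> {..<n}" using star_Union[of e] by simp
    then have "special_pair e \<in> free_pairs" using s order_trans unfolding special_def free_pairs_def by blast
    then have "weight e (special_pair e) \<le> (\<Sum>f\<in>free_pairs. weight e f)" using free_pairs_finite weight_nonneg by (intro member_le_sum) auto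
    then show ?thesis using True D4D[OF True] by (simp add: weight_def)
  next
    case n4: False
    show ?thesis
    proof (cases "strong3 e")
      case True
      then have t: "card (star e) = 2" "card (strong_crossing e) = 3" by (auto simp: strong3_def)
      have "real 1 * 1 \<le> (\<Sum>f\<in>free_pairs. weight e f)"
      proof (rule low[OF order_refl])
        show "1 \<le> card NW" using card_crossing[OF he] t cNW by simp
      qed (use n4 True NWD in \<open>auto simp: weight_def\<close>)
      then show ?thesis using t by simp
    next
      case n3: False
      have don: "card (star e) = 2 \<and> strong_crossing e = {}" if "f \<in> NW" "e1 \<in> hosts f" "strong3 e1" for f e1
      proof -
        have "e \<noteq> e1" using n3 that by auto
        then show ?thesis using strong3_donated[OF that(3), of f e] NWD[OF that(1)] hosts_D[OF that(2)] by blast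
      qed
      have full: "weight e f = 1 / real (card (hosts f))" if "f \<in> NW" "\<And>e1. e1 \<in> hosts f \<Longrightarrow> \<not> strong3 e1" for f
        using that n3 n4 NWD[OF that(1)] by (auto simp: weight_def)
      consider (a) "3 \<le> card (star e)" | (b) "card (star e) = 2" "strong_crossing e = {}" | (c) "card (star e) = 2" "card (strong_crossing e) = 1"
        | (d) "card (star e) = 2" "card (strong_crossing e) = 2"
      proof -
        have "card (strong_crossing e) = 0 \<or> card (strong_crossing e) = 1 \<or> card (strong_crossing e) = 2" if "card (star e) = 2"
          using n3 n4 he that by (auto simp: strong3_def strong4_def)
        moreover have "strong_crossing e = {}" if "card (strong_crossing e) = 0" using that strong_crossing_finite[of e] by simp
        ultimately show thesis using that m2 by (metis antisym_conv1 le_antisym less_2_cases_iff not_less_eq_eq numeral_2_eq_2 numeral_3_eq_3)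
      qed
      then show ?thesis
      proof cases
        case a
        obtain k where k: "card (star e) = k + 3" using a by (metis add.commute le_Suc_ex)
        have "2 * (k + 3) * (k + 2) \<le> card (crossing e)" using card_crossing[OF he] k by simp
        moreover have "k + 3 + card (strong_crossing e) \<le> 7" using strong_crossing_le[OF he] k by simp
        ultimately have "3 * (k + 2) \<le> card NW" using cNW by (simp add: algebra_simps)
        then have "real (3 * (k + 2)) * (1 / 3) \<le> (\<Sum>f\<in>free_pairs. weight e f)"
        proof (rule low[OF order_refl])
          fix f assume f: "f \<in> NW"
          have "weight e f = 1 / real (card (hosts f))" by (rule full[OF f]) (use don[OF f] a in force)
          then show "1 / 3 \<le> weight e f" using third[OF f] by simp
        qed simp
        then show ?thesis using k by simp
      next
        case b
        define Q where "Q = {f \<in> NW. \<exists>e1\<in>hosts f. strong3 e1}"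
        have fQ: "finite Q" using fNW by (simp add: Q_def)
        have Q1: "card Q \<le> 1"
        proof (rule ccontr)
          assume "\<not> ?thesis"
          then obtain f1 f2 where q: "f1 \<in> Q" "f2 \<in> Q" "f1 \<noteq> f2"
            using fQ by (metis card_le_Suc0_iff_eq One_nat_def)
          obtain e1 where e1: "e1 \<in> hosts f1" "strong3 e1" using q by (auto simp: Q_def)
          obtain e2 where e2: "e2 \<in> hosts f2" "strong3 e2" using q by (auto simp: Q_def)
          have "f1 \<in> NW" "f2 \<in> NW" using q by (auto simp: Q_def)
          then show False using strong3_unique[OF he, of f1 f2 e1 e2] NWD q(3) e1 e2 n3 hosts_D[OF e1(1)] hosts_D[OF e2(1)] by blast
        qed
        have "4 \<le> card NW" using card_crossing[OF he] b cNW by simp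
        moreover have "card (NW - Q) = card NW - card Q" using fQ by (intro card_Diff_subset) (auto simp: Q_def)
        ultimately have c3: "3 \<le> card (NW - Q)" using Q1 by simp
        have "real 3 * (1 / 3) \<le> (\<Sum>f\<in>free_pairs. weight e f)"
        proof (rule low[OF _ c3])
          fix f assume f: "f \<in> NW - Q"
          then have "weight e f = 1 / real (card (hosts f))" by (intro full) (auto simp: Q_def)
          then show "1 / 3 \<le> weight e f" using third[of f] f by simp
        qed auto
        then show ?thesis using b by simp
      next
        case c
        have c3: "3 \<le> card NW" using card_crossing[OF he] c cNW by simp
        have "real 3 * (1 / 3) \<le> (\<Sum>f\<in>free_pairs. weight e f)"
        proof (rule low[OF order_refl c3])
          fix f assume f: "f \<in> NW"
          have "weight e f = 1 / real (card (hosts f))" by (rule full[OF f]) (use don[OF f] c in force)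
          then show "1 / 3 \<le> weight e f" using third[OF f] by simp
        qed simp
        then show ?thesis using c by simp
      next
        case d
        have c2: "2 \<le> card NW" using card_crossing[OF he] d cNW by simp
        have "real 2 * (1 / 2) \<le> (\<Sum>f\<in>free_pairs. weight e f)"
        proof (rule low[OF order_refl c2])
          fix f assume f: "f \<in> NW"
          have w: "weight e f = 1 / real (card (hosts f))" by (rule full[OF f]) (use don[OF f] d in force)
          have "card (hosts f) \<le> 2" using hosts_le2[OF he d(1), of f] NWD[OF f] d(2) by simp
          moreover have "0 < card (hosts f)" using NWD[OF f] hosts_finite[of f] by (auto simp: card_gt_0_iff)
          ultimately show "1 / 2 \<le> weight e f" unfolding w by (intro divide_left_mono) auto
        qed simp
        then show ?thesis using d by simp
      qed
    qed
  qed
qed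

lemma heavy_excess: "(\<Sum>e\<in>heavy_pairs. real (card (star e)) - 1) \<le> real (card free_pairs)"
proof -
  have "(\<Sum>e\<in>heavy_pairs. real (card (star e)) - 1) \<le> (\<Sum>e\<in>heavy_pairs. \<Sum>f\<in>free_pairs. weight e f)" by (rule sum_mono) (rule sum_weight_ge)
  also have "\<dots> = (\<Sum>f\<in>free_pairs. \<Sum>e\<in>heavy_pairs. weight e f)" by (rule sum.swap)
  also have "\<dots> \<le> (\<Sum>f\<in>free_pairs. 1)" by (rule sum_mono) (rule sum_weight_le)
  finally show ?thesis by simp
qed

text \<open>Incidences of pairs and blocks number \<open>6 * card H\<close>. They are the strong
  pairs, once each, plus the excess of the heavy ones, which by \<open>heavy_excess\<close> is at
  most the number of pairs in no block.\<close>

theorem card_le_sixth: "6 * card H \<le> n choose 2"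
proof -
  let ?P = "{f. f \<subseteq> {..<n} \<and> card f = 2}"
  have fP: "finite ?P" by simp
  have cP: "card ?P = n choose 2" using n_subsets[of "{..<n}" 2] by simp
  have "(\<Sum>x\<in>H. \<Sum>f\<in>?P. of_bool (f \<subseteq> x)) = (\<Sum>x\<in>H. 6 :: real)"
  proof (rule sum.cong[OF refl])
    fix x assume x: "x \<in> H"
    have "?P \<inter> {f. f \<subseteq> x} = {f. f \<subseteq> x \<and> card f = 2}" using H[OF x] by auto
    moreover have "card {f. f \<subseteq> x \<and> card f = 2} = 6"
      using n_subsets[OF fx(1)[OF x], of 2] fx(2)[OF x] by (simp add: eval_nat_numeral)
    ultimately show "(\<Sum>f\<in>?P. of_bool (f \<subseteq> x)) = (6::real)" using fP by (simp add: sum_of_bool_eq)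
  qed
  moreover have "(\<Sum>x\<in>H. \<Sum>f\<in>?P. of_bool (f \<subseteq> x)) = (\<Sum>f\<in>?P. \<Sum>x\<in>H. of_bool (f \<subseteq> x) :: real)" by (rule sum.swap)
  moreover have "(\<Sum>f\<in>?P. \<Sum>x\<in>H. of_bool (f \<subseteq> x)) = (\<Sum>f\<in>?P. of_bool (strong f) + of_bool (heavy f) * (real (card (star f)) - 1))"
  proof (rule sum.cong[OF refl])
    fix f assume f: "f \<in> ?P"
    have "(\<Sum>x\<in>H. of_bool (f \<subseteq> x)) = real (card (star f))" using fH by (simp add: sum_of_bool_eq star_def Int_def)
    moreover have "strong f \<longleftrightarrow> star f \<noteq> {}" by (auto simp: strong_def star_def)
    then have "strong f \<longleftrightarrow> 0 < card (star f)" using star_sub(2)[of f] by (simp add: card_gt_0_iff)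
    moreover have "heavy f \<longleftrightarrow> 2 \<le> card (star f)" using f by (simp add: heavy_def)
    ultimately show "(\<Sum>x\<in>H. of_bool (f \<subseteq> x)) = of_bool (strong f) + of_bool (heavy f) * (real (card (star f)) - 1)"
      by (cases "card (star f) = 0"; cases "card (star f) = 1") auto
  qed
  moreover have "\<dots> = (\<Sum>f\<in>?P. of_bool (strong f)) + (\<Sum>f\<in>?P. of_bool (heavy f) * (real (card (star f)) - 1))"
    by (rule sum.distrib)
  moreover have "(\<Sum>f\<in>?P. of_bool (heavy f) * (real (card (star f)) - 1)) = (\<Sum>f\<in>heavy_pairs. real (card (star f)) - 1)"
    using heavy_pairs_sub by (intro sum.mono_neutral_cong_right[OF fP]) (auto simp: heavy_pairs_def)
  moreover have "(\<Sum>f\<in>?P. of_bool (strong f)) + real (card free_pairs) = real (card ?P)"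
  proof -
    have "(\<Sum>f\<in>?P. of_bool (strong f)) = real (card (?P \<inter> {f. strong f}))" using fP by (simp add: sum_of_bool_eq)
    moreover have "card ?P = card (?P \<inter> {f. strong f}) + card (?P - {f. strong f})" by (rule card_Int_Diff[OF fP])
    moreover have "?P - {f. strong f} = free_pairs" by (auto simp: free_pairs_def)
    ultimately show ?thesis by simp
  qed
  ultimately have "real (6 * card H) \<le> real (n choose 2)" using heavy_excess cP by simp
  then show ?thesis by linarith
qed

end

section \<open>Colourings\<close>

lemma nsets2: "finite A \<Longrightarrow> finite (nsets A 2) \<and> card (nsets A 2) = card A choose 2"
proof -
  assume A: "finite A"
  then have "nsets A 2 = {N. N \<subseteq> A \<and> card N = 2}" by (auto simp: nsets_def intro: finite_subset)
  then show ?thesis using n_subsets[OF A, of 2] A by simp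
qed

text \<open>Colours correspond to representative edges, so the other edges, indexed by
  \<open>I\<close>, number \<open>n choose 2\<close> minus the colours. Eight of them with supports
  on 18 vertices would leave at most \<open>153 - 8 = 145\<close> colours there. The term
  \<open>42 * n\<close> is six times the \<open>7 * n\<close> items removed.\<close>

lemma GR_lower:
  assumes n: "18 \<le> n"
  shows "5 * (n choose 2) \<le> 6 * GR n 18 146 + 42 * n"
proof -
  have "146 \<le> (18::nat) choose 2" by (simp add: choose_two)
  then obtain c where c: "pq_colouring n 18 146 c" "card (c ` nsets {..<n} 2) = GR n 18 146"
    using GR_attained by blast
  let ?E = "nsets {..<n} 2"
  have E: "finite ?E" "card ?E = n choose 2" using nsets2[of "{..<n}"] by auto
  define rep where "rep e = (SOME e'. e' \<in> ?E \<and> c e' = c e)" for e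
  have rep: "rep e \<in> ?E \<and> c (rep e) = c e" if "e \<in> ?E" for e
    unfolding rep_def by (rule someI[of _ e]) (use that in simp)
  have repc: "rep e = rep e'" if "c e = c e'" for e e' unfolding rep_def that ..
  have rr: "rep (rep e) = rep e" if "e \<in> ?E" for e by (rule repc) (use rep[OF that] in simp)
  define I where "I = {e \<in> ?E. rep e \<noteq> e}"
  define supp where "supp e = e \<union> rep e" for e
  have IE: "I \<subseteq> ?E" by (auto simp: I_def)
  have fI: "finite I" using IE E(1) by (rule finite_subset)
  have "inj_on c (?E - I)"
  proof (rule inj_onI)
    fix e e' assume e: "e \<in> ?E - I" "e' \<in> ?E - I" "c e = c e'"
    then show "e = e'" using repc[OF e(3)] by (simp add: I_def)
  qed
  moreover have "c ` (?E - I) = c ` ?E"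
  proof
    show "c ` ?E \<subseteq> c ` (?E - I)"
    proof
      fix z assume "z \<in> c ` ?E"
      then obtain e where e: "e \<in> ?E" "z = c e" by auto
      have "rep e \<in> ?E - I" using rep[OF e(1)] rr[OF e(1)] by (simp add: I_def)
      moreover have "z = c (rep e)" using rep[OF e(1)] e(2) by simp
      ultimately show "z \<in> c ` (?E - I)" by blast
    qed
  qed auto
  ultimately have "card (?E - I) = GR n 18 146" using c(2) card_image by metis
  then have cE: "n choose 2 = card I + GR n 18 146"
    using card_Diff_subset[OF fI IE] card_mono[OF E(1) IE] E(2) by simp
  have sub: "e \<subseteq> {..<n} \<and> finite e \<and> card e = 2" if "e \<in> ?E" for e using that by (simp add: nsets_def)
  have supp: "supp x \<subseteq> {..<n} \<and> card (supp x) \<le> 4" if "x \<in> I" for x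
  proof -
    have x: "x \<in> ?E" using that IE by blast
    have "card (x \<union> rep x) \<le> card x + card (rep x)" by (rule card_Un_le)
    then show ?thesis unfolding supp_def using sub[OF x] sub[of "rep x"] rep[OF x] by simp
  qed
  have P8: "19 \<le> card (\<Union>(supp ` Q))" if Q: "Q \<subseteq> I" "card Q = 8" for Q
  proof (rule ccontr)
    assume "\<not> ?thesis"
    then have "card (\<Union>(supp ` Q)) \<le> 18" by simp
    moreover have "\<Union>(supp ` Q) \<subseteq> {..<n}" using supp Q(1) by blast
    ultimately obtain S where S: "\<Union>(supp ` Q) \<subseteq> S" "S \<subseteq> {..<n}" "card S = 18"
      using exists_subset_between[of "\<Union>(supp ` Q)" 18 "{..<n}"] n by auto
    have fS: "finite S" using S(3) by (intro card_ge_0_finite) simp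
    have "S \<in> nsets {..<n} 18" using S fS by (simp add: nsets_def)
    then have c146: "146 \<le> card (c ` nsets S 2)" using c(1) by (simp add: pq_colouring_def)
    have QS: "q \<in> nsets S 2 \<and> rep q \<in> nsets S 2 - Q" if q: "q \<in> Q" for q
    proof -
      have qE: "q \<in> ?E" using q Q IE by blast
      have "q \<union> rep q \<subseteq> S" using S(1) q by (auto simp: supp_def)
      moreover have "rep q \<notin> Q" using rr[OF qE] Q(1) by (auto simp: I_def)
      ultimately show ?thesis using sub[OF qE] sub[of "rep q"] rep[OF qE] by (simp add: nsets_def)
    qed
    have "c ` nsets S 2 \<subseteq> c ` (nsets S 2 - Q)"
    proof
      fix z assume "z \<in> c ` nsets S 2"
      then obtain e where e: "e \<in> nsets S 2" "z = c e" by auto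
      show "z \<in> c ` (nsets S 2 - Q)"
      proof (cases "e \<in> Q")
        case True
        then have "c (rep e) = c e" using rep[of e] Q IE by blast
        then show ?thesis using QS[OF True] e by (metis imageI)
      qed (use e in auto)
    qed
    then have "card (c ` nsets S 2) \<le> card (c ` (nsets S 2 - Q))"
      using nsets2[OF fS] by (intro card_mono) auto
    also have "\<dots> \<le> card (nsets S 2 - Q)" using nsets2[OF fS] by (intro card_image_le) auto
    also have "\<dots> = card (nsets S 2) - card Q"
      using QS fI Q(1) by (intro card_Diff_subset) (auto intro: finite_subset)
    also have "\<dots> = 145" using nsets2[OF fS] S(3) Q(2) by (simp add: choose_two)
    finally show False using c146 by simp
  qed
  obtain I' where I': "I' \<subseteq> I" "card I \<le> card I' + 7 * n"
    and ex: "\<And>v S. builtv supp I' v S \<Longrightarrow> card (\<Union>(supp ` S)) = 2 * card S + 2"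
    using cleaning[OF fI supp P8] by blast
  have ne: "supp x \<noteq> {}" if "x \<in> I'" for x
    using sub[of x] that I' IE by (force simp: supp_def)
  have start: "\<exists>v. builtv supp I' v {x}" if x: "x \<in> I'" for x
    using ne[OF x] builtv.start[OF x] by blast
  have c4: "card (supp x) = 4" if x: "x \<in> I'" for x
    using start[OF x] ex[of _ "{x}"] by auto
  have inj: "inj_on supp I'"
  \<comment> \<open>Two items with the same support would form a built set of two items on four
    vertices instead of six.\<close>
  proof (rule inj_onI, rule ccontr)
    fix x y assume xy: "x \<in> I'" "y \<in> I'" "supp x = supp y" "x \<noteq> y"
    obtain v where v: "builtv supp I' v {x}" using start[OF xy(1)] by blast
    have "builtv supp I' v (insert y {x})"
      by (rule builtv.step[OF v xy(2)]) (use xy c4[OF xy(2)] in auto)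
    then have "card (\<Union>(supp ` insert y {x})) = 6" using ex[of v "insert y {x}"] xy(4) by simp
    moreover have "\<Union>(supp ` insert y {x}) = supp y" using xy(3) by simp
    ultimately show False using c4[OF xy(2)] by simp
  qed
  interpret sparse_system "supp ` I'" n
  proof
    fix x assume "x \<in> supp ` I'"
    then show "x \<subseteq> {..<n} \<and> card x = 4" using supp I' c4 by blast
  next
    fix S assume "built (supp ` I') S"
    then obtain v T where "builtv supp I' v T" "supp ` T = S" "card T = card S"
      using built_image ne by meson
    then show "card (\<Union>S) = 2 * card S + 2" using ex by metis
  next
    fix Q assume Q: "Q \<subseteq> supp ` I'" "card Q = 8"
    then obtain R where R: "R \<subseteq> I'" "inj_on supp R" "Q = supp ` R" by (meson subset_image_inj)
    then have "card R = 8" using Q(2) card_image by metis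
    then show "19 \<le> card (\<Union>Q)" using P8[of R] R I' by blast
  qed
  have "6 * card I' \<le> n choose 2" using card_le_sixth card_image[OF inj] by simp
  then show ?thesis using cE I'(2) by linarith
qed

lemma GR_upper:
  assumes F: "F \<subseteq> blocks n"
    and sparse: "\<And>Q. Q \<subseteq> F \<Longrightarrow> 2 \<le> card Q \<Longrightarrow> card Q \<le> 8 \<Longrightarrow> 2 * card Q + 3 \<le> card (\<Union>Q)"
  shows "GR n 18 146 + card F \<le> n choose 2"
proof -
  let ?E = "nsets {..<n} 2"
  have E: "finite ?E" "card ?E = n choose 2" using nsets2[of "{..<n}"] by auto
  have b4: "b \<subseteq> {..<n} \<and> card b = 4 \<and> finite b" if "b \<in> F" for b
    using that F by (auto simp: blocks_def intro: finite_subset)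
  have "F \<subseteq> Pow {..<n}" using b4 by blast
  then have fF: "finite F" by (rule finite_subset) simp
  have "\<exists>a d. a \<union> d = b \<and> card a = 2 \<and> card d = 2 \<and> a \<inter> d = {}" if b: "b \<in> F" for b
  proof -
    have "2 \<le> card b" using b4[OF b] by simp
    then obtain a where a: "a \<subseteq> b" "card a = 2" using obtain_subset_with_card_n by metis
    then have "card (b - a) = 2" using b4[OF b] by (simp add: card_Diff_subset finite_subset)
    then show ?thesis using a by (intro exI[of _ a] exI[of _ "b - a"]) auto
  qed
  then obtain a d where ad: "\<And>b. b \<in> F \<Longrightarrow> a b \<union> d b = b" "\<And>b. b \<in> F \<Longrightarrow> card (a b) = 2"
    "\<And>b. b \<in> F \<Longrightarrow> card (d b) = 2" "\<And>b. b \<in> F \<Longrightarrow> a b \<inter> d b = {}" by metis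
  have uniq: "b = b'" if b: "b \<in> F" "b' \<in> F" and e: "e \<subseteq> b" "e \<subseteq> b'" "card e = 2" for b b' e
  proof (rule ccontr)
    assume ne: "b \<noteq> b'"
    have "7 \<le> card (b \<union> b')" using sparse[of "{b, b'}"] b ne by simp
    moreover have "card (b \<union> b') + card (b \<inter> b') = card b + card b'" using b4 b by (intro card_Un_le_Int) auto
    moreover have "card e \<le> card (b \<inter> b')" using e b4[OF b(1)] by (intro card_mono) auto
    ultimately show False using b4[OF b(1)] b4[OF b(2)] e(3) by simp
  qed
  have asub: "a b \<subseteq> b" "d b \<subseteq> b" if "b \<in> F" for b using ad(1)[OF that] by auto
  have injd: "inj_on d F" using uniq asub ad(3) by (metis inj_onI)
  have aE: "a b \<in> ?E" "d b \<in> ?E" if b: "b \<in> F" for b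
    using asub[OF b] b4[OF b] ad(2,3)[OF b] by (auto simp: nsets_def intro: finite_subset)
  have anD: "a b \<notin> d ` F" if b: "b \<in> F" for b
  proof
    assume "a b \<in> d ` F"
    then obtain b' where b': "b' \<in> F" "a b = d b'" by auto
    have "b = b'" using uniq[OF b b'(1) asub(1)[OF b]] asub(2)[OF b'(1)] b'(2) ad(2)[OF b] by simp
    then have "a b = {}" using ad(4)[OF b] b'(2) by simp
    then show False using ad(2)[OF b] by simp
  qed
  \<comment> \<open>The edge \<open>d b\<close> is replaced by the opposite edge \<open>a b\<close>
    of its block; \<open>idx\<close> later turns edges into numbers.\<close>
  define c0 where "c0 e = (if e \<in> d ` F then a (inv_into F d e) else e)" for e
  have c0d: "c0 (d b) = a b" if "b \<in> F" for b using that by (simp add: c0_def inv_into_f_f[OF injd])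
  obtain idx :: "nat set \<Rightarrow> nat" where idx: "inj_on idx ?E" using finite_imp_inj_to_nat_seg[OF E(1)] by metis
  have c0E: "c0 e \<in> ?E - d ` F" if "e \<in> ?E" for e
  proof (cases "e \<in> d ` F")
    case True
    then obtain b where "b \<in> F" "e = d b" by auto
    then show ?thesis using c0d anD aE(1) by simp
  qed (use that in \<open>simp add: c0_def\<close>)
  define c where "c e = idx (c0 e)" for e
  have "card (c ` ?E) \<le> card (?E - d ` F)"
  proof -
    have "c ` ?E \<subseteq> idx ` (?E - d ` F)" using c0E by (auto simp: c_def)
    then have "card (c ` ?E) \<le> card (idx ` (?E - d ` F))" using E by (intro card_mono) auto
    also have "\<dots> \<le> card (?E - d ` F)" using E by (intro card_image_le) auto
    finally show ?thesis .
  qed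
  moreover have dE: "d ` F \<subseteq> ?E" using aE by auto
  then have "card (?E - d ` F) + card F = n choose 2"
    using E fF card_image[OF injd] card_mono[OF E(1) dE] by (simp add: card_Diff_subset)
  ultimately have cc: "card (c ` ?E) + card F \<le> n choose 2" by simp
  have "pq_colouring n 18 146 c"
    unfolding pq_colouring_def
  proof
    fix S assume "S \<in> nsets {..<n} 18"
    then have S: "S \<subseteq> {..<n}" "finite S" "card S = 18" by (auto simp: nsets_def)
    define FS where "FS = {b \<in> F. b \<subseteq> S}"
    have FS: "FS \<subseteq> F" "finite FS" using fF by (auto simp: FS_def)
    have c7: "card FS \<le> 7"
    proof (rule ccontr)
      assume "\<not> ?thesis"
      then obtain Q where Q: "Q \<subseteq> FS" "card Q = 8" using obtain_subset_with_card_n[of 8 FS] by auto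
      have "19 \<le> card (\<Union>Q)" using sparse[of Q] Q FS by auto
      moreover have "card (\<Union>Q) \<le> card S" using Q S by (intro card_mono) (auto simp: FS_def)
      ultimately show False using S by simp
    qed
    let ?X = "nsets S 2 - d ` FS"
    have SE: "nsets S 2 \<subseteq> ?E" using S by (auto simp: nsets_def)
    \<comment> \<open>A block not inside \<open>S\<close> causes no loss: \<open>d b\<close> may lie
      in \<open>S\<close>, but it then takes the colour of \<open>a b\<close>, which does not. Only
      the at most seven blocks inside \<open>S\<close> cost a colour, and
      \<open>153 - 7 = 146\<close>.\<close>
    have out: "\<exists>b\<in>F. e = d b \<and> c0 e = a b \<and> \<not> a b \<subseteq> S" if e: "e \<in> ?X" "e \<in> d ` F" for e
    proof -
      obtain b where b: "b \<in> F" "e = d b" using e by auto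
      have "\<not> b \<subseteq> S" using e b by (auto simp: FS_def)
      moreover have "d b \<subseteq> S" using e b by (auto simp: nsets_def)
      ultimately have "\<not> a b \<subseteq> S" using ad(1)[OF b(1)] by blast
      then show ?thesis using b c0d by blast
    qed
    have inside: "c0 e = e \<and> c0 e \<subseteq> S" if "e \<in> ?X" "e \<notin> d ` F" for e
      using that by (simp add: c0_def nsets_def)
    have "inj_on c0 ?X"
    proof (rule inj_onI)
      fix e e' assume e: "e \<in> ?X" "e' \<in> ?X" "c0 e = c0 e'"
      consider "e \<in> d ` F" "e' \<in> d ` F" | "e \<notin> d ` F" "e' \<notin> d ` F" | "e \<in> d ` F" "e' \<notin> d ` F" | "e \<notin> d ` F" "e' \<in> d ` F" by blast
      then show "e = e'"
      proof cases
        case 1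
        obtain b where b: "b \<in> F" "e = d b" "c0 e = a b" using out[OF e(1) 1(1)] by blast
        obtain b' where b': "b' \<in> F" "e' = d b'" "c0 e' = a b'" using out[OF e(2) 1(2)] by blast
        have "b = b'" using uniq[OF b(1) b'(1), of "a b"] asub(1) b b' e(3) ad(2) by metis
        then show ?thesis using b b' by simp
      next
        case 2
        then show ?thesis using inside[of e] inside[of e'] e by simp
      next
        case 3
        then show ?thesis using out[OF e(1) 3(1)] inside[OF e(2) 3(2)] e(3) by auto
      next
        case 4
        then show ?thesis using out[OF e(2) 4(2)] inside[OF e(1) 4(1)] e(3) by auto
      qed
    qed
    moreover have "c0 ` ?X \<subseteq> ?E" using c0E SE by blast
    then have "inj_on idx (c0 ` ?X)" by (rule inj_on_subset[OF idx])
    ultimately have "inj_on (idx \<circ> c0) ?X" by (rule comp_inj_on)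
    then have "inj_on c ?X" unfolding c_def comp_def .
    then have "card ?X = card (c ` ?X)" by (simp add: card_image)
    also have "\<dots> \<le> card (c ` nsets S 2)" using nsets2[OF S(2)] by (intro card_mono) auto
    finally have "card ?X \<le> card (c ` nsets S 2)" .
    moreover have "card (nsets S 2) \<le> card ?X + card (d ` FS)"
      using nsets2[OF S(2)] FS diff_card_le_card_Diff[of "d ` FS" "nsets S 2"] by simp
    moreover have "card (d ` FS) \<le> 7" using card_image_le[OF FS(2), of d] c7 by simp
    moreover have "card (nsets S 2) = 153" using nsets2[OF S(2)] S(3) by (simp add: choose_two)
    ultimately show "146 \<le> card (c ` nsets S 2)" by simp
  qed
  then have "GR n 18 146 \<le> card (c ` ?E)" unfolding GR_def by (intro Least_le) blast
  then show ?thesis using cc by simp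
qed

lemma real_choose_two: "real (n choose 2) = real n * (real n - 1) / 2"
proof (cases n)
  case (Suc m)
  have "2 dvd n * (n - 1)" using Suc by simp
  then have "2 * (n choose 2) = n * (n - 1)" unfolding choose_two by (rule dvd_mult_div_cancel)
  then have "real (2 * (n choose 2)) = real (n * (n - 1))" by simp
  then show ?thesis using Suc by (simp add: field_simps)
qed simp

theorem theorem1p5:
  shows "(\<lambda>n. real (GR n 18 146) / real n ^ 2) \<longlonglongrightarrow> 5 / 12"
proof (rule LIMSEQ_I)
  fix r :: real assume r: "0 < r"
  define \<epsilon> where "\<epsilon> = min 1 r"
  have \<epsilon>: "0 < \<epsilon>" "\<epsilon> \<le> 1" "\<epsilon> \<le> r" using r by (auto simp: \<epsilon>_def)
  obtain N where N: "\<And>n. N \<le> n \<Longrightarrow> \<exists>F\<subseteq>blocks n. (1 - \<epsilon>) * real n ^ 2 / 12 \<le> real (card F) \<and>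
      (\<forall>Q\<subseteq>F. 2 \<le> card Q \<longrightarrow> card Q \<le> 8 \<longrightarrow> 2 * card Q + 3 \<le> card (\<Union>Q))"
    using sparse_family[OF \<epsilon>(1,2)] by blast
  \<comment> \<open>The linear error of the lower bound, \<open>(42 + 5 / 2) / 6 * n\<close>, is
    below \<open>8 * n\<close>.\<close>
  obtain M :: nat where M: "8 / r < real M" using reals_Archimedean2 by blast
  show "\<exists>no. \<forall>n\<ge>no. norm (real (GR n 18 146) / real n ^ 2 - 5 / 12) < r"
  proof (intro exI[of _ "max 18 (max N M)"] allI impI)
    fix n assume "max 18 (max N M) \<le> n"
    then have n: "18 \<le> n" "N \<le> n" "real M \<le> real n" by auto
    let ?g = "real (GR n 18 146)"
    have n0: "0 < real n" using n(1) by simp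
    have n2: "0 < real n ^ 2" using n0 by simp
    have "8 / r < real n" using M n(3) by linarith
    then have "8 < r * real n" using r by (simp add: field_simps)
    then have nr: "8 * real n < r * real n ^ 2" using n0 by (simp add: power2_eq_square)
    obtain F where F: "F \<subseteq> blocks n" "(1 - \<epsilon>) * real n ^ 2 / 12 \<le> real (card F)"
      "\<forall>Q\<subseteq>F. 2 \<le> card Q \<longrightarrow> card Q \<le> 8 \<longrightarrow> 2 * card Q + 3 \<le> card (\<Union>Q)" using N[OF n(2)] by blast
    have "GR n 18 146 + card F \<le> n choose 2" by (rule GR_upper[OF F(1)]) (use F(3) in blast)
    then have "real (GR n 18 146 + card F) \<le> real (n choose 2)" by (rule of_nat_mono)
    then have u: "?g \<le> real n * (real n - 1) / 2 - (1 - \<epsilon>) * real n ^ 2 / 12" using F(2) unfolding real_choose_two by simp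
    have "real (5 * (n choose 2)) \<le> real (6 * GR n 18 146 + 42 * n)" by (rule of_nat_mono) (rule GR_lower[OF n(1)])
    then have l: "5 * (real n * (real n - 1) / 2) \<le> 6 * ?g + 42 * real n" by (simp add: real_choose_two)
    have e1: "\<epsilon> * real n ^ 2 \<le> r * real n ^ 2" using \<epsilon>(3) by (intro mult_right_mono) auto
    have e2: "0 < r * real n ^ 2" using r n2 by simp
    have sq: "real n * (real n - 1) = real n ^ 2 - real n" "(1 - \<epsilon>) * real n ^ 2 = real n ^ 2 - \<epsilon> * real n ^ 2"
      by (simp_all add: algebra_simps power2_eq_square)
    have "?g - 5 / 12 * real n ^ 2 < r * real n ^ 2"
      using u e1 e2 n0 unfolding sq by argo
    moreover have "- (r * real n ^ 2) < ?g - 5 / 12 * real n ^ 2"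
      using l nr n0 unfolding sq by argo
    ultimately have "\<bar>?g - 5 / 12 * real n ^ 2\<bar> < r * real n ^ 2" by (simp add: abs_less_iff)
    moreover have "?g / real n ^ 2 - 5 / 12 = (?g - 5 / 12 * real n ^ 2) / real n ^ 2" using n2 by (simp add: diff_divide_distrib)
    ultimately show "norm (?g / real n ^ 2 - 5 / 12) < r" using n2 by (simp add: abs_divide pos_divide_less_eq)
  qed
qed

end
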